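(* Let $n\ge2$ and let $\phi\in C^{\infty}(\mathbb{R}^{n}\setminus\{0\})$ be real-valued and positively homogeneous of degree $1$. Let $p\in(2,\infty)$, $s\in\mathbb{R}$ and $C\geq0$ be such that $$\Big(\int_{0}^{1}\|e^{it\phi(D)}f\|_{L^{p}(\mathbb{R}^{n})}^{p}\,dt\Big)^{1/p}\leq C\|f\|_{\mathcal{H}^{s,p}_{FIO}(\mathbb{R}^{n})}$$ for all $f\in \mathcal{H}^{s,p}_{FIO}(\mathbb{R}^{n})$. Then $s\geq d(p)-s(p)$.
   Context: Exponents. $n\ge2$ is a fixed integer. Set $s(p):=\frac{n-1}{2}\big|\frac12-\frac1p\big|$ and, for $2\le p<\infty$, $d(p):=2s(p)-\frac1p$ if $p\geq \frac{2(n+1)}{n-1}$, and $d(p):=s(p)$ if $2\leq p<\frac{2(n+1)}{n-1}$. (So $d(p)-s(p)=\max(0,s(p)-\frac1p)$.) Notation. $\hat\xi=\xi/|\xi|$ for $\xi\ne0$, $\langle\xi\rangle=(1+|\xi|^2)^{1/2}$, and $m(D)$ is the Fourier multiplier with symbol $m$, with Fourier transform $\widehat f(\xi)=\int e^{-ix\cdot\xi}f(x)\,dx$. For $1<p<\infty$, $\mathcal H^p(\mathbb R^n):=L^p(\mathbb R^n)$; $\mathcal H^1(\mathbb R^n)$ is the (Goldberg) local Hardy space; $\mathcal H^\infty(\mathbb R^n):=\mathrm{bmo}(\mathbb R^n)$. Hardy spaces for Fourier integral operators. Fix a non-negative radial $\varphi\in C_c^\infty(\mathbb R^n)$ with $\varphi(\xi)=0$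 for $|\xi|>1$ and $\varphi\equiv1$ near $0$. For $\omega\in S^{n-1}$, $\sigma>0$, $\xi\neq0$ put $\varphi_{\omega,\sigma}(\xi):=c_\sigma\varphi\big(\frac{\hat\xi-\omega}{\sqrt\sigma}\big)$ with $c_\sigma:=\big(\int_{S^{n-1}}\varphi(\frac{e_1-\nu}{\sqrt\sigma})^2d\nu\big)^{-1/2}$, where $d\nu$ is normalized surface measure on $S^{n-1}$ and $e_1=(1,0,\dots,0)$; put $\varphi_{\omega,\sigma}(0):=0$. Let $\Psi\in C_c^\infty(\mathbb R^n)$ be non-negative, radial, with $\Psi(\xi)=0$ if $|\xi|\notin[1/2,2]$ and $\int_0^\infty\Psi(\sigma\xi)^2\frac{d\sigma}{\sigma}=1$ for all $\xi\ne0$. Set $\varphi_\omega(\xi):=\int_0^4\Psi(\sigma\xi)\varphi_{\omega,\sigma}(\xi)\frac{d\sigma}{\sigma}$. Fix $q\in C_c^\infty(\mathbb R^n)$ with $q(\xi)=1$ for $|\xi|\le2$. For $p\in[1,\infty)$, $\mathcal H^p_{FIO}(\mathbb R^n)$ is the space of $f\in\mathcal S'(\mathbb R^n)$ with $q(D)f\in L^p(\mathbb R^n)$, $\varphi_\omega(D)f\in\mathcal H^p(\mathbb R^n)$ for almost all $\omega\in S^{n-1}$, and finite norm $$\|f\|_{\mathcal H^p_{FIO}(\mathbb R^n)}:=\|q(D)f\|_{L^p(\mathbb R^n)}+\Big(\int_{S^{n-1}}\|\varphi_\omega(D)f\|_{\mathcal H^p(\mathbb R^n)}^p\,d\omega\Big)^{1/p}.$$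 For $s\in\mathbb R$, $\mathcal H^{s,p}_{FIO}(\mathbb R^n)$ consists of all $f\in\mathcal S'(\mathbb R^n)$ with $\langle D\rangle^sf\in\mathcal H^p_{FIO}(\mathbb R^n)$, normed by $\|f\|_{\mathcal H^{s,p}_{FIO}}:=\|\langle D\rangle^sf\|_{\mathcal H^p_{FIO}}$. Schwartz functions are dense in $\mathcal H^{s,p}_{FIO}(\mathbb R^n)$ for $p<\infty$. $e^{it\phi(D)}$ is the Fourier multiplier with symbol $e^{it\phi(\xi)}$, extended by continuity from Schwartz functions to $\mathcal H^{s,p}_{FIO}(\mathbb R^n)$. *)

theory Defs
  imports "HOL-Analysis.Analysis"
begin

section \<open>Smooth functions, Schwartz functions, tempered distributions\<close>

text \<open>Differentiability of all iterated partial derivatives (along the standard orthonormal basis)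
  at every point of an open set amounts to being infinitely often continuously differentiable there.\<close>

primrec iter_deriv ::
  "'a list \<Rightarrow> ('a::real_normed_vector \<Rightarrow> 'b::real_normed_vector) \<Rightarrow> 'a \<Rightarrow> 'b" where
  "iter_deriv [] f = f"
| "iter_deriv (v # vs) f = (\<lambda>x. frechet_derivative (iter_deriv vs f) (at x) v)"

definition smooth_on :: "'a set \<Rightarrow> ('a::euclidean_space \<Rightarrow> 'b::real_normed_vector) \<Rightarrow> bool" where
  "smooth_on S f \<longleftrightarrow> (\<forall>vs \<in> lists Basis. \<forall>x \<in> S. iter_deriv vs f differentiable (at x))"

definition test_fun :: "('a::euclidean_space \<Rightarrow> 'b::real_normed_vector) \<Rightarrow> bool" where
  "test_fun f \<longleftrightarrow> smooth_on UNIV f \<and> compact (closure {x. f x \<noteq> 0})"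

definition radial :: "('a::real_normed_vector \<Rightarrow> 'b) \<Rightarrow> bool" where
  "radial f \<longleftrightarrow> (\<forall>x y. norm x = norm y \<longrightarrow> f x = f y)"

definition schwartz :: "('a::euclidean_space \<Rightarrow> complex) set" where
  "schwartz = {f. smooth_on UNIV f \<and>
     (\<forall>k. \<forall>vs \<in> lists Basis. bdd_above (range (\<lambda>x. norm x ^ k * norm (iter_deriv vs f x))))}"

definition schwartz_seminorm :: "nat \<Rightarrow> 'a list \<Rightarrow> ('a::euclidean_space \<Rightarrow> complex) \<Rightarrow> real" where
  "schwartz_seminorm k vs f = (SUP x. norm x ^ k * norm (iter_deriv vs f x))"

text \<open>A tempered distribution is a continuous complex-linear functional on the Schwartz space.
  So that equality of distributions is equality of functionals, the (irrelevant) values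
  outside the Schwartz space are normalised to be zero.\<close>

type_synonym 'a distribution = "('a \<Rightarrow> complex) \<Rightarrow> complex"

definition tempered :: "'a::euclidean_space distribution set" where
  "tempered = {u.
     (\<forall>\<psi>. \<psi> \<notin> schwartz \<longrightarrow> u \<psi> = 0) \<and>
     (\<forall>\<psi>\<in>schwartz. \<forall>\<eta>\<in>schwartz. u (\<lambda>x. \<psi> x + \<eta> x) = u \<psi> + u \<eta>) \<and>
     (\<forall>c. \<forall>\<psi>\<in>schwartz. u (\<lambda>x. c * \<psi> x) = c * u \<psi>) \<and>
     (\<exists>B N. \<forall>\<psi>\<in>schwartz. norm (u \<psi>) \<le>
        B * (\<Sum>k\<le>N. \<Sum>vs | set vs \<subseteq> Basis \<and> length vs \<le> N. schwartz_seminorm k vs \<psi>))}"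

text \<open>The distribution induced by a function (bilinear pairing, no complex conjugate).\<close>

definition distr_of :: "('a::euclidean_space \<Rightarrow> complex) \<Rightarrow> 'a distribution" where
  "distr_of h = (\<lambda>\<psi>. if \<psi> \<in> schwartz then (LINT x|lborel. h x * \<psi> x) else 0)"

definition distr_diff :: "'a distribution \<Rightarrow> 'a distribution \<Rightarrow> 'a distribution" where
  "distr_diff u v = (\<lambda>\<psi>. u \<psi> - v \<psi>)"


section \<open>Fourier transform and Fourier multipliers\<close>

definition fourier :: "('a::euclidean_space \<Rightarrow> complex) \<Rightarrow> 'a \<Rightarrow> complex" where
  "fourier f \<xi> = (LINT x|lborel. cis (- (x \<bullet> \<xi>)) * f x)"

definition inv_fourier :: "('a::euclidean_space \<Rightarrow> complex) \<Rightarrow> 'a \<Rightarrow> complex" where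
  "inv_fourier g x =
     complex_of_real (1 / (2 * pi) ^ DIM('a)) * (LINT \<xi>|lborel. cis (x \<bullet> \<xi>) * g \<xi>)"

definition fourier_distr :: "'a::euclidean_space distribution \<Rightarrow> 'a distribution" where
  "fourier_distr u = (\<lambda>\<psi>. if \<psi> \<in> schwartz then u (fourier \<psi>) else 0)"

definition inv_fourier_distr :: "'a::euclidean_space distribution \<Rightarrow> 'a distribution" where
  "inv_fourier_distr u = (\<lambda>\<psi>. if \<psi> \<in> schwartz then u (inv_fourier \<psi>) else 0)"

definition mult_distr ::
  "('a::euclidean_space \<Rightarrow> complex) \<Rightarrow> 'a distribution \<Rightarrow> 'a distribution" where
  "mult_distr m u = (\<lambda>\<psi>. if \<psi> \<in> schwartz then u (\<lambda>\<xi>. m \<xi> * \<psi> \<xi>) else 0)"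

text \<open>\<open>multiplier m u\<close> is meant for smooth symbols all of whose derivatives have at most polynomial
  growth; it then acts on all tempered distributions. For a symbol that is merely bounded and
  measurable, such as one that is singular at the origin, \<open>multiplier_fun\<close> acts on Schwartz
  functions.\<close>

definition multiplier ::
  "('a::euclidean_space \<Rightarrow> complex) \<Rightarrow> 'a distribution \<Rightarrow> 'a distribution" where
  "multiplier m u = inv_fourier_distr (mult_distr m (fourier_distr u))"

definition multiplier_fun ::
  "('a::euclidean_space \<Rightarrow> complex) \<Rightarrow> ('a \<Rightarrow> complex) \<Rightarrow> 'a \<Rightarrow> complex" where
  "multiplier_fun m f = inv_fourier (\<lambda>\<xi>. m \<xi> * fourier f \<xi>)"

definition bessel :: "real \<Rightarrow> 'a::euclidean_space distribution \<Rightarrow> 'a distribution" where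
  "bessel s = multiplier (\<lambda>\<xi>. complex_of_real (sqrt (1 + (norm \<xi>)\<^sup>2) powr s))"


section \<open>Lebesgue norms\<close>

definition epowr :: "ennreal \<Rightarrow> real \<Rightarrow> ennreal"
  where \<comment> \<open>only used for positive exponents\<close>
  "epowr x a = (if x = \<infinity> then \<infinity> else ennreal (enn2real x powr a))"

text \<open>The \<open>L\<^sup>p\<close> norm of a distribution, for \<open>1 \<le> p < \<infinity>\<close>. All representing functions agree almost
  everywhere; if there is none, the infimum over the empty set is \<open>\<infinity>\<close>.\<close>

definition Lp_norm :: "real \<Rightarrow> 'a::euclidean_space distribution \<Rightarrow> ennreal" where
  "Lp_norm p u =
     (INF h \<in> {h \<in> borel_measurable lborel.
                 (\<integral>\<^sup>+x. ennreal (norm (h x) powr p) \<partial>lborel) < \<infinity> \<and> distr_of h = u}.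
        epowr (\<integral>\<^sup>+x. ennreal (norm (h x) powr p) \<partial>lborel) (1 / p))"

definition Lp :: "real \<Rightarrow> 'a::euclidean_space distribution set" where
  "Lp p = {u \<in> tempered. Lp_norm p u < \<infinity>}"


section \<open>Hardy spaces for Fourier integral operators\<close>

text \<open>Normalised surface measure on the unit sphere, as the image of the uniform distribution on
  the unit ball under radial projection. It is a measure on the whole space, concentrated on the
  unit sphere.\<close>

definition sphere_measure :: "'a::euclidean_space measure" where
  "sphere_measure = distr (uniform_measure lborel (ball 0 1)) borel sgn"

text \<open>By rotation invariance, the choice of the unit vector \<open>e\<^sub>1\<close> below is immaterial.\<close>

definition e1 :: "'a::euclidean_space" where
  "e1 = (SOME b. b \<in> Basis)"

definition FIO_cutoffs ::
  "('a::euclidean_space \<Rightarrow> real) \<Rightarrow> ('a \<Rightarrow> real) \<Rightarrow> ('a \<Rightarrow> complex) \<Rightarrow> bool" where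
  "FIO_cutoffs \<theta> \<Psi> q \<longleftrightarrow>
     test_fun \<theta> \<and> radial \<theta> \<and> (\<forall>\<xi>. \<theta> \<xi> \<ge> 0) \<and>
     (\<forall>\<xi>. norm \<xi> > 1 \<longrightarrow> \<theta> \<xi> = 0) \<and> (\<forall>\<^sub>F \<xi> in nhds 0. \<theta> \<xi> = 1) \<and>
     test_fun \<Psi> \<and> radial \<Psi> \<and> (\<forall>\<xi>. \<Psi> \<xi> \<ge> 0) \<and>
     (\<forall>\<xi>. norm \<xi> \<notin> {1/2..2} \<longrightarrow> \<Psi> \<xi> = 0) \<and>
     (\<forall>\<xi>. \<xi> \<noteq> 0 \<longrightarrow> (LINT \<sigma>:{0<..}|lborel. (\<Psi> (\<sigma> *\<^sub>R \<xi>))\<^sup>2 / \<sigma>) = 1) \<and>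
     test_fun q \<and> (\<forall>\<xi>. norm \<xi> \<le> 2 \<longrightarrow> q \<xi> = 1)"

definition angular_const :: "('a::euclidean_space \<Rightarrow> real) \<Rightarrow> real \<Rightarrow> real" where
  "angular_const \<theta> \<sigma> =
     (LINT \<nu>|sphere_measure. (\<theta> ((e1 - \<nu>) /\<^sub>R sqrt \<sigma>))\<^sup>2) powr (- 1 / 2)"

definition angular_cutoff :: "('a::euclidean_space \<Rightarrow> real) \<Rightarrow> 'a \<Rightarrow> real \<Rightarrow> 'a \<Rightarrow> real" where
  "angular_cutoff \<theta> \<omega> \<sigma> \<xi> =
     (if \<xi> = 0 then 0 else angular_const \<theta> \<sigma> * \<theta> ((sgn \<xi> - \<omega>) /\<^sub>R sqrt \<sigma>))"

definition packet_symbol ::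
  "('a::euclidean_space \<Rightarrow> real) \<Rightarrow> ('a \<Rightarrow> real) \<Rightarrow> 'a \<Rightarrow> 'a \<Rightarrow> complex" where
  "packet_symbol \<theta> \<Psi> \<omega> \<xi> = complex_of_real
     (LINT \<sigma>:{0<..<4}|lborel. \<Psi> (\<sigma> *\<^sub>R \<xi>) * angular_cutoff \<theta> \<omega> \<sigma> \<xi> / \<sigma>)"

text \<open>The Hardy space for Fourier integral operators and its Sobolev version, for
  \<open>1 < p < \<infinity>\<close>; in this range the Hardy space over \<open>\<real>\<^sup>n\<close> from which they are built is \<open>L\<^sup>p\<close>.\<close>

definition HpFIO_norm ::
  "('a::euclidean_space \<Rightarrow> real) \<Rightarrow> ('a \<Rightarrow> real) \<Rightarrow> ('a \<Rightarrow> complex) \<Rightarrow> real \<Rightarrow>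
    'a distribution \<Rightarrow> ennreal" where
  "HpFIO_norm \<theta> \<Psi> q p f =
     Lp_norm p (multiplier q f) +
     epowr (\<integral>\<^sup>+\<omega>. epowr (Lp_norm p (multiplier (packet_symbol \<theta> \<Psi> \<omega>) f)) p \<partial>sphere_measure) (1 / p)"

definition HpFIO ::
  "('a::euclidean_space \<Rightarrow> real) \<Rightarrow> ('a \<Rightarrow> real) \<Rightarrow> ('a \<Rightarrow> complex) \<Rightarrow> real \<Rightarrow>
    'a distribution set" where
  "HpFIO \<theta> \<Psi> q p = {f \<in> tempered.
     multiplier q f \<in> Lp p \<and>
     (AE \<omega> in sphere_measure. multiplier (packet_symbol \<theta> \<Psi> \<omega>) f \<in> Lp p) \<and>
     HpFIO_norm \<theta> \<Psi> q p f < \<infinity>}"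

definition HspFIO_norm ::
  "('a::euclidean_space \<Rightarrow> real) \<Rightarrow> ('a \<Rightarrow> real) \<Rightarrow> ('a \<Rightarrow> complex) \<Rightarrow> real \<Rightarrow> real \<Rightarrow>
    'a distribution \<Rightarrow> ennreal" where
  "HspFIO_norm \<theta> \<Psi> q s p f = HpFIO_norm \<theta> \<Psi> q p (bessel s f)"

definition HspFIO ::
  "('a::euclidean_space \<Rightarrow> real) \<Rightarrow> ('a \<Rightarrow> real) \<Rightarrow> ('a \<Rightarrow> complex) \<Rightarrow> real \<Rightarrow> real \<Rightarrow>
    'a distribution set" where
  "HspFIO \<theta> \<Psi> q s p = {f \<in> tempered. bessel s f \<in> HpFIO \<theta> \<Psi> q p}"


section \<open>The propagators\<close>

definition positively_homogeneous1 :: "('a::real_vector \<Rightarrow> real) \<Rightarrow> bool" where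
  "positively_homogeneous1 \<phi> \<longleftrightarrow> (\<forall>r>0. \<forall>\<xi>. \<xi> \<noteq> 0 \<longrightarrow> \<phi> (r *\<^sub>R \<xi>) = r * \<phi> \<xi>)"

text \<open>The extension by continuity, from Schwartz functions to \<open>HspFIO\<close>, of the multiplier with
  symbol \<open>m\<close>: a Schwartz function is sent to its image under \<open>multiplier_fun m\<close>, and any other
  element of \<open>HspFIO\<close> to the common limit in \<open>HspFIO\<close> of the images of all sequences of Schwartz
  functions that approximate it.\<close>

definition multiplier_ext ::
  "('a::euclidean_space \<Rightarrow> real) \<Rightarrow> ('a \<Rightarrow> real) \<Rightarrow> ('a \<Rightarrow> complex) \<Rightarrow> real \<Rightarrow> real \<Rightarrow>
    ('a \<Rightarrow> complex) \<Rightarrow> 'a distribution \<Rightarrow> 'a distribution" where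
  "multiplier_ext \<theta> \<Psi> q s p m f =
     (if f \<in> distr_of ` schwartz
      then distr_of (multiplier_fun m (inv_into schwartz distr_of f))
      else (THE g. g \<in> HspFIO \<theta> \<Psi> q s p \<and>
        (\<forall>F. (\<forall>k::nat. F k \<in> schwartz) \<and>
             (\<lambda>k. HspFIO_norm \<theta> \<Psi> q s p (distr_diff (distr_of (F k)) f)) \<longlonglongrightarrow> 0 \<longrightarrow>
             (\<lambda>k. HspFIO_norm \<theta> \<Psi> q s p (distr_diff (distr_of (multiplier_fun m (F k))) g)) \<longlonglongrightarrow> 0)))"

definition wave_op ::
  "('a::euclidean_space \<Rightarrow> real) \<Rightarrow> ('a \<Rightarrow> real) \<Rightarrow> ('a \<Rightarrow> complex) \<Rightarrow> real \<Rightarrow> real \<Rightarrow>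
    ('a \<Rightarrow> real) \<Rightarrow> real \<Rightarrow> 'a distribution \<Rightarrow> 'a distribution" where
  "wave_op \<theta> \<Psi> q s p \<phi> t = multiplier_ext \<theta> \<Psi> q s p (\<lambda>\<xi>. cis (t * \<phi> \<xi>))"


section \<open>Exponents\<close>

definition s_exp :: "nat \<Rightarrow> real \<Rightarrow> real" where
  "s_exp n p = (real n - 1) / 2 * \<bar>1 / 2 - 1 / p\<bar>"

definition d_exp :: "nat \<Rightarrow> real \<Rightarrow> real" where
  "d_exp n p = (if p \<ge> 2 * (real n + 1) / (real n - 1) then 2 * s_exp n p - 1 / p else s_exp n p)"

end

theory Submission
  imports Defs "HOL-Probability.Distributions"
begin

text \<open>The bound is tested on two families of Schwartz functions \<open>f\<close> with Fourier support in an annulus of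
radius about \<open>R\<close>, and \<open>R\<close> tends to infinity. One family gives \<open>s \<ge> s(p) - 1/p\<close>, the other
\<open>s \<ge> 0\<close>, and \<open>d(p) - s(p)\<close> is the larger of these two bounds. Below, \<open>n\<close> is the dimension.

The upper bounds for the right-hand side all have one source. Since \<open>p > 2\<close>, the \<open>L\<^sup>p\<close> norm
of a function is at most an interpolation of its supremum and its \<open>L\<^sup>2\<close> norm, and both are
controlled on the Fourier side by the size and the support of the Fourier transform
(\<open>nn_integral_powr_inv_fourier_le\<close>). The packet symbol in direction \<open>\<omega>\<close> has size at most a constant times
\<open>|\<xi>|\<^bsup>(n-1)/4\<^esup>\<close> and lives where the direction of \<open>\<xi>\<close> is within about
\<open>|\<xi>|\<^bsup>-1/2\<^esup>\<close> of \<open>\<omega>\<close>. So if the Fourier transform of \<open>f\<close> is bounded, and if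
its part in each such sector is contained in a set of volume \<open>V\<close>, then the \<open>p\<close>-th power of the norm
of \<open>f\<close> is at most a constant times \<open>R\<^bsup>((n-1)/4+s)p\<^esup> V\<^bsup>p-1\<^esup>\<close>
(\<open>annular_HspFIO_norm_le\<close>).

Focusing (\<open>focusing_exponent\<close>): the Fourier transform of \<open>f\<close> is a bump of width \<open>R\<close> in the
annulus. For times \<open>t\<close> and points \<open>x\<close> of size at most a small multiple of \<open>1/R\<close> the phase
\<open>t\<phi>(\<xi>) + x\<xi>\<close> is at most 1, nothing cancels, and the solution is of size \<open>R\<^sup>n\<close>
on a space-time set of volume \<open>R\<^bsup>-n-1\<^esup>\<close>. A sector has volume
\<open>R\<^bsup>(n+1)/2\<^esup>\<close>. Comparing powers of \<open>R\<close> gives \<open>s \<ge> s(p) - 1/p\<close>.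

Packets in all directions (\<open>packets_exponent\<close>): the Fourier transform of \<open>f\<close> is a sum of
equal bumps of tiny radius \<open>1/L\<close> around frequencies \<open>\<zeta>\<close> of size about \<open>R\<close>, with one
frequency in each of about \<open>R\<^bsup>(n-1)/2\<^esup>\<close> sectors. Each sector meets boundedly many bumps,
so \<open>V\<close> is a multiple of \<open>L\<^bsup>-n\<^esup>\<close>. On bumps this small \<open>\<phi>\<close> is almost constant, hence
for all times up to 1 the solution is, on a ball of radius comparable to \<open>L\<close>, essentially
\<open>L\<^bsup>-n\<^esup>\<close> times a sum of characters with unimodular coefficients. For large \<open>L\<close> these
characters are almost orthogonal on that ball, so the mean square of the sum is comparable to the number
\<open>N\<close> of frequencies, and its \<open>p\<close>-th power has mean at least a multiple of
\<open>N\<^bsup>p/2\<^esup>\<close>, that is of \<open>R\<^bsup>(n-1)p/4\<^esup>\<close>. The powers of \<open>L\<close> agree on both sides, and comparing powers of \<open>R\<close> gives \<open>s \<ge> 0\<close>.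

The two lower bounds pair the solution with an explicit test function; the pairing can be computed on
the Fourier side (\<open>wave_op_pairing\<close>, \<open>Lp_norm_ge\<close>).

The rest is Fourier analysis: families of functions with controlled derivatives, the Fourier transform on
Schwartz functions up to inversion and Plancherel, the action of moderate symbols on them, and the
regularity, support and size of the packet symbols.\<close>

section \<open>Families of functions with controlled derivatives\<close>

text \<open>\<open>F\<close> is a family of functions indexed by \<open>I\<close>, and \<open>W\<close> is a set of admissible majorants: one
majorant must serve the whole family. The choice of \<open>W\<close> turns the same notion into boundedness,
polynomial growth or rapid decay, uniformly in the index.\<close>

definition controlled ::
  "'i set \<Rightarrow> 'a set \<Rightarrow> ('i \<Rightarrow> 'a \<Rightarrow> real) set \<Rightarrow> ('i \<Rightarrow> 'a \<Rightarrow> 'b::real_normed_vector) \<Rightarrow> bool" where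
  "controlled I S W F \<longleftrightarrow> (\<exists>w\<in>W. \<forall>i\<in>I. \<forall>x\<in>S. norm (F i x) \<le> w i x)"

text \<open>All partial derivatives of order up to \<open>k\<close> are admissible. The recursion strips a derivative from the
inside, so that facts about all derivatives follow by induction on \<open>k\<close> once they are known for the
derivative of a general family.\<close>

primrec Ck_family ::
  "'i set \<Rightarrow> 'a set \<Rightarrow> ('i \<Rightarrow> 'a \<Rightarrow> real) set \<Rightarrow> nat \<Rightarrow>
    ('i \<Rightarrow> 'a::euclidean_space \<Rightarrow> 'b::real_normed_vector) \<Rightarrow> bool" where
  "Ck_family I S W 0 F \<longleftrightarrow> controlled I S W F"
| "Ck_family I S W (Suc k) F \<longleftrightarrow> controlled I S W F \<and>
     (\<forall>i\<in>I. \<forall>x\<in>S. F i differentiable (at x)) \<and>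
     (\<forall>b\<in>Basis. Ck_family I S W k (\<lambda>i x. frechet_derivative (F i) (at x) b))"

definition weight_cone :: "('i \<Rightarrow> 'a \<Rightarrow> real) set \<Rightarrow> bool" where
  "weight_cone W \<longleftrightarrow> (\<lambda>_ _. 0) \<in> W \<and> (\<forall>u\<in>W. \<forall>v\<in>W. (\<lambda>i x. u i x + v i x) \<in> W) \<and>
     (\<forall>c. \<forall>u\<in>W. (\<lambda>i x. c * u i x) \<in> W)"

lemma controlled_cong:
  assumes "\<And>i x. i \<in> I \<Longrightarrow> x \<in> S \<Longrightarrow> F i x = G i x"
  shows "controlled I S W F \<longleftrightarrow> controlled I S W G"
  using assms by (auto simp: controlled_def)

lemma Ck_family_cong:
  assumes S: "open S"
    and "\<And>i x. i \<in> I \<Longrightarrow> x \<in> S \<Longrightarrow> F i x = G i x" "Ck_family I S W k F"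
  shows "Ck_family I S W k G"
  using assms(2,3)
proof (induction k arbitrary: F G)
  case 0
  then show ?case using controlled_cong[of I S F G W] by simp
next
  case (Suc k)
  have d: "frechet_derivative (F i) (at x) = frechet_derivative (G i) (at x)"
    "G i differentiable (at x)" if "i \<in> I" "x \<in> S" for i x
  proof -
    have 1: "(F i has_derivative frechet_derivative (F i) (at x)) (at x)"
      using Suc.prems(2) that by (simp add: frechet_derivative_works)
    have "(G i has_derivative frechet_derivative (F i) (at x)) (at x)"
      by (rule has_derivative_transform_within_open[OF 1 S that(2)]) (simp add: Suc.prems(1) that)
    then show "frechet_derivative (F i) (at x) = frechet_derivative (G i) (at x)"
      "G i differentiable (at x)"
      by (auto simp: frechet_derivative_at differentiable_def)
  qed
  have "Ck_family I S W k (\<lambda>i x. frechet_derivative (G i) (at x) b)" if "b \<in> Basis" for b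
    by (rule Suc.IH[of "\<lambda>i x. frechet_derivative (F i) (at x) b"])
      (use Suc.prems(2) that d in auto)
  then show ?case
    using Suc.prems(2) d(2) controlled_cong[of I S F G W, OF Suc.prems(1)] by auto
qed

lemma Ck_family_controlled: "Ck_family I S W k F \<Longrightarrow> controlled I S W F"
  by (cases k) auto

lemma Ck_family_Suc_down: "Ck_family I S W (Suc k) F \<Longrightarrow> Ck_family I S W k F"
proof (induction k arbitrary: F)
  case (Suc k)
  then show ?case by (auto simp del: Ck_family.simps(2) simp: Ck_family.simps(2)[of I S W "Suc k"] intro!: Ck_family.simps(2)[THEN iffD2])
qed auto

text \<open>The derivative may be given by any formula: frequently a product or a sum to which the induction
hypothesis applies, while \<open>frechet_derivative\<close> itself has no usable form.\<close>

lemma Ck_family_SucI: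
  assumes "open S" "controlled I S W F"
    and D: "\<And>i x. i \<in> I \<Longrightarrow> x \<in> S \<Longrightarrow> (F i has_derivative F' i x) (at x)"
    and "\<And>b. b \<in> Basis \<Longrightarrow> Ck_family I S W k (\<lambda>i x. F' i x b)"
  shows "Ck_family I S W (Suc k) F"
proof -
  have "Ck_family I S W k (\<lambda>i x. frechet_derivative (F i) (at x) b)" if "b \<in> Basis" for b
    by (rule Ck_family_cong[OF assms(1) _ assms(4)[OF that]])
      (metis D frechet_derivative_at)
  then show ?thesis using assms by (auto simp: differentiable_def)
qed

lemma Ck_family_has_derivative:
  "Ck_family I S W (Suc k) F \<Longrightarrow> i \<in> I \<Longrightarrow> x \<in> S \<Longrightarrow>
    (F i has_derivative frechet_derivative (F i) (at x)) (at x)"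
  by (simp add: frechet_derivative_works)

lemma Ck_family_const:
  fixes c :: "'i \<Rightarrow> 'b::real_normed_vector"
  assumes "open S" "weight_cone W" "controlled I S W (\<lambda>i x. c i)"
  shows "Ck_family I S W k (\<lambda>i x. c i)"
proof -
  have 0: "controlled I S W (\<lambda>i x. 0::'b)"
    using assms(2) by (auto simp: controlled_def weight_cone_def intro!: bexI[of _ "\<lambda>_ _. 0"])
  have z: "Ck_family I S W k (\<lambda>i x. 0::'b)" for k
    by (induction k) (auto simp: 0 intro!: Ck_family_SucI[OF assms(1) 0] simp del: Ck_family.simps(2))
  show ?thesis
  proof (cases k)
    case (Suc m)
    then show ?thesis
      using assms z by (auto intro!: Ck_family_SucI[where F'="\<lambda>_ _ _. 0"] simp del: Ck_family.simps(2))
  qed (use assms in auto)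
qed

lemma controlled_add:
  assumes "weight_cone W" "controlled I S W F" "controlled I S W G"
  shows "controlled I S W (\<lambda>i x. F i x + G i x)"
proof -
  from assms obtain u v where uv: "u \<in> W" "v \<in> W" "\<And>i x. i \<in> I \<Longrightarrow> x \<in> S \<Longrightarrow> norm (F i x) \<le> u i x"
    "\<And>i x. i \<in> I \<Longrightarrow> x \<in> S \<Longrightarrow> norm (G i x) \<le> v i x" by (auto simp: controlled_def)
  show ?thesis unfolding controlled_def
    by (rule bexI[of _ "\<lambda>i x. u i x + v i x"])
      (use uv assms(1) in \<open>auto simp: weight_cone_def intro: norm_triangle_mono\<close>)
qed

lemma Ck_family_add:
  assumes S: "open S" and W: "weight_cone W"
    and "Ck_family I S W k F" "Ck_family I S W k G"
  shows "Ck_family I S W k (\<lambda>i x. F i x + G i x)"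
  using assms(3,4)
proof (induction k arbitrary: F G)
  case 0
  then show ?case using controlled_add[OF W] by simp
next
  case (Suc k)
  show ?case
    by (rule Ck_family_SucI[OF S _ has_derivative_add[OF Ck_family_has_derivative[OF Suc.prems(1)]
        Ck_family_has_derivative[OF Suc.prems(2)]]])
      (use Suc.prems Suc.IH controlled_add[OF W] in auto)
qed

lemma Ck_family_sum:
  assumes S: "open S" and W: "weight_cone W" and "finite A"
    and "\<And>a. a \<in> A \<Longrightarrow> Ck_family I S W k (F a)"
  shows "Ck_family I S W k (\<lambda>i x. \<Sum>a\<in>A. F a i x)"
  using assms(3,4)
proof (induction A rule: finite_induct)
  case empty
  show ?case using W by (auto intro!: Ck_family_const[OF S W] simp: controlled_def weight_cone_def)
next
  case (insert a A)
  then show ?case by (auto intro!: Ck_family_add[OF S W])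
qed

text \<open>The derivative of a bilinear expression is a sum of two bilinear expressions with one factor
  differentiated, so the induction hypothesis applies to each. One induction covers products of numbers and
  of scalars with vectors, and also mixed weights, such as a moderate times a rapidly decreasing factor.\<close>

lemma Ck_family_bilinear:
  assumes S: "open S" and W: "weight_cone W" and B: "bounded_bilinear B"
    and UV: "\<And>u v. u \<in> U \<Longrightarrow> v \<in> V \<Longrightarrow> (\<lambda>i x. u i x * v i x) \<in> W"
    and "Ck_family I S U k F" "Ck_family I S V k G"
  shows "Ck_family I S W k (\<lambda>i x. B (F i x) (G i x))"
proof -
  have *: "controlled I S W (\<lambda>i x. B (F i x) (G i x))"
    if "controlled I S U F" "controlled I S V G" for F G
  proof -
    from that obtain u v where uv: "u \<in> U" "v \<in> V" "\<And>i x. i \<in> I \<Longrightarrow> x \<in> S \<Longrightarrow> norm (F i x) \<le> u i x"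
      "\<And>i x. i \<in> I \<Longrightarrow> x \<in> S \<Longrightarrow> norm (G i x) \<le> v i x" by (auto simp: controlled_def)
    from bounded_bilinear.nonneg_bounded[OF B] obtain K where K: "0 \<le> K"
      "\<And>a b. norm (B a b) \<le> norm a * norm b * K" by blast
    have "norm (B (F i x) (G i x)) \<le> K * (u i x * v i x)" if "i \<in> I" "x \<in> S" for i x
    proof -
      have "norm (F i x) * norm (G i x) \<le> u i x * v i x"
        using uv(3,4)[OF that] by (meson mult_mono norm_ge_zero order_trans)
      then show ?thesis
        using K(2)[of "F i x" "G i x"] mult_right_mono[OF _ K(1)] by (fastforce simp: mult.commute)
    qed
    moreover have "(\<lambda>i x. K * (u i x * v i x)) \<in> W"
      using W UV[OF uv(1,2)] by (auto simp: weight_cone_def)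
    ultimately show ?thesis unfolding controlled_def
      by (intro bexI[of _ "\<lambda>i x. K * (u i x * v i x)"]) auto
  qed
  show ?thesis using assms(5,6)
  proof (induction k arbitrary: F G)
    case 0
    then show ?case using * by simp
  next
    case (Suc k)
    show ?case
    proof (rule Ck_family_SucI[OF S _ bounded_bilinear.FDERIV[OF B Ck_family_has_derivative[OF Suc.prems(1)]
          Ck_family_has_derivative[OF Suc.prems(2)]]])
      show "controlled I S W (\<lambda>i x. B (F i x) (G i x))"
        using * Suc.prems by simp
    next
      fix b :: 'a assume b: "b \<in> Basis"
      show "Ck_family I S W k (\<lambda>i x. B (F i x) (frechet_derivative (G i) (at x) b) +
          B (frechet_derivative (F i) (at x) b) (G i x))"
        by (rule Ck_family_add[OF S W]; rule Suc.IH)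
          (use Suc.prems[THEN Ck_family_Suc_down] Suc.prems b in \<open>auto\<close>)
    qed
  qed
qed

lemma Ck_family_weight_mono:
  assumes "Ck_family I S U k F" "\<And>u. u \<in> U \<Longrightarrow> \<exists>w\<in>W. \<forall>i\<in>I. \<forall>x\<in>S. u i x \<le> w i x"
  shows "Ck_family I S W k F"
proof -
  have *: "controlled I S W F" if "controlled I S U F" for F :: "_ \<Rightarrow> _ \<Rightarrow> 'c::real_normed_vector"
    using that assms(2) by (simp add: controlled_def) (meson order_trans)
  show ?thesis using assms(1)
    by (induction k arbitrary: F) (auto intro: *)
qed

text \<open>Moderate families: every derivative is bounded by a power of one weight function \<open>w\<close>. For
  \<open>w \<ge> 1\<close> the powers absorb sums as well as products.\<close>

definition powers :: "('i \<Rightarrow> 'a \<Rightarrow> real) \<Rightarrow> ('i \<Rightarrow> 'a \<Rightarrow> real) set" where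
  "powers w = {u. \<exists>C N. 0 \<le> C \<and> (\<forall>i x. \<bar>u i x\<bar> \<le> C * w i x ^ N)}"

lemma powers_mult:
  assumes "u \<in> powers w" "v \<in> powers w"
  shows "(\<lambda>i x. u i x * v i x) \<in> powers w"
proof -
  from assms obtain C N D M where *: "0 \<le> C" "\<And>i x. \<bar>u i x\<bar> \<le> C * w i x ^ N"
     "0 \<le> D" "\<And>i x. \<bar>v i x\<bar> \<le> D * w i x ^ M" by (auto simp: powers_def)
  have "\<bar>u i x * v i x\<bar> \<le> (C*D) * w i x ^ (N+M)" for i x
    using mult_mono'[OF *(2)[of i x] *(4)[of i x]] by (simp add: abs_mult power_add mult_ac)
  with * show ?thesis unfolding powers_def by (auto intro!: exI[of _ "C*D"] exI[of _ "N+M"])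
qed

lemma powers_cone:
  assumes w: "\<And>i x. 1 \<le> w i x"
  shows "weight_cone (powers w)"
  unfolding weight_cone_def
proof (intro conjI ballI allI)
  show "(\<lambda>_ _. 0) \<in> powers w" by (auto simp: powers_def intro!: exI[of _ 0])
next
  fix u v assume "u \<in> powers w" "v \<in> powers w"
  then obtain C N D M where *: "0 \<le> C" "\<And>i x. \<bar>u i x\<bar> \<le> C * w i x ^ N"
     "0 \<le> D" "\<And>i x. \<bar>v i x\<bar> \<le> D * w i x ^ M" by (auto simp: powers_def)
  have "\<bar>u i x + v i x\<bar> \<le> (C+D) * w i x ^ (N+M)" for i x
  proof -
    have "w i x ^ N \<le> w i x ^ (N+M)" "w i x ^ M \<le> w i x ^ (N+M)"
      using w by (auto intro!: power_increasing)
    then have "C * w i x ^ N \<le> C * w i x ^ (N+M)" "D * w i x ^ M \<le> D * w i x ^ (N+M)"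
      using *(1,3) by (auto intro!: mult_left_mono)
    with *(2,4)[of i x] show ?thesis by (simp add: distrib_right)
  qed
  with * show "(\<lambda>i x. u i x + v i x) \<in> powers w"
    unfolding powers_def by (auto intro!: exI[of _ "C+D"] exI[of _ "N+M"])
next
  fix c u assume "u \<in> powers w"
  then obtain C N where *: "0 \<le> C" "\<And>i x. \<bar>u i x\<bar> \<le> C * w i x ^ N" by (auto simp: powers_def)
  show "(\<lambda>i x. c * u i x) \<in> powers w" unfolding powers_def
    using mult_left_mono[OF *(2), of "\<bar>c\<bar>"] *(1)
    by (auto intro!: exI[of _ "\<bar>c\<bar>*C"] exI[of _ N] simp: abs_mult mult_ac)
qed

lemma controlled_powersI:
  assumes "0 \<le> C" "\<And>i x. 1 \<le> w i x" "\<And>i x. i \<in> I \<Longrightarrow> x \<in> S \<Longrightarrow> norm (F i x) \<le> C * w i x ^ N"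
  shows "controlled I S (powers w) F"
proof -
  have "0 \<le> w i x" for i x using assms(2)[of i x] by linarith
  then show ?thesis
    unfolding controlled_def powers_def using assms(1,3)
    by (intro bexI[of _ "\<lambda>i x. C * w i x ^ N"]) (auto simp: abs_mult)
qed

lemma controlled_powersE:
  assumes "controlled I S (powers w) F"
  obtains C N where "0 \<le> C" "\<And>i x. i \<in> I \<Longrightarrow> x \<in> S \<Longrightarrow> norm (F i x) \<le> C * w i x ^ N"
  using assms by (auto simp: controlled_def powers_def) (meson abs_le_iff order_trans)

lemmas Ck_family_moderate_mult =
  Ck_family_bilinear[OF _ _ bounded_bilinear_mult powers_mult]
lemmas Ck_family_moderate_scaleR =
  Ck_family_bilinear[OF _ _ bounded_bilinear_scaleR powers_mult]

text \<open>By the chain rule each derivative is a sum of products of a coordinate of the derivative of \<open>\<eta>\<close>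
  and a partial derivative of \<open>\<kappa>\<close> evaluated at \<open>\<eta>\<close>; the latter is again a composition of the same kind.
  With bounded derivatives of \<open>\<kappa>\<close> these factors stay bounded whatever the size of \<open>\<eta>\<close>.\<close>

lemma Ck_family_compose:
  fixes \<kappa> :: "'c::euclidean_space \<Rightarrow> 'b::real_normed_vector"
    and \<eta> :: "'i \<Rightarrow> 'a::euclidean_space \<Rightarrow> 'c"
  assumes S: "open S" and w: "\<And>i x. 1 \<le> w i x"
    and "Ck_family {()} UNIV (powers (\<lambda>_ _. 1)) k (\<lambda>_. \<kappa>)"
    and \<eta>: "\<And>c. c \<in> Basis \<Longrightarrow> Ck_family I S (powers w) k (\<lambda>i x. \<eta> i x \<bullet> c)"
  shows "Ck_family I S (powers w) k (\<lambda>i x. \<kappa> (\<eta> i x))"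
proof -
  have *: "controlled I S (powers w) (\<lambda>i x. \<kappa> (\<eta> i x))"
    if "controlled {()} UNIV (powers (\<lambda>_ _. 1)) (\<lambda>_. \<kappa>)" for \<kappa> :: "'c \<Rightarrow> 'b"
  proof -
    from controlled_powersE[OF that] obtain C where "0 \<le> C" "\<And>x. norm (\<kappa> x) \<le> C"
      by (metis UNIV_I insertI1 mult.right_neutral power_one)
    then show ?thesis by (intro controlled_powersI[of C _ _ _ _ 0] w) auto
  qed
  show ?thesis using assms(3,4)
  proof (induction k arbitrary: \<kappa>)
    case 0
    then show ?case using * by simp
  next
    case (Suc k)
    let ?D = "\<lambda>i x h. frechet_derivative (\<lambda>x. \<eta> i x \<bullet> h) (at x)"
    have \<eta>d: "(\<eta> i has_derivative (\<lambda>h. \<Sum>c\<in>Basis. (?D i x c h) *\<^sub>R c)) (at x)"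
      if "i \<in> I" "x \<in> S" for i x
      using Ck_family_has_derivative[OF Suc.prems(2) that]
      by (subst has_derivative_componentwise_within) (simp add: inner_sum_left inner_Basis if_distrib cong: if_cong)
    have \<kappa>d: "(\<kappa> has_derivative frechet_derivative \<kappa> (at y)) (at y)" for y
      using Ck_family_has_derivative[OF Suc.prems(1)] by simp
    have comp: "((\<lambda>x. \<kappa> (\<eta> i x)) has_derivative
       (\<lambda>h. \<Sum>c\<in>Basis. ?D i x c h *\<^sub>R frechet_derivative \<kappa> (at (\<eta> i x)) c)) (at x)"
      if "i \<in> I" "x \<in> S" for i x
    proof -
      have lin: "linear (frechet_derivative \<kappa> (at (\<eta> i x)))"
        using \<kappa>d has_derivative_linear by blast
      show ?thesis
        using has_derivative_compose[OF \<eta>d[OF that] \<kappa>d] by (simp add: linear_sum[OF lin] linear_cmul[OF lin])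
    qed
    show ?case
    proof (rule Ck_family_SucI[OF S _ comp])
      show "controlled I S (powers w) (\<lambda>i x. \<kappa> (\<eta> i x))"
        using * Suc.prems by simp
    next
      fix b :: 'a assume b: "b \<in> Basis"
      show "Ck_family I S (powers w) k
          (\<lambda>i x. \<Sum>c\<in>Basis. ?D i x c b *\<^sub>R frechet_derivative \<kappa> (at (\<eta> i x)) c)"
      proof (rule Ck_family_sum[OF S powers_cone[OF w]])
        fix c :: 'c assume c: "c \<in> Basis"
        show "Ck_family I S (powers w) k (\<lambda>i x. ?D i x c b *\<^sub>R frechet_derivative \<kappa> (at (\<eta> i x)) c)"
        proof (rule Ck_family_moderate_scaleR[OF S powers_cone[OF w]])
          show "Ck_family I S (powers w) k (\<lambda>i x. ?D i x c b)"
            using Suc.prems(2)[OF c] b by simp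
          show "Ck_family I S (powers w) k (\<lambda>i x. frechet_derivative \<kappa> (at (\<eta> i x)) c)"
            by (rule Suc.IH[of "\<lambda>y. frechet_derivative \<kappa> (at y) c"])
              (use Suc.prems(1) c Ck_family_Suc_down[OF Suc.prems(2)] in auto)
        qed
      qed simp
    qed
  qed
qed

section \<open>Schwartz functions and moderate symbols\<close>

text \<open>Rapidly decreasing and polynomially growing majorants for a single function, which is a family over
\<open>unit\<close>.\<close>

definition rapid :: "(unit \<Rightarrow> 'a::real_normed_vector \<Rightarrow> real) set" where
  "rapid = {w. \<forall>N. \<exists>C. \<forall>i x. (1 + norm x) ^ N * \<bar>w i x\<bar> \<le> C}"

definition tame :: "(unit \<Rightarrow> 'a::real_normed_vector \<Rightarrow> real) set" where
  "tame = powers (\<lambda>_ x. 1 + norm x)"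

definition csmooth ::
  "(unit \<Rightarrow> 'a \<Rightarrow> real) set \<Rightarrow> ('a::euclidean_space \<Rightarrow> 'b::real_normed_vector) \<Rightarrow> bool" where
  "csmooth W f \<longleftrightarrow> (\<forall>k. Ck_family {()} UNIV W k (\<lambda>_. f))"

lemma iter_deriv_snoc:
  "iter_deriv (vs @ [v]) f = iter_deriv vs (\<lambda>x. frechet_derivative f (at x) v)"
  by (induction vs) auto

text \<open>\<open>Ck_family\<close> peels off the derivative that is taken first, \<open>iter_deriv\<close> the one that is taken
last; \<open>iter_deriv_snoc\<close> reconciles them.\<close>

lemma Ck_family_iff_iter_deriv:
  fixes f :: "'a::euclidean_space \<Rightarrow> 'b::real_normed_vector"
  shows "Ck_family {()} UNIV W k (\<lambda>_. f) \<longleftrightarrow>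
    (\<forall>vs\<in>lists Basis. length vs \<le> k \<longrightarrow> controlled {()} UNIV W (\<lambda>_. iter_deriv vs f)) \<and>
    (\<forall>vs\<in>lists Basis. length vs < k \<longrightarrow> (\<forall>x. iter_deriv vs f differentiable (at x)))"
proof (induction k arbitrary: f)
  case 0
  show ?case by auto
next
  case (Suc k)
  have snoc: "(\<forall>vs\<in>lists Basis. P vs) \<longleftrightarrow> P [] \<and> (\<forall>b\<in>Basis. \<forall>vs\<in>lists Basis. P (vs @ [b]))"
    for P :: "'a list \<Rightarrow> bool"
  proof (intro iffI ballI conjI)
    fix vs :: "'a list" assume P: "P [] \<and> (\<forall>b\<in>Basis. \<forall>vs\<in>lists Basis. P (vs @ [b]))" and vs: "vs \<in> lists Basis"
    from vs show "P vs" using P by (cases vs rule: rev_cases) auto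
  qed auto
  show ?case
    unfolding Ck_family.simps Suc.IH
    apply (subst (4) snoc) apply (subst (3) snoc)
    by (simp add: iter_deriv_snoc) blast
qed

lemma csmooth_iff:
  "csmooth W f \<longleftrightarrow> smooth_on UNIV f \<and>
    (\<forall>vs\<in>lists Basis. controlled {()} UNIV W (\<lambda>_. iter_deriv vs f))"
  unfolding csmooth_def Ck_family_iff_iter_deriv smooth_on_def by (auto; meson lessI order_refl)

lemma csmooth_derivI:
  assumes "controlled {()} UNIV W (\<lambda>_. f)" "\<And>x. (f has_derivative f' x) (at x)"
    "\<And>b. b \<in> Basis \<Longrightarrow> csmooth W (\<lambda>x. f' x b)"
  shows "csmooth W f"
  unfolding csmooth_def
proof
  fix k show "Ck_family {()} UNIV W k (\<lambda>_. f)"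
  proof (cases k)
    case (Suc m)
    then show ?thesis using assms
      by (auto intro!: Ck_family_SucI[of UNIV "{()}" W "\<lambda>_. f" "\<lambda>_. f'"] simp: csmooth_def simp del: Ck_family.simps(2))
  qed (use assms in simp)
qed

lemma csmooth_has_derivative:
  assumes "csmooth W f" shows "(f has_derivative frechet_derivative f (at x)) (at x)"
  using Ck_family_has_derivative[of "{()}" UNIV W 0 "\<lambda>_. f" "()" x] assms unfolding csmooth_def by blast

lemma csmooth_deriv:
  "csmooth W f \<Longrightarrow> b \<in> Basis \<Longrightarrow> csmooth W (\<lambda>x. frechet_derivative f (at x) b)"
  unfolding csmooth_def using Ck_family.simps(2)[of "{()}" UNIV W _ "\<lambda>_. f"] by blast

lemma csmooth_continuous: "csmooth W f \<Longrightarrow> continuous_on S f"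
  by (meson csmooth_has_derivative continuous_at_imp_continuous_on has_derivative_continuous)

lemma csmooth_measurable [measurable_dest]:
  "csmooth W f \<Longrightarrow> f \<in> borel_measurable borel"
  by (intro borel_measurable_continuous_onI csmooth_continuous)

lemma csmooth_controlled: "csmooth W f \<Longrightarrow> controlled {()} UNIV W (\<lambda>_. f)"
  unfolding csmooth_def by (meson Ck_family.simps(1))

lemma tame_cone: "weight_cone tame" unfolding tame_def by (rule powers_cone) simp

lemma rapid_cone: "weight_cone rapid"
  unfolding weight_cone_def
proof (intro conjI ballI allI)
  show "(\<lambda>_ _. 0) \<in> rapid" by (auto simp: rapid_def)
next
  fix u v :: "unit \<Rightarrow> 'a \<Rightarrow> real" assume u: "u \<in> rapid" and v: "v \<in> rapid"
  show "(\<lambda>i x. u i x + v i x) \<in> rapid" unfolding rapid_def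
  proof (safe)
    fix N
    from u v obtain C D where *: "\<And>i x. (1 + norm x) ^ N * \<bar>u i x\<bar> \<le> C" "\<And>i x. (1 + norm x) ^ N * \<bar>v i x\<bar> \<le> D"
      unfolding rapid_def by blast
    have "(1 + norm x) ^ N * \<bar>u i x + v i x\<bar> \<le> C + D" for i x
    proof -
      have "(1 + norm x) ^ N * \<bar>u i x + v i x\<bar> \<le> (1 + norm x) ^ N * (\<bar>u i x\<bar> + \<bar>v i x\<bar>)"
        by (intro mult_left_mono) auto
      then show ?thesis using *[where i=i and x=x] by (simp add: distrib_left)
    qed
    then show "\<exists>C. \<forall>i x. (1 + norm x) ^ N * \<bar>u i x + v i x\<bar> \<le> C" by blast
  qed
next
  fix c and u :: "unit \<Rightarrow> 'a \<Rightarrow> real" assume u: "u \<in> rapid"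
  show "(\<lambda>i x. c * u i x) \<in> rapid" unfolding rapid_def
  proof safe
    fix N
    from u obtain C where *: "\<And>i x. (1 + norm x) ^ N * \<bar>u i x\<bar> \<le> C" 
      unfolding rapid_def by blast
    have "(1 + norm x) ^ N * \<bar>c * u i x\<bar> \<le> \<bar>c\<bar> * C" for i x
      using mult_left_mono[OF *[where i=i and x=x], of "\<bar>c\<bar>"] by (simp add: abs_mult mult_ac)
    then show "\<exists>C. \<forall>i x. (1 + norm x) ^ N * \<bar>c * u i x\<bar> \<le> C" by blast
  qed
qed

lemma tame_mult_rapid:
  assumes "u \<in> tame" "v \<in> rapid" shows "(\<lambda>i x. u i x * v i x) \<in> rapid"
proof -
  from assms(1) obtain C N where *: "0 \<le> C" "\<And>i x. \<bar>u i x\<bar> \<le> C * (1 + norm x) ^ N"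
    by (auto simp: tame_def powers_def)
  show ?thesis unfolding rapid_def
  proof safe
    fix M
    from assms(2) obtain D where D: "\<And>i x. (1 + norm x) ^ (M+N) * \<bar>v i x\<bar> \<le> D" 
      unfolding rapid_def by blast
    have "(1 + norm x) ^ M * \<bar>u i x * v i x\<bar> \<le> C * D" for i x
    proof -
      have "(1 + norm x) ^ M * \<bar>u i x * v i x\<bar> = (1 + norm x) ^ M * \<bar>v i x\<bar> * \<bar>u i x\<bar>" by (simp add: abs_mult)
      also have "\<dots> \<le> (1 + norm x) ^ M * \<bar>v i x\<bar> * (C * (1 + norm x) ^ N)"
        by (intro mult_left_mono *) auto
      also have "\<dots> = C * ((1 + norm x) ^ (M+N) * \<bar>v i x\<bar>)" by (simp add: power_add)
      also have "\<dots> \<le> C * D" by (intro mult_left_mono * D)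
      finally show ?thesis .
    qed
    then show "\<exists>C. \<forall>i x. (1 + norm x) ^ M * \<bar>u i x * v i x\<bar> \<le> C" by blast
  qed
qed

lemma controlled_rapid_iff:
  "controlled {()} UNIV rapid (\<lambda>_. f) \<longleftrightarrow> (\<forall>N. \<exists>C. \<forall>x. (1 + norm x) ^ N * norm (f x) \<le> C)"
proof
  assume "controlled {()} UNIV rapid (\<lambda>_. f)"
  then obtain w where w: "w \<in> rapid" "\<And>x. norm (f x) \<le> w () x" by (auto simp: controlled_def)
  show "\<forall>N. \<exists>C. \<forall>x. (1 + norm x) ^ N * norm (f x) \<le> C"
  proof
    fix N
    from w(1) obtain C where C: "\<And>x. (1 + norm x) ^ N * \<bar>w () x\<bar> \<le> C" unfolding rapid_def by blast
    have "(1 + norm x) ^ N * norm (f x) \<le> C" for x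
      using C[of x] w(2)[of x] by (meson abs_ge_self add_nonneg_nonneg mult_left_mono norm_ge_zero order_trans zero_le_one zero_le_power)
    then show "\<exists>C. \<forall>x. (1 + norm x) ^ N * norm (f x) \<le> C" by blast
  qed
next
  assume "\<forall>N. \<exists>C. \<forall>x. (1 + norm x) ^ N * norm (f x) \<le> C"
  then show "controlled {()} UNIV rapid (\<lambda>_. f)"
    unfolding controlled_def by (intro bexI[of _ "\<lambda>_ x. norm (f x)"]) (auto simp: rapid_def)
qed

lemma rapid_iff_powers_bounded:
  fixes f :: "'a::real_normed_vector \<Rightarrow> 'b::real_normed_vector"
  shows "(\<forall>N. \<exists>C. \<forall>x. (1 + norm x) ^ N * norm (f x) \<le> C) \<longleftrightarrow>
    (\<forall>k. bdd_above (range (\<lambda>x. norm x ^ k * norm (f x))))"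
proof (intro iffI allI)
  fix k assume "\<forall>N. \<exists>C. \<forall>x. (1 + norm x) ^ N * norm (f x) \<le> C"
  then obtain C where C: "\<And>x. (1 + norm x) ^ k * norm (f x) \<le> C" by blast
  have "norm x ^ k * norm (f x) \<le> C" for x
    using C[of x] mult_right_mono[OF power_mono[of "norm x" "1 + norm x" k], of "norm (f x)"] by simp
  then show "bdd_above (range (\<lambda>x. norm x ^ k * norm (f x)))" by (auto simp: bdd_above_def)
next
  fix N assume *: "\<forall>k. bdd_above (range (\<lambda>x. norm x ^ k * norm (f x)))"
  have "\<exists>B. \<forall>x. norm x ^ k * norm (f x) \<le> B" for k
    using *[rule_format, of k] by (auto simp: bdd_above_def)
  then obtain B where B: "\<And>k x. norm x ^ k * norm (f x) \<le> B k" by metis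
  have "(1 + norm x) ^ N * norm (f x) \<le> (\<Sum>k\<le>N. of_nat (N choose k) * B k)" for x
  proof -
    have "(1 + norm x) ^ N * norm (f x) = (\<Sum>k\<le>N. of_nat (N choose k) * (norm x ^ k * norm (f x)))"
      using binomial_ring[of "norm x" 1 N] by (simp add: add.commute sum_distrib_right mult.assoc)
    also have "\<dots> \<le> (\<Sum>k\<le>N. of_nat (N choose k) * B k)"
      by (intro sum_mono mult_left_mono B) auto
    finally show ?thesis .
  qed
  then show "\<exists>C. \<forall>x. (1 + norm x) ^ N * norm (f x) \<le> C" by blast
qed

text \<open>This equivalence moves the Schwartz space into the calculus of controlled families, where closure
properties have short inductive proofs.\<close>

lemma schwartz_iff: "f \<in> schwartz \<longleftrightarrow> csmooth rapid f"
  unfolding schwartz_def csmooth_iff controlled_rapid_iff rapid_iff_powers_bounded by auto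

lemma csmooth_mult:
  fixes f g :: "'a::euclidean_space \<Rightarrow> 'b::real_normed_algebra"
  assumes "csmooth tame f" "csmooth tame g"
  shows "csmooth tame (\<lambda>x. f x * g x)"
  using assms tame_cone unfolding csmooth_def tame_def
  by (auto intro!: Ck_family_moderate_mult)

lemma csmooth_add: "weight_cone W \<Longrightarrow> csmooth W f \<Longrightarrow> csmooth W g \<Longrightarrow> csmooth W (\<lambda>x. f x + g x)"
  unfolding csmooth_def by (auto intro!: Ck_family_add)

lemma csmooth_sum:
  "weight_cone W \<Longrightarrow> finite A \<Longrightarrow> (\<And>a. a \<in> A \<Longrightarrow> csmooth W (f a)) \<Longrightarrow> csmooth W (\<lambda>x. \<Sum>a\<in>A. f a x)"
  unfolding csmooth_def by (auto intro!: Ck_family_sum)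

lemma tame_mult_schwartz:
  "csmooth tame f \<Longrightarrow> g \<in> schwartz \<Longrightarrow> (\<lambda>x. f x * g x) \<in> schwartz"
  unfolding schwartz_iff csmooth_def
  by (auto intro!: Ck_family_bilinear[OF _ rapid_cone bounded_bilinear_mult tame_mult_rapid])

lemma controlled_tameI:
  assumes "0 \<le> C" "\<And>x. norm (f x) \<le> C * (1 + norm x) ^ N"
  shows "controlled {()} UNIV tame (\<lambda>_. f)"
  unfolding tame_def by (rule controlled_powersI[of C _ _ _ _ N]) (use assms in auto)

lemma csmooth_const: "csmooth tame (\<lambda>x. c)"
  unfolding csmooth_def
  by (intro allI Ck_family_const tame_cone controlled_tameI[of "norm c" _ 0]) auto

lemma csmooth_linear:
  fixes f :: "'a::euclidean_space \<Rightarrow> 'b::real_normed_vector"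
  assumes f: "bounded_linear f" shows "csmooth tame f"
proof (rule csmooth_derivI[OF _ bounded_linear_imp_has_derivative[OF f] csmooth_const])
  from bounded_linear.nonneg_bounded[OF f] obtain K where K: "0 \<le> K" "\<And>x. norm (f x) \<le> norm x * K" by blast
  show "controlled {()} UNIV tame (\<lambda>_. f)"
  proof (rule controlled_tameI[of K _ 1])
    show "norm (f x) \<le> K * (1 + norm x) ^ 1" for x
      using K(2)[of x] K(1) by (simp add: algebra_simps)
  qed (rule K)
qed

lemma csmooth_bounded_linear_image:
  fixes f :: "'a::euclidean_space \<Rightarrow> 'b::real_normed_vector"
  assumes T: "bounded_linear T" and W: "weight_cone W" and f: "csmooth W f"
  shows "csmooth W (\<lambda>x. T (f x))"
proof -
    have *: "controlled {()} UNIV W (\<lambda>_ x. T (f x))" if "controlled {()} UNIV W (\<lambda>_. f)" for f :: "'a \<Rightarrow> 'b"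
    proof -
      from bounded_linear.nonneg_bounded[OF T] obtain K where K: "0 \<le> K" "\<And>x. norm (T x) \<le> norm x * K" by blast
      from that obtain w where w: "w \<in> W" "\<And>x. norm (f x) \<le> w () x" by (auto simp: controlled_def)
      have "norm (T (f x)) \<le> K * w () x" for x
        using K(2)[of "f x"] mult_left_mono[OF w(2)[of x] K(1)] by (simp add: mult.commute)
      then show ?thesis unfolding controlled_def
        using W w(1) by (intro bexI[of _ "\<lambda>i x. K * w i x"]) (auto simp: weight_cone_def)
    qed
  have "Ck_family {()} UNIV W k (\<lambda>_ x. T (f x))" if "Ck_family {()} UNIV W k (\<lambda>_. f)" for k
    using that
  proof (induction k arbitrary: f)
    case 0 then show ?case using * by simp
  next
    case (Suc k)
    show ?case
      by (rule Ck_family_SucI[OF open_UNIV _ bounded_linear.has_derivative[OF T Ck_family_has_derivative[OF Suc.prems]]])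
        (use Suc.prems Suc.IH * in auto)
  qed
  with f show ?thesis by (auto simp: csmooth_def)
qed

lemma schwartz_cnj: "f \<in> schwartz \<Longrightarrow> (\<lambda>x. cnj (f x)) \<in> schwartz"
  unfolding schwartz_iff by (rule csmooth_bounded_linear_image[OF bounded_linear_cnj rapid_cone])

lemma schwartz_add: "f \<in> schwartz \<Longrightarrow> g \<in> schwartz \<Longrightarrow> (\<lambda>x. f x + g x) \<in> schwartz"
  unfolding schwartz_iff by (rule csmooth_add[OF rapid_cone])

lemma schwartz_sum: "finite A \<Longrightarrow> (\<And>a. a \<in> A \<Longrightarrow> f a \<in> schwartz) \<Longrightarrow> (\<lambda>x. \<Sum>a\<in>A. f a x) \<in> schwartz"
  unfolding schwartz_iff by (rule csmooth_sum[OF rapid_cone])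

lemma schwartz_cmult: "f \<in> schwartz \<Longrightarrow> (\<lambda>x. c * f x) \<in> schwartz"
  by (rule tame_mult_schwartz[OF csmooth_const])

lemma schwartz_deriv: "f \<in> schwartz \<Longrightarrow> b \<in> Basis \<Longrightarrow> (\<lambda>x. frechet_derivative f (at x) b) \<in> schwartz"
  unfolding schwartz_iff by (rule csmooth_deriv)

lemma schwartz_bounded:
  assumes "f \<in> schwartz" obtains C where "0 \<le> C" "\<And>x. (1 + norm x) ^ N * norm (f x) \<le> C"
proof -
  from assms obtain C where C: "\<And>x. (1 + norm x) ^ N * norm (f x) \<le> C"
    unfolding schwartz_iff csmooth_iff controlled_rapid_iff using csmooth_controlled controlled_rapid_iff
    by (metis iter_deriv.simps(1) lists.Nil)
  from C[of 0] have "0 \<le> C" by (metis norm_ge_zero add_nonneg_nonneg mult_nonneg_nonneg order_trans zero_le_one zero_le_power)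
  with C show ?thesis using that by blast
qed

lemma schwartz_measurable [measurable_dest]: "f \<in> schwartz \<Longrightarrow> f \<in> borel_measurable borel"
  unfolding schwartz_iff by (rule csmooth_measurable)

section \<open>Differentiation under the integral sign\<close>

text \<open>Dominated convergence for the difference quotients: they are bounded by \<open>2 * w\<close> because
\<open>H i\<close> is Lipschitz with constant \<open>w i\<close> on the convex set \<open>S\<close>. The measurability of the derivative in
the parameter \<open>i\<close> is a conclusion, since it is a limit of difference quotients.\<close>

lemma has_derivative_integral:
  fixes H :: "'i \<Rightarrow> 'a::euclidean_space \<Rightarrow> 'b::{banach, second_countable_topology}"
  assumes S: "open S" "convex S" "x0 \<in> S"
    and int: "\<And>x. x \<in> S \<Longrightarrow> integrable M (\<lambda>i. H i x)"
    and D: "\<And>i x. i \<in> space M \<Longrightarrow> x \<in> S \<Longrightarrow> (H i has_derivative H' i x) (at x)"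
    and bound: "\<And>i x h. i \<in> space M \<Longrightarrow> x \<in> S \<Longrightarrow> norm (H' i x h) \<le> w i * norm h"
    and w: "integrable M w"
  shows "((\<lambda>x. LINT i|M. H i x) has_derivative (\<lambda>h. LINT i|M. H' i x0 h)) (at x0)"
    and "\<And>h. integrable M (\<lambda>i. H' i x0 h)"
proof -
  have ev: "\<exists>n0. \<forall>n. X (n + n0) \<in> S" if "X \<longlonglongrightarrow> x0" for X :: "nat \<Rightarrow> 'a"
    using topological_tendstoD[OF that S(1,3)] by (auto simp: eventually_sequentially) (metis le_add2)
  have meas: "(\<lambda>i. H' i x0 h) \<in> borel_measurable M" for h
  proof -
    define X where "X n = x0 + (1 / real (Suc n)) *\<^sub>R h" for n
    have X: "X \<longlonglongrightarrow> x0"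
    proof -
      have "(\<lambda>n. (1 / real (Suc n)) *\<^sub>R h) \<longlonglongrightarrow> 0 *\<^sub>R h"
        by (intro tendsto_scaleR tendsto_const) (rule LIMSEQ_Suc[OF lim_const_over_n])
      then show ?thesis unfolding X_def using tendsto_add[OF tendsto_const[of x0]] by fastforce
    qed
    from ev[OF X] obtain n0 where n0: "\<And>n. X (n + n0) \<in> S" by blast
    show ?thesis
    proof (rule borel_measurable_LIMSEQ_metric)
      show "(\<lambda>i. real (Suc (n + n0)) *\<^sub>R (H i (X (n + n0)) - H i x0)) \<in> borel_measurable M" for n
        using int[OF n0[of n]] int[OF S(3)] by (intro borel_measurable_scaleR) auto
    next
      fix i assume i: "i \<in> space M"
      have "((\<lambda>t. (H i (x0 + t *\<^sub>R h) - H i x0) /\<^sub>R t) \<longlongrightarrow> H' i x0 h) (at 0)"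
      proof -
        have "((\<lambda>t. H i (x0 + t *\<^sub>R h)) has_derivative (\<lambda>t. H' i x0 (t *\<^sub>R h))) (at 0)"
          by (rule has_derivative_compose[of "\<lambda>t. x0 + t *\<^sub>R h" "\<lambda>t. t *\<^sub>R h" _ _ "H i"])
            (auto intro!: derivative_eq_intros D[OF i S(3)])
        then have 1: "((\<lambda>t. norm (H i (x0 + t *\<^sub>R h) - H i x0 - H' i x0 (t *\<^sub>R h)) / norm t) \<longlongrightarrow> 0) (at 0)"
          by (simp add: has_derivative_iff_norm)
        have "((\<lambda>t. norm ((H i (x0 + t *\<^sub>R h) - H i x0) /\<^sub>R t - H' i x0 h)) \<longlongrightarrow> 0) (at 0)"
        proof (rule Lim_transform_eventually[OF 1])
          have "norm (H i (x0 + t *\<^sub>R h) - H i x0 - H' i x0 (t *\<^sub>R h)) / norm t =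
              norm ((H i (x0 + t *\<^sub>R h) - H i x0) /\<^sub>R t - H' i x0 h)" if "t \<noteq> 0" for t
          proof -
            have "(H i (x0 + t *\<^sub>R h) - H i x0) /\<^sub>R t - H' i x0 h =
               (H i (x0 + t *\<^sub>R h) - H i x0 - H' i x0 (t *\<^sub>R h)) /\<^sub>R t"
              using that linear_cmul[OF has_derivative_linear[OF D[OF i S(3)]], of t h]
              by (simp add: scaleR_right_diff_distrib)
            then show ?thesis by (simp add: divide_inverse mult.commute)
          qed
          then show "\<forall>\<^sub>F t in at 0. norm (H i (x0 + t *\<^sub>R h) - H i x0 - H' i x0 (t *\<^sub>R h)) / norm t =
              norm ((H i (x0 + t *\<^sub>R h) - H i x0) /\<^sub>R t - H' i x0 h)"
            by (auto simp: eventually_at_filter)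
        qed
        then show ?thesis by (rule LIM_zero_cancel[OF tendsto_norm_zero_cancel])
      qed
      moreover have "filterlim (\<lambda>n. 1 / real (Suc (n + n0))) (at 0) sequentially"
        unfolding filterlim_at using LIMSEQ_ignore_initial_segment[OF LIMSEQ_Suc[OF lim_const_over_n[of 1]], of n0] by auto
      ultimately have "(\<lambda>n. (H i (x0 + (1 / real (Suc (n + n0))) *\<^sub>R h) - H i x0) /\<^sub>R (1 / real (Suc (n + n0)))) \<longlonglongrightarrow> H' i x0 h"
        by (rule filterlim_compose)
      then show "(\<lambda>n. real (Suc (n + n0)) *\<^sub>R (H i (X (n + n0)) - H i x0)) \<longlonglongrightarrow> H' i x0 h"
        unfolding X_def by (simp add: divide_inverse)
    qed
  qed
  show int': "integrable M (\<lambda>i. H' i x0 h)" for h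
  proof (rule Bochner_Integration.integrable_bound)
    show "integrable M (\<lambda>i. w i * norm h)" using w by simp
    show "AE i in M. norm (H' i x0 h) \<le> norm (w i * norm h)"
      using bound[OF _ S(3)] by (intro AE_I2) (metis abs_ge_self order_trans real_norm_def)
  qed (rule meas)
  have lin: "linear (H' i x0)" if "i \<in> space M" for i
    using D[OF that S(3)] by (rule has_derivative_linear)
  have bl: "bounded_linear (\<lambda>h. LINT i|M. H' i x0 h)"
  proof (rule bounded_linear_intro)
    fix h k
    have "(LINT i|M. H' i x0 (h + k)) = (LINT i|M. H' i x0 h + H' i x0 k)"
      by (rule Bochner_Integration.integral_cong) (simp_all add: linear_add[OF lin])
    also have "\<dots> = (LINT i|M. H' i x0 h) + (LINT i|M. H' i x0 k)"
      by (rule Bochner_Integration.integral_add[OF int' int'])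
    finally show "(LINT i|M. H' i x0 (h + k)) = (LINT i|M. H' i x0 h) + (LINT i|M. H' i x0 k)" .
  next
    fix r h
    have "(LINT i|M. H' i x0 (r *\<^sub>R h)) = (LINT i|M. r *\<^sub>R H' i x0 h)"
      by (rule Bochner_Integration.integral_cong) (simp_all add: linear_cmul[OF lin])
    then show "(LINT i|M. H' i x0 (r *\<^sub>R h)) = r *\<^sub>R (LINT i|M. H' i x0 h)" by simp
  next
    fix h
    have "norm (LINT i|M. H' i x0 h) \<le> (LINT i|M. norm (H' i x0 h))"
      by (rule Bochner_Integration.integral_norm_bound)
    also have "\<dots> \<le> (LINT i|M. w i * norm h)"
      by (rule Bochner_Integration.integral_mono[OF integrable_norm[OF int'] integrable_mult_left[OF w]])
        (rule bound[OF _ S(3)])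
    finally have "norm (LINT i|M. H' i x0 h) \<le> (LINT i|M. w i * norm h)" .
    then show "norm (LINT i|M. H' i x0 h) \<le> norm h * (LINT i|M. w i)" by (simp add: mult.commute)
  qed
  show "((\<lambda>x. LINT i|M. H i x) has_derivative (\<lambda>h. LINT i|M. H' i x0 h)) (at x0)"
    unfolding has_derivative_iff_norm
  proof (intro conjI bl)
    show "((\<lambda>y. norm ((LINT i|M. H i y) - (LINT i|M. H i x0) - (LINT i|M. H' i x0 (y - x0))) / norm (y - x0)) \<longlongrightarrow> 0) (at x0)"
      unfolding tendsto_at_iff_sequentially comp_def
    proof (intro allI impI)
      fix X assume X: "\<forall>n. X n \<in> UNIV - {x0}" "X \<longlonglongrightarrow> x0"
      from ev[OF X(2)] obtain n0 where n0: "\<And>n. X (n + n0) \<in> S" by blast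
      define Y where "Y n = X (n + n0)" for n
      have Y: "Y n \<in> S" "Y n \<noteq> x0" for n using n0 X by (auto simp: Y_def)
      have Yl: "Y \<longlonglongrightarrow> x0" unfolding Y_def using X(2) by (rule LIMSEQ_ignore_initial_segment)
      let ?R = "\<lambda>n i. (H i (Y n) - H i x0 - H' i x0 (Y n - x0)) /\<^sub>R norm (Y n - x0)"
      have iR: "integrable M (\<lambda>i. H i (Y n) - H i x0 - H' i x0 (Y n - x0))" for n
        by (intro Bochner_Integration.integrable_diff int int' Y S)
      have "(\<lambda>n. LINT i|M. ?R n i) \<longlonglongrightarrow> (LINT i|M. 0)"
      proof (rule integral_dominated_convergence[where w="\<lambda>i. 2 * w i"])
        show "(\<lambda>i. ?R n i) \<in> borel_measurable M" for n
          using iR[of n] by (intro borel_measurable_scaleR) auto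
        show "AE i in M. (\<lambda>n. ?R n i) \<longlonglongrightarrow> 0"
        proof (rule AE_I2)
          fix i assume i: "i \<in> space M"
          have "((\<lambda>y. norm (H i y - H i x0 - H' i x0 (y - x0)) / norm (y - x0)) \<longlongrightarrow> 0) (at x0)"
            using D[OF i S(3)] unfolding has_derivative_iff_norm by blast
          moreover have "filterlim Y (at x0) sequentially"
            unfolding filterlim_at using Y Yl by auto
          ultimately have "(\<lambda>n. norm (H i (Y n) - H i x0 - H' i x0 (Y n - x0)) / norm (Y n - x0)) \<longlonglongrightarrow> 0"
            by (rule filterlim_compose)
          then show "(\<lambda>n. ?R n i) \<longlonglongrightarrow> 0"
            by (subst tendsto_norm_zero_iff[symmetric]) (simp add: divide_inverse mult.commute)
        qed
        show "AE i in M. norm (?R n i) \<le> 2 * w i" for n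
        proof (rule AE_I2)
          fix i assume i: "i \<in> space M"
          have wi: "onorm (H' i x) \<le> w i" if "x \<in> S" for x
            by (rule onorm_le) (rule bound[OF i that])
          have "norm (H i (Y n) - H i x0) \<le> w i * norm (Y n - x0)"
            by (rule differentiable_bound[OF S(2) _ wi Y(1) S(3)])
              (use D[OF i] has_derivative_at_withinI in blast)
          moreover have "norm (H' i x0 (Y n - x0)) \<le> w i * norm (Y n - x0)" by (rule bound[OF i S(3)])
          ultimately have "norm (H i (Y n) - H i x0 - H' i x0 (Y n - x0)) \<le> 2 * w i * norm (Y n - x0)"
            using norm_triangle_ineq4[of "H i (Y n) - H i x0" "H' i x0 (Y n - x0)"] by (simp add: algebra_simps)
          moreover have "norm (?R n i) = norm (H i (Y n) - H i x0 - H' i x0 (Y n - x0)) / norm (Y n - x0)"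
            by (simp add: divide_inverse mult.commute)
          ultimately show "norm (?R n i) \<le> 2 * w i" using Y(2)[of n] by (simp add: pos_divide_le_eq)
        qed
      qed (use w in auto)
      then have "(\<lambda>n. norm (LINT i|M. ?R n i)) \<longlonglongrightarrow> 0"
        unfolding Bochner_Integration.integral_zero by (rule tendsto_norm_zero)
      moreover have "norm (LINT i|M. ?R n i) = norm ((LINT i|M. H i (Y n)) - (LINT i|M. H i x0) - (LINT i|M. H' i x0 (Y n - x0))) / norm (Y n - x0)" for n
        by (simp add: Bochner_Integration.integral_diff int int' Y S Bochner_Integration.integrable_diff divide_inverse mult.commute)
      ultimately have "(\<lambda>n. norm ((LINT i|M. H i (Y n)) - (LINT i|M. H i x0) - (LINT i|M. H' i x0 (Y n - x0))) / norm (Y n - x0)) \<longlonglongrightarrow> 0"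
        by simp
      then show "(\<lambda>n. norm ((LINT i|M. H i (X n)) - (LINT i|M. H i x0) - (LINT i|M. H' i x0 (X n - x0))) / norm (X n - x0)) \<longlonglongrightarrow> 0"
        unfolding Y_def by (rule LIMSEQ_offset)
    qed
  qed
qed

section \<open>Integrals of Schwartz functions\<close>

lemma integrable_inverse_one_plus_square: "integrable lborel (\<lambda>t::real. 1 / (1 + t\<^sup>2))"
proof -
  have "set_integrable lborel (einterval (-\<infinity>) \<infinity>) (\<lambda>t::real. 1 / (1 + t\<^sup>2))"
  proof (rule interval_integral_FTC_nonneg(1)[where F=arctan and A="-(pi/2)" and B="pi/2"])
    show "DERIV arctan x :> 1 / (1 + x\<^sup>2)" for x :: real
      using DERIV_arctan[of x] by (simp add: divide_inverse)
    show "isCont (\<lambda>t::real. 1 / (1 + t\<^sup>2)) x" for x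
      by (intro continuous_intros) (simp add: add_nonneg_eq_0_iff)
    show "((arctan \<circ> real_of_ereal) \<longlongrightarrow> - (pi / 2)) (at_right (-\<infinity>))"
      by (simp add: ereal_tendsto_simps tendsto_arctan_at_bot)
    show "((arctan \<circ> real_of_ereal) \<longlongrightarrow> pi / 2) (at_left \<infinity>)"
      by (simp add: ereal_tendsto_simps tendsto_arctan_at_top)
  qed auto
  then show ?thesis by (simp add: set_integrable_def)
qed

text \<open>The exponent \<open>2 * DIM('a)\<close> lets the integrand be dominated by a product of one-dimensional
functions \<open>1 / (1 + t\<^sup>2)\<close>, one for each coordinate.\<close>

lemma integrable_inverse_power_norm:
  "integrable lborel (\<lambda>x::'a::euclidean_space. 1 / (1 + norm x) ^ (2 * DIM('a)))"
proof (rule integrableI_bounded)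
  have le: "1 / (1 + norm x) ^ (2 * DIM('a)) \<le> (\<Prod>b\<in>Basis. 1 / (1 + (x \<bullet> b)\<^sup>2))" for x :: 'a
  proof -
    have "1 + (x \<bullet> b)\<^sup>2 \<le> (1 + norm x)\<^sup>2" if "b \<in> Basis" for b
    proof -
      have "(x \<bullet> b)\<^sup>2 \<le> (norm x)\<^sup>2"
        using Basis_le_norm[OF that, of x] by (metis abs_le_square_iff abs_norm_cancel)
      then show ?thesis by (simp add: power2_sum add_increasing2)
    qed
    then have "(\<Prod>b\<in>Basis. 1 + (x \<bullet> b)\<^sup>2) \<le> (\<Prod>b\<in>(Basis::'a set). (1 + norm x)\<^sup>2)"
      by (intro prod_mono) auto
    also have "\<dots> = (1 + norm x) ^ (2 * DIM('a))" by (simp add: power_mult)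
    finally have "1 / (1 + norm x) ^ (2 * DIM('a)) \<le> 1 / (\<Prod>b\<in>Basis. 1 + (x \<bullet> b)\<^sup>2)"
      by (intro divide_left_mono) (auto intro!: mult_pos_pos prod_pos zero_less_power add_pos_nonneg)
    then show ?thesis by (simp add: prod_dividef)
  qed
  have "(\<integral>\<^sup>+x. ennreal (norm (1 / (1 + norm x) ^ (2 * DIM('a)))) \<partial>(lborel::'a measure))
      \<le> (\<integral>\<^sup>+x. (\<Prod>b\<in>Basis. ennreal (1 / (1 + (x \<bullet> b)\<^sup>2))) \<partial>(lborel::'a measure))"
  proof (rule nn_integral_mono)
    fix x :: 'a
    show "ennreal (norm (1 / (1 + norm x) ^ (2 * DIM('a)))) \<le> (\<Prod>b\<in>Basis. ennreal (1 / (1 + (x \<bullet> b)\<^sup>2)))"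
      using ennreal_leI[OF le[of x]] by (simp add: prod_ennreal)
  qed
  also have "\<dots> = (\<Prod>b\<in>(Basis::'a set). \<integral>\<^sup>+t. ennreal (1 / (1 + t\<^sup>2)) \<partial>lborel)"
    by (rule nn_integral_lborel_prod) auto
  also have "\<dots> < \<infinity>"
    using integrable_inverse_one_plus_square
    by (simp add: integrable_iff_bounded power_less_top_ennreal)
  finally show "(\<integral>\<^sup>+x. ennreal (norm (1 / (1 + norm x) ^ (2 * DIM('a)))) \<partial>(lborel::'a measure)) < \<infinity>" .
qed measurable

lemma integrable_rapid:
  fixes f :: "'a::euclidean_space \<Rightarrow> 'b::{banach, second_countable_topology}"
  assumes [measurable]: "f \<in> borel_measurable borel"
    and "\<And>x. (1 + norm x) ^ (2 * DIM('a)) * norm (f x) \<le> C"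
  shows "integrable lborel f"
proof (rule Bochner_Integration.integrable_bound)
  show "integrable lborel (\<lambda>x::'a. C * (1 / (1 + norm x) ^ (2 * DIM('a))))"
    by (intro integrable_mult_right integrable_inverse_power_norm)
  have "norm (f x) \<le> C * (1 / (1 + norm x) ^ (2 * DIM('a)))" for x
    using assms(2)[of x] by (simp add: pos_le_divide_eq add_pos_nonneg mult.commute)
  then show "AE x in lborel. norm (f x) \<le> norm (C * (1 / (1 + norm x) ^ (2 * DIM('a))))"
    by (intro AE_I2) (metis abs_ge_self order_trans real_norm_def)
qed simp

lemma schwartz_integrable:
  assumes "f \<in> schwartz" shows "integrable lborel f"
proof -
  obtain C where "\<And>x. (1 + norm x) ^ (2 * DIM('a)) * norm (f x) \<le> C"
    using schwartz_bounded[OF assms] by blast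
  then show ?thesis by (rule integrable_rapid[OF schwartz_measurable[OF assms]])
qed

lemma schwartz_integrable_weighted:
  assumes "f \<in> schwartz"
  shows "integrable lborel (\<lambda>x. (1 + norm x) ^ N *\<^sub>R f x)"
proof -
  obtain C where "\<And>x. (1 + norm x) ^ (2 * DIM('a) + N) * norm (f x) \<le> C"
    using schwartz_bounded[OF assms] by blast
  then show ?thesis
    using schwartz_measurable[OF assms]
    by (intro integrable_rapid[where C=C]) (auto simp: power_add mult.assoc)
qed

lemma integrable_schwartz_times_bounded:
  fixes f :: "'a::euclidean_space \<Rightarrow> complex"
  assumes "f \<in> schwartz" "m \<in> borel_measurable borel" "\<And>x. norm (m x) \<le> B"
  shows "integrable lborel (\<lambda>x. m x * f x)"
proof (rule Bochner_Integration.integrable_bound)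
  show "integrable lborel (\<lambda>x. B * norm (f x))"
    using schwartz_integrable[OF assms(1)] by (intro integrable_mult_right integrable_norm)
  show "AE x in lborel. norm (m x * f x) \<le> norm (B * norm (f x))"
  proof (rule AE_I2)
    fix x
    have "norm (m x) * norm (f x) \<le> B * norm (f x)" by (intro mult_right_mono assms(3)) simp
    then show "norm (m x * f x) \<le> norm (B * norm (f x))" by (simp add: norm_mult)
  qed
  show "(\<lambda>x. m x * f x) \<in> borel_measurable lborel"
    using assms schwartz_measurable by auto
qed

lemma integral_translate:
  fixes f :: "'a::euclidean_space \<Rightarrow> 'b::{banach, second_countable_topology}"
  shows "f \<in> borel_measurable borel \<Longrightarrow> (LINT x|lborel. f (c + x)) = (LINT x|lborel. f x)"
  by (subst (2) lborel_distr_plus[symmetric, of c]) (subst integral_distr; simp)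

text \<open>The integral of \<open>u (t *\<^sub>R b + x)\<close> over \<open>x\<close> does not depend on \<open>t\<close>, and its derivative at \<open>t = 0\<close> is
  the integral of the derivative of \<open>u\<close>. This replaces integration by parts.\<close>

lemma integral_derivative_zero:
  fixes u :: "'a::euclidean_space \<Rightarrow> complex"
  assumes u: "u \<in> schwartz" and b: "b \<in> Basis"
  shows "(LINT x|lborel. frechet_derivative u (at x) b) = 0"
proof -
  let ?n = "2 * DIM('a)"
  obtain C where C: "0 \<le> C" "\<And>x. (1 + norm x) ^ ?n * norm (frechet_derivative u (at x) b) \<le> C"
    using schwartz_bounded[OF schwartz_deriv[OF u b]] by blast
  have ud: "(u has_derivative frechet_derivative u (at x)) (at x)" for x
    using u csmooth_has_derivative unfolding schwartz_iff by blast
  (* The factor 2 ^ ?n pays for a translation by at most 1: 1 + norm i \<le> 2 * (1 + norm (x * b + i)). *)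
  define w where "w x = C * 2 ^ ?n * (1 / (1 + norm x) ^ ?n)" for x :: 'a
  have "((\<lambda>t. LINT x|lborel. u (t *\<^sub>R b + x)) has_derivative
      (\<lambda>h. LINT x|lborel. frechet_derivative u (at (0 *\<^sub>R b + x)) (h *\<^sub>R b))) (at (0::real))"
  proof (rule has_derivative_integral(1)[where S="ball 0 1" and w=w])
    show "integrable lborel w" unfolding w_def
      by (intro integrable_mult_right integrable_inverse_power_norm)
    show "integrable lborel (\<lambda>i. u (x *\<^sub>R b + i))" for x :: real
      by (subst lborel_distr_plus[symmetric, of "- x *\<^sub>R b"], subst integrable_distr_eq)
        (use schwartz_integrable[OF u] schwartz_measurable[OF u] in auto)
    show "((\<lambda>x. u (x *\<^sub>R b + i)) has_derivative (\<lambda>h. frechet_derivative u (at (x *\<^sub>R b + i)) (h *\<^sub>R b))) (at x)"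
      for i and x :: real
      by (rule has_derivative_compose[of "\<lambda>t. t *\<^sub>R b + i" "\<lambda>t. t *\<^sub>R b" x UNIV u])
        (auto intro!: derivative_eq_intros ud)
    fix i :: 'a and x h :: real assume "x \<in> ball 0 1"
    then have x: "\<bar>x\<bar> \<le> 1" by (simp add: dist_real_def)
    let ?y = "x *\<^sub>R b + i"
    have "norm i \<le> norm ?y + norm (x *\<^sub>R b)"
      using norm_triangle_ineq4[of ?y "x *\<^sub>R b"] by simp
    also have "\<dots> \<le> norm ?y + 1" by (rule add_left_mono) (use x b in simp)
    finally have "1 + norm i \<le> 1 + (norm ?y + 1)" by (rule add_left_mono)
    also have "\<dots> \<le> 2 * (1 + norm ?y)" unfolding distrib_left by simp
    finally have "1 + norm i \<le> 2 * (1 + norm ?y)" .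
    then have "(1 + norm i) ^ ?n \<le> 2 ^ ?n * (1 + norm ?y) ^ ?n"
      by (subst power_mult_distrib[symmetric], intro power_mono) auto
    then have "(1 + norm i) ^ ?n * norm (frechet_derivative u (at ?y) b)
        \<le> 2 ^ ?n * (1 + norm ?y) ^ ?n * norm (frechet_derivative u (at ?y) b)"
      by (intro mult_right_mono) auto
    also have "\<dots> \<le> 2 ^ ?n * C" using C(2)[of ?y] by simp
    finally have "norm (frechet_derivative u (at ?y) b) \<le> w i"
      unfolding w_def by (simp add: pos_le_divide_eq add_pos_nonneg mult.commute)
    moreover have "frechet_derivative u (at ?y) (h *\<^sub>R b) = h *\<^sub>R frechet_derivative u (at ?y) b"
      using linear_cmul[OF has_derivative_linear[OF ud]] .
    ultimately show "norm (frechet_derivative u (at ?y) (h *\<^sub>R b)) \<le> w i * norm h"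
      by (simp add: mult.commute mult_left_mono)
  qed auto
  moreover have "(\<lambda>t. LINT x|lborel. u (t *\<^sub>R b + x)) = (\<lambda>t. LINT x|lborel. u x)"
    using integral_translate[OF schwartz_measurable[OF u]] by auto
  ultimately have "(\<lambda>h::real. LINT x|lborel. frechet_derivative u (at (0 *\<^sub>R b + x)) (h *\<^sub>R b)) = (\<lambda>h. 0)"
    by (metis has_derivative_const has_derivative_unique)
  from fun_cong[OF this, of 1] show ?thesis by simp
qed

section \<open>Exponentials and coordinates as moderate symbols\<close>

text \<open>A class of functions that is closed under partial derivatives and whose members are all controlled
consists of smooth functions. For a class such as \<open>fourier ` schwartz\<close> this avoids any formula for
the higher derivatives.\<close>

lemma csmooth_coinduct:
  assumes "f \<in> X"
    and "\<And>f. f \<in> X \<Longrightarrow> controlled {()} UNIV W (\<lambda>_. f) \<and>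
      (\<exists>f'. (\<forall>x. (f has_derivative f' x) (at x)) \<and> (\<forall>b\<in>Basis. (\<lambda>x. f' x b) \<in> X))"
  shows "csmooth W f"
proof -
  have "Ck_family {()} UNIV W k (\<lambda>_. f)" if "f \<in> X" for k f
    using that
  proof (induction k arbitrary: f)
    case 0
    then show ?case using assms(2) by simp
  next
    case (Suc k)
    from assms(2)[OF Suc.prems] obtain f' where f': "controlled {()} UNIV W (\<lambda>_. f)"
      "\<And>x. (f has_derivative f' x) (at x)" "\<And>b. b \<in> Basis \<Longrightarrow> (\<lambda>x. f' x b) \<in> X" by blast
    show ?case
      by (rule Ck_family_SucI[OF open_UNIV f'(1,2)]) (use Suc.IH f'(3) in auto)
  qed
  with assms(1) show ?thesis by (simp add: csmooth_def)
qed

lemma has_derivative_cis_inner: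
  "((\<lambda>x. cis (c * (x \<bullet> \<xi>))) has_derivative (\<lambda>h. \<i> * of_real (c * (h \<bullet> \<xi>)) * cis (c * (x \<bullet> \<xi>)))) (at x)"
proof -
  have 1: "((\<lambda>x. \<i> * of_real (c * (x \<bullet> \<xi>))) has_derivative (\<lambda>h. \<i> * of_real (c * (h \<bullet> \<xi>)) :: complex)) (at x)"
    by (intro has_derivative_mult_right has_derivative_of_real has_derivative_inner_left has_derivative_ident)
  have "((\<lambda>x. exp (\<i> * of_real (c * (x \<bullet> \<xi>)))) has_derivative
      (\<lambda>h. exp (\<i> * of_real (c * (x \<bullet> \<xi>))) * (\<i> * of_real (c * (h \<bullet> \<xi>))))) (at x)"
    by (rule has_derivative_compose[OF 1 DERIV_exp[unfolded has_field_derivative_def]])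
  then have "((\<lambda>x. exp (\<i> * of_real (c * (x \<bullet> \<xi>)))) has_derivative
      (\<lambda>h. \<i> * of_real (c * (h \<bullet> \<xi>)) * exp (\<i> * of_real (c * (x \<bullet> \<xi>))))) (at x)"
    by (simp only: mult.commute[of "exp _"])
  then show ?thesis by (simp add: cis_conv_exp)
qed

lemma csmooth_cis: "csmooth tame (\<lambda>x. cis (c * (x \<bullet> \<xi>)))"
proof (rule csmooth_coinduct[where X="range (\<lambda>k x. k * cis (c * (x \<bullet> \<xi>)))"])
  show "(\<lambda>x. cis (c * (x \<bullet> \<xi>))) \<in> range (\<lambda>k x. k * cis (c * (x \<bullet> \<xi>)))"
    by (rule image_eqI[of _ _ 1]) auto
  fix f assume "f \<in> range (\<lambda>k (x::'a). k * cis (c * (x \<bullet> \<xi>)))"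
  then obtain k where f: "f = (\<lambda>x. k * cis (c * (x \<bullet> \<xi>)))" by blast
  show "controlled {()} UNIV tame (\<lambda>_. f) \<and> (\<exists>f'. (\<forall>x. (f has_derivative f' x) (at x)) \<and>
      (\<forall>b\<in>Basis. (\<lambda>x. f' x b) \<in> range (\<lambda>k x. k * cis (c * (x \<bullet> \<xi>)))))"
  proof (intro conjI exI allI ballI)
    show "controlled {()} UNIV tame (\<lambda>_. f)"
      by (rule controlled_tameI[of "norm k" _ 0]) (auto simp: f norm_mult)
    show "(f has_derivative (\<lambda>h. k * (\<i> * of_real (c * (h \<bullet> \<xi>)) * cis (c * (x \<bullet> \<xi>))))) (at x)" for x
      unfolding f by (intro has_derivative_mult_right has_derivative_cis_inner)
    show "(\<lambda>x. k * (\<i> * of_real (c * (b \<bullet> \<xi>)) * cis (c * (x \<bullet> \<xi>)))) \<in> range (\<lambda>k x. k * cis (c * (x \<bullet> \<xi>)))" for b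
      by (rule image_eqI[of _ _ "k * (\<i> * of_real (c * (b \<bullet> \<xi>)))"]) (auto simp: mult.assoc)
  qed
qed

lemma csmooth_inner: "csmooth tame (\<lambda>x. of_real (x \<bullet> b) :: complex)"
  by (intro csmooth_linear bounded_linear_compose[OF bounded_linear_of_real bounded_linear_inner_left])

section \<open>The Fourier transform of a Schwartz function\<close>

text \<open>Differentiation under the integral sign; the integrand of the derivative is dominated by
\<open>norm x * norm (\<psi> x)\<close>, which is integrable.\<close>

lemma fourier_has_derivative:
  assumes \<psi>: "\<psi> \<in> schwartz"
  shows "(fourier \<psi> has_derivative
     (\<lambda>h. LINT x|lborel. (- \<i> * of_real (x \<bullet> h)) * cis (- (x \<bullet> \<xi>)) * \<psi> x)) (at \<xi>)"
  unfolding fourier_def[abs_def]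
proof (rule has_derivative_integral(1)[where S=UNIV and w="\<lambda>x. norm ((1 + norm x) ^ 1 *\<^sub>R \<psi> x)" and H'="\<lambda>x \<xi> h. (- \<i> * of_real (x \<bullet> h)) * cis (- (x \<bullet> \<xi>)) * \<psi> x"])
  show "integrable lborel (\<lambda>x. norm ((1 + norm x) ^ 1 *\<^sub>R \<psi> x))"
    by (intro integrable_norm schwartz_integrable_weighted \<psi>)
  show "integrable lborel (\<lambda>x. cis (- (x \<bullet> \<xi>)) * \<psi> x)" for \<xi>
    by (rule integrable_schwartz_times_bounded[OF \<psi>, of _ 1]) (auto intro!: borel_measurable_continuous_onI continuous_intros)
  show "((\<lambda>\<xi>. cis (- (x \<bullet> \<xi>)) * \<psi> x) has_derivative (\<lambda>h. (- \<i> * of_real (x \<bullet> h)) * cis (- (x \<bullet> \<xi>)) * \<psi> x)) (at \<xi>)" for x \<xi>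
    using has_derivative_mult_left[OF has_derivative_cis_inner[of "-1" x \<xi>], of "\<psi> x"]
    by (simp add: inner_commute)
  show "norm ((- \<i> * of_real (x \<bullet> h)) * cis (- (x \<bullet> \<xi>)) * \<psi> x) \<le> norm ((1 + norm x) ^ 1 *\<^sub>R \<psi> x) * norm h" for x \<xi> h
  proof -
    have "\<bar>x \<bullet> h\<bar> * norm (\<psi> x) \<le> (norm x * norm h) * norm (\<psi> x)"
      by (intro mult_right_mono Cauchy_Schwarz_ineq2) auto
    also have "\<dots> \<le> (1 + norm x) * norm (\<psi> x) * norm h"
      by (simp add: algebra_simps)
    finally show ?thesis by (simp add: norm_mult)
  qed
qed auto

lemma schwartz_times_coordinate: "\<psi> \<in> schwartz \<Longrightarrow> (\<lambda>x. (k * of_real (x \<bullet> b)) * \<psi> x) \<in> schwartz"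
  by (intro tame_mult_schwartz csmooth_mult csmooth_const csmooth_inner)

lemma fourier_has_derivative_basis:
  assumes "\<psi> \<in> schwartz"
  shows "(LINT x|lborel. (- \<i> * of_real (x \<bullet> b)) * cis (- (x \<bullet> \<xi>)) * \<psi> x) =
    fourier (\<lambda>x. (- \<i> * of_real (x \<bullet> b)) * \<psi> x) \<xi>"
  unfolding fourier_def by (rule Bochner_Integration.integral_cong) auto

text \<open>The derivative of \<open>cis (- (x \<bullet> \<xi>)) * \<psi> x\<close> has integral zero, and the product rule
splits it into the two sides of the equation.\<close>

lemma fourier_derivative:
  assumes \<psi>: "\<psi> \<in> schwartz" and b: "b \<in> Basis"
  shows "fourier (\<lambda>x. frechet_derivative \<psi> (at x) b) \<xi> = \<i> * of_real (b \<bullet> \<xi>) * fourier \<psi> \<xi>"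
proof -
  let ?e = "\<lambda>x. cis (- 1 * (x \<bullet> \<xi>))"
  have e: "csmooth tame ?e" by (rule csmooth_cis)
  have d: "((\<lambda>x. ?e x * \<psi> x) has_derivative
     (\<lambda>h. ?e x * frechet_derivative \<psi> (at x) h + (\<i> * of_real (- 1 * (h \<bullet> \<xi>)) * ?e x) * \<psi> x)) (at x)" for x
    using \<psi> unfolding schwartz_iff
    by (intro has_derivative_mult has_derivative_cis_inner csmooth_has_derivative)
  have d': "frechet_derivative (\<lambda>x. ?e x * \<psi> x) (at x) b =
      ?e x * frechet_derivative \<psi> (at x) b + (- \<i> * of_real (b \<bullet> \<xi>)) * (?e x * \<psi> x)" for x
    unfolding frechet_derivative_at[OF d, symmetric] by simp
  have "0 = (LINT x|lborel. frechet_derivative (\<lambda>x. ?e x * \<psi> x) (at x) b)"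
    using integral_derivative_zero[OF tame_mult_schwartz[OF e \<psi>] b] by simp
  also have "\<dots> = (LINT x|lborel. ?e x * frechet_derivative \<psi> (at x) b) + (LINT x|lborel. (- \<i> * of_real (b \<bullet> \<xi>)) * (?e x * \<psi> x))"
    unfolding d'
    by (intro Bochner_Integration.integral_add schwartz_integrable schwartz_cmult tame_mult_schwartz[OF e] schwartz_deriv \<psi> b)
  also have "(LINT x|lborel. (- \<i> * of_real (b \<bullet> \<xi>)) * (?e x * \<psi> x)) = (- \<i> * of_real (b \<bullet> \<xi>)) * (LINT x|lborel. ?e x * \<psi> x)"
    by (rule integral_mult_right_zero)
  finally show ?thesis unfolding fourier_def by (simp add: algebra_simps)
qed

lemma norm_fourier_le: "norm (fourier \<psi> \<xi>) \<le> (LINT x|lborel. norm (\<psi> x))"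
proof -
  have "norm (fourier \<psi> \<xi>) \<le> (LINT x|lborel. norm (cis (- (x \<bullet> \<xi>)) * \<psi> x))"
    unfolding fourier_def by (rule Bochner_Integration.integral_norm_bound)
  then show ?thesis by (simp add: norm_mult)
qed

text \<open>One more factor \<open>1 + norm \<xi>\<close> is paid for by one derivative: \<open>norm \<xi>\<close> is at most the sum
of the absolute coordinates, and a coordinate times \<open>fourier \<psi>\<close> is the transform of a derivative
of \<open>\<psi>\<close>.\<close>

lemma fourier_rapid:
  assumes "\<psi> \<in> schwartz"
  shows "\<exists>C. \<forall>\<xi>. (1 + norm \<xi>) ^ N * norm (fourier \<psi> \<xi>) \<le> C"
  using assms
proof (induction N arbitrary: \<psi>)
  case 0
  then show ?case using norm_fourier_le by auto
next
  case (Suc N)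
  from Suc.IH[OF Suc.prems] obtain C0 where C0: "\<And>\<xi>. (1 + norm \<xi>) ^ N * norm (fourier \<psi> \<xi>) \<le> C0" by blast
  have "\<forall>b\<in>Basis. \<exists>C. \<forall>\<xi>. (1 + norm \<xi>) ^ N * norm (fourier (\<lambda>x. frechet_derivative \<psi> (at x) b) \<xi>) \<le> C"
    using Suc.IH schwartz_deriv[OF Suc.prems] by blast
  then obtain C where C: "\<And>b \<xi>. b \<in> Basis \<Longrightarrow> (1 + norm \<xi>) ^ N * norm (fourier (\<lambda>x. frechet_derivative \<psi> (at x) b) \<xi>) \<le> C b"
    by metis
  have "(1 + norm \<xi>) ^ Suc N * norm (fourier \<psi> \<xi>) \<le> C0 + (\<Sum>b\<in>Basis. C b)" for \<xi>
  proof -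
    have "(1 + norm \<xi>) ^ Suc N * norm (fourier \<psi> \<xi>)
       = (1 + norm \<xi>) ^ N * norm (fourier \<psi> \<xi>) + norm \<xi> * ((1 + norm \<xi>) ^ N * norm (fourier \<psi> \<xi>))"
      by (simp add: algebra_simps)
    also have "\<dots> \<le> C0 + (\<Sum>b\<in>Basis. \<bar>\<xi> \<bullet> b\<bar>) * ((1 + norm \<xi>) ^ N * norm (fourier \<psi> \<xi>))"
      by (intro add_mono C0 mult_right_mono norm_le_l1) auto
    also have "(\<Sum>b\<in>Basis. \<bar>\<xi> \<bullet> b\<bar>) * ((1 + norm \<xi>) ^ N * norm (fourier \<psi> \<xi>)) =
       (\<Sum>b\<in>Basis. (1 + norm \<xi>) ^ N * norm (fourier (\<lambda>x. frechet_derivative \<psi> (at x) b) \<xi>))"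
      unfolding sum_distrib_right
      by (intro sum.cong refl) (simp add: fourier_derivative[OF Suc.prems] norm_mult inner_commute)
    also have "\<dots> \<le> (\<Sum>b\<in>Basis. C b)" by (intro sum_mono C)
    finally show ?thesis by simp
  qed
  then show ?case by blast
qed

text \<open>The partial derivatives of a transform are transforms of Schwartz functions multiplied by a coordinate,
so \<open>fourier ` schwartz\<close> satisfies the hypotheses of \<open>csmooth_coinduct\<close>.\<close>

theorem fourier_schwartz:
  assumes "\<psi> \<in> schwartz" shows "fourier \<psi> \<in> schwartz"
  unfolding schwartz_iff
proof (rule csmooth_coinduct[where X="fourier ` schwartz"])
  show "fourier \<psi> \<in> fourier ` schwartz" using assms by simp
  fix f :: "'a \<Rightarrow> complex" assume "f \<in> fourier ` schwartz"
  then obtain \<eta> where \<eta>: "\<eta> \<in> schwartz" "f = fourier \<eta>" by blast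
  show "controlled {()} UNIV rapid (\<lambda>_. f) \<and>
      (\<exists>f'. (\<forall>x. (f has_derivative f' x) (at x)) \<and> (\<forall>b\<in>Basis. (\<lambda>x. f' x b) \<in> fourier ` schwartz))"
  proof (intro conjI exI allI ballI)
    show "controlled {()} UNIV rapid (\<lambda>_. f)"
      unfolding controlled_rapid_iff \<eta>(2) using fourier_rapid[OF \<eta>(1)] by blast
    show "(f has_derivative (\<lambda>h. LINT x|lborel. (- \<i> * of_real (x \<bullet> h)) * cis (- (x \<bullet> \<xi>)) * \<eta> x)) (at \<xi>)" for \<xi>
      unfolding \<eta>(2) by (rule fourier_has_derivative[OF \<eta>(1)])
    show "(\<lambda>\<xi>. LINT x|lborel. (- \<i> * of_real (x \<bullet> b)) * cis (- (x \<bullet> \<xi>)) * \<eta> x) \<in> fourier ` schwartz" for b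
      unfolding fourier_has_derivative_basis[OF \<eta>(1)]
      by (intro image_eqI[of _ _ "\<lambda>x. (- \<i> * of_real (x \<bullet> b)) * \<eta> x"] schwartz_times_coordinate \<eta>) simp
  qed
qed

section \<open>Affine changes of variables and test functions\<close>

lemma integral_affine:
  fixes f :: "'a::euclidean_space \<Rightarrow> 'b::{banach, second_countable_topology}"
  assumes [measurable]: "f \<in> borel_measurable borel" and c: "c \<noteq> 0"
  shows "(LINT x|lborel. f (t + c *\<^sub>R x)) = (LINT x|lborel. f x) /\<^sub>R \<bar>c\<bar> ^ DIM('a)"
proof -
  have "(LINT x|lborel. f x) = (LINT x|distr lborel borel (\<lambda>x. t + c *\<^sub>R x). \<bar>c\<bar> ^ DIM('a) *\<^sub>R f x)"
    by (subst lborel_affine[OF c, of t], subst integral_density) auto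
  also have "\<dots> = \<bar>c\<bar> ^ DIM('a) *\<^sub>R (LINT x|lborel. f (t + c *\<^sub>R x))"
    by (subst integral_distr) auto
  finally show ?thesis using c by simp
qed

lemma nn_integral_affine:
  fixes f :: "'a::euclidean_space \<Rightarrow> ennreal"
  assumes [measurable]: "f \<in> borel_measurable borel" and c: "c \<noteq> 0"
  shows "(\<integral>\<^sup>+x. f x \<partial>lborel) = ennreal (\<bar>c\<bar> ^ DIM('a)) * (\<integral>\<^sup>+x. f (t + c *\<^sub>R x) \<partial>lborel)"
  by (subst lborel_affine[OF c, of t], subst nn_integral_density)
    (auto simp: nn_integral_distr nn_integral_cmult)

lemma integrable_affine:
  fixes f :: "'a::euclidean_space \<Rightarrow> 'b::{banach, second_countable_topology}"
  assumes f: "integrable lborel f" and c: "c \<noteq> 0"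
  shows "integrable lborel (\<lambda>x. f (t + c *\<^sub>R x))"
proof (rule integrableI_bounded)
  have [measurable]: "f \<in> borel_measurable borel" using f by auto
  show "(\<lambda>x. f (t + c *\<^sub>R x)) \<in> borel_measurable lborel" by simp
  have "ennreal (\<bar>c\<bar> ^ DIM('a)) * (\<integral>\<^sup>+x. norm (f (t + c *\<^sub>R x)) \<partial>lborel) < \<infinity>"
    using nn_integral_affine[of "\<lambda>x. ennreal (norm (f x))" c t] f c
    by (simp add: integrable_iff_bounded)
  then show "(\<integral>\<^sup>+x. norm (f (t + c *\<^sub>R x)) \<partial>lborel) < \<infinity>"
    using c by (auto simp: ennreal_mult_less_top)
qed

lemma integral_reflect:
  fixes f :: "'a::euclidean_space \<Rightarrow> 'b::{banach, second_countable_topology}"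
  assumes "f \<in> borel_measurable borel"
  shows "(LINT x|lborel. f (- x)) = (LINT x|lborel. f x)"
  using integral_affine[OF assms, of "-1" 0] by simp

lemma schwartz_affine:
  fixes f :: "'a::euclidean_space \<Rightarrow> complex"
  assumes f: "f \<in> schwartz" and c: "c \<noteq> 0"
  shows "(\<lambda>x. f (t + c *\<^sub>R x)) \<in> schwartz"
  unfolding schwartz_iff
proof (rule csmooth_coinduct[where X="(\<lambda>g x. g (t + c *\<^sub>R x)) ` schwartz"])
  show "(\<lambda>x. f (t + c *\<^sub>R x)) \<in> (\<lambda>g x. g (t + c *\<^sub>R x)) ` schwartz" using f by blast
  fix h :: "'a \<Rightarrow> complex" assume "h \<in> (\<lambda>g x. g (t + c *\<^sub>R x)) ` schwartz"
  then obtain g where g: "g \<in> schwartz" "h = (\<lambda>x. g (t + c *\<^sub>R x))" by blast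
  have gd: "(g has_derivative frechet_derivative g (at x)) (at x)" for x
    using g csmooth_has_derivative unfolding schwartz_iff by blast
  define K where "K = 1 + (1 + norm t) / \<bar>c\<bar>"
  have K: "1 + norm x \<le> K * (1 + norm (t + c *\<^sub>R x))" for x
  proof -
    have "\<bar>c\<bar> * norm x \<le> norm (t + c *\<^sub>R x) + norm t"
      using norm_triangle_ineq4[of "t + c *\<^sub>R x" t] by simp
    then have "norm x \<le> (norm (t + c *\<^sub>R x) + norm t) / \<bar>c\<bar>"
      using c by (simp add: pos_le_divide_eq mult.commute)
    also have "\<dots> \<le> ((1 + norm t) * (1 + norm (t + c *\<^sub>R x))) / \<bar>c\<bar>"
      by (intro divide_right_mono) (auto simp: distrib_left distrib_right intro!: add_nonneg_nonneg)
    finally have "1 + norm x \<le> (1 + norm (t + c *\<^sub>R x)) + (1 + norm t) / \<bar>c\<bar> * (1 + norm (t + c *\<^sub>R x))"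
      by (intro add_mono) simp_all
    then show ?thesis by (simp only: K_def distrib_right[of 1] mult_1)
  qed
  have K0: "0 \<le> K" unfolding K_def by simp
  show "controlled {()} UNIV rapid (\<lambda>_. h) \<and> (\<exists>f'. (\<forall>x. (h has_derivative f' x) (at x)) \<and>
     (\<forall>b\<in>Basis. (\<lambda>x. f' x b) \<in> (\<lambda>g x. g (t + c *\<^sub>R x)) ` schwartz))"
  proof (intro conjI exI allI ballI)
    show "controlled {()} UNIV rapid (\<lambda>_. h)" unfolding controlled_rapid_iff
    proof
      fix N
      obtain C where C: "\<And>x. (1 + norm x) ^ N * norm (g x) \<le> C" using schwartz_bounded[OF g(1)] by blast
      have "(1 + norm x) ^ N * norm (h x) \<le> K ^ N * C" for x
      proof -
        have "(1 + norm x) ^ N \<le> (K * (1 + norm (t + c *\<^sub>R x))) ^ N"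
          by (intro power_mono K) simp
        then have "(1 + norm x) ^ N * norm (h x) \<le> (K ^ N * (1 + norm (t + c *\<^sub>R x)) ^ N) * norm (h x)"
          by (intro mult_right_mono) (simp_all only: power_mult_distrib norm_ge_zero)
        also have "\<dots> = K ^ N * ((1 + norm (t + c *\<^sub>R x)) ^ N * norm (g (t + c *\<^sub>R x)))"
          by (simp only: g(2) mult.assoc)
        also have "\<dots> \<le> K ^ N * C" by (intro mult_left_mono C zero_le_power K0)
        finally show ?thesis .
      qed
      then show "\<exists>C. \<forall>x. (1 + norm x) ^ N * norm (h x) \<le> C" by blast
    qed
    show "(h has_derivative (\<lambda>k. frechet_derivative g (at (t + c *\<^sub>R x)) (c *\<^sub>R k))) (at x)" for x
      unfolding g(2)
      by (rule has_derivative_compose[of "\<lambda>x. t + c *\<^sub>R x" "\<lambda>k. c *\<^sub>R k" x UNIV g])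
        (auto intro!: derivative_eq_intros gd)
    fix b :: 'a assume b: "b \<in> Basis"
    have "frechet_derivative g (at y) (c *\<^sub>R b) = of_real c * frechet_derivative g (at y) b" for y
      using linear_cmul[OF has_derivative_linear[OF gd], of y c b] by (simp add: scaleR_conv_of_real)
    then show "(\<lambda>x. frechet_derivative g (at (t + c *\<^sub>R x)) (c *\<^sub>R b)) \<in> (\<lambda>g x. g (t + c *\<^sub>R x)) ` schwartz"
      by (intro image_eqI[of _ _ "\<lambda>y. of_real c * frechet_derivative g (at y) b"] schwartz_cmult schwartz_deriv g b) simp
  qed
qed

text \<open>Every iterated derivative vanishes off the compact support and is continuous on it, so it is bounded
even after multiplication by a power of \<open>1 + norm x\<close>.\<close>

lemma test_fun_csmooth:
  fixes f :: "'a::euclidean_space \<Rightarrow> 'b::real_normed_vector"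
  assumes "test_fun f"
  shows "csmooth rapid f"
  unfolding csmooth_iff
proof (intro conjI ballI)
  show sm: "smooth_on UNIV f" using assms by (simp add: test_fun_def)
  define K where "K = closure {x. f x \<noteq> 0}"
  have K: "compact K" "closed K" using assms by (auto simp: K_def test_fun_def)
  fix vs :: "'a list" assume vs: "vs \<in> lists Basis"
  have "\<forall>x. x \<notin> K \<longrightarrow> iter_deriv vs f x = 0"
  proof (induction vs)
    case Nil
    then show ?case using closure_subset[of "{x. f x \<noteq> 0}"] by (auto simp: K_def)
  next
    case (Cons v vs)
    show ?case
    proof (intro allI impI)
      fix x assume x: "x \<notin> K"
      have "((\<lambda>_. 0) has_derivative (\<lambda>_. 0)) (at x)" by simp
      then have "(iter_deriv vs f has_derivative (\<lambda>_. 0)) (at x)"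
        by (rule has_derivative_transform_within_open[where s="- K"]) (use K x Cons.IH in auto)
      then show "iter_deriv (v # vs) f x = 0"
        by (simp add: frechet_derivative_at[symmetric])
    qed
  qed
  moreover have "continuous_on K (iter_deriv vs f)"
    using sm vs by (intro continuous_at_imp_continuous_on ballI differentiable_imp_continuous_within) (simp add: smooth_on_def)
  ultimately show "controlled {()} UNIV rapid (\<lambda>_. iter_deriv vs f)"
    unfolding controlled_rapid_iff
  proof (intro allI)
    fix N
    let ?g = "\<lambda>x. (1 + norm x) ^ N * norm (iter_deriv vs f x)"
    assume z: "\<forall>x. x \<notin> K \<longrightarrow> iter_deriv vs f x = 0" and c: "continuous_on K (iter_deriv vs f)"
    have "continuous_on K ?g" by (intro continuous_intros c)
    then have "bounded (?g ` K)" using K(1) by (intro compact_imp_bounded compact_continuous_image)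
    then obtain B where B: "\<And>x. x \<in> K \<Longrightarrow> \<bar>?g x\<bar> \<le> B" by (auto simp: bounded_iff)
    have "?g x \<le> max B 0" for x
    proof (cases "x \<in> K")
      case True then show ?thesis using B[of x] by (meson abs_ge_self max.coboundedI1 order_trans)
    qed (simp add: z)
    then show "\<exists>C. \<forall>x. ?g x \<le> C" by blast
  qed
qed

lemma test_fun_of_real_schwartz: "test_fun f \<Longrightarrow> (\<lambda>x. of_real (f x)) \<in> schwartz"
  unfolding schwartz_iff
  by (rule csmooth_bounded_linear_image[OF bounded_linear_of_real rapid_cone test_fun_csmooth])

lemma rapid_subset_powers_1: "rapid \<subseteq> powers (\<lambda>_ _. 1)"
proof
  fix w :: "unit \<Rightarrow> 'a \<Rightarrow> real" assume "w \<in> rapid"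
  then obtain C where "\<And>i x. (1 + norm x) ^ 0 * \<bar>w i x\<bar> \<le> C" unfolding rapid_def by blast
  then have "\<bar>w i x\<bar> \<le> \<bar>C\<bar> * 1 ^ 0" for i x by (simp add: order_trans[OF _ abs_ge_self])
  then show "w \<in> powers (\<lambda>_ _. 1)" unfolding powers_def mem_Collect_eq
    by (intro exI[of _ "\<bar>C\<bar>"] exI[of _ 0] conjI allI) auto
qed

lemma rapid_subset_tame: "rapid \<subseteq> tame"
proof
  fix w :: "unit \<Rightarrow> 'a \<Rightarrow> real" assume "w \<in> rapid"
  then obtain C where "\<And>i x. (1 + norm x) ^ 0 * \<bar>w i x\<bar> \<le> C" unfolding rapid_def by blast
  then have "\<bar>w i x\<bar> \<le> \<bar>C\<bar> * (1 + norm x) ^ 0" for i x by (simp add: order_trans[OF _ abs_ge_self])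
  then show "w \<in> tame" unfolding tame_def powers_def mem_Collect_eq
    by (intro exI[of _ "\<bar>C\<bar>"] exI[of _ 0] conjI allI) auto
qed

lemma csmooth_weight_mono:
  assumes "csmooth U f" "U \<subseteq> W" shows "csmooth W f"
  using assms unfolding csmooth_def
  by (intro allI Ck_family_weight_mono[of "{()}" UNIV U _ "\<lambda>_. f" W]) auto

section \<open>The Gaussian\<close>

definition gauss :: "'a::euclidean_space \<Rightarrow> complex" where
  "gauss x = of_real (exp (- (norm x)\<^sup>2 / 2))"

lemma gauss_has_derivative:
  "(gauss has_derivative (\<lambda>h. (- 1 * of_real (x \<bullet> h)) * gauss x)) (at x)"
proof -
  have 1: "((\<lambda>x. - (x \<bullet> x) / 2) has_derivative (\<lambda>h. - (x \<bullet> h))) (at x)"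
    by (auto intro!: derivative_eq_intros simp: inner_commute)
  have "((\<lambda>x. exp (- (x \<bullet> x) / 2)) has_derivative (\<lambda>h. exp (- (x \<bullet> x) / 2) * - (x \<bullet> h))) (at x)"
    by (rule has_derivative_compose[OF 1 DERIV_exp[unfolded has_field_derivative_def]])
  then have "((\<lambda>x. of_real (exp (- (x \<bullet> x) / 2)) :: complex) has_derivative
     (\<lambda>h. of_real (exp (- (x \<bullet> x) / 2) * - (x \<bullet> h)))) (at x)"
    by (rule has_derivative_of_real)
  then show ?thesis
    unfolding gauss_def[abs_def] power2_norm_eq_inner by (simp add: mult.commute)
qed

text \<open>A single term of the exponential series; with it the Gaussian beats every power.\<close>

lemma power_le_fact_exp:
  fixes r :: real assumes "0 \<le> r" shows "r ^ N \<le> fact N * exp r"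
proof -
  have "r ^ N /\<^sub>R fact N \<le> (\<Sum>n. r ^ n /\<^sub>R fact n)"
    using sum_le_suminf[OF sums_summable[OF exp_converges[of r]], of "{N}"] assms by simp
  also have "\<dots> = exp r" using exp_converges[of r] by (simp add: sums_unique[symmetric])
  finally show ?thesis by (simp add: field_simps)
qed

lemma gauss_rapid: "\<exists>C. \<forall>x. (1 + norm x) ^ N * norm (gauss x) \<le> C"
proof (intro exI allI)
  fix x :: 'a
  have "(1 + norm x) ^ N \<le> fact N * exp (1 + norm x)" by (rule power_le_fact_exp) simp
  moreover have "1 + norm x \<le> 3/2 + (norm x)\<^sup>2 / 2"
    using zero_le_power2[of "norm x - 1"] by (simp add: power2_diff field_simps)
  ultimately have "(1 + norm x) ^ N \<le> fact N * exp (3/2 + (norm x)\<^sup>2 / 2)"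
    by (elim order_trans) (intro mult_left_mono, simp_all)
  then have "(1 + norm x) ^ N * exp (- (norm x)\<^sup>2 / 2) \<le> fact N * exp (3/2 + (norm x)\<^sup>2 / 2) * exp (- (norm x)\<^sup>2 / 2)"
    by (intro mult_right_mono) auto
  also have "\<dots> = fact N * exp (3/2)" by (simp add: mult.assoc flip: exp_add)
  finally show "(1 + norm x) ^ N * norm (gauss x) \<le> fact N * exp (3/2)" by (simp add: gauss_def norm_of_real)
qed

lemma gauss_schwartz: "gauss \<in> schwartz"
proof -
  have "Ck_family {()} UNIV rapid k (\<lambda>_. gauss :: 'a \<Rightarrow> complex)" for k
  proof (induction k)
    case 0
    show ?case unfolding Ck_family.simps controlled_rapid_iff by (intro allI gauss_rapid)
  next
    case (Suc k)
    show ?case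
    proof (rule Ck_family_SucI[OF open_UNIV Ck_family_controlled[OF Suc.IH] gauss_has_derivative])
      fix b :: 'a
      have "csmooth tame (\<lambda>x::'a. - 1 * of_real (x \<bullet> b) :: complex)"
        by (intro csmooth_mult csmooth_const csmooth_inner)
      then show "Ck_family {()} UNIV rapid k (\<lambda>i x::'a. (- 1 * of_real (x \<bullet> b)) * gauss x)"
        unfolding csmooth_def
        by (intro Ck_family_bilinear[OF open_UNIV rapid_cone bounded_bilinear_mult tame_mult_rapid _ Suc.IH]) auto
    qed
  qed
  then show ?thesis unfolding schwartz_iff csmooth_def by blast
qed

lemma integral_gauss: "(LINT x|lborel. gauss (x::'a::euclidean_space)) = of_real (sqrt (2 * pi) ^ DIM('a))"
proof -
  have 1: "(\<integral>\<^sup>+t. ennreal (exp (- t\<^sup>2 / 2)) \<partial>lborel) = ennreal (sqrt (2 * pi))"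
  proof -
    have "(\<integral>\<^sup>+t. ennreal (sqrt (2 * pi) * std_normal_density t) \<partial>lborel) = ennreal (LINT t|lborel. sqrt (2 * pi) * std_normal_density t)"
      by (intro nn_integral_eq_integral integrable_mult_right integrable_normal_density) auto
    also have "(LINT t|lborel. sqrt (2 * pi) * std_normal_density t) = sqrt (2 * pi)"
      by (subst integral_mult_right_zero) simp
    finally show ?thesis by (simp add: std_normal_density_def)
  qed
  have e: "ennreal (exp (- (norm x)\<^sup>2 / 2)) = (\<Prod>b\<in>Basis. ennreal (exp (- (x \<bullet> b)\<^sup>2 / 2)))" for x :: 'a
  proof -
    have "- (norm x)\<^sup>2 / 2 = (\<Sum>b\<in>Basis. - (x \<bullet> b)\<^sup>2 / 2)"
      unfolding power2_norm_eq_inner by (subst euclidean_inner) (simp add: power2_eq_square sum_divide_distrib sum_negf)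
    then show ?thesis by (simp only: exp_sum[OF finite_Basis] prod_ennreal exp_ge_zero)
  qed
  have "(\<integral>\<^sup>+x. ennreal (exp (- (norm x)\<^sup>2 / 2)) \<partial>(lborel :: 'a measure)) = (\<Prod>b\<in>(Basis::'a set). ennreal (sqrt (2 * pi)))"
    unfolding e 1[symmetric] by (rule nn_integral_lborel_prod) auto
  also have "\<dots> = ennreal (sqrt (2 * pi) ^ DIM('a))" by (simp add: ennreal_power)
  finally have "(LINT x|(lborel :: 'a measure). exp (- (norm x)\<^sup>2 / 2)) = sqrt (2 * pi) ^ DIM('a)"
    by (subst integral_eq_nn_integral) auto
  then show ?thesis unfolding gauss_def by simp
qed

text \<open>The derivative of \<open>gauss\<close> in a coordinate direction is minus the coordinate times \<open>gauss\<close>. The Fourier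
transform exchanges derivatives and coordinates, so the transform satisfies the same equation. Hence the transform times
\<open>exp ((\<xi> \<bullet> \<xi>) / 2)\<close> has derivative zero, and its value at the origin is the Gaussian integral.\<close>

lemma fourier_gauss: "fourier gauss (\<xi>::'a::euclidean_space) = of_real (sqrt (2 * pi) ^ DIM('a)) * gauss \<xi>"
proof -
  let ?G = "fourier (gauss :: 'a \<Rightarrow> complex)"
  let ?D = "\<lambda>\<xi> h. LINT x|lborel. (- \<i> * of_real (x \<bullet> h)) * cis (- (x \<bullet> \<xi>)) * gauss (x::'a)"
  have d: "(?G has_derivative ?D \<xi>) (at \<xi>)" for \<xi>
    by (rule fourier_has_derivative[OF gauss_schwartz])
  have b: "?D \<xi> b = - of_real (\<xi> \<bullet> b) * ?G \<xi>" if b: "b \<in> Basis" for b \<xi>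
  proof -
    have "?D \<xi> b = (LINT x|lborel. \<i> * (cis (- (x \<bullet> \<xi>)) * frechet_derivative gauss (at x) b))"
      by (simp add: frechet_derivative_at[OF gauss_has_derivative, symmetric] mult_ac)
    also have "\<dots> = \<i> * fourier (\<lambda>x. frechet_derivative gauss (at x) b) \<xi>"
      unfolding fourier_def by simp
    finally show ?thesis
      by (simp add: fourier_derivative[OF gauss_schwartz b] inner_commute flip: mult.assoc)
  qed
  let ?e = "\<lambda>\<xi>::'a. of_real (exp ((\<xi> \<bullet> \<xi>) / 2)) :: complex"
  have ed: "(?e has_derivative (\<lambda>h. of_real (\<xi> \<bullet> h) * ?e \<xi>)) (at \<xi>)" for \<xi>
  proof -
    have 1: "((\<lambda>x. (x \<bullet> x) / 2) has_derivative (\<lambda>h. \<xi> \<bullet> h)) (at \<xi>)"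
      by (auto intro!: derivative_eq_intros simp: inner_commute)
    have "((\<lambda>x. exp ((x \<bullet> x) / 2)) has_derivative (\<lambda>h. exp ((\<xi> \<bullet> \<xi>) / 2) * (\<xi> \<bullet> h))) (at \<xi>)"
      by (rule has_derivative_compose[OF 1 DERIV_exp[unfolded has_field_derivative_def]])
    from has_derivative_of_real[OF this] show ?thesis by (simp add: mult.commute)
  qed
  have "((\<lambda>\<xi>. ?G \<xi> * ?e \<xi>) has_derivative (\<lambda>h. 0)) (at \<xi>)" for \<xi>
  proof -
    have p: "((\<lambda>\<xi>. ?G \<xi> * ?e \<xi>) has_derivative (\<lambda>h. ?G \<xi> * (of_real (\<xi> \<bullet> h) * ?e \<xi>) + ?D \<xi> h * ?e \<xi>)) (at \<xi>)"
      by (rule has_derivative_mult[OF d ed])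
    have "(\<lambda>h. ?G \<xi> * (of_real (\<xi> \<bullet> h) * ?e \<xi>) + ?D \<xi> h * ?e \<xi>) = (\<lambda>h. 0)"
    proof (rule linear_eq_stdbasis[OF has_derivative_linear[OF p]])
      show "?G \<xi> * (of_real (\<xi> \<bullet> b) * ?e \<xi>) + ?D \<xi> b * ?e \<xi> = 0" if "b \<in> Basis" for b
        unfolding b[OF that] by simp
    qed (simp add: linear_iff)
    with p show ?thesis by simp
  qed
  then have "?G \<xi> * ?e \<xi> = ?G 0 * ?e 0"
    using has_derivative_zero_unique[of UNIV "\<lambda>\<xi>. ?G \<xi> * ?e \<xi>" 0 \<xi>] by simp
  moreover have "?G 0 = of_real (sqrt (2 * pi) ^ DIM('a))"
    unfolding integral_gauss[symmetric] fourier_def by simp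
  moreover have "?e \<xi> * gauss \<xi> = 1"
    by (simp add: gauss_def power2_norm_eq_inner flip: of_real_mult exp_add)
  ultimately show ?thesis
    by (metis (no_types, lifting) divide_self exp_zero inner_zero_left mult.assoc mult.right_neutral of_real_1 mult_zero_left div_0)
qed

section \<open>Fourier inversion and Plancherel\<close>

lemma borel_measurable_cis [measurable]: "cis \<in> borel_measurable borel"
  by (intro borel_measurable_continuous_onI continuous_intros)

text \<open>Fubini: both sides are the integral of \<open>f x * g \<xi> * cis (- (x \<bullet> \<xi>))\<close>.\<close>

lemma fourier_multiplication_formula:
  fixes f g :: "'a::euclidean_space \<Rightarrow> complex"
  assumes f: "integrable lborel f" and g: "integrable lborel g"
  shows "(LINT \<xi>|lborel. fourier f \<xi> * g \<xi>) = (LINT x|lborel. f x * fourier g x)"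
proof -
  let ?F = "\<lambda>x \<xi>. cis (- (x \<bullet> \<xi>)) * f x * g \<xi>"
  have [measurable]: "f \<in> borel_measurable borel" "g \<in> borel_measurable borel"
    using f g by (auto dest: borel_measurable_integrable)
  have "integrable (lborel \<Otimes>\<^sub>M lborel) (\<lambda>p. ?F (fst p) (snd p))"
  proof (rule lborel_pair.Fubini_integrable)
    show "(\<lambda>p. ?F (fst p) (snd p)) \<in> borel_measurable (lborel \<Otimes>\<^sub>M lborel)" by measurable
    have "(LINT y|lborel. norm (?F (fst (x, y)) (snd (x, y)))) = norm (f x) * (LINT y|lborel. norm (g y))" for x
      by (simp add: norm_mult)
    then show "integrable lborel (\<lambda>x. LINT y|lborel. norm (?F (fst (x, y)) (snd (x, y))))"
      using f by (simp only:) (intro integrable_mult_left integrable_norm)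
    show "AE x in lborel. integrable lborel (\<lambda>y. ?F (fst (x, y)) (snd (x, y)))"
    proof (rule AE_I2)
      fix x :: 'a
      show "integrable lborel (\<lambda>y. ?F (fst (x, y)) (snd (x, y)))"
        by (rule Bochner_Integration.integrable_bound[OF integrable_mult_right[OF integrable_norm[OF g], of "norm (f x)"]])
          (auto simp: norm_mult)
    qed
  qed
  then have A: "(LINT \<xi>|lborel. LINT x|lborel. ?F x \<xi>) = (LINT x|lborel. LINT \<xi>|lborel. ?F x \<xi>)"
    by (intro lborel_pair.Fubini_integral) (simp add: case_prod_beta')
  have B: "(LINT x|lborel. ?F x \<xi>) = fourier f \<xi> * g \<xi>" for \<xi>
    unfolding fourier_def by simp
  have C: "(LINT \<xi>|lborel. ?F x \<xi>) = f x * fourier g x" for x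
  proof -
    have "(LINT \<xi>|lborel. ?F x \<xi>) = (LINT \<xi>|lborel. f x * (cis (- (\<xi> \<bullet> x)) * g \<xi>))"
      by (simp add: inner_commute mult_ac)
    then show ?thesis unfolding fourier_def by simp
  qed
  show ?thesis using A unfolding B C .
qed

lemma inv_fourier_eq_fourier:
  "inv_fourier \<psi> (x::'a::euclidean_space) = of_real (1 / (2 * pi) ^ DIM('a)) * fourier \<psi> (- x)"
  unfolding inv_fourier_def fourier_def by (simp add: inner_commute)

lemma inv_fourier_schwartz:
  assumes "\<psi> \<in> schwartz" shows "inv_fourier \<psi> \<in> schwartz"
  using schwartz_cmult[OF schwartz_affine[OF fourier_schwartz[OF assms], of "-1" 0], of "of_real (1 / (2 * pi) ^ DIM('a))"]
  unfolding inv_fourier_eq_fourier[abs_def] by simp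

lemma inv_fourier_multiplication_formula:
  fixes f g :: "'a::euclidean_space \<Rightarrow> complex"
  assumes "integrable lborel f" "integrable lborel g"
  shows "(LINT \<xi>|lborel. inv_fourier f \<xi> * g \<xi>) = (LINT x|lborel. f x * inv_fourier g x)"
proof -
  let ?c = "of_real (1 / (2 * pi) ^ DIM('a)) :: complex"
  have r: "integrable lborel (\<lambda>x. g (- x))"
    using integrable_affine[OF assms(2), of "-1" 0] by simp
  have [measurable]: "f \<in> borel_measurable borel" "g \<in> borel_measurable borel"
    using assms by auto
  have fg: "fourier (\<lambda>x. g (- x)) x = fourier g (- x)" for x
  proof -
    have "(\<lambda>y. cis (- (y \<bullet> - x)) * g y) \<in> borel_measurable borel"
      by measurable
    from integral_reflect[OF this] show ?thesis unfolding fourier_def by simp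
  qed
  have fm: "fourier f \<in> borel_measurable borel"
    unfolding fourier_def[abs_def]
    by (rule lborel.borel_measurable_lebesgue_integral) measurable
  have "(LINT \<xi>|lborel. inv_fourier f \<xi> * g \<xi>) = ?c * (LINT \<xi>|lborel. fourier f (- \<xi>) * g (- (- \<xi>)))"
    unfolding inv_fourier_eq_fourier by (simp add: mult.assoc)
  also have "(LINT \<xi>|lborel. fourier f (- \<xi>) * g (- (- \<xi>))) = (LINT \<xi>|lborel. fourier f \<xi> * g (- \<xi>))"
    using fm measurable_compose[OF borel_measurable_uminus[OF measurable_ident] \<open>g \<in> borel_measurable borel\<close>]
    by (intro integral_reflect[of "\<lambda>\<xi>. fourier f \<xi> * g (- \<xi>)"]) simp
  also have "\<dots> = (LINT x|lborel. f x * fourier g (- x))"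
    using fourier_multiplication_formula[OF assms(1) r] by (simp add: fg)
  also have "?c * \<dots> = (LINT x|lborel. f x * inv_fourier g x)"
    unfolding inv_fourier_eq_fourier by (subst integral_mult_right_zero[symmetric]) (simp add: mult_ac)
  finally show ?thesis .
qed

lemma schwartz_minus: "f \<in> schwartz \<Longrightarrow> g \<in> schwartz \<Longrightarrow> (\<lambda>x. f x - g x) \<in> schwartz"
  using schwartz_add[OF _ schwartz_cmult[of g "-1"], of f] by simp

lemma schwartz_continuous: "f \<in> schwartz \<Longrightarrow> isCont f x"
  unfolding schwartz_iff using csmooth_has_derivative has_derivative_continuous by blast

text \<open>The inversion integral is regularised by the Gaussian factor \<open>gauss (\<epsilon> x)\<close>. By the
multiplication formula the regularised integral is the average of \<open>a\<close> against a Gaussian of width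
\<open>\<epsilon>\<close> around \<open>\<xi>\<close>, which tends to \<open>a \<xi>\<close> as \<open>\<epsilon>\<close> tends to 0; the regularised integral
itself tends to the one without the factor. Both limits are by dominated convergence.\<close>

theorem fourier_inv_fourier:
  fixes a :: "'a::euclidean_space \<Rightarrow> complex"
  assumes a: "a \<in> schwartz"
  shows "fourier (inv_fourier a) \<xi> = a \<xi>"
proof -
  let ?n = "DIM('a)" and ?k = "of_real (sqrt (2 * pi) ^ DIM('a)) :: complex"
  define \<epsilon> where "\<epsilon> j = 1 / real (Suc j)" for j
  have \<epsilon>: "0 < \<epsilon> j" "\<epsilon> j \<noteq> 0" for j by (auto simp: \<epsilon>_def)
  have \<epsilon>0: "\<epsilon> \<longlonglongrightarrow> 0" unfolding \<epsilon>_def by (rule LIMSEQ_Suc[OF lim_const_over_n])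
  define H where "H j x = cis (- 1 * (x \<bullet> (- \<xi>))) * gauss (0 + \<epsilon> j *\<^sub>R x)" for j x
  have H: "H j \<in> schwartz" for j
    unfolding H_def[abs_def] by (intro tame_mult_schwartz csmooth_cis schwartz_affine gauss_schwartz \<epsilon>)
  have fH: "fourier (H j) y = ?k * gauss ((y - \<xi>) /\<^sub>R \<epsilon> j) /\<^sub>R \<epsilon> j ^ ?n" for j y
  proof -
    let ?e = "\<lambda>x. cis (- (x \<bullet> ((y - \<xi>) /\<^sub>R \<epsilon> j))) * gauss x"
    have m: "?e \<in> borel_measurable borel"
      using schwartz_measurable[OF gauss_schwartz] by (intro borel_measurable_times) measurable
    have "fourier (H j) y = (LINT x|lborel. ?e (0 + \<epsilon> j *\<^sub>R x))"
      unfolding fourier_def H_def using \<epsilon>(2)[of j]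
      by (intro Bochner_Integration.integral_cong refl)
        (simp add: mult.assoc[symmetric] cis_mult inner_diff_right algebra_simps)
    also have "\<dots> = fourier gauss ((y - \<xi>) /\<^sub>R \<epsilon> j) /\<^sub>R \<epsilon> j ^ ?n"
      using integral_affine[OF m \<epsilon>(2), of 0] \<epsilon>(1)[of j] unfolding fourier_def by simp
    finally show ?thesis by (simp add: fourier_gauss)
  qed
  have fa: "fourier a \<in> schwartz" by (rule fourier_schwartz[OF a])
  have L: "(\<lambda>j. LINT x|lborel. fourier a x * H j x) \<longlonglongrightarrow> (LINT x|lborel. fourier a x * cis (x \<bullet> \<xi>))"
  proof (rule integral_dominated_convergence[where w="\<lambda>x. norm (fourier a x)"])
    show "integrable lborel (\<lambda>x. norm (fourier a x))" by (intro integrable_norm schwartz_integrable fa)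
    show "(\<lambda>x. fourier a x * H j x) \<in> borel_measurable lborel" for j
      using schwartz_measurable[OF fa] schwartz_measurable[OF H[of j]] by simp
    have "(\<lambda>x. cis (x \<bullet> \<xi>)) \<in> borel_measurable borel"
      by (intro borel_measurable_continuous_onI continuous_intros)
    then show "(\<lambda>x. fourier a x * cis (x \<bullet> \<xi>)) \<in> borel_measurable lborel"
      using schwartz_measurable[OF fa] by simp
    show "AE x in lborel. norm (fourier a x * H j x) \<le> norm (fourier a x)" for j
      by (rule AE_I2) (simp add: norm_mult H_def gauss_def norm_of_real mult_left_le)
    show "AE x in lborel. (\<lambda>j. fourier a x * H j x) \<longlonglongrightarrow> fourier a x * cis (x \<bullet> \<xi>)"
    proof (rule AE_I2)
      fix x :: 'a
      have "(\<lambda>j. gauss (0 + \<epsilon> j *\<^sub>R x)) \<longlonglongrightarrow> gauss (0 + 0 *\<^sub>R x)"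
        by (intro isCont_tendsto_compose[OF schwartz_continuous[OF gauss_schwartz]] tendsto_add tendsto_scaleR tendsto_const \<epsilon>0)
      then have "(\<lambda>j. fourier a x * (cis (- 1 * (x \<bullet> (- \<xi>))) * gauss (0 + \<epsilon> j *\<^sub>R x))) \<longlonglongrightarrow> fourier a x * (cis (- 1 * (x \<bullet> (- \<xi>))) * gauss (0 + 0 *\<^sub>R x))"
        by (intro tendsto_mult tendsto_const)
      then show "(\<lambda>j. fourier a x * H j x) \<longlonglongrightarrow> fourier a x * cis (x \<bullet> \<xi>)"
        by (simp add: H_def gauss_def)
    qed
  qed
  have eq: "(LINT x|lborel. fourier a x * H j x) = (LINT z|lborel. a (\<xi> + \<epsilon> j *\<^sub>R z) * (?k * gauss z))" for j
  proof -
    let ?g = "\<lambda>y. a y * (?k * gauss ((y - \<xi>) /\<^sub>R \<epsilon> j))"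
    have m: "?g \<in> borel_measurable borel"
      using schwartz_measurable[OF a] measurable_compose[OF _ schwartz_measurable[OF gauss_schwartz], of "\<lambda>y. (y - \<xi>) /\<^sub>R \<epsilon> j"]
      by simp
    have "(LINT x|lborel. fourier a x * H j x) = (LINT y|lborel. a y * fourier (H j) y)"
      by (intro fourier_multiplication_formula schwartz_integrable a H)
    also have "\<dots> = (LINT y|lborel. ?g y /\<^sub>R \<epsilon> j ^ ?n)"
      by (simp add: fH)
    also have "\<dots> = (LINT z|lborel. ?g (\<xi> + \<epsilon> j *\<^sub>R z))"
      using integral_affine[OF m \<epsilon>(2), of \<xi> j] \<epsilon>(1)[of j] by simp
    finally show ?thesis using \<epsilon>(2)[of j] by simp
  qed
  obtain B where B: "\<And>x. norm (a x) \<le> B" using schwartz_bounded[OF a, of 0] by auto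
  have R: "(\<lambda>j. LINT z|lborel. a (\<xi> + \<epsilon> j *\<^sub>R z) * (?k * gauss z)) \<longlonglongrightarrow> (LINT z|(lborel :: 'a measure). a \<xi> * (?k * gauss z))"
  proof (rule integral_dominated_convergence[where w="\<lambda>z::'a. B * norm (?k * gauss z)"])
    show "integrable lborel (\<lambda>z::'a. B * norm (?k * gauss z))"
      by (intro integrable_mult_right integrable_norm schwartz_integrable schwartz_cmult gauss_schwartz)
    show "(\<lambda>z. a (\<xi> + \<epsilon> j *\<^sub>R z) * (?k * gauss z)) \<in> borel_measurable lborel" for j
      using schwartz_measurable[OF gauss_schwartz] measurable_compose[OF _ schwartz_measurable[OF a], of "\<lambda>z. \<xi> + \<epsilon> j *\<^sub>R z" borel]
      by (intro borel_measurable_times) simp_all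
    show "(\<lambda>z::'a. a \<xi> * (?k * gauss z)) \<in> borel_measurable lborel"
      using schwartz_measurable[OF gauss_schwartz] by (intro borel_measurable_times) simp_all
    show "AE z in lborel. norm (a (\<xi> + \<epsilon> j *\<^sub>R z) * (?k * gauss z)) \<le> B * norm (?k * gauss z)" for j
      unfolding norm_mult[of "a _"] by (intro AE_I2 mult_right_mono B norm_ge_zero)
    show "AE z in lborel. (\<lambda>j. a (\<xi> + \<epsilon> j *\<^sub>R z) * (?k * gauss z)) \<longlonglongrightarrow> a \<xi> * (?k * gauss z)"
    proof (intro AE_I2 tendsto_mult tendsto_const)
      fix z :: 'a
      have "(\<lambda>j. a (\<xi> + \<epsilon> j *\<^sub>R z)) \<longlonglongrightarrow> a (\<xi> + 0 *\<^sub>R z)"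
        by (intro isCont_tendsto_compose[OF schwartz_continuous[OF a]] tendsto_add tendsto_scaleR tendsto_const \<epsilon>0)
      then show "(\<lambda>j. a (\<xi> + \<epsilon> j *\<^sub>R z)) \<longlonglongrightarrow> a \<xi>" by simp
    qed
  qed
  have "(LINT x|lborel. fourier a x * cis (x \<bullet> \<xi>)) = (LINT z|(lborel :: 'a measure). a \<xi> * (?k * gauss z))"
    using LIMSEQ_unique[OF L] R unfolding eq by blast
  also have "\<dots> = a \<xi> * of_real ((2 * pi) ^ ?n)"
  proof -
    have "sqrt (2 * pi) ^ ?n * sqrt (2 * pi) ^ ?n = (2 * pi) ^ ?n"
      by (subst power_mult_distrib[symmetric]) simp
    then have "?k * ?k = of_real ((2 * pi) ^ ?n)" by (simp only: of_real_mult[symmetric])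
    then show ?thesis by (simp only: integral_mult_right_zero integral_gauss)
  qed
  finally have 1: "(LINT x|lborel. fourier a x * cis (x \<bullet> \<xi>)) = a \<xi> * of_real ((2 * pi) ^ ?n)" .
  have m2: "(\<lambda>x. fourier a x * cis (x \<bullet> \<xi>)) \<in> borel_measurable borel"
    using schwartz_measurable[OF fa] by simp
  have "fourier (inv_fourier a) \<xi> = (LINT x|lborel. of_real (1 / (2 * pi) ^ ?n) * (fourier a (- x) * cis ((- x) \<bullet> \<xi>)))"
    unfolding fourier_def[of "inv_fourier a"] inv_fourier_eq_fourier by (simp add: mult_ac)
  also have "\<dots> = of_real (1 / (2 * pi) ^ ?n) * (LINT x|lborel. fourier a (- x) * cis ((- x) \<bullet> \<xi>))"
    by (rule integral_mult_right_zero)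
  also have "(LINT x|lborel. fourier a (- x) * cis ((- x) \<bullet> \<xi>)) = (LINT x|lborel. fourier a x * cis (x \<bullet> \<xi>))"
    by (rule integral_reflect[OF m2])
  finally show ?thesis unfolding 1 by simp
qed

text \<open>The conjugate of \<open>inv_fourier a\<close> is a multiple of the transform of the conjugate of \<open>a\<close>; the
multiplication formula then moves this transform onto \<open>inv_fourier a\<close>, where it inverts.\<close>

theorem plancherel_inv_fourier:
  fixes a :: "'a::euclidean_space \<Rightarrow> complex"
  assumes a: "a \<in> schwartz"
  shows "(LINT x|lborel. (norm (inv_fourier a x))\<^sup>2) = (LINT \<xi>|lborel. (norm (a \<xi>))\<^sup>2) / (2 * pi) ^ DIM('a)"
proof -
  let ?c = "of_real (1 / (2 * pi) ^ DIM('a)) :: complex"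
  let ?u = "inv_fourier a" and ?b = "\<lambda>x. cnj (a x)"
  have b: "?b \<in> schwartz" by (rule schwartz_cnj[OF a])
  have cnj: "cnj (?u x) = ?c * fourier ?b x" for x
  proof -
    have "cnj (?u x) = ?c * cnj (LINT \<xi>|lborel. cis (x \<bullet> \<xi>) * a \<xi>)"
      unfolding inv_fourier_def by simp
    also have "cnj (LINT \<xi>|lborel. cis (x \<bullet> \<xi>) * a \<xi>) = (LINT \<xi>|lborel. cnj (cis (x \<bullet> \<xi>) * a \<xi>))"
      by (simp only: Bochner_Integration.integral_cnj)
    also have "\<dots> = fourier ?b x"
      unfolding fourier_def by (simp add: cis_cnj inner_commute del: integral_cnj)
    finally show ?thesis .
  qed
  have "of_real (LINT x|lborel. (norm (?u x))\<^sup>2) = (LINT x|lborel. ?u x * (?c * fourier ?b x))"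
    unfolding cnj[symmetric] complex_norm_square[symmetric] by (rule integral_complex_of_real[symmetric])
  also have "\<dots> = ?c * (LINT x|lborel. ?u x * fourier ?b x)"
    by (subst integral_mult_right_zero[symmetric]) (simp add: mult_ac)
  also have "(LINT x|lborel. ?u x * fourier ?b x) = (LINT x|lborel. fourier ?u x * ?b x)"
    by (rule fourier_multiplication_formula[symmetric]) (intro schwartz_integrable inv_fourier_schwartz a b)+
  also have "\<dots> = of_real (LINT \<xi>|lborel. (norm (a \<xi>))\<^sup>2)"
    unfolding fourier_inv_fourier[OF a] complex_norm_square[symmetric] by (rule integral_complex_of_real)
  also have "?c * \<dots> = of_real ((LINT \<xi>|lborel. (norm (a \<xi>))\<^sup>2) / (2 * pi) ^ DIM('a))"
    by (simp flip: of_real_mult)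
  finally show ?thesis unfolding of_real_eq_iff .
qed

section \<open>Multipliers acting on Schwartz functions\<close>

lemma schwartz_mult: "f \<in> schwartz \<Longrightarrow> g \<in> schwartz \<Longrightarrow> (\<lambda>x. f x * g x) \<in> schwartz"
  by (rule tame_mult_schwartz[OF csmooth_weight_mono[OF _ rapid_subset_tame]]) (simp_all add: schwartz_iff)

lemma distr_of_apply: "\<psi> \<in> schwartz \<Longrightarrow> distr_of f \<psi> = (LINT x|lborel. f x * \<psi> x)"
  by (simp add: distr_of_def)

text \<open>For the continuity bound the supremum of \<open>\<psi>\<close> suffices, because \<open>f\<close> is integrable.\<close>

lemma distr_of_tempered:
  fixes f :: "'a::euclidean_space \<Rightarrow> complex"
  assumes f: "f \<in> schwartz"
  shows "distr_of f \<in> tempered"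
  unfolding tempered_def mem_Collect_eq
proof (intro conjI allI ballI impI)
  fix \<psi> :: "'a \<Rightarrow> complex" assume "\<psi> \<notin> schwartz" then show "distr_of f \<psi> = 0" by (simp add: distr_of_def)
next
  fix \<psi> \<eta> :: "'a \<Rightarrow> complex" assume \<psi>: "\<psi> \<in> schwartz" and \<eta>: "\<eta> \<in> schwartz"
  have "(LINT x|lborel. f x * (\<psi> x + \<eta> x)) = (LINT x|lborel. f x * \<psi> x + f x * \<eta> x)" by (simp add: distrib_left)
  also have "\<dots> = (LINT x|lborel. f x * \<psi> x) + (LINT x|lborel. f x * \<eta> x)"
    by (intro Bochner_Integration.integral_add schwartz_integrable schwartz_mult f \<psi> \<eta>)
  finally show "distr_of f (\<lambda>x. \<psi> x + \<eta> x) = distr_of f \<psi> + distr_of f \<eta>"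
    by (simp add: distr_of_apply \<psi> \<eta> schwartz_add)
next
  fix c and \<psi> :: "'a \<Rightarrow> complex" assume \<psi>: "\<psi> \<in> schwartz"
  have "(LINT x|lborel. f x * (c * \<psi> x)) = (LINT x|lborel. c * (f x * \<psi> x))" by (simp add: mult_ac)
  also have "\<dots> = c * (LINT x|lborel. f x * \<psi> x)" by (rule integral_mult_right_zero)
  finally show "distr_of f (\<lambda>x. c * \<psi> x) = c * distr_of f \<psi>"
    by (simp add: distr_of_apply \<psi> schwartz_cmult)
next
  show "\<exists>B N. \<forall>\<psi>\<in>schwartz. norm (distr_of f \<psi>) \<le>
        B * (\<Sum>k\<le>N. \<Sum>vs | set vs \<subseteq> Basis \<and> length vs \<le> N. schwartz_seminorm k vs \<psi>)"
  proof (intro exI ballI)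
    fix \<psi> :: "'a \<Rightarrow> complex" assume \<psi>: "\<psi> \<in> schwartz"
    have e: "{vs :: 'a list. set vs \<subseteq> Basis \<and> length vs \<le> 0} = {[]}" by auto
    have bdd: "bdd_above (range (\<lambda>x. norm x ^ 0 * norm (iter_deriv [] \<psi> x)))"
    proof -
      have "\<forall>k. \<forall>vs\<in>lists Basis. bdd_above (range (\<lambda>x. norm x ^ k * norm (iter_deriv vs \<psi> x)))"
        using \<psi> unfolding schwartz_def by simp
      then show ?thesis by (metis lists.Nil)
    qed
    have s: "norm (\<psi> x) \<le> schwartz_seminorm 0 [] \<psi>" for x
      unfolding schwartz_seminorm_def using cSUP_upper[OF UNIV_I bdd, of x] by simp
    have "norm (distr_of f \<psi>) \<le> (LINT x|lborel. norm (f x * \<psi> x))"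
      unfolding distr_of_apply[OF \<psi>] by (rule Bochner_Integration.integral_norm_bound)
    also have "\<dots> \<le> (LINT x|lborel. norm (f x) * schwartz_seminorm 0 [] \<psi>)"
      by (intro Bochner_Integration.integral_mono integrable_norm integrable_mult_left schwartz_integrable schwartz_mult f \<psi>)
        (simp add: norm_mult mult_left_mono s)
    also have "\<dots> = (LINT x|lborel. norm (f x)) * schwartz_seminorm 0 [] \<psi>" by simp
    finally show "norm (distr_of f \<psi>) \<le> (LINT x|lborel. norm (f x)) *
       (\<Sum>k\<le>0. \<Sum>vs | set vs \<subseteq> Basis \<and> length vs \<le> 0. schwartz_seminorm k vs \<psi>)"
      unfolding e by simp
  qed
qed

text \<open>On distributions, multipliers are defined by duality. For one that is given by a Schwartz function, two
applications of the multiplication formula turn the duality into the formula for functions.\<close>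

theorem multiplier_distr_of:
  fixes f :: "'a::euclidean_space \<Rightarrow> complex"
  assumes m: "csmooth tame m" and f: "f \<in> schwartz"
  shows "multiplier m (distr_of f) = distr_of (inv_fourier (\<lambda>\<xi>. m \<xi> * fourier f \<xi>))"
proof
  fix \<psi> :: "'a \<Rightarrow> complex"
  show "multiplier m (distr_of f) \<psi> = distr_of (inv_fourier (\<lambda>\<xi>. m \<xi> * fourier f \<xi>)) \<psi>"
  proof (cases "\<psi> \<in> schwartz")
    case False
    then show ?thesis by (simp add: multiplier_def inv_fourier_distr_def distr_of_def)
  next
    case \<psi>: True
    have i: "inv_fourier \<psi> \<in> schwartz" by (rule inv_fourier_schwartz[OF \<psi>])
    have mi: "(\<lambda>\<xi>. m \<xi> * inv_fourier \<psi> \<xi>) \<in> schwartz" by (rule tame_mult_schwartz[OF m i])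
    have mf: "(\<lambda>\<xi>. m \<xi> * fourier f \<xi>) \<in> schwartz" by (rule tame_mult_schwartz[OF m fourier_schwartz[OF f]])
    have "multiplier m (distr_of f) \<psi> = (LINT x|lborel. f x * fourier (\<lambda>\<xi>. m \<xi> * inv_fourier \<psi> \<xi>) x)"
      using \<psi> i mi fourier_schwartz[OF mi]
      by (simp add: multiplier_def inv_fourier_distr_def mult_distr_def fourier_distr_def distr_of_def)
    also have "\<dots> = (LINT \<xi>|lborel. fourier f \<xi> * (m \<xi> * inv_fourier \<psi> \<xi>))"
      by (rule fourier_multiplication_formula[symmetric]) (intro schwartz_integrable f mi)+
    also have "\<dots> = (LINT \<xi>|lborel. (m \<xi> * fourier f \<xi>) * inv_fourier \<psi> \<xi>)" by (simp add: mult_ac)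
    also have "\<dots> = (LINT x|lborel. inv_fourier (\<lambda>\<xi>. m \<xi> * fourier f \<xi>) x * \<psi> x)"
      by (rule inv_fourier_multiplication_formula[symmetric]) (intro schwartz_integrable mf \<psi>)+
    finally show ?thesis by (simp add: distr_of_apply[OF \<psi>])
  qed
qed

corollary multiplier_distr_of_inv_fourier:
  assumes "csmooth tame m" "a \<in> schwartz"
  shows "multiplier m (distr_of (inv_fourier a)) = distr_of (inv_fourier (\<lambda>\<xi>. m \<xi> * a \<xi>))"
  using multiplier_distr_of[OF assms(1) inv_fourier_schwartz[OF assms(2)]]
  by (simp add: fourier_inv_fourier[OF assms(2)])

text \<open>Pairing \<open>f - g\<close> with its own conjugate shows that it vanishes almost everywhere, and the Fourier
transform does not see null sets. This makes \<open>multiplier_ext\<close> independent of the representing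
function that is chosen in its definition.\<close>

lemma distr_of_eq_imp_fourier_eq:
  fixes f g :: "'a::euclidean_space \<Rightarrow> complex"
  assumes f: "f \<in> schwartz" and g: "g \<in> schwartz" and eq: "distr_of f = distr_of g"
  shows "fourier f = fourier g"
proof
  fix \<xi> :: 'a
  let ?d = "\<lambda>x. f x - g x"
  have d: "?d \<in> schwartz" by (rule schwartz_minus[OF f g])
  have c: "(\<lambda>x. cnj (?d x)) \<in> schwartz" by (rule schwartz_cnj[OF d])
  have "of_real (LINT x|lborel. (norm (?d x))\<^sup>2) = (LINT x|lborel. f x * cnj (?d x) - g x * cnj (?d x))"
    unfolding left_diff_distrib[symmetric] complex_norm_square[symmetric] by (rule integral_complex_of_real[symmetric])
  also have "\<dots> = (LINT x|lborel. f x * cnj (?d x)) - (LINT x|lborel. g x * cnj (?d x))"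
    by (intro Bochner_Integration.integral_diff schwartz_integrable schwartz_mult f g c)
  also have "\<dots> = 0" using fun_cong[OF eq, of "\<lambda>x. cnj (?d x)"] by (simp only: distr_of_apply[OF c]) simp
  finally have "(LINT x|lborel. (norm (?d x))\<^sup>2) = 0" by simp
  moreover have "integrable lborel (\<lambda>x. (norm (?d x))\<^sup>2)"
    using integrable_norm[OF schwartz_integrable[OF schwartz_mult[OF d d]]] by (simp add: norm_mult power2_eq_square)
  ultimately have "AE x in lborel. (norm (?d x))\<^sup>2 = 0"
    by (subst (asm) integral_nonneg_eq_0_iff_AE) auto
  then have "AE x in lborel. cis (- (x \<bullet> \<xi>)) * f x = cis (- (x \<bullet> \<xi>)) * g x" by eventually_elim simp
  moreover have "(\<lambda>x. cis (- (x \<bullet> \<xi>)) * f x) \<in> borel_measurable lborel" "(\<lambda>x. cis (- (x \<bullet> \<xi>)) * g x) \<in> borel_measurable lborel"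
    using schwartz_measurable[OF f] schwartz_measurable[OF g] by simp_all
  ultimately show "fourier f \<xi> = fourier g \<xi>" unfolding fourier_def by (intro integral_cong_AE)
qed

lemma multiplier_ext_distr_of:
  assumes f: "f \<in> schwartz"
  shows "multiplier_ext \<theta> \<Psi> q s p m (distr_of f) = distr_of (multiplier_fun m f)"
proof -
  let ?g = "inv_into schwartz distr_of (distr_of f)"
  have "distr_of f \<in> distr_of ` schwartz" using f by (rule imageI)
  then have "?g \<in> schwartz" "distr_of ?g = distr_of f"
    by (rule inv_into_into, rule f_inv_into_f)
  then have "fourier ?g = fourier f" using distr_of_eq_imp_fourier_eq f by blast
  then show ?thesis using f by (simp add: multiplier_ext_def multiplier_fun_def)
qed

text \<open>Differentiating \<open>(1 + \<xi> \<bullet> \<xi>) powr r\<close> gives a linear factor times the same expression with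
\<open>r - 1\<close>, so the induction is over all exponents at once.\<close>

lemma csmooth_bessel_symbol:
  "csmooth tame (\<lambda>\<xi>::'a::euclidean_space. complex_of_real (sqrt (1 + (norm \<xi>)\<^sup>2) powr s))"
proof -
  let ?K = "\<lambda>r (\<xi>::'a). complex_of_real ((1 + \<xi> \<bullet> \<xi>) powr r)"
  have pos: "0 < 1 + \<xi> \<bullet> \<xi>" for \<xi> :: 'a by (simp add: add_pos_nonneg)
  have ctrl: "controlled {()} UNIV tame (\<lambda>_. ?K r)" for r
  proof -
    obtain N :: nat where N: "r \<le> real N" using real_arch_simple by blast
    have "norm (?K r \<xi>) \<le> 1 * (1 + norm \<xi>) ^ (2 * N)" for \<xi> :: 'a
    proof -
      have "(1 + \<xi> \<bullet> \<xi>) powr r \<le> (1 + \<xi> \<bullet> \<xi>) powr real N" by (rule powr_mono[OF N]) simp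
      also have "\<dots> = (1 + \<xi> \<bullet> \<xi>) ^ N" by (rule powr_realpow[OF pos])
      also have "\<dots> \<le> ((1 + norm \<xi>)\<^sup>2) ^ N"
        by (intro power_mono) (simp_all add: power2_sum power2_norm_eq_inner)
      finally show ?thesis by (simp add: power_mult norm_of_real)
    qed
    then show ?thesis by (intro controlled_tameI[of 1]) auto
  qed
  have der: "(?K r has_derivative (\<lambda>h. (of_real (2 * r) * of_real (\<xi> \<bullet> h)) * ?K (r - 1) \<xi>)) (at \<xi>)" for r and \<xi> :: 'a
  proof -
    have 1: "((\<lambda>\<xi>. 1 + \<xi> \<bullet> \<xi>) has_derivative (\<lambda>h. 2 * (\<xi> \<bullet> h))) (at \<xi>)"
      by (auto intro!: derivative_eq_intros simp: inner_commute)
    have "((\<lambda>y. y powr r) has_field_derivative r * (1 + \<xi> \<bullet> \<xi>) powr (r - 1)) (at (1 + \<xi> \<bullet> \<xi>))"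
      by (rule has_real_derivative_powr[OF pos])
    from has_derivative_compose[OF 1 this[unfolded has_field_derivative_def]]
    have "((\<lambda>\<xi>. (1 + \<xi> \<bullet> \<xi>) powr r) has_derivative (\<lambda>h. r * (1 + \<xi> \<bullet> \<xi>) powr (r - 1) * (2 * (\<xi> \<bullet> h)))) (at \<xi>)" .
    then have "((\<lambda>\<xi>. complex_of_real ((1 + \<xi> \<bullet> \<xi>) powr r)) has_derivative
        (\<lambda>h. complex_of_real (r * (1 + \<xi> \<bullet> \<xi>) powr (r - 1) * (2 * (\<xi> \<bullet> h))))) (at \<xi>)"
      by (rule has_derivative_of_real)
    then show ?thesis by (simp add: mult_ac)
  qed
  have "Ck_family {()} UNIV tame k (\<lambda>_. ?K r)" for k r
  proof (induction k arbitrary: r)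
    case 0
    then show ?case using ctrl by simp
  next
    case (Suc k)
    show ?case
    proof (rule Ck_family_SucI[OF open_UNIV ctrl der])
      fix b :: 'a
      have "csmooth tame (\<lambda>\<xi>::'a. of_real (2 * r) * of_real (\<xi> \<bullet> b) :: complex)"
        by (intro csmooth_mult csmooth_const csmooth_inner)
      then show "Ck_family {()} UNIV tame k (\<lambda>i \<xi>. (of_real (2 * r) * of_real (\<xi> \<bullet> b)) * ?K (r - 1) \<xi>)"
        using Suc.IH[of "r - 1"] tame_cone unfolding csmooth_def tame_def
        by (intro Ck_family_moderate_mult) auto
    qed
  qed
  then have "csmooth tame (?K (s / 2))" by (simp add: csmooth_def)
  moreover have "sqrt (1 + (norm \<xi>)\<^sup>2) powr s = (1 + \<xi> \<bullet> \<xi>) powr (s / 2)" for \<xi> :: 'a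
    using pos[of \<xi>] by (simp add: power2_norm_eq_inner powr_half_sqrt[symmetric] powr_powr)
  ultimately show ?thesis by simp
qed

section \<open>Lebesgue norms of functions given by their Fourier transform\<close>

lemma epowr_ennreal: "0 \<le> r \<Longrightarrow> epowr (ennreal r) a = ennreal (r powr a)"
  by (simp add: epowr_def)

lemma epowr_mono:
  assumes "x \<le> y" "0 \<le> a" shows "epowr x a \<le> epowr y a"
proof (cases "y = \<infinity>")
  case False
  then have "x \<noteq> \<infinity>" using assms(1) by (auto simp: top_unique)
  moreover have "enn2real x \<le> enn2real y" using assms(1) False by (intro enn2real_mono) (auto simp: less_top)
  ultimately show ?thesis using False assms(2) by (auto simp: epowr_def intro!: ennreal_leI powr_mono2)
qed (simp add: epowr_def)

lemma epowr_epowr: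
  assumes "a \<noteq> 0" shows "epowr (epowr x (1 / a)) a = x"
proof (cases x)
  case (real r)
  then show ?thesis using assms by (simp add: epowr_ennreal powr_powr)
qed (simp add: epowr_def)

lemma norm_inv_fourier_le:
  "norm (inv_fourier a (x::'a::euclidean_space)) \<le> (LINT \<xi>|lborel. norm (a \<xi>))"
proof -
  define c where "c = (2 * pi) ^ DIM('a)"
  have "1 \<le> c" unfolding c_def by (intro one_le_power) (use pi_ge_two in simp)
  then have "norm (inv_fourier a x) \<le> 1 * norm (fourier a (- x))"
    unfolding inv_fourier_eq_fourier norm_mult norm_of_real c_def[symmetric]
    by (intro mult_right_mono) simp_all
  also have "\<dots> \<le> (LINT \<xi>|lborel. norm (a \<xi>))" using norm_fourier_le[of a "- x"] by simp
  finally show ?thesis .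
qed

text \<open>For exponents from 2 on, the Lebesgue norm is controlled by the supremum, which is at most \<open>B V\<close>,
  and the \<open>L\<^sup>2\<close> norm, whose square is at most \<open>B\<^sup>2 V\<close> by Plancherel. So size and support of \<open>a\<close>
  suffice, and no localisation of \<open>inv_fourier a\<close> in space has to be proved.\<close>

lemma nn_integral_powr_inv_fourier_le:
  fixes a :: "'a::euclidean_space \<Rightarrow> complex"
  assumes a: "a \<in> schwartz" and p: "2 \<le> p" and B: "0 \<le> B" "\<And>\<xi>. norm (a \<xi>) \<le> B"
    and A: "A \<in> sets borel" "emeasure lborel A \<le> ennreal V" "0 \<le> V" "\<And>\<xi>. \<xi> \<notin> A \<Longrightarrow> a \<xi> = 0"
  shows "(\<integral>\<^sup>+x. ennreal (norm (inv_fourier a x) powr p) \<partial>lborel) \<le> ennreal (B powr p * V powr (p - 1))"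
proof -
  let ?u = "inv_fourier a"
  have fin: "emeasure lborel A < \<infinity>" using A(2) by (auto simp: less_top[symmetric] top_unique)
  have mA: "measure lborel A \<le> V"
    using A(2,3) by (simp add: measure_def enn2real_leI)
  have iA: "integrable lborel (\<lambda>\<xi>. C * indicat_real A \<xi>)" for C
    using A(1) fin by (intro integrable_mult_right integrable_real_indicator) auto
  have I: "(LINT \<xi>|lborel. norm (a \<xi>) ^ k) \<le> B ^ k * V" if "0 < k" for k :: nat
  proof (cases "integrable lborel (\<lambda>\<xi>. norm (a \<xi>) ^ k)")
    case True
    have "(LINT \<xi>|lborel. norm (a \<xi>) ^ k) \<le> (LINT \<xi>|lborel. B ^ k * indicator A \<xi>)"
      by (rule Bochner_Integration.integral_mono[OF True iA])
        (use A(4) B that in \<open>auto simp: indicator_def power_mono zero_power\<close>)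
    also have "\<dots> = B ^ k * measure lborel A" using A(1) by simp
    also have "\<dots> \<le> B ^ k * V" using mA B by (simp add: mult_left_mono)
    finally show ?thesis .
  qed (use B A in \<open>simp add: not_integrable_integral_eq\<close>)
  have sup: "norm (?u x) \<le> B * V" for x
    using norm_inv_fourier_le[of a x] I[of 1] by simp
  have sq: "(LINT x|lborel. (norm (?u x))\<^sup>2) \<le> B\<^sup>2 * V"
  proof -
    have "1 \<le> (2 * pi) ^ DIM('a)" using pi_ge_two by (intro one_le_power) simp
    then have "(LINT \<xi>|lborel. (norm (a \<xi>))\<^sup>2) / (2 * pi) ^ DIM('a) \<le> (LINT \<xi>|lborel. (norm (a \<xi>))\<^sup>2) / 1"
      by (intro divide_left_mono) auto
    then show ?thesis unfolding plancherel_inv_fourier[OF a] using I[of 2] by simp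
  qed
  have u: "?u \<in> schwartz" by (rule inv_fourier_schwartz[OF a])
  have isq: "integrable lborel (\<lambda>x. (norm (?u x))\<^sup>2)"
    using integrable_norm[OF schwartz_integrable[OF schwartz_mult[OF u u]]] by (simp add: norm_mult power2_eq_square)
  (* Interpolation: p - 2 of the p factors are bounded by the supremum. *)
  have pw: "norm (?u x) powr p \<le> (B * V) powr (p - 2) * (norm (?u x))\<^sup>2" for x
  proof (cases "?u x = 0")
    case False
    have "norm (?u x) powr p = norm (?u x) powr (p - 2) * norm (?u x) powr 2"
      by (subst powr_add[symmetric]) simp
    also have "\<dots> \<le> (B * V) powr (p - 2) * norm (?u x) powr 2"
      by (intro mult_right_mono powr_mono2) (use p sup in auto)
    finally show ?thesis using False by simp
  qed simp
  have "(\<integral>\<^sup>+x. ennreal (norm (?u x) powr p) \<partial>lborel) \<le> (\<integral>\<^sup>+x. ennreal ((B * V) powr (p - 2) * (norm (?u x))\<^sup>2) \<partial>lborel)"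
    by (intro nn_integral_mono ennreal_leI pw)
  also have "\<dots> = ennreal ((B * V) powr (p - 2) * (LINT x|lborel. (norm (?u x))\<^sup>2))"
    by (subst nn_integral_eq_integral) (use isq in auto)
  also have "\<dots> \<le> ennreal ((B * V) powr (p - 2) * (B\<^sup>2 * V))"
    by (intro ennreal_leI mult_left_mono sq) auto
  also have "(B * V) powr (p - 2) * (B\<^sup>2 * V) = B powr p * V powr (p - 1)"
  proof (cases "B = 0 \<or> V = 0")
    case False
    then have "0 < B" "0 < V" using B A by auto
    then have "(B * V) powr (p - 2) * (B\<^sup>2 * V) = (B powr (p - 2) * B powr 2) * (V powr (p - 2) * V powr 1)"
      by (simp add: powr_mult)
    also have "B powr (p - 2) * B powr 2 = B powr p" by (subst powr_add[symmetric]) simp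
    also have "V powr (p - 2) * V powr 1 = V powr (p - 1)" by (subst powr_add[symmetric]) simp
    finally show ?thesis .
  qed (use p in auto)
  finally show ?thesis .
qed

lemma Lp_norm_distr_of_le:
  assumes "u \<in> schwartz" "(\<integral>\<^sup>+x. ennreal (norm (u x) powr p) \<partial>lborel) \<le> ennreal K" "0 \<le> K" "0 < p"
  shows "Lp_norm p (distr_of u) \<le> epowr (ennreal K) (1 / p)"
proof -
  have "Lp_norm p (distr_of u) \<le> epowr (\<integral>\<^sup>+x. ennreal (norm (u x) powr p) \<partial>lborel) (1 / p)"
    unfolding Lp_norm_def
    by (rule INF_lower) (use assms schwartz_measurable[OF assms(1)] in \<open>auto simp: less_top[symmetric] top_unique\<close>)
  also have "\<dots> \<le> epowr (ennreal K) (1 / p)" using assms by (intro epowr_mono) auto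
  finally show ?thesis .
qed

section \<open>Upper bounds for the Hardy space norm\<close>

lemma borel_measurable_sgn_euclidean [measurable]: "(sgn :: 'a::euclidean_space \<Rightarrow> 'a) \<in> borel_measurable borel"
  unfolding sgn_div_norm[abs_def] by measurable

lemma emeasure_unit_ball: "0 < emeasure lborel (ball 0 1 :: 'a::euclidean_space set)" "emeasure lborel (ball 0 1 :: 'a::euclidean_space set) < \<infinity>"
proof -
  show "0 < emeasure lborel (ball 0 1 :: 'a set)"
    using content_ball_pos[of 1 "0::'a"] by (auto simp: measure_def enn2real_positive_iff)
  show "emeasure lborel (ball 0 1 :: 'a set) < \<infinity>"
    by (rule emeasure_bounded_finite) simp
qed

interpretation unit_ball: prob_space "uniform_measure lborel (ball 0 1 :: 'a::euclidean_space set)"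
  using emeasure_unit_ball[where 'a='a] by (intro prob_space_uniform_measure) auto

interpretation sphere: prob_space "sphere_measure :: 'a::euclidean_space measure"
  unfolding sphere_measure_def by (rule unit_ball.prob_space_distr) simp

lemma sets_sphere_measure [simp, measurable_cong]: "sets sphere_measure = sets borel"
  by (simp add: sphere_measure_def)

lemma AE_sphere_measure_norm: "AE \<omega> in (sphere_measure :: 'a::euclidean_space measure). norm \<omega> = 1"
proof -
  have "AE x in uniform_measure lborel (ball 0 1 :: 'a set). norm (sgn x) = 1"
    by (rule AE_uniform_measureI) (use AE_lborel_singleton[of 0] in \<open>auto simp: norm_sgn\<close>)
  then show ?thesis unfolding sphere_measure_def by (subst AE_distr_iff) auto
qed

text \<open>The low-frequency part vanishes because \<open>q\<close> is zero wherever \<open>a\<close> is not. For each direction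
\<open>\<omega>\<close> the wave packet coefficient of \<open>f\<close> has Fourier transform the packet symbol times the
Bessel weight times \<open>a\<close>, so \<open>nn_integral_powr_inv_fourier_le\<close> applies; the bound is uniform in
\<open>\<omega>\<close>, and the sphere has total measure 1.\<close>

theorem HspFIO_norm_le:
  fixes a :: "'a::euclidean_space \<Rightarrow> complex"
  assumes a: "a \<in> schwartz" and p: "2 \<le> p" and q: "csmooth tame q" "\<And>\<xi>. q \<xi> * a \<xi> = 0"
    and tame: "\<And>\<omega>. norm \<omega> = 1 \<Longrightarrow> csmooth tame (packet_symbol \<theta> \<Psi> \<omega>)"
    and B: "0 \<le> B" "\<And>\<omega> \<xi>. norm \<omega> = 1 \<Longrightarrow>
      norm (packet_symbol \<theta> \<Psi> \<omega> \<xi> * (of_real (sqrt (1 + (norm \<xi>)\<^sup>2) powr s) * a \<xi>)) \<le> B"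
    and V: "0 \<le> V" "\<And>\<omega>. norm \<omega> = 1 \<Longrightarrow> A \<omega> \<in> sets borel" "\<And>\<omega>. norm \<omega> = 1 \<Longrightarrow> emeasure lborel (A \<omega>) \<le> ennreal V"
    and supp: "\<And>\<omega> \<xi>. norm \<omega> = 1 \<Longrightarrow> \<xi> \<notin> A \<omega> \<Longrightarrow> packet_symbol \<theta> \<Psi> \<omega> \<xi> * a \<xi> = 0"
  shows "distr_of (inv_fourier a) \<in> HspFIO \<theta> \<Psi> q s p"
    and "epowr (HspFIO_norm \<theta> \<Psi> q s p (distr_of (inv_fourier a))) p \<le> ennreal (B powr p * V powr (p - 1))"
proof -
  let ?J = "\<lambda>\<xi>::'a. complex_of_real (sqrt (1 + (norm \<xi>)\<^sup>2) powr s)"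
  let ?K = "B powr p * V powr (p - 1)" and ?g = "bessel s (distr_of (inv_fourier a))"
  have Ja: "(\<lambda>\<xi>. ?J \<xi> * a \<xi>) \<in> schwartz" by (rule tame_mult_schwartz[OF csmooth_bessel_symbol a])
  have g: "?g = distr_of (inv_fourier (\<lambda>\<xi>. ?J \<xi> * a \<xi>))"
    unfolding bessel_def by (rule multiplier_distr_of_inv_fourier[OF csmooth_bessel_symbol a])
  have mg: "multiplier m ?g = distr_of (inv_fourier (\<lambda>\<xi>. m \<xi> * (?J \<xi> * a \<xi>)))" if "csmooth tame m" for m
    unfolding g by (rule multiplier_distr_of_inv_fourier[OF that Ja])
  have mS: "inv_fourier (\<lambda>\<xi>. m \<xi> * (?J \<xi> * a \<xi>)) \<in> schwartz" if "csmooth tame m" for m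
    by (intro inv_fourier_schwartz tame_mult_schwartz[OF that] Ja)
  have q0: "(\<lambda>\<xi>. q \<xi> * (?J \<xi> * a \<xi>)) = (\<lambda>\<xi>. 0)"
  proof
    fix \<xi> show "q \<xi> * (?J \<xi> * a \<xi>) = 0" using q(2)[of \<xi>] by auto
  qed
  have qg: "Lp_norm p (multiplier q ?g) = 0"
  proof -
    have "Lp_norm p (multiplier q ?g) \<le> epowr (ennreal 0) (1 / p)"
      unfolding mg[OF q(1)]
    proof (rule Lp_norm_distr_of_le[OF mS[OF q(1)]])
      show "(\<integral>\<^sup>+x. ennreal (norm (inv_fourier (\<lambda>\<xi>. q \<xi> * (?J \<xi> * a \<xi>)) x) powr p) \<partial>lborel) \<le> ennreal 0"
        unfolding q0 by (simp add: inv_fourier_def)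
    qed (use p in auto)
    then show ?thesis by (simp add: epowr_def)
  qed
  have pk: "Lp_norm p (multiplier (packet_symbol \<theta> \<Psi> \<omega>) ?g) \<le> epowr (ennreal ?K) (1 / p)" if \<omega>: "norm \<omega> = 1" for \<omega>
    unfolding mg[OF tame[OF \<omega>]]
  proof (rule Lp_norm_distr_of_le[OF mS[OF tame[OF \<omega>]]])
    show "(\<integral>\<^sup>+x. ennreal (norm (inv_fourier (\<lambda>\<xi>. packet_symbol \<theta> \<Psi> \<omega> \<xi> * (?J \<xi> * a \<xi>)) x) powr p) \<partial>lborel) \<le> ennreal ?K"
    proof (rule nn_integral_powr_inv_fourier_le[OF _ p B(1) B(2)[OF \<omega>] V(2)[OF \<omega>] V(3)[OF \<omega>] V(1)])
      show "(\<lambda>\<xi>. packet_symbol \<theta> \<Psi> \<omega> \<xi> * (?J \<xi> * a \<xi>)) \<in> schwartz"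
        by (rule tame_mult_schwartz[OF tame[OF \<omega>] Ja])
      show "packet_symbol \<theta> \<Psi> \<omega> \<xi> * (?J \<xi> * a \<xi>) = 0" if "\<xi> \<notin> A \<omega>" for \<xi>
        using supp[OF \<omega> that] by auto
    qed
  qed (use p in auto)
  have fin: "epowr (ennreal ?K) (1 / p) < \<infinity>" by (simp add: epowr_def)
  have I: "(\<integral>\<^sup>+\<omega>. epowr (Lp_norm p (multiplier (packet_symbol \<theta> \<Psi> \<omega>) ?g)) p \<partial>sphere_measure) \<le> ennreal ?K"
  proof -
    have "(\<integral>\<^sup>+\<omega>. epowr (Lp_norm p (multiplier (packet_symbol \<theta> \<Psi> \<omega>) ?g)) p \<partial>sphere_measure)
      \<le> (\<integral>\<^sup>+\<omega>. ennreal ?K \<partial>(sphere_measure :: 'a measure))"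
    proof (rule nn_integral_mono_AE)
      show "AE \<omega> in sphere_measure. epowr (Lp_norm p (multiplier (packet_symbol \<theta> \<Psi> \<omega>) ?g)) p \<le> ennreal ?K"
        using AE_sphere_measure_norm
      proof eventually_elim
        fix \<omega> :: 'a assume "norm \<omega> = 1"
        from epowr_mono[OF pk[OF this], of p] show "epowr (Lp_norm p (multiplier (packet_symbol \<theta> \<Psi> \<omega>) ?g)) p \<le> ennreal ?K"
          using p by (simp add: epowr_epowr)
      qed
    qed
    also have "\<dots> = ennreal ?K" by (simp add: sphere.emeasure_space_1)
    finally show ?thesis .
  qed
  have N: "HpFIO_norm \<theta> \<Psi> q p ?g = epowr (\<integral>\<^sup>+\<omega>. epowr (Lp_norm p (multiplier (packet_symbol \<theta> \<Psi> \<omega>) ?g)) p \<partial>sphere_measure) (1 / p)"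
    by (simp add: HpFIO_norm_def qg)
  show "epowr (HspFIO_norm \<theta> \<Psi> q s p (distr_of (inv_fourier a))) p \<le> ennreal ?K"
    unfolding HspFIO_norm_def N using I p by (subst epowr_epowr) auto
  show "distr_of (inv_fourier a) \<in> HspFIO \<theta> \<Psi> q s p"
    unfolding HspFIO_def HpFIO_def mem_Collect_eq
  proof (intro conjI)
    show "distr_of (inv_fourier a) \<in> tempered" by (intro distr_of_tempered inv_fourier_schwartz a)
    show "?g \<in> tempered" unfolding g by (intro distr_of_tempered inv_fourier_schwartz Ja)
    show "multiplier q ?g \<in> Lp p"
      unfolding Lp_def using qg mS[OF q(1)] by (auto simp: mg[OF q(1)] intro: distr_of_tempered)
    show "AE \<omega> in sphere_measure. multiplier (packet_symbol \<theta> \<Psi> \<omega>) ?g \<in> Lp p"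
      using AE_sphere_measure_norm
    proof eventually_elim
      fix \<omega> :: 'a assume \<omega>: "norm \<omega> = 1"
      have "Lp_norm p (multiplier (packet_symbol \<theta> \<Psi> \<omega>) ?g) < \<infinity>" using pk[OF \<omega>] fin by (rule le_less_trans)
      then show "multiplier (packet_symbol \<theta> \<Psi> \<omega>) ?g \<in> Lp p"
        unfolding Lp_def using mS[OF tame[OF \<omega>]] by (auto simp: mg[OF tame[OF \<omega>]] intro: distr_of_tempered)
    qed
    have "epowr (\<integral>\<^sup>+\<omega>. epowr (Lp_norm p (multiplier (packet_symbol \<theta> \<Psi> \<omega>) ?g)) p \<partial>sphere_measure) (1 / p) \<le> epowr (ennreal ?K) (1 / p)"
      using I p by (intro epowr_mono) auto
    then show "HpFIO_norm \<theta> \<Psi> q p ?g < \<infinity>" unfolding N using fin by (rule le_less_trans)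
  qed
qed

section \<open>The symbols of the wave packet transform\<close>

lemma FIO_cutoffsD:
  assumes "FIO_cutoffs \<theta> \<Psi> q"
  shows "test_fun \<theta>" "\<And>\<xi>. 0 \<le> \<theta> \<xi>" "\<And>\<xi>. 1 < norm \<xi> \<Longrightarrow> \<theta> \<xi> = 0" "\<forall>\<^sub>F \<xi> in nhds 0. \<theta> \<xi> = 1"
    "test_fun \<Psi>" "\<And>\<xi>. 0 \<le> \<Psi> \<xi>" "\<And>\<xi>. norm \<xi> \<notin> {1/2..2} \<Longrightarrow> \<Psi> \<xi> = 0" "test_fun q"
  using assms unfolding FIO_cutoffs_def by blast+

lemma test_fun_measurable: "test_fun f \<Longrightarrow> f \<in> borel_measurable borel"
  by (rule csmooth_measurable[OF test_fun_csmooth])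

lemma test_fun_bounded:
  assumes "test_fun f" obtains B where "0 < B" "\<And>x. norm (f x) \<le> B"
proof -
  have "controlled {()} UNIV rapid (\<lambda>_. f)" by (rule csmooth_controlled[OF test_fun_csmooth[OF assms]])
  then obtain C where C: "\<And>x. (1 + norm x) ^ 0 * norm (f x) \<le> C" unfolding controlled_rapid_iff by blast
  show ?thesis
  proof (rule that[of "max C 1"])
    show "norm (f x) \<le> max C 1" for x using C[of x] by simp
  qed simp
qed

lemma e1_Basis: "(e1 :: 'a::euclidean_space) \<in> Basis"
  unfolding e1_def using nonempty_Basis by (rule someI_ex[OF ex_in_conv[THEN iffD2]])

text \<open>The vector \<open>x = norm x * sgn x\<close> differs from \<open>(x \<bullet> u) *\<^sub>R u\<close> by its component orthogonal to
\<open>u\<close>, and \<open>norm x\<close> differs from \<open>x \<bullet> u\<close> by at most the length of this component.\<close>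

lemma norm_sgn_minus_le:
  assumes u: "norm u = 1" and x: "0 < x \<bullet> u"
  shows "norm (sgn x - u) \<le> 2 * norm (x - (x \<bullet> u) *\<^sub>R u) / norm x"
proof -
  let ?y = "x - (x \<bullet> u) *\<^sub>R u"
  have x0: "0 < norm x" using x by auto
  have "\<bar>norm x - norm ((x \<bullet> u) *\<^sub>R u)\<bar> \<le> norm ?y" by (rule norm_triangle_ineq3)
  then have 1: "norm (((x \<bullet> u) - norm x) *\<^sub>R u) \<le> norm ?y" using u x by (simp add: abs_minus_commute)
  have "norm x *\<^sub>R (sgn x - u) = ?y + ((x \<bullet> u) - norm x) *\<^sub>R u"
    using x0 by (simp add: sgn_div_norm algebra_simps)
  then have "norm x * norm (sgn x - u) \<le> norm ?y + norm ?y"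
    using norm_triangle_ineq[of ?y "((x \<bullet> u) - norm x) *\<^sub>R u"] 1
    by (metis abs_norm_cancel add_left_mono norm_scaleR order_trans)
  then show ?thesis using x0 by (simp add: pos_le_divide_eq mult.commute)
qed

section \<open>The angular normalisation\<close>

text \<open>The measure of a cap is the proportion of the unit ball that projects into it. This part contains a box
around a segment of the axis, of fixed length and with the other sides proportional to \<open>r\<close>, whose
volume is explicit.\<close>

lemma sphere_measure_cap_ge:
  obtains k where "0 < k"
    "\<And>r. 0 < r \<Longrightarrow> r \<le> 1 \<Longrightarrow> k * r ^ (DIM('a) - 1) \<le> measure sphere_measure (ball (e1 :: 'a::euclidean_space) r)"
proof -
  let ?n = "DIM('a)" and ?v = "measure lborel (ball 0 1 :: 'a set)"
  define k where "k = (1/4) * (1 / (8 * real ?n)) ^ (?n - 1) / ?v"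
  have v: "0 < ?v" by (rule content_ball_pos) simp
  let ?e = "e1 :: 'a"
  have E: "?e \<in> Basis" by (rule e1_Basis)
  have nE: "norm ?e = 1" by (rule norm_Basis[OF E])
  have "0 < k" unfolding k_def using v by simp
  moreover have "k * r ^ (?n - 1) \<le> measure sphere_measure (ball ?e r)" if r: "0 < r" "r \<le> 1" for r
  proof -
    (* Half the width of the box across the axis. The box reaches from 1/4 to 1/2 along the axis; the distance
       of its points from the axis is at most n times the half width, that is r/16. *)
    define \<rho> where "\<rho> = r / (16 * real ?n)"
    have \<rho>: "0 < \<rho>" unfolding \<rho>_def using r by simp
    define l where "l = (\<Sum>b\<in>Basis. (if b = ?e then 1/4 else - \<rho>) *\<^sub>R b)"
    define u where "u = (\<Sum>b\<in>Basis. (if b = ?e then 1/2 else \<rho>) *\<^sub>R b)"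
    have l: "l \<bullet> b = (if b = ?e then 1/4 else - \<rho>)" if "b \<in> Basis" for b
      unfolding l_def using that by (simp add: inner_sum_left_Basis)
    have u: "u \<bullet> b = (if b = ?e then 1/2 else \<rho>)" if "b \<in> Basis" for b
      unfolding u_def using that by (simp add: inner_sum_left_Basis)
    have sub: "box l u \<subseteq> ball 0 1 \<inter> sgn -` ball ?e r"
    proof
      fix x assume x: "x \<in> box l u"
      have xb: "\<bar>x \<bullet> b\<bar> \<le> \<rho>" if "b \<in> Basis" "b \<noteq> ?e" for b
        using x l[OF that(1)] u[OF that(1)] that by (auto simp: mem_box abs_le_iff)
      have xe: "1/4 < x \<bullet> ?e" "x \<bullet> ?e < 1/2"
        using x l[OF E] u[OF E] E by (auto simp: mem_box)
      let ?y = "x - (x \<bullet> ?e) *\<^sub>R ?e"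
      have "norm ?y \<le> (\<Sum>b\<in>Basis. \<bar>?y \<bullet> b\<bar>)" by (rule norm_le_l1)
      also have "\<dots> \<le> (\<Sum>b\<in>(Basis::'a set). \<rho>)"
      proof (rule sum_mono)
        fix b :: 'a assume b: "b \<in> Basis"
        show "\<bar>?y \<bullet> b\<bar> \<le> \<rho>"
          using xb[OF b] b E \<rho> inner_not_same_Basis[OF E b]
          by (cases "b = ?e") (auto simp: inner_diff_left)
      qed
      also have "\<dots> = r / 16" unfolding \<rho>_def by simp
      finally have y: "norm ?y \<le> r / 16" .
      have "norm x \<le> norm ?y + norm ((x \<bullet> ?e) *\<^sub>R ?e)"
        using norm_triangle_ineq[of ?y "(x \<bullet> ?e) *\<^sub>R ?e"] by simp
      also have "\<dots> \<le> r / 16 + 1/2" using y xe nE by (intro add_mono) auto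
      finally have "norm x < 1" using r by simp
      moreover have "1/4 \<le> norm x"
        using xe Basis_le_norm[OF E, of x] by linarith
      moreover have "norm (sgn x - ?e) \<le> 2 * norm ?y / norm x"
        by (rule norm_sgn_minus_le) (use xe nE in auto)
      moreover have "2 * norm ?y / norm x \<le> 2 * (r / 16) / (1/4)"
        using y r \<open>1/4 \<le> norm x\<close> by (intro frac_le) auto
      ultimately show "x \<in> ball 0 1 \<inter> sgn -` ball ?e r"
        using r by (auto simp: dist_norm norm_minus_commute)
    qed
    have "emeasure lborel (box l u) = ennreal (\<Prod>b\<in>Basis. (u - l) \<bullet> b)"
      using \<rho> by (subst emeasure_lborel_box) (auto simp: l u)
    also have "(\<Prod>b\<in>Basis. (u - l) \<bullet> b) = (\<Prod>b\<in>(Basis::'a set). if b = ?e then 1/4 else 2 * \<rho>)"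
      by (intro prod.cong) (auto simp: l u inner_diff_left)
    also have "\<dots> = 1/4 * (2 * \<rho>) ^ (?n - 1)"
    proof -
      have "(\<Prod>b\<in>(Basis::'a set). if b = ?e then 1/4 else 2 * \<rho>)
        = (if ?e = ?e then 1/4 else 2 * \<rho>) * (\<Prod>b\<in>Basis - {?e}. if b = ?e then 1/4 else 2 * \<rho>)"
        by (rule prod.remove) (auto simp: E)
      also have "(\<Prod>b\<in>Basis - {?e}. if b = ?e then 1/4 else 2 * \<rho>) = (\<Prod>b\<in>Basis - {?e}. 2 * \<rho>)"
        by (intro prod.cong) auto
      also have "\<dots> = (2 * \<rho>) ^ (?n - 1)"
        unfolding prod_constant using E by (subst card_Diff_singleton) auto
      finally show ?thesis by simp
    qed
    finally have eb: "emeasure lborel (box l u) = ennreal (1/4 * (2 * \<rho>) ^ (?n - 1))" .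
    have ms: "sgn -` ball ?e r \<in> sets (borel :: 'a measure)"
      using measurable_sets[OF borel_measurable_sgn_euclidean, of "ball ?e r"] by simp
    have "emeasure sphere_measure (ball ?e r) = emeasure lborel (ball 0 1 \<inter> sgn -` ball ?e r) / emeasure lborel (ball 0 1 :: 'a set)"
      unfolding sphere_measure_def
      by (subst emeasure_distr) (use ms in \<open>auto simp: emeasure_uniform_measure\<close>)
    also have "\<dots> \<ge> ennreal (1/4 * (2 * \<rho>) ^ (?n - 1)) / emeasure lborel (ball 0 1 :: 'a set)"
      unfolding eb[symmetric] by (intro divide_right_mono_ennreal emeasure_mono sub) (use ms in auto)
    finally have "ennreal (1/4 * (2 * \<rho>) ^ (?n - 1)) / ennreal ?v \<le> emeasure sphere_measure (ball ?e r)"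
      using emeasure_unit_ball(2)[where 'a='a] by (simp add: emeasure_eq_ennreal_measure)
    then have "1/4 * (2 * \<rho>) ^ (?n - 1) / ?v \<le> measure sphere_measure (ball ?e r)"
      using v \<rho> by (simp add: divide_ennreal sphere.emeasure_eq_measure)
    moreover have "2 * \<rho> = 1 / (8 * real ?n) * r" unfolding \<rho>_def by simp
    ultimately show ?thesis unfolding k_def by (simp only: power_mult_distrib) (simp add: mult_ac)
  qed
  ultimately show ?thesis by (rule that)
qed

text \<open>\<open>\<theta>\<close> equals 1 on a small ball, so the integral in the normalisation is at least the measure of a
cap of radius comparable to \<open>sqrt \<sigma>\<close>, which is a multiple of \<open>\<sigma> powr ((n - 1) / 2)\<close>.\<close>

lemma angular_const_le:
  assumes F: "FIO_cutoffs \<theta> \<Psi> (q :: 'a::euclidean_space \<Rightarrow> complex)"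
  obtains C where "0 < C"
    "\<And>\<sigma>. 0 < \<sigma> \<Longrightarrow> \<sigma> < 4 \<Longrightarrow> angular_const \<theta> \<sigma> \<le> C * \<sigma> powr (- ((real DIM('a) - 1) / 4))"
proof -
  let ?n = "DIM('a)"
  from FIO_cutoffsD(4)[OF F] obtain \<delta>0 where \<delta>0: "0 < \<delta>0" "\<And>\<xi>. dist \<xi> 0 < \<delta>0 \<Longrightarrow> \<theta> \<xi> = 1"
    unfolding eventually_nhds_metric by blast
  (* At most 1/2, so that the radius \<delta> * sqrt \<sigma> is below 1 for all scales \<sigma> < 4. *)
  define \<delta> where "\<delta> = min \<delta>0 (1/2)"
  have \<delta>: "0 < \<delta>" "\<delta> \<le> 1/2" "\<And>\<xi>. norm \<xi> < \<delta> \<Longrightarrow> \<theta> \<xi> = 1"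
    using \<delta>0 by (auto simp: \<delta>_def)
  obtain k where k: "0 < k" "\<And>r. 0 < r \<Longrightarrow> r \<le> 1 \<Longrightarrow> k * r ^ (?n - 1) \<le> measure sphere_measure (ball (e1 :: 'a) r)"
    using sphere_measure_cap_ge[where 'a='a] by blast
  have meas[measurable]: "\<theta> \<in> borel_measurable borel" by (rule test_fun_measurable[OF FIO_cutoffsD(1)[OF F]])
  obtain B where B: "0 < B" "\<And>x. norm (\<theta> x) \<le> B" using test_fun_bounded[OF FIO_cutoffsD(1)[OF F]] by blast
  define C where "C = (k * \<delta> ^ (?n - 1)) powr (- 1 / 2)"
  have k\<delta>: "0 < k * \<delta> ^ (?n - 1)" using k \<delta> by simp
  have "angular_const \<theta> \<sigma> \<le> C * \<sigma> powr (- ((real ?n - 1) / 4))" if \<sigma>: "0 < \<sigma>" "\<sigma> < 4" for \<sigma>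
  proof -
    define r where "r = \<delta> * sqrt \<sigma>"
    have "sqrt \<sigma> < 2" using real_sqrt_less_mono[OF \<sigma>(2)] by simp
    then have r: "0 < r" "r \<le> 1" unfolding r_def using \<delta> \<sigma> mult_mono[of \<delta> "1/2" "sqrt \<sigma>" 2] by auto
    let ?f = "\<lambda>\<nu>::'a. (\<theta> ((e1 - \<nu>) /\<^sub>R sqrt \<sigma>))\<^sup>2"
    have "k * r ^ (?n - 1) \<le> measure sphere_measure (ball (e1 :: 'a) r)" by (rule k(2)[OF r])
    also have "\<dots> = (LINT \<nu>|sphere_measure. indicator (ball (e1 :: 'a) r) \<nu>)" by simp
    also have "\<dots> \<le> (LINT \<nu>|sphere_measure. ?f \<nu>)"
    proof (rule Bochner_Integration.integral_mono)
      show "integrable sphere_measure (indicat_real (ball (e1 :: 'a) r))"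
        by (intro integrable_real_indicator) (simp_all add: less_top[symmetric])
      show "integrable sphere_measure ?f"
      proof (rule sphere.integrable_const_bound[where B="B\<^sup>2"])
        have "?f \<nu> \<le> B\<^sup>2" for \<nu>
          using B(2)[of "(e1 - \<nu>) /\<^sub>R sqrt \<sigma>"] B(1) by (simp add: abs_le_square_iff[symmetric])
        then show "AE \<nu> in sphere_measure. norm (?f \<nu>) \<le> B\<^sup>2" by simp
      qed measurable
      fix \<nu> :: 'a
      show "indicat_real (ball e1 r) \<nu> \<le> ?f \<nu>"
      proof (cases "\<nu> \<in> ball e1 r")
        case True
        then have "norm ((e1 - \<nu>) /\<^sub>R sqrt \<sigma>) < \<delta>"
        proof -
          have "norm ((e1 - \<nu>) /\<^sub>R sqrt \<sigma>) = norm (e1 - \<nu>) / sqrt \<sigma>"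
            using \<sigma> by (simp add: divide_inverse mult.commute)
          also have "\<dots> < \<delta>"
            using True \<sigma> by (subst pos_divide_less_eq) (simp_all add: dist_norm r_def)
          finally show ?thesis .
        qed
        then show ?thesis using \<delta>(3) True by simp
      qed simp
    qed
    finally have le: "k * r ^ (?n - 1) \<le> (LINT \<nu>|sphere_measure. ?f \<nu>)" .
    have n1: "real (?n - 1) = real ?n - 1" using DIM_positive[where 'a='a] by (simp add: of_nat_diff)
    have "r ^ (?n - 1) = \<delta> ^ (?n - 1) * \<sigma> powr ((real ?n - 1) / 2)"
    proof -
      have "sqrt \<sigma> ^ (?n - 1) = sqrt \<sigma> powr real (?n - 1)"
        by (rule powr_realpow[symmetric]) (use \<sigma> in simp)
      moreover have sq: "sqrt \<sigma> = \<sigma> powr (1/2)" using \<sigma> by (simp add: powr_half_sqrt)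
      have "sqrt \<sigma> powr real (?n - 1) = \<sigma> powr ((real ?n - 1) / 2)"
        unfolding sq powr_powr n1 by simp
      ultimately have "sqrt \<sigma> ^ (?n - 1) = \<sigma> powr ((real ?n - 1) / 2)" by (rule trans)
      then show ?thesis unfolding r_def power_mult_distrib by simp
    qed
    then have eq: "k * r ^ (?n - 1) = (k * \<delta> ^ (?n - 1)) * \<sigma> powr ((real ?n - 1) / 2)" by simp
    have "angular_const \<theta> \<sigma> \<le> (k * r ^ (?n - 1)) powr (- 1 / 2)"
      unfolding angular_const_def by (rule powr_mono2'[OF _ _ le]) (use k r in auto)
    also have "\<dots> = C * \<sigma> powr (- ((real ?n - 1) / 4))"
    proof -
      have "(K * S) powr (- 1 / 2) = K powr (- 1 / 2) * S powr (- 1 / 2)" if "0 < K" "0 < S" for K S :: real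
        using that by (simp add: powr_mult)
      moreover have "0 < \<sigma> powr ((real ?n - 1) / 2)" using \<sigma> by simp
      ultimately have "((k * \<delta> ^ (?n - 1)) * \<sigma> powr ((real ?n - 1) / 2)) powr (- 1 / 2)
          = C * (\<sigma> powr ((real ?n - 1) / 2)) powr (- 1 / 2)"
        unfolding C_def using k\<delta> by blast
      moreover have "(real ?n - 1) / 2 * (- 1 / 2) = - ((real ?n - 1) / 4)" by simp
      ultimately show ?thesis unfolding eq powr_powr by (simp only:)
    qed
    finally show ?thesis .
  qed
  moreover have "0 < C" unfolding C_def powr_gt_zero using k\<delta> by (metis less_irrefl)
  ultimately show ?thesis using that by blast
qed

lemma angular_const_nonneg: "0 \<le> angular_const \<theta> \<sigma>"
  by (simp add: angular_const_def)

lemma angular_const_measurable: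
  assumes [measurable]: "\<theta> \<in> borel_measurable borel"
  shows "angular_const \<theta> \<in> borel_measurable borel"
proof -
  have "(\<lambda>\<sigma>. LINT \<nu>|sphere_measure. (\<theta> ((e1 - \<nu>) /\<^sub>R sqrt \<sigma>))\<^sup>2) \<in> borel_measurable borel"
    by (rule sphere.borel_measurable_lebesgue_integral) measurable
  note this [measurable]
  show ?thesis unfolding angular_const_def[abs_def] by measurable
qed

section \<open>Regularity, support and size of the packet symbols\<close>

text \<open>The integrand of the packet symbol is a family of functions of \<open>\<xi>\<close>, indexed by the scale
\<open>\<sigma>\<close>. Its derivatives grow polynomially both in \<open>1 / \<sigma>\<close> and in \<open>\<xi>\<close>, and this weight
records both.\<close>

definition scale_weight :: "real \<Rightarrow> 'a::real_normed_vector \<Rightarrow> real" where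
  "scale_weight \<sigma> \<xi> = (1 + 1 / \<bar>\<sigma>\<bar>) * (1 + norm \<xi>)"

text \<open>For \<open>\<sigma> < 4\<close> the factor \<open>\<Psi> (\<sigma> \<xi>)\<close> vanishes unless \<open>norm \<xi> \<ge> 1/8\<close>. The radius
\<open>1/16\<close> is smaller, so the region with singular behaviour at the origin is covered by an open set on
which the integrand vanishes.\<close>

abbreviation "scales \<equiv> {0<..<4::real}"
abbreviation "off_origin \<equiv> {\<xi>::'a::euclidean_space. 1/16 < norm \<xi>}"

text \<open>The class on which differentiation under the integral over the scales can be iterated. Where a member
does not vanish, \<open>1 / \<sigma> \<le> 2 * norm \<xi>\<close>, so negative powers of the scale turn into polynomial
growth in \<open>\<xi>\<close>.\<close>

definition packet_family :: "(real \<Rightarrow> 'a::euclidean_space \<Rightarrow> real) \<Rightarrow> bool" where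
  "packet_family H \<longleftrightarrow> (\<forall>k. Ck_family scales off_origin (powers scale_weight) k H) \<and>
    (\<forall>\<sigma>\<in>scales. \<forall>\<xi>. \<sigma> * norm \<xi> < 1/2 \<longrightarrow> H \<sigma> \<xi> = 0) \<and>
    (\<forall>\<xi>. (\<lambda>\<sigma>. H \<sigma> \<xi>) \<in> borel_measurable (restrict_space lborel scales))"

lemma scale_weight_ge_1: "1 \<le> scale_weight \<sigma> \<xi>"
proof -
  have "1 * 1 \<le> (1 + 1 / \<bar>\<sigma>\<bar>) * (1 + norm \<xi>)" by (intro mult_mono) auto
  then show ?thesis by (simp add: scale_weight_def)
qed

lemma open_off_origin: "open (off_origin :: 'a::euclidean_space set)"
  by (intro open_Collect_less continuous_intros)

lemma scale_controlled_bounded: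
  assumes "controlled scales off_origin (powers scale_weight) H"
    and vanish: "\<And>\<sigma> \<xi>. \<sigma> \<in> scales \<Longrightarrow> \<sigma> * norm \<xi> < 1/2 \<Longrightarrow> H \<sigma> \<xi> = 0"
  obtains C N where "0 \<le> C" "\<And>\<sigma> \<xi>. \<sigma> \<in> scales \<Longrightarrow> \<bar>H \<sigma> \<xi>\<bar> \<le> C * (1 + norm \<xi>) ^ N"
proof -
  obtain C N where C: "0 \<le> C"
    "\<And>\<sigma> \<xi>. \<sigma> \<in> scales \<Longrightarrow> \<xi> \<in> off_origin \<Longrightarrow> norm (H \<sigma> \<xi>) \<le> C * scale_weight \<sigma> \<xi> ^ N"
    using controlled_powersE[OF assms(1)] by blast
  have "\<bar>H \<sigma> \<xi>\<bar> \<le> (C * 2 ^ N) * (1 + norm \<xi>) ^ (2 * N)" if \<sigma>: "\<sigma> \<in> scales" for \<sigma> \<xi>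
  proof (cases "\<sigma> * norm \<xi> < 1/2")
    case True
    then have "H \<sigma> \<xi> = 0" using vanish \<sigma> by blast
    then show ?thesis using C(1) by simp
  next
    case False
    have s: "0 < \<sigma>" "\<sigma> < 4" using \<sigma> by auto
    have "1/2 \<le> 4 * norm \<xi>" using False s mult_right_mono[of \<sigma> 4 "norm \<xi>"] by simp
    then have off: "\<xi> \<in> off_origin" by simp
    have "1 / \<sigma> \<le> 2 * norm \<xi>" using False s by (simp add: pos_divide_le_eq mult_ac)
    then have "scale_weight \<sigma> \<xi> \<le> (2 * (1 + norm \<xi>)) * (1 + norm \<xi>)"
      unfolding scale_weight_def using s by (intro mult_right_mono) auto
    also have "\<dots> = 2 * (1 + norm \<xi>)\<^sup>2" by (simp add: power2_eq_square)
    finally have "scale_weight \<sigma> \<xi> ^ N \<le> (2 * (1 + norm \<xi>)\<^sup>2) ^ N"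
      using scale_weight_ge_1[of \<sigma> \<xi>] by (intro power_mono) auto
    then have "C * scale_weight \<sigma> \<xi> ^ N \<le> C * (2 * (1 + norm \<xi>)\<^sup>2) ^ N"
      using C(1) by (rule mult_left_mono)
    with C(2)[OF \<sigma> off] show ?thesis by (simp add: power_mult_distrib power_mult mult.assoc)
  qed
  then show ?thesis using C(1) that[of "C * 2 ^ N" "2 * N"] by simp
qed

lemma packet_family_bounded:
  assumes "packet_family H"
  obtains C N where "0 \<le> C" "\<And>\<sigma> \<xi>. \<sigma> \<in> scales \<Longrightarrow> \<bar>H \<sigma> \<xi>\<bar> \<le> C * (1 + norm \<xi>) ^ N"
proof (rule scale_controlled_bounded[of H])
  show "controlled scales off_origin (powers scale_weight) H"
    using assms unfolding packet_family_def by (meson Ck_family.simps(1))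
qed (use assms that in \<open>auto simp: packet_family_def\<close>)

interpretation scales: finite_measure "restrict_space lborel scales"
  by (rule finite_measureI) (simp add: emeasure_restrict_space)

lemma packet_family_integrable:
  assumes "packet_family H"
  shows "integrable (restrict_space lborel scales) (\<lambda>\<sigma>. H \<sigma> \<xi>)"
proof -
  obtain C N where C: "0 \<le> C" "\<And>\<sigma> \<xi>. \<sigma> \<in> scales \<Longrightarrow> \<bar>H \<sigma> \<xi>\<bar> \<le> C * (1 + norm \<xi>) ^ N"
    using packet_family_bounded[OF assms] by blast
  show ?thesis
    by (rule scales.integrable_const_bound[where B="C * (1 + norm \<xi>) ^ N"])
      (use C(2) assms in \<open>auto simp: packet_family_def space_restrict_space intro!: AE_I2\<close>)
qed

lemma packet_family_vanish:
  assumes "packet_family H" "\<sigma> \<in> scales" "\<sigma> * norm \<xi> < 1/2"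
  shows "(H \<sigma> has_derivative (\<lambda>_. 0)) (at \<xi>)"
proof (rule has_derivative_transform_within_open[of "\<lambda>_. 0" _ _ _ "{\<xi>. \<sigma> * norm \<xi> < 1/2}"])
  show "open {\<xi>::'a. \<sigma> * norm \<xi> < 1/2}" by (intro open_Collect_less continuous_intros)
qed (use assms in \<open>auto simp: packet_family_def\<close>)

text \<open>Near the origin the integrand vanishes for every scale below 4; away from it
  \<open>has_derivative_integral\<close> applies on a ball, where the derivatives are bounded uniformly in the scale.\<close>

lemma packet_family_integral_derivative:
  fixes H :: "real \<Rightarrow> 'a::euclidean_space \<Rightarrow> real"
  assumes H: "packet_family H"
  shows "((\<lambda>\<xi>. LINT \<sigma>|restrict_space lborel scales. H \<sigma> \<xi>) has_derivative
      (\<lambda>h. LINT \<sigma>|restrict_space lborel scales. frechet_derivative (H \<sigma>) (at \<xi>) h)) (at \<xi>)"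
    and "(\<lambda>\<sigma>. frechet_derivative (H \<sigma>) (at \<xi>) h) \<in> borel_measurable (restrict_space lborel scales)"
proof -
  let ?M = "restrict_space lborel scales"
  have sp: "space ?M = scales" by (simp add: space_restrict_space)
  have Ck: "Ck_family scales off_origin (powers scale_weight) (Suc 0) H"
    using H unfolding packet_family_def by blast
  have D: "(H \<sigma> has_derivative frechet_derivative (H \<sigma>) (at \<xi>)) (at \<xi>)" if "\<sigma> \<in> scales" "\<xi> \<in> off_origin" for \<sigma> \<xi>
    by (rule Ck_family_has_derivative[OF Ck that])
  have van: "frechet_derivative (H \<sigma>) (at \<xi>) = (\<lambda>_. 0)" if "\<sigma> \<in> scales" "\<sigma> * norm \<xi> < 1/2" for \<sigma> \<xi>
    using frechet_derivative_at[OF packet_family_vanish[OF H that]] by simp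
  have "\<exists>C N. 0 \<le> C \<and> (\<forall>\<sigma>\<in>scales. \<forall>\<xi>. \<bar>frechet_derivative (H \<sigma>) (at \<xi>) b\<bar> \<le> C * (1 + norm \<xi>) ^ N)"
    if b: "b \<in> Basis" for b
  proof -
    obtain C N where "0 \<le> C" "\<And>\<sigma> \<xi>. \<sigma> \<in> scales \<Longrightarrow> \<bar>frechet_derivative (H \<sigma>) (at \<xi>) b\<bar> \<le> C * (1 + norm \<xi>) ^ N"
    proof (rule scale_controlled_bounded[of "\<lambda>\<sigma> \<xi>. frechet_derivative (H \<sigma>) (at \<xi>) b"])
      show "controlled scales off_origin (powers scale_weight) (\<lambda>\<sigma> \<xi>. frechet_derivative (H \<sigma>) (at \<xi>) b)"
        using Ck b unfolding Ck_family.simps by blast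
    qed (use van in auto)
    then show ?thesis by blast
  qed
  then obtain C N where C: "\<And>b. b \<in> Basis \<Longrightarrow> 0 \<le> C b"
    "\<And>b \<sigma> \<xi>. b \<in> Basis \<Longrightarrow> \<sigma> \<in> scales \<Longrightarrow> \<bar>frechet_derivative (H \<sigma>) (at \<xi>) b\<bar> \<le> C b * (1 + norm \<xi>) ^ N b"
    by metis
  have "((\<lambda>\<xi>. LINT \<sigma>|?M. H \<sigma> \<xi>) has_derivative (\<lambda>h. LINT \<sigma>|?M. frechet_derivative (H \<sigma>) (at \<xi>) h)) (at \<xi>) \<and>
     (\<forall>h. (\<lambda>\<sigma>. frechet_derivative (H \<sigma>) (at \<xi>) h) \<in> borel_measurable ?M)"
  proof (cases "norm \<xi> < 1/8")
    case True
    have z: "\<sigma> * norm \<eta> < 1/2" if "\<sigma> \<in> scales" "norm \<eta> < 1/8" for \<sigma> and \<eta> :: 'a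
    proof -
      have "\<sigma> * norm \<eta> \<le> 4 * norm \<eta>" using that by (intro mult_right_mono) auto
      then show ?thesis using that by linarith
    qed
    have d0: "frechet_derivative (H \<sigma>) (at \<xi>) h = 0" if "\<sigma> \<in> scales" for \<sigma> h
      using van[OF that z[OF that True]] by simp
    have m: "(\<lambda>\<sigma>. frechet_derivative (H \<sigma>) (at \<xi>) h) \<in> borel_measurable ?M" for h
      by (rule measurable_cong[THEN iffD2, of _ _ "\<lambda>_. 0"]) (auto simp: sp d0)
    have i0: "(LINT \<sigma>|?M. frechet_derivative (H \<sigma>) (at \<xi>) h) = 0" for h
      by (rule integral_eq_zero_AE) (auto simp: sp d0 intro!: AE_I2)
    have "((\<lambda>\<xi>. LINT \<sigma>|?M. H \<sigma> \<xi>) has_derivative (\<lambda>_. 0)) (at \<xi>)"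
    proof (rule has_derivative_transform_within_open[of "\<lambda>_. 0" _ _ _ "ball 0 (1/8)"])
      fix \<eta> :: 'a assume "\<eta> \<in> ball 0 (1/8)"
      then have "H \<sigma> \<eta> = 0" if "\<sigma> \<in> scales" for \<sigma>
        using H z[OF that, of \<eta>] that unfolding packet_family_def by auto
      then show "0 = (LINT \<sigma>|?M. H \<sigma> \<eta>)"
        by (intro integral_eq_zero_AE[symmetric]) (auto simp: sp intro!: AE_I2)
    qed (use True in auto)
    then show ?thesis using m unfolding i0 by simp
  next
    case False
    then have off: "\<xi> \<in> off_origin" by simp
    then obtain e where e: "0 < e" "ball \<xi> e \<subseteq> off_origin" using open_off_origin openE by blast
    define S where "S = ball \<xi> (min e 1)"
    have S: "open S" "convex S" "\<xi> \<in> S" "S \<subseteq> off_origin" using e by (auto simp: S_def)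
    have nS: "1 + norm \<eta> \<le> 2 + norm \<xi>" if "\<eta> \<in> S" for \<eta>
      using that norm_triangle_ineq2[of \<eta> \<xi>] by (simp add: S_def dist_norm norm_minus_commute)
    define W where "W = (\<Sum>b\<in>Basis. C b * (2 + norm \<xi>) ^ N b)"
    have bound: "norm (frechet_derivative (H \<sigma>) (at \<eta>) h) \<le> W * norm h" if "\<sigma> \<in> space ?M" "\<eta> \<in> S" for \<sigma> \<eta> h
    proof -
      have lin: "linear (frechet_derivative (H \<sigma>) (at \<eta>))"
        using D[of \<sigma> \<eta>] that S sp by (auto intro: has_derivative_linear)
      have "frechet_derivative (H \<sigma>) (at \<eta>) h = frechet_derivative (H \<sigma>) (at \<eta>) (\<Sum>b\<in>Basis. (h \<bullet> b) *\<^sub>R b)"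
        by (simp add: euclidean_representation)
      also have "\<dots> = (\<Sum>b\<in>Basis. (h \<bullet> b) * frechet_derivative (H \<sigma>) (at \<eta>) b)"
        by (simp add: linear_sum[OF lin] linear_cmul[OF lin])
      finally have "norm (frechet_derivative (H \<sigma>) (at \<eta>) h) \<le> (\<Sum>b\<in>Basis. \<bar>(h \<bullet> b) * frechet_derivative (H \<sigma>) (at \<eta>) b\<bar>)"
        using sum_abs[of "\<lambda>b. (h \<bullet> b) * frechet_derivative (H \<sigma>) (at \<eta>) b" Basis] by simp
      also have "\<dots> \<le> (\<Sum>b\<in>Basis. norm h * (C b * (2 + norm \<xi>) ^ N b))"
      proof (rule sum_mono)
        fix b :: 'a assume b: "b \<in> Basis"
        have "\<bar>frechet_derivative (H \<sigma>) (at \<eta>) b\<bar> \<le> C b * (1 + norm \<eta>) ^ N b"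
          by (rule C(2)[OF b]) (use that sp in simp)
        also have "\<dots> \<le> C b * (2 + norm \<xi>) ^ N b"
          by (intro mult_left_mono power_mono nS that C b) simp
        finally show "\<bar>(h \<bullet> b) * frechet_derivative (H \<sigma>) (at \<eta>) b\<bar> \<le> norm h * (C b * (2 + norm \<xi>) ^ N b)"
          unfolding abs_mult by (intro mult_mono Basis_le_norm b) auto
      qed
      finally show ?thesis by (simp add: W_def sum_distrib_left[symmetric] mult.commute)
    qed
    have D': "(H \<sigma> has_derivative frechet_derivative (H \<sigma>) (at \<eta>)) (at \<eta>)" if "\<sigma> \<in> space ?M" "\<eta> \<in> S" for \<sigma> \<eta>
      using D[of \<sigma> \<eta>] that S sp by auto
    have iW: "integrable ?M (\<lambda>_. W)" by simp
    note L = has_derivative_integral[OF S(1,2,3) packet_family_integrable[OF H] D' bound iW]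
    show ?thesis using L by (auto intro: borel_measurable_integrable)
  qed
  then show "((\<lambda>\<xi>. LINT \<sigma>|?M. H \<sigma> \<xi>) has_derivative (\<lambda>h. LINT \<sigma>|?M. frechet_derivative (H \<sigma>) (at \<xi>) h)) (at \<xi>)"
    "(\<lambda>\<sigma>. frechet_derivative (H \<sigma>) (at \<xi>) h) \<in> borel_measurable ?M" by blast+
qed

lemma packet_family_derivative:
  assumes H: "packet_family H" and b: "b \<in> Basis"
  shows "packet_family (\<lambda>\<sigma> \<xi>. frechet_derivative (H \<sigma>) (at \<xi>) b)"
  unfolding packet_family_def
proof (intro conjI allI ballI impI)
  show "Ck_family scales off_origin (powers scale_weight) k (\<lambda>\<sigma> \<xi>. frechet_derivative (H \<sigma>) (at \<xi>) b)" for k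
  proof -
    have "Ck_family scales off_origin (powers scale_weight) (Suc k) H"
      using H unfolding packet_family_def by blast
    then show ?thesis using b unfolding Ck_family.simps by blast
  qed
  show "frechet_derivative (H \<sigma>) (at \<xi>) b = 0" if "\<sigma> \<in> scales" "\<sigma> * norm \<xi> < 1/2" for \<sigma> \<xi>
    by (simp add: frechet_derivative_at[OF packet_family_vanish[OF H that], symmetric])
qed (rule packet_family_integral_derivative(2)[OF H])

text \<open>The integrals of packet families are closed under partial derivatives and grow polynomially, as
\<open>csmooth_coinduct\<close> requires.\<close>

lemma packet_family_integral_tame:
  fixes H :: "real \<Rightarrow> 'a::euclidean_space \<Rightarrow> real"
  assumes "packet_family H"
  shows "csmooth tame (\<lambda>\<xi>. LINT \<sigma>|restrict_space lborel scales. H \<sigma> \<xi>)"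
proof (rule csmooth_coinduct[where X="(\<lambda>H \<xi>. LINT \<sigma>|restrict_space lborel scales. H \<sigma> \<xi>) ` Collect packet_family"])
  let ?M = "restrict_space lborel scales"
  show "(\<lambda>\<xi>. LINT \<sigma>|?M. H \<sigma> \<xi>) \<in> (\<lambda>H \<xi>. LINT \<sigma>|?M. H \<sigma> \<xi>) ` Collect packet_family"
    using assms by blast
  fix f :: "'a \<Rightarrow> real" assume "f \<in> (\<lambda>H \<xi>. LINT \<sigma>|?M. H \<sigma> \<xi>) ` Collect packet_family"
  then obtain G where G: "packet_family G" "f = (\<lambda>\<xi>. LINT \<sigma>|?M. G \<sigma> \<xi>)" by blast
  show "controlled {()} UNIV tame (\<lambda>_. f) \<and> (\<exists>f'. (\<forall>x. (f has_derivative f' x) (at x)) \<and>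
      (\<forall>b\<in>Basis. (\<lambda>x. f' x b) \<in> (\<lambda>H \<xi>. LINT \<sigma>|?M. H \<sigma> \<xi>) ` Collect packet_family))"
  proof (intro conjI exI allI ballI)
    obtain C N where C: "0 \<le> C" "\<And>\<sigma> \<xi>. \<sigma> \<in> scales \<Longrightarrow> \<bar>G \<sigma> \<xi>\<bar> \<le> C * (1 + norm \<xi>) ^ N"
      using packet_family_bounded[OF G(1)] by blast
    have "norm (f \<xi>) \<le> (4 * C) * (1 + norm \<xi>) ^ N" for \<xi>
    proof -
      have "norm (f \<xi>) \<le> (LINT \<sigma>|?M. norm (G \<sigma> \<xi>))"
        unfolding G(2) by (rule Bochner_Integration.integral_norm_bound)
      also have "\<dots> \<le> (LINT \<sigma>|?M. C * (1 + norm \<xi>) ^ N)"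
        by (rule Bochner_Integration.integral_mono[OF integrable_norm[OF packet_family_integrable[OF G(1)]]])
          (use C(2) in \<open>simp_all add: space_restrict_space\<close>)
      also have "\<dots> = (4 * C) * (1 + norm \<xi>) ^ N"
        by (simp add: measure_restrict_space space_restrict_space)
      finally show ?thesis .
    qed
    then show "controlled {()} UNIV tame (\<lambda>_. f)" using C(1) by (intro controlled_tameI[of "4 * C"]) auto
    show "(f has_derivative (\<lambda>h. LINT \<sigma>|?M. frechet_derivative (G \<sigma>) (at \<xi>) h)) (at \<xi>)" for \<xi>
      unfolding G(2) by (rule packet_family_integral_derivative(1)[OF G(1)])
    show "(\<lambda>\<xi>. LINT \<sigma>|?M. frechet_derivative (G \<sigma>) (at \<xi>) b) \<in> (\<lambda>H \<xi>. LINT \<sigma>|?M. H \<sigma> \<xi>) ` Collect packet_family"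
      if "b \<in> Basis" for b
      using packet_family_derivative[OF G(1) that]
      by (intro image_eqI[of _ _ "\<lambda>\<sigma> \<xi>. frechet_derivative (G \<sigma>) (at \<xi>) b"]) simp_all
  qed
qed

lemma Ck_family_scale_mult:
  fixes F G :: "real \<Rightarrow> 'a::euclidean_space \<Rightarrow> real"
  assumes "Ck_family scales off_origin (powers scale_weight) k F"
    "Ck_family scales off_origin (powers scale_weight) k G"
  shows "Ck_family scales off_origin (powers scale_weight) k (\<lambda>\<sigma> \<xi>. F \<sigma> \<xi> * G \<sigma> \<xi>)"
  by (rule Ck_family_moderate_mult[OF open_off_origin powers_cone[OF scale_weight_ge_1] _ _ assms]) simp_all

lemma Ck_family_coordinate:
  "Ck_family scales off_origin (powers scale_weight) k (\<lambda>\<sigma> \<xi>. (\<xi>::'a::euclidean_space) \<bullet> c)"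
proof -
  have 1: "norm (\<xi> \<bullet> c) \<le> norm c * scale_weight \<sigma> \<xi> ^ 1" for \<sigma> and \<xi> :: 'a
  proof -
    have "norm (\<xi> \<bullet> c) \<le> norm c * norm \<xi>" using Cauchy_Schwarz_ineq2[of \<xi> c] by (simp add: mult.commute)
    also have "\<dots> \<le> norm c * scale_weight \<sigma> \<xi>"
      unfolding scale_weight_def distrib_right by (intro mult_left_mono) (auto simp: add_increasing2)
    finally show ?thesis by simp
  qed
  have ctrl: "controlled scales off_origin (powers scale_weight) (\<lambda>\<sigma> \<xi>. (\<xi>::'a) \<bullet> c)"
    by (rule controlled_powersI[of "norm c" _ _ _ _ 1]) (use 1 scale_weight_ge_1 in auto)
  show ?thesis
  proof (cases k)
    case (Suc m)
    have "((\<lambda>\<xi>. \<xi> \<bullet> c) has_derivative (\<lambda>h. h \<bullet> c)) (at \<xi>)" for \<xi> :: 'a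
      by (auto intro!: derivative_eq_intros)
    moreover have "Ck_family scales off_origin (powers scale_weight) m (\<lambda>\<sigma> (\<xi>::'a). b \<bullet> c)" for b
      by (rule Ck_family_const[OF open_off_origin powers_cone[OF scale_weight_ge_1]])
        (rule controlled_powersI[of "\<bar>b \<bullet> c\<bar>" _ _ _ _ 0], auto simp: scale_weight_ge_1)
    ultimately show ?thesis unfolding Suc by (intro Ck_family_SucI[OF open_off_origin ctrl]) auto
  qed (use ctrl in simp)
qed

text \<open>Needed for \<open>r = - 1 / 2\<close>, that is for \<open>sgn\<close>; the exponents occurring in the derivatives
are smaller still, and away from the origin all these powers are bounded.\<close>

lemma Ck_family_inner_powr:
  assumes "r \<le> 0"
  shows "Ck_family scales off_origin (powers scale_weight) k (\<lambda>\<sigma> \<xi>. ((\<xi>::'a::euclidean_space) \<bullet> \<xi>) powr r)"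
  using assms
proof (induction k arbitrary: r)
  have ctrl: "controlled scales off_origin (powers scale_weight) (\<lambda>\<sigma> \<xi>. ((\<xi>::'a) \<bullet> \<xi>) powr r)" if r: "r \<le> 0" for r
  proof (rule controlled_powersI[of "(1/256) powr r" _ _ _ _ 0])
    fix \<xi> :: 'a assume "\<xi> \<in> off_origin"
    then have "(1/16)\<^sup>2 \<le> (norm \<xi>)\<^sup>2" by (intro power_mono) auto
    then have "1/256 \<le> \<xi> \<bullet> \<xi>" unfolding power2_norm_eq_inner by (simp add: power2_eq_square)
    then have "(\<xi> \<bullet> \<xi>) powr r \<le> (1/256) powr r" by (intro powr_mono2' r) auto
    then show "norm ((\<xi> \<bullet> \<xi>) powr r) \<le> (1/256) powr r * scale_weight \<sigma> \<xi> ^ 0" for \<sigma> by simp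
  qed (auto simp: scale_weight_ge_1)
  {
    case 0
    then show ?case using ctrl by simp
  next
    case (Suc k)
    show ?case
    proof (rule Ck_family_SucI[OF open_off_origin ctrl[OF Suc.prems], of "\<lambda>_ \<xi> h. (2 * r) * ((\<xi> \<bullet> h) * (\<xi> \<bullet> \<xi>) powr (r - 1))"])
      fix \<sigma> and \<xi> :: 'a assume "\<xi> \<in> off_origin"
      then have pos: "0 < \<xi> \<bullet> \<xi>" by auto
      have 1: "((\<lambda>\<xi>. \<xi> \<bullet> \<xi>) has_derivative (\<lambda>h. 2 * (\<xi> \<bullet> h))) (at \<xi>)"
        by (auto intro!: derivative_eq_intros simp: inner_commute)
      have "((\<lambda>y. y powr r) has_field_derivative r * (\<xi> \<bullet> \<xi>) powr (r - 1)) (at (\<xi> \<bullet> \<xi>))"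
        by (rule has_real_derivative_powr[OF pos])
      from has_derivative_compose[OF 1 this[unfolded has_field_derivative_def]]
      show "((\<lambda>\<xi>. (\<xi> \<bullet> \<xi>) powr r) has_derivative (\<lambda>h. (2 * r) * ((\<xi> \<bullet> h) * (\<xi> \<bullet> \<xi>) powr (r - 1)))) (at \<xi>)"
        by (simp add: mult_ac)
    next
      fix b :: 'a
      have "Ck_family scales off_origin (powers scale_weight) k (\<lambda>\<sigma> (\<xi>::'a). 2 * r)"
        by (rule Ck_family_const[OF open_off_origin powers_cone[OF scale_weight_ge_1]])
          (rule controlled_powersI[of "\<bar>2 * r\<bar>" _ _ _ _ 0], auto simp: scale_weight_ge_1)
      moreover have "Ck_family scales off_origin (powers scale_weight) k (\<lambda>\<sigma> \<xi>. (\<xi> \<bullet> b) * (\<xi> \<bullet> \<xi>) powr (r - 1))"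
        using Suc by (intro Ck_family_scale_mult Ck_family_coordinate) auto
      ultimately show "Ck_family scales off_origin (powers scale_weight) k (\<lambda>\<sigma> \<xi>. (2 * r) * ((\<xi> \<bullet> b) * (\<xi> \<bullet> \<xi>) powr (r - 1)))"
        by (rule Ck_family_scale_mult)
    qed
  }
qed

lemma Ck_family_scale_const:
  assumes "0 \<le> C" "\<And>\<sigma>. \<sigma> \<in> scales \<Longrightarrow> \<bar>g \<sigma>\<bar> \<le> C * (1 + 1 / \<sigma>) ^ N"
  shows "Ck_family scales off_origin (powers scale_weight) k (\<lambda>\<sigma> (\<xi>::'a::euclidean_space). g \<sigma>)"
proof (rule Ck_family_const[OF open_off_origin powers_cone[OF scale_weight_ge_1]], rule controlled_powersI[OF assms(1) scale_weight_ge_1])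
  fix \<sigma> and \<xi> :: 'a assume \<sigma>: "\<sigma> \<in> scales"
  have "(1 + 1 / \<sigma>) * 1 \<le> scale_weight \<sigma> \<xi>"
    unfolding scale_weight_def using \<sigma> by (intro mult_mono) auto
  then have "C * (1 + 1 / \<sigma>) ^ N \<le> C * scale_weight \<sigma> \<xi> ^ N"
    using \<sigma> assms(1) by (intro mult_left_mono power_mono) auto
  with assms(2)[OF \<sigma>] show "norm (g \<sigma>) \<le> C * scale_weight \<sigma> \<xi> ^ N" by simp
qed

text \<open>A composition of test functions with the moderate maps \<open>\<sigma> \<xi>\<close> and
\<open>(sgn \<xi> - \<omega>) / sqrt \<sigma>\<close>, times a power of \<open>1 / \<sigma>\<close>.\<close>

lemma packet_integrand_family:
  assumes F: "FIO_cutoffs \<theta> \<Psi> (q :: 'a::euclidean_space \<Rightarrow> complex)"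
  shows "packet_family (\<lambda>\<sigma> (\<xi>::'a). \<Psi> (\<sigma> *\<^sub>R \<xi>) * (angular_const \<theta> \<sigma> / \<sigma> * \<theta> ((sgn \<xi> - \<omega>) /\<^sub>R sqrt \<sigma>)))"
  unfolding packet_family_def
proof (intro conjI allI ballI impI)
  note mm = Ck_family_scale_mult
  have b1: "Ck_family {()} UNIV (powers (\<lambda>_ _. 1)) k (\<lambda>_. f)" if "test_fun f" for k and f :: "'a \<Rightarrow> real"
    using csmooth_weight_mono[OF test_fun_csmooth[OF that] rapid_subset_powers_1] unfolding csmooth_def by blast
  fix k
  show "Ck_family scales off_origin (powers scale_weight) k
     (\<lambda>\<sigma> (\<xi>::'a). \<Psi> (\<sigma> *\<^sub>R \<xi>) * (angular_const \<theta> \<sigma> / \<sigma> * \<theta> ((sgn \<xi> - \<omega>) /\<^sub>R sqrt \<sigma>)))"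
  proof (intro mm)
    show "Ck_family scales off_origin (powers scale_weight) k (\<lambda>\<sigma> (\<xi>::'a). \<Psi> (\<sigma> *\<^sub>R \<xi>))"
    proof (rule Ck_family_compose[OF open_off_origin scale_weight_ge_1 b1[OF FIO_cutoffsD(5)[OF F]]])
      fix c :: 'a
      have "Ck_family scales off_origin (powers scale_weight) k (\<lambda>\<sigma> (\<xi>::'a). \<sigma> * (\<xi> \<bullet> c))"
        by (rule mm[OF Ck_family_scale_const[of 4 _ 0] Ck_family_coordinate]) auto
      then show "Ck_family scales off_origin (powers scale_weight) k (\<lambda>\<sigma> (\<xi>::'a). (\<sigma> *\<^sub>R \<xi>) \<bullet> c)" by simp
    qed
    obtain C where C: "0 < C" "\<And>\<sigma>. 0 < \<sigma> \<Longrightarrow> \<sigma> < 4 \<Longrightarrow> angular_const \<theta> \<sigma> \<le> C * \<sigma> powr (- ((real DIM('a) - 1) / 4))"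
      using angular_const_le[OF F] by blast
    show "Ck_family scales off_origin (powers scale_weight) k (\<lambda>\<sigma> (\<xi>::'a). angular_const \<theta> \<sigma> / \<sigma>)"
    proof (rule Ck_family_scale_const[of C _ "DIM('a) + 1"])
      fix \<sigma> assume "\<sigma> \<in> scales"
      then have \<sigma>: "0 < \<sigma>" "\<sigma> < 4" by auto
      have "\<sigma> powr (- ((real DIM('a) - 1) / 4)) = (1 / \<sigma>) powr ((real DIM('a) - 1) / 4)"
        using \<sigma> by (simp add: powr_minus_divide powr_divide)
      also have "\<dots> \<le> (1 + 1 / \<sigma>) powr ((real DIM('a) - 1) / 4)"
        using \<sigma> DIM_positive[where 'a='a] by (intro powr_mono2) auto
      also have "\<dots> \<le> (1 + 1 / \<sigma>) powr real DIM('a)"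
        using \<sigma> DIM_positive[where 'a='a] by (intro powr_mono) auto
      also have "\<dots> = (1 + 1 / \<sigma>) ^ DIM('a)"
        by (rule powr_realpow) (use \<sigma> in \<open>simp add: add_pos_pos\<close>)
      finally have "angular_const \<theta> \<sigma> * (1 / \<sigma>) \<le> (C * (1 + 1 / \<sigma>) ^ DIM('a)) * (1 + 1 / \<sigma>)"
        using C(2)[OF \<sigma>] C(1) \<sigma> by (intro mult_mono) (auto intro: order_trans mult_left_mono)
      then show "\<bar>angular_const \<theta> \<sigma> / \<sigma>\<bar> \<le> C * (1 + 1 / \<sigma>) ^ (DIM('a) + 1)"
        using \<sigma> angular_const_nonneg[of \<theta> \<sigma>] by (simp add: mult_ac)
    qed (use C in simp)
    show "Ck_family scales off_origin (powers scale_weight) k (\<lambda>\<sigma> (\<xi>::'a). \<theta> ((sgn \<xi> - \<omega>) /\<^sub>R sqrt \<sigma>))"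
    proof (rule Ck_family_compose[OF open_off_origin scale_weight_ge_1 b1[OF FIO_cutoffsD(1)[OF F]]])
      fix c :: 'a
      have s: "Ck_family scales off_origin (powers scale_weight) k (\<lambda>\<sigma> (\<xi>::'a). 1 / sqrt \<sigma>)"
      proof (rule Ck_family_scale_const[of 1 _ 1])
        fix \<sigma> assume "\<sigma> \<in> scales"
        then have \<sigma>: "0 < \<sigma>" by auto
        have "1 / sqrt \<sigma> \<le> 1 + 1 / \<sigma>"
        proof -
          have "sqrt \<sigma> \<le> \<sigma> + 1"
            using zero_le_power2[of "sqrt \<sigma> - 1"] \<sigma> by (simp add: power2_diff)
          then have "sqrt \<sigma> / \<sigma> \<le> (\<sigma> + 1) / \<sigma>" using \<sigma> by (intro divide_right_mono) auto
          moreover have "sqrt \<sigma> / \<sigma> = 1 / sqrt \<sigma>" using \<sigma> by (simp add: field_simps)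
          ultimately show ?thesis using \<sigma> by (simp add: add_divide_distrib)
        qed
        then show "\<bar>1 / sqrt \<sigma>\<bar> \<le> 1 * (1 + 1 / \<sigma>) ^ 1" using \<sigma> by simp
      qed simp
      have "Ck_family scales off_origin (powers scale_weight) k (\<lambda>\<sigma> (\<xi>::'a). (1 / sqrt \<sigma>) * ((\<xi> \<bullet> \<xi>) powr (- 1 / 2) * (\<xi> \<bullet> c) + (- (\<omega> \<bullet> c))))"
        by (rule mm[OF s Ck_family_add[OF open_off_origin powers_cone[OF scale_weight_ge_1]
            mm[OF Ck_family_inner_powr Ck_family_coordinate] Ck_family_scale_const[of "\<bar>\<omega> \<bullet> c\<bar>" _ 0]]]) simp_all
      then show "Ck_family scales off_origin (powers scale_weight) k (\<lambda>\<sigma> (\<xi>::'a). ((sgn \<xi> - \<omega>) /\<^sub>R sqrt \<sigma>) \<bullet> c)"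
      proof (rule Ck_family_cong[OF open_off_origin, rotated])
        fix \<sigma> and \<xi> :: 'a assume "\<xi> \<in> off_origin"
        then have "0 < norm \<xi>" by auto
        then have pw: "(\<xi> \<bullet> \<xi>) powr (- 1 / 2) = 1 / norm \<xi>"
          by (simp add: powr_minus_divide norm_eq_sqrt_inner powr_half_sqrt)
        show "(1 / sqrt \<sigma>) * ((\<xi> \<bullet> \<xi>) powr (- 1 / 2) * (\<xi> \<bullet> c) + (- (\<omega> \<bullet> c))) = ((sgn \<xi> - \<omega>) /\<^sub>R sqrt \<sigma>) \<bullet> c"
          by (simp only: pw sgn_div_norm inverse_eq_divide diff_conv_add_uminus inner_scaleR_left inner_add_left inner_minus_left)
      qed
    qed
  qed
next
  fix \<sigma> and \<xi> :: 'a assume "\<sigma> \<in> scales" "\<sigma> * norm \<xi> < 1/2"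
  then have "\<Psi> (\<sigma> *\<^sub>R \<xi>) = 0" by (intro FIO_cutoffsD(7)[OF F]) auto
  then show "\<Psi> (\<sigma> *\<^sub>R \<xi>) * (angular_const \<theta> \<sigma> / \<sigma> * \<theta> ((sgn \<xi> - \<omega>) /\<^sub>R sqrt \<sigma>)) = 0" by simp
next
  fix \<xi> :: 'a
  have [measurable]: "\<theta> \<in> borel_measurable borel" "\<Psi> \<in> borel_measurable borel" "angular_const \<theta> \<in> borel_measurable borel"
    using F by (auto intro!: test_fun_measurable angular_const_measurable dest: FIO_cutoffsD)
  have "(\<lambda>\<sigma>. \<Psi> (\<sigma> *\<^sub>R \<xi>) * (angular_const \<theta> \<sigma> / \<sigma> * \<theta> ((sgn \<xi> - \<omega>) /\<^sub>R sqrt \<sigma>))) \<in> borel_measurable lborel"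
    by measurable
  then show "(\<lambda>\<sigma>. \<Psi> (\<sigma> *\<^sub>R \<xi>) * (angular_const \<theta> \<sigma> / \<sigma> * \<theta> ((sgn \<xi> - \<omega>) /\<^sub>R sqrt \<sigma>))) \<in> borel_measurable (restrict_space lborel scales)"
    by (rule measurable_restrict_space1)
qed

lemma packet_symbol_eq:
  assumes F: "FIO_cutoffs \<theta> \<Psi> (q :: 'a::euclidean_space \<Rightarrow> complex)"
  shows "packet_symbol \<theta> \<Psi> \<omega> (\<xi>::'a) = of_real (LINT \<sigma>|restrict_space lborel scales.
      \<Psi> (\<sigma> *\<^sub>R \<xi>) * (angular_const \<theta> \<sigma> / \<sigma> * \<theta> ((sgn \<xi> - \<omega>) /\<^sub>R sqrt \<sigma>)))"
proof -
  have "\<Psi> 0 = 0" by (rule FIO_cutoffsD(7)[OF F]) simp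
  then have "\<Psi> (\<sigma> *\<^sub>R \<xi>) * angular_cutoff \<theta> \<omega> \<sigma> \<xi> / \<sigma> =
      \<Psi> (\<sigma> *\<^sub>R \<xi>) * (angular_const \<theta> \<sigma> / \<sigma> * \<theta> ((sgn \<xi> - \<omega>) /\<^sub>R sqrt \<sigma>))" for \<sigma>
    by (simp add: angular_cutoff_def)
  note eq = this
  show ?thesis
    unfolding packet_symbol_def eq set_lebesgue_integral_def
    by (subst integral_restrict_space) simp_all
qed

theorem packet_symbol_tame:
  assumes F: "FIO_cutoffs \<theta> \<Psi> (q :: 'a::euclidean_space \<Rightarrow> complex)"
  shows "csmooth tame (packet_symbol \<theta> \<Psi> (\<omega> :: 'a))"
  unfolding packet_symbol_eq[OF F, abs_def]
  by (rule csmooth_bounded_linear_image[OF bounded_linear_of_real tame_cone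
      packet_family_integral_tame[OF packet_integrand_family[OF F]]])

text \<open>A scale that contributes satisfies \<open>\<sigma> * norm \<xi> \<le> 2\<close> because of \<open>\<Psi>\<close> and
\<open>norm (sgn \<xi> - \<omega>) \<le> sqrt \<sigma>\<close> because of \<open>\<theta>\<close>.\<close>

lemma packet_symbol_support:
  assumes F: "FIO_cutoffs \<theta> \<Psi> (q :: 'a::euclidean_space \<Rightarrow> complex)"
    and nz: "packet_symbol \<theta> \<Psi> \<omega> (\<xi>::'a) \<noteq> 0"
  shows "norm \<xi> * (norm (sgn \<xi> - \<omega>))\<^sup>2 \<le> 2"
proof (rule ccontr)
  assume c: "\<not> norm \<xi> * (norm (sgn \<xi> - \<omega>))\<^sup>2 \<le> 2"
  have "\<Psi> (\<sigma> *\<^sub>R \<xi>) * (angular_const \<theta> \<sigma> / \<sigma> * \<theta> ((sgn \<xi> - \<omega>) /\<^sub>R sqrt \<sigma>)) = 0" if \<sigma>: "\<sigma> \<in> scales" for \<sigma>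
  proof (cases "\<sigma> * norm \<xi> \<le> 2")
    case True
    have x0: "0 < norm \<xi>" using c by auto
    have "\<sigma> < (norm (sgn \<xi> - \<omega>))\<^sup>2"
    proof (rule ccontr)
      assume "\<not> \<sigma> < (norm (sgn \<xi> - \<omega>))\<^sup>2"
      then have "norm \<xi> * (norm (sgn \<xi> - \<omega>))\<^sup>2 \<le> norm \<xi> * \<sigma>" by (intro mult_left_mono) auto
      then show False using c True by (simp add: mult.commute)
    qed
    then have "sqrt \<sigma> < norm (sgn \<xi> - \<omega>)" using \<sigma> by (simp add: real_less_lsqrt)
    then have "1 < norm ((sgn \<xi> - \<omega>) /\<^sub>R sqrt \<sigma>)"
      using \<sigma> by (simp add: divide_inverse[symmetric] mult.commute[of "inverse _"])
    then show ?thesis using FIO_cutoffsD(3)[OF F] by simp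
  next
    case False
    then have "\<Psi> (\<sigma> *\<^sub>R \<xi>) = 0" using \<sigma> by (intro FIO_cutoffsD(7)[OF F]) auto
    then show ?thesis by simp
  qed
  then have "packet_symbol \<theta> \<Psi> \<omega> \<xi> = 0"
    unfolding packet_symbol_eq[OF F] of_real_eq_0_iff
    by (intro integral_eq_zero_AE AE_I2) (simp add: space_restrict_space)
  with nz show False by simp
qed

text \<open>Only scales with \<open>\<sigma>\<close> comparable to \<open>1 / norm \<xi>\<close> contribute. Their measure with respect to
\<open>d\<sigma>/\<sigma>\<close> is bounded, and there the normalisation is at most a multiple of
\<open>norm \<xi> powr ((n - 1) / 4)\<close>.\<close>

lemma packet_symbol_bound:
  assumes F: "FIO_cutoffs \<theta> \<Psi> (q :: 'a::euclidean_space \<Rightarrow> complex)"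
  obtains C where "0 < C"
    "\<And>\<omega> \<xi>::'a. 1 \<le> norm \<xi> \<Longrightarrow> norm (packet_symbol \<theta> \<Psi> \<omega> \<xi>) \<le> C * norm \<xi> powr ((real DIM('a) - 1) / 4)"
proof -
  obtain A where A: "0 < A" "\<And>\<sigma>. 0 < \<sigma> \<Longrightarrow> \<sigma> < 4 \<Longrightarrow> angular_const \<theta> \<sigma> \<le> A * \<sigma> powr (- ((real DIM('a) - 1) / 4))"
    using angular_const_le[OF F] by blast
  obtain B where B: "0 < B" "\<And>x. norm (\<theta> x) \<le> B" using test_fun_bounded[OF FIO_cutoffsD(1)[OF F]] by blast
  obtain D where D: "0 < D" "\<And>x. norm (\<Psi> x) \<le> D" using test_fun_bounded[OF FIO_cutoffsD(5)[OF F]] by blast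
  define e where "e = (real DIM('a) - 1) / 4"
  have e: "0 \<le> e" unfolding e_def using DIM_positive[where 'a='a] by simp
  define C where "C = 4 * D * A * B * 2 powr e"
  let ?M = "restrict_space lborel scales"
  have "norm (packet_symbol \<theta> \<Psi> \<omega> \<xi>) \<le> C * norm \<xi> powr e" if \<xi>: "1 \<le> norm \<xi>" for \<omega> \<xi> :: 'a
  proof -
    let ?H = "\<lambda>\<sigma>. \<Psi> (\<sigma> *\<^sub>R \<xi>) * (angular_const \<theta> \<sigma> / \<sigma> * \<theta> ((sgn \<xi> - \<omega>) /\<^sub>R sqrt \<sigma>))"
    define K where "K = D * ((A * (2 * norm \<xi>) powr e) * (2 * norm \<xi>) * B)"
    have K0: "0 \<le> K" unfolding K_def using A B D by simp
    have pt: "\<bar>?H \<sigma>\<bar> \<le> K * indicator {0..2 / norm \<xi>} \<sigma>" if "\<sigma> \<in> scales" for \<sigma>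
    proof (cases "\<sigma> * norm \<xi> \<in> {1/2..2}")
      case False
      then have "\<Psi> (\<sigma> *\<^sub>R \<xi>) = 0" using that by (intro FIO_cutoffsD(7)[OF F]) auto
      then show ?thesis using K0 by simp
    next
      case True
      have \<sigma>: "0 < \<sigma>" "\<sigma> < 4" using that by auto
      have s: "1 / \<sigma> \<le> 2 * norm \<xi>" using True \<sigma> by (simp add: pos_divide_le_eq mult_ac)
      have "angular_const \<theta> \<sigma> \<le> A * \<sigma> powr (- e)" using A(2)[OF \<sigma>] by (simp add: e_def)
      also have "\<sigma> powr (- e) = (1 / \<sigma>) powr e" using \<sigma> by (simp add: powr_minus_divide powr_divide)
      also have "A * \<dots> \<le> A * (2 * norm \<xi>) powr e"
        using A(1) \<sigma> s by (intro mult_left_mono powr_mono2 e) auto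
      finally have a: "angular_const \<theta> \<sigma> \<le> A * (2 * norm \<xi>) powr e" .
      have "\<bar>?H \<sigma>\<bar> = \<bar>\<Psi> (\<sigma> *\<^sub>R \<xi>)\<bar> * (angular_const \<theta> \<sigma> * (1 / \<sigma>) * \<bar>\<theta> ((sgn \<xi> - \<omega>) /\<^sub>R sqrt \<sigma>)\<bar>)"
        using \<sigma> angular_const_nonneg[of \<theta> \<sigma>] by (simp add: abs_mult)
      also have "\<dots> \<le> K"
      proof -
        have 1: "angular_const \<theta> \<sigma> * (1 / \<sigma>) \<le> (A * (2 * norm \<xi>) powr e) * (2 * norm \<xi>)"
          by (rule mult_mono[OF a s]) (use \<sigma> A(1) in auto)
        have 2: "angular_const \<theta> \<sigma> * (1 / \<sigma>) * \<bar>\<theta> ((sgn \<xi> - \<omega>) /\<^sub>R sqrt \<sigma>)\<bar> \<le> (A * (2 * norm \<xi>) powr e) * (2 * norm \<xi>) * B"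
          by (rule mult_mono[OF 1]) (use B(2)[of "(sgn \<xi> - \<omega>) /\<^sub>R sqrt \<sigma>"] A(1) in auto)
        show ?thesis unfolding K_def
          by (rule mult_mono[OF _ 2]) (use D(1) D(2)[of "\<sigma> *\<^sub>R \<xi>"] \<sigma> angular_const_nonneg[of \<theta> \<sigma>] in auto)
      qed
      finally have "\<bar>?H \<sigma>\<bar> \<le> K" .
      moreover have "0 < norm \<xi>" using \<xi> by linarith
      then have "\<sigma> \<in> {0..2 / norm \<xi>}" using True \<sigma> by (simp add: pos_le_divide_eq)
      ultimately show ?thesis by (simp only: indicator_simps mult_1_right)
    qed
    have i1: "integrable lborel (\<lambda>\<sigma>. K * indicat_real {0..2 / norm \<xi>} \<sigma>)"
      by (intro integrable_mult_right integrable_real_indicator) auto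
    have i2: "integrable ?M (\<lambda>\<sigma>. K * indicat_real {0..2 / norm \<xi>} \<sigma>)"
      by (rule scales.integrable_const_bound[of _ K])
         (use K0 in \<open>auto intro!: AE_I2 measurable_restrict_space1 simp: indicator_def\<close>)
    have "norm (packet_symbol \<theta> \<Psi> \<omega> \<xi>) = \<bar>LINT \<sigma>|?M. ?H \<sigma>\<bar>"
      unfolding packet_symbol_eq[OF F] by simp
    also have "\<dots> \<le> (LINT \<sigma>|?M. \<bar>?H \<sigma>\<bar>)" by (rule integral_abs_bound)
    also have "\<dots> \<le> (LINT \<sigma>|?M. K * indicat_real {0..2 / norm \<xi>} \<sigma>)"
      by (rule Bochner_Integration.integral_mono[OF integrable_abs[OF packet_family_integrable[OF packet_integrand_family[OF F]]] i2])
        (use pt in \<open>simp add: space_restrict_space\<close>)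
    also have "\<dots> \<le> (LINT \<sigma>|lborel. K * indicat_real {0..2 / norm \<xi>} \<sigma>)"
    proof -
      have "(LINT \<sigma>|?M. K * indicat_real {0..2 / norm \<xi>} \<sigma>) = (LINT \<sigma>|lborel. indicator scales \<sigma> *\<^sub>R (K * indicat_real {0..2 / norm \<xi>} \<sigma>))"
        by (subst integral_restrict_space) (simp_all add: set_lebesgue_integral_def)
      also have "\<dots> \<le> (LINT \<sigma>|lborel. K * indicat_real {0..2 / norm \<xi>} \<sigma>)"
      proof (rule Bochner_Integration.integral_mono[OF _ i1])
        show "integrable lborel (\<lambda>\<sigma>. indicator scales \<sigma> *\<^sub>R (K * indicat_real {0..2 / norm \<xi>} \<sigma>))"
          by (rule Bochner_Integration.integrable_bound[OF i1]) (use K0 in \<open>auto simp: indicator_def\<close>)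
      qed (use K0 in \<open>auto simp: indicator_def\<close>)
      finally show ?thesis .
    qed
    also have "\<dots> = K * (2 / norm \<xi>)" by simp
    also have "\<dots> = C * norm \<xi> powr e"
    proof -
      have "0 < norm \<xi>" using \<xi> by linarith
      then show ?thesis unfolding C_def K_def by (simp add: powr_mult field_simps)
    qed
    finally show ?thesis .
  qed
  moreover have "0 < C" unfolding C_def using A B D by simp
  ultimately show ?thesis using that unfolding e_def by blast
qed

section \<open>Lower bounds for Lebesgue norms by duality\<close>

text \<open>A quantitative Hoelder inequality with the weight \<open>G\<close>: the bound \<open>K\<close> on the pairing and the square
integral of \<open>g\<close> force the mean square of \<open>h\<close> over \<open>G\<close> to be large, and for \<open>p > 2\<close> this forces
the \<open>p\<close>-th power to have a large integral. The pointwise Young inequality, with parameters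
\<open>\<epsilon>\<close> and \<open>\<delta>\<close> chosen so that the first two terms use up three quarters of \<open>K\<close>, gives this
with a loss of a constant factor.\<close>

lemma nn_integral_powr_ge:
  fixes h g :: "'a \<Rightarrow> complex" and G :: "'a \<Rightarrow> real"
  assumes [measurable]: "h \<in> borel_measurable M" "g \<in> borel_measurable M" "G \<in> borel_measurable M"
    and G: "\<And>x. 0 \<le> G x" "\<And>x. G x \<le> 1" and p: "2 < p"
    and pos: "0 < K" "0 < Q" "0 < W"
    and K: "K \<le> norm (LINT x|M. h x * (g x * of_real (G x)))"
    and Q: "(\<integral>\<^sup>+x. ennreal ((norm (g x))\<^sup>2 * G x) \<partial>M) \<le> ennreal Q"
    and W: "(\<integral>\<^sup>+x. ennreal (G x) \<partial>M) \<le> ennreal W"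
  shows "ennreal (W * (K\<^sup>2 / (2 * Q * W)) powr (p / 2)) \<le> (\<integral>\<^sup>+x. ennreal (norm (h x) powr p) \<partial>M)"
proof (cases "\<integral>\<^sup>+x. ennreal (norm (h x) powr p) \<partial>M")
  case (real X)
  define \<delta> where "\<delta> = K\<^sup>2 / (2 * Q * W)"
  define \<epsilon> where "\<epsilon> = K / Q"
  have \<delta>: "0 < \<delta>" and \<epsilon>: "0 < \<epsilon>" unfolding \<delta>_def \<epsilon>_def using pos by simp_all
  (* Below the threshold \<delta> the square is small; above it, it is dominated by the higher power. *)
  have sq: "r\<^sup>2 \<le> \<delta> + \<delta> powr (1 - p / 2) * r powr p" if r: "0 \<le> r" for r
  proof (cases "r\<^sup>2 \<le> \<delta>")
    case True then show ?thesis by (simp add: add_increasing2)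
  next
    case False
    then have r0: "0 < r" using \<delta> r by (metis less_eq_real_def linorder_not_less power_zero_numeral)
    have "\<delta> powr (p / 2 - 1) \<le> (r\<^sup>2) powr (p / 2 - 1)" using False \<delta> p by (intro powr_mono2) auto
    also have "\<dots> = r powr (p - 2)" using r0 by (simp add: powr_powr flip: powr_numeral)
    finally have "\<delta> powr (1 - p / 2) * \<delta> powr (p / 2 - 1) * r\<^sup>2 \<le> \<delta> powr (1 - p / 2) * r powr (p - 2) * r\<^sup>2"
      by (intro mult_right_mono mult_left_mono) auto
    moreover have "\<delta> powr (1 - p / 2) * \<delta> powr (p / 2 - 1) = 1" using \<delta> by (simp flip: powr_add)
    moreover have "r powr (p - 2) * r\<^sup>2 = r powr p"
      using r0 by (simp flip: powr_numeral powr_add)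
    ultimately have "r\<^sup>2 \<le> \<delta> powr (1 - p / 2) * r powr p" by (simp add: mult.assoc)
    then show ?thesis using \<delta> by simp
  qed
  have pt: "norm (h x * (g x * of_real (G x))) \<le>
      \<epsilon> / 2 * ((norm (g x))\<^sup>2 * G x) + (\<delta> / (2 * \<epsilon>) * G x + \<delta> powr (1 - p / 2) / (2 * \<epsilon>) * norm (h x) powr p)" for x
  proof -
    let ?a = "norm (h x)" and ?b = "norm (g x)"
    have "0 \<le> (?a - \<epsilon> * ?b)\<^sup>2 / \<epsilon>" using \<epsilon> by simp
    also have "(?a - \<epsilon> * ?b)\<^sup>2 / \<epsilon> = ?a\<^sup>2 / \<epsilon> + \<epsilon> * ?b\<^sup>2 - 2 * (?a * ?b)"
      using \<epsilon> by (simp add: power2_diff field_simps power2_eq_square)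
    finally have "?a * ?b \<le> \<epsilon> / 2 * ?b\<^sup>2 + ?a\<^sup>2 / (2 * \<epsilon>)" by simp
    then have "?a * ?b * G x \<le> (\<epsilon> / 2 * ?b\<^sup>2 + ?a\<^sup>2 / (2 * \<epsilon>)) * G x"
      by (intro mult_right_mono G)
    also have "\<dots> = \<epsilon> / 2 * (?b\<^sup>2 * G x) + (?a\<^sup>2 * G x) / (2 * \<epsilon>)" by (simp add: algebra_simps)
    also have "?a\<^sup>2 * G x \<le> \<delta> * G x + \<delta> powr (1 - p / 2) * ?a powr p"
    proof -
      have "?a\<^sup>2 * G x \<le> (\<delta> + \<delta> powr (1 - p / 2) * ?a powr p) * G x"
        by (intro mult_right_mono sq G) simp
      also have "\<dots> \<le> \<delta> * G x + \<delta> powr (1 - p / 2) * ?a powr p"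
        using G(2)[of x] by (simp add: distrib_right mult_left_le)
      finally show ?thesis .
    qed
    finally have "?a * ?b * G x \<le> \<epsilon> / 2 * (?b\<^sup>2 * G x) + (\<delta> * G x + \<delta> powr (1 - p / 2) * ?a powr p) / (2 * \<epsilon>)"
      using \<epsilon> by (simp add: divide_right_mono)
    then show ?thesis using G(1)[of x] by (simp add: norm_mult add_divide_distrib mult.assoc)
  qed
  have int: "integrable M (\<lambda>x. h x * (g x * of_real (G x)))"
    using K pos(1) by (metis linorder_not_less norm_zero not_integrable_integral_eq)
  have "ennreal K \<le> (\<integral>\<^sup>+x. ennreal (norm (h x * (g x * of_real (G x)))) \<partial>M)"
    using order_trans[OF ennreal_leI[OF K] integral_norm_bound_ennreal[OF int]] .
  also have "\<dots> \<le> (\<integral>\<^sup>+x. ennreal (\<epsilon> / 2) * ennreal ((norm (g x))\<^sup>2 * G x) + (ennreal (\<delta> / (2 * \<epsilon>)) * ennreal (G x) +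
      ennreal (\<delta> powr (1 - p / 2) / (2 * \<epsilon>)) * ennreal (norm (h x) powr p)) \<partial>M)"
  proof (rule nn_integral_mono)
    fix x
    have "ennreal (norm (h x * (g x * of_real (G x)))) \<le> ennreal (\<epsilon> / 2 * ((norm (g x))\<^sup>2 * G x) + (\<delta> / (2 * \<epsilon>) * G x + \<delta> powr (1 - p / 2) / (2 * \<epsilon>) * norm (h x) powr p))"
      by (rule ennreal_leI[OF pt])
    also have "\<dots> = ennreal (\<epsilon> / 2) * ennreal ((norm (g x))\<^sup>2 * G x) + (ennreal (\<delta> / (2 * \<epsilon>)) * ennreal (G x) +
      ennreal (\<delta> powr (1 - p / 2) / (2 * \<epsilon>)) * ennreal (norm (h x) powr p))"
      using \<epsilon> \<delta> G(1)[of x] by (simp add: ennreal_mult[symmetric] ennreal_plus[symmetric] del: ennreal_plus)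
    finally show "ennreal (norm (h x * (g x * of_real (G x)))) \<le> ennreal (\<epsilon> / 2) * ennreal ((norm (g x))\<^sup>2 * G x) + (ennreal (\<delta> / (2 * \<epsilon>)) * ennreal (G x) +
      ennreal (\<delta> powr (1 - p / 2) / (2 * \<epsilon>)) * ennreal (norm (h x) powr p))" .
  qed
  also have "\<dots> = ennreal (\<epsilon> / 2) * (\<integral>\<^sup>+x. ennreal ((norm (g x))\<^sup>2 * G x) \<partial>M) + (ennreal (\<delta> / (2 * \<epsilon>)) * (\<integral>\<^sup>+x. ennreal (G x) \<partial>M) +
      ennreal (\<delta> powr (1 - p / 2) / (2 * \<epsilon>)) * (\<integral>\<^sup>+x. ennreal (norm (h x) powr p) \<partial>M))"
    by (simp add: nn_integral_add nn_integral_cmult)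
  also have "\<dots> \<le> ennreal (\<epsilon> / 2) * ennreal Q + (ennreal (\<delta> / (2 * \<epsilon>)) * ennreal W +
      ennreal (\<delta> powr (1 - p / 2) / (2 * \<epsilon>)) * ennreal X)"
    unfolding real(2) by (intro add_mono mult_left_mono Q W) auto
  also have "\<dots> = ennreal (\<epsilon> / 2 * Q + (\<delta> / (2 * \<epsilon>) * W + \<delta> powr (1 - p / 2) / (2 * \<epsilon>) * X))"
    using \<epsilon> \<delta> pos real(1) by (simp add: ennreal_mult[symmetric] ennreal_plus[symmetric] del: ennreal_plus)
  finally have "K \<le> \<epsilon> / 2 * Q + (\<delta> / (2 * \<epsilon>) * W + \<delta> powr (1 - p / 2) / (2 * \<epsilon>) * X)"
    using \<epsilon> \<delta> pos real(1) by (subst (asm) ennreal_le_iff) auto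
  moreover have "\<epsilon> / 2 * Q = K / 2" unfolding \<epsilon>_def using pos by simp
  moreover have "\<delta> / (2 * \<epsilon>) * W = K / 4" unfolding \<epsilon>_def \<delta>_def using pos by (simp add: field_simps power2_eq_square)
  ultimately have "K / 4 \<le> \<delta> powr (1 - p / 2) / (2 * \<epsilon>) * X" by linarith
  then have "(K / 4) * (2 * \<epsilon>) * \<delta> powr (p / 2 - 1) \<le> (\<delta> powr (1 - p / 2) / (2 * \<epsilon>) * X) * (2 * \<epsilon>) * \<delta> powr (p / 2 - 1)"
    using \<epsilon> by (intro mult_right_mono) auto
  also have "\<dots> = (\<delta> powr (1 - p / 2) * \<delta> powr (p / 2 - 1)) * X" using \<epsilon> by simp
  also have "\<delta> powr (1 - p / 2) * \<delta> powr (p / 2 - 1) = 1" using \<delta> by (simp flip: powr_add)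
  also have "(K / 4) * (2 * \<epsilon>) = W * \<delta>" unfolding \<epsilon>_def \<delta>_def using pos by (simp add: power2_eq_square)
  also have "W * \<delta> * \<delta> powr (p / 2 - 1) = W * \<delta> powr (p / 2)"
    using \<delta> powr_add[of \<delta> 1 "p / 2 - 1"] by simp
  finally show ?thesis unfolding real(2) \<delta>_def by (intro ennreal_leI) simp
qed simp

text \<open>All functions that represent the same distribution have the same pairing with the Schwartz function
\<open>g G\<close>, so the bound holds for each of them, hence for the infimum.\<close>

lemma Lp_norm_ge:
  fixes F g :: "'a::euclidean_space \<Rightarrow> complex" and G :: "'a \<Rightarrow> real"
  assumes \<psi>: "(\<lambda>x. g x * of_real (G x)) \<in> schwartz"
    and g: "g \<in> borel_measurable borel" "G \<in> borel_measurable borel"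
    and G: "\<And>x. 0 \<le> G x" "\<And>x. G x \<le> 1" and p: "2 < p"
    and pos: "0 < K" "0 < Q" "0 < W"
    and K: "K \<le> norm (LINT x|lborel. F x * (g x * of_real (G x)))"
    and Q: "(\<integral>\<^sup>+x. ennreal ((norm (g x))\<^sup>2 * G x) \<partial>lborel) \<le> ennreal Q"
    and W: "(\<integral>\<^sup>+x. ennreal (G x) \<partial>lborel) \<le> ennreal W"
  shows "ennreal (W * (K\<^sup>2 / (2 * Q * W)) powr (p / 2)) \<le> epowr (Lp_norm p (distr_of F)) p"
proof -
  let ?c = "ennreal (W * (K\<^sup>2 / (2 * Q * W)) powr (p / 2))"
  have "epowr ?c (1 / p) \<le> Lp_norm p (distr_of F)"
    unfolding Lp_norm_def
  proof (rule INF_greatest)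
    fix h assume "h \<in> {h \<in> borel_measurable lborel. (\<integral>\<^sup>+x. ennreal (norm (h x) powr p) \<partial>lborel) < \<infinity> \<and> distr_of h = distr_of F}"
    then have h: "h \<in> borel_measurable lborel" "distr_of h = distr_of F" by auto
    have "(LINT x|lborel. h x * (g x * of_real (G x))) = (LINT x|lborel. F x * (g x * of_real (G x)))"
      using fun_cong[OF h(2), of "\<lambda>x. g x * of_real (G x)"] by (simp only: distr_of_apply[OF \<psi>])
    then have "?c \<le> (\<integral>\<^sup>+x. ennreal (norm (h x) powr p) \<partial>lborel)"
      using g K by (intro nn_integral_powr_ge[OF h(1) _ _ G p pos _ Q W]) auto
    then show "epowr ?c (1 / p) \<le> epowr (\<integral>\<^sup>+x. ennreal (norm (h x) powr p) \<partial>lborel) (1 / p)"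
      using p by (intro epowr_mono) auto
  qed
  then have "epowr (epowr ?c (1 / p)) p \<le> epowr (Lp_norm p (distr_of F)) p" using p by (intro epowr_mono) auto
  then show ?thesis using p by (simp add: epowr_epowr)
qed

section \<open>Phase functions and propagators\<close>

lemma smooth_off_origin_continuous:
  assumes "smooth_on (- {0}) \<phi>" "\<xi> \<noteq> 0" shows "isCont \<phi> \<xi>"
  using assms unfolding smooth_on_def by (metis ComplI iter_deriv.simps(1) lists.Nil singletonD differentiable_imp_continuous_within)

lemma smooth_off_origin_measurable:
  fixes \<phi> :: "'a::euclidean_space \<Rightarrow> real"
  assumes "smooth_on (- {0}) \<phi>" shows "\<phi> \<in> borel_measurable borel"
  by (rule borel_measurable_continuous_countable_exceptions[of "{0}"])
    (auto intro!: continuous_at_imp_continuous_on smooth_off_origin_continuous[OF assms])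

lemma homogeneous_phase_bound:
  fixes \<phi> :: "'a::euclidean_space \<Rightarrow> real"
  assumes sm: "smooth_on (- {0}) \<phi>" and hom: "positively_homogeneous1 \<phi>"
  obtains D where "0 < D" "\<And>\<xi>. \<xi> \<noteq> 0 \<Longrightarrow> \<bar>\<phi> \<xi>\<bar> \<le> D * norm \<xi>"
proof -
  have "continuous_on (sphere 0 1) \<phi>"
    by (intro continuous_at_imp_continuous_on ballI smooth_off_origin_continuous[OF sm]) auto
  then have "bounded (\<phi> ` sphere 0 1)" by (intro compact_imp_bounded compact_continuous_image) auto
  then obtain D where D: "\<And>\<xi>. \<xi> \<in> sphere 0 1 \<Longrightarrow> \<bar>\<phi> \<xi>\<bar> \<le> D"
    unfolding bounded_iff by (metis imageI real_norm_def)
  have "\<bar>\<phi> \<xi>\<bar> \<le> max D 1 * norm \<xi>" if \<xi>: "\<xi> \<noteq> 0" for \<xi>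
  proof -
    have "\<phi> (norm \<xi> *\<^sub>R sgn \<xi>) = norm \<xi> * \<phi> (sgn \<xi>)"
      using hom \<xi> unfolding positively_homogeneous1_def by (simp add: sgn_zero_iff)
    moreover have "norm \<xi> *\<^sub>R sgn \<xi> = \<xi>" using \<xi> by (simp add: sgn_div_norm)
    ultimately have "\<bar>\<phi> \<xi>\<bar> = norm \<xi> * \<bar>\<phi> (sgn \<xi>)\<bar>" by (simp add: abs_mult)
    also have "\<dots> \<le> norm \<xi> * max D 1" using D[of "sgn \<xi>"] \<xi> by (intro mult_left_mono) (auto simp: norm_sgn)
    finally show ?thesis by (simp add: mult.commute)
  qed
  then show ?thesis using that[of "max D 1"] by simp
qed

text \<open>Since the phase factor may be singular at the origin, the solution need not be a Schwartz function;
its pairings are nevertheless absolutely convergent integrals over frequencies.\<close>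

lemma wave_op_pairing:
  fixes a :: "'a::euclidean_space \<Rightarrow> complex"
  assumes sm: "smooth_on (- {0}) \<phi>" and a: "a \<in> schwartz" and \<psi>: "\<psi> \<in> schwartz"
  shows "(LINT x|lborel. multiplier_fun (\<lambda>\<xi>. cis (t * \<phi> \<xi>)) (inv_fourier a) x * \<psi> x) =
     (LINT \<xi>|lborel. (cis (t * \<phi> \<xi>) * a \<xi>) * inv_fourier \<psi> \<xi>)"
  unfolding multiplier_fun_def fourier_inv_fourier[OF a]
proof (rule inv_fourier_multiplication_formula[OF _ schwartz_integrable[OF \<psi>]])
  have [measurable]: "\<phi> \<in> borel_measurable borel" by (rule smooth_off_origin_measurable[OF sm])
  show "integrable lborel (\<lambda>\<xi>. cis (t * \<phi> \<xi>) * a \<xi>)"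
    by (rule integrable_schwartz_times_bounded[OF a, of _ 1]) auto
qed

lemma wave_op_distr_of:
  "f \<in> schwartz \<Longrightarrow> wave_op \<theta> \<Psi> q s p \<phi> t (distr_of f) = distr_of (multiplier_fun (\<lambda>\<xi>. cis (t * \<phi> \<xi>)) f)"
  unfolding wave_op_def by (rule multiplier_ext_distr_of)

section \<open>From one test function to an inequality of exponents\<close>

lemma epowr_mult:
  assumes "0 \<le> C" "x \<noteq> \<infinity>" "0 < p" shows "epowr (ennreal C * x) p = ennreal (C powr p) * epowr x p"
proof (cases x)
  case (real r)
  then show ?thesis using assms by (simp add: epowr_ennreal ennreal_mult[symmetric] powr_mult)
qed (use assms in simp)

text \<open>A lower bound on the time interval \<open>{0..T}\<close> and an upper bound for the norm of one test function
turn the assumed inequality into one between numbers.\<close>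

lemma testing_inequality:
  fixes C U Y :: real
  assumes p: "0 < p" and C: "0 \<le> C" and T: "0 \<le> T" "T \<le> 1" and Y: "0 \<le> Y" and U: "0 \<le> U"
    and hyp: "epowr (\<integral>\<^sup>+t\<in>{0..1}. u t \<partial>lborel) (1 / p) \<le> ennreal C * N"
    and lower: "\<And>t. 0 \<le> t \<Longrightarrow> t \<le> T \<Longrightarrow> ennreal Y \<le> u t"
    and upper: "epowr N p \<le> ennreal U"
  shows "T * Y \<le> C powr p * U"
proof -
  have fin: "N \<noteq> \<infinity>" using upper by (auto simp: epowr_def top_unique)
  have "ennreal (T * Y) = (\<integral>\<^sup>+t. ennreal Y * indicator {0..T} t \<partial>lborel)"
    using T Y by (simp add: nn_integral_cmult ennreal_mult[symmetric] mult.commute)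
  also have "\<dots> \<le> (\<integral>\<^sup>+t\<in>{0..1}. u t \<partial>lborel)"
    by (intro nn_integral_mono) (use lower T in \<open>auto simp: indicator_def\<close>)
  also have "\<dots> = epowr (epowr (\<integral>\<^sup>+t\<in>{0..1}. u t \<partial>lborel) (1 / p)) p"
    using p by (simp add: epowr_epowr)
  also have "\<dots> \<le> epowr (ennreal C * N) p" using hyp p by (intro epowr_mono) auto
  also have "\<dots> = ennreal (C powr p) * epowr N p" by (rule epowr_mult[OF C fin p])
  also have "\<dots> \<le> ennreal (C powr p) * ennreal U" by (intro mult_left_mono upper) simp
  also have "\<dots> = ennreal (C powr p * U)" using U by (simp add: ennreal_mult)
  finally show ?thesis using U by (subst (asm) ennreal_le_iff) auto
qed

lemma exponent_le_if_powr_le: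
  fixes c K :: real
  assumes c: "0 < c" and K: "\<And>m. m0 \<le> m \<Longrightarrow> c * real m powr \<alpha> \<le> K * real m powr \<beta>"
  shows "\<alpha> \<le> \<beta>"
proof (rule ccontr)
  assume "\<not> \<alpha> \<le> \<beta>"
  then have d: "0 < \<alpha> - \<beta>" by simp
  define B where "B = \<bar>K\<bar> / c + 1"
  have B: "0 < B" unfolding B_def using c by (simp add: add_nonneg_pos)
  obtain m :: nat where m0: "max (real (max m0 1)) (B powr (1 / (\<alpha> - \<beta>))) \<le> real m" using real_arch_simple by blast
  have "K / c < B" unfolding B_def using c abs_ge_self[of K] by (simp add: divide_right_mono add_strict_increasing2 le_less_trans[of _ "\<bar>K\<bar> / c"])
  also have "B = (B powr (1 / (\<alpha> - \<beta>))) powr (\<alpha> - \<beta>)" using B d by (simp add: powr_powr)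
  also have "\<dots> \<le> real m powr (\<alpha> - \<beta>)" using m0 d by (intro powr_mono2) auto
  finally have m: "K / c < real m powr (\<alpha> - \<beta>)" "m0 \<le> m" "1 \<le> m" using m0 by auto
  have "K * real m powr \<beta> < (c * real m powr (\<alpha> - \<beta>)) * real m powr \<beta>"
    using m c by (intro mult_strict_right_mono) (simp_all add: pos_divide_less_eq mult.commute)
  also have "\<dots> = c * real m powr \<alpha>" by (simp add: mult.assoc flip: powr_add)
  finally show False using K[OF m(2)] by simp
qed

lemma cos_ge_half:
  assumes "\<bar>y\<bar> \<le> 1" shows "1/2 \<le> cos (y::real)"
proof -
  have "\<bar>sin (y/2)\<bar> \<le> \<bar>y/2\<bar>" by (rule abs_sin_x_le_abs_x)
  also have "\<dots> \<le> 1/2" using assms by simp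
  finally have "(sin (y/2))\<^sup>2 \<le> (1/2)\<^sup>2" by (simp add: abs_le_square_iff[symmetric])
  then show ?thesis using cos_double_sin[of "y/2"] by (simp add: power2_eq_square)
qed

section \<open>Test functions with Fourier support in an annulus\<close>

lemma powr_comparable:
  fixes y R \<kappa> s :: real
  assumes R: "0 < R" and \<kappa>: "1 \<le> \<kappa>" and y: "R / \<kappa> \<le> y" "y \<le> \<kappa> * R"
  shows "y powr s \<le> \<kappa> powr \<bar>s\<bar> * R powr s"
proof (cases "0 \<le> s")
  case True
  have "0 < R / \<kappa>" using R \<kappa> by simp
  then have "y powr s \<le> (\<kappa> * R) powr s" using True y by (intro powr_mono2) auto
  then show ?thesis using True R \<kappa> by (simp add: powr_mult)
next
  case False
  have "0 < R / \<kappa>" using R \<kappa> by simp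
  then have "y powr s \<le> (R / \<kappa>) powr s" using False y by (intro powr_mono2') auto
  also have "\<dots> = \<kappa> powr \<bar>s\<bar> * R powr s" using False R \<kappa> by (simp add: powr_divide powr_minus_divide)
  finally show ?thesis .
qed

text \<open>The factor 2 compares \<open>sqrt (1 + (norm \<xi>)\<^sup>2)\<close> with \<open>norm \<xi>\<close>, and the exponent
\<open>\<bar>s\<bar>\<close> serves both signs of \<open>s\<close>.\<close>

lemma bessel_weight_le:
  fixes \<xi> :: "'a::real_normed_vector"
  assumes "1 \<le> R" "1 \<le> \<kappa>" "R / \<kappa> \<le> norm \<xi>" "norm \<xi> \<le> \<kappa> * R"
  shows "sqrt (1 + (norm \<xi>)\<^sup>2) powr s \<le> (2 * \<kappa>) powr \<bar>s\<bar> * R powr s"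
proof (rule powr_comparable)
  have "norm \<xi> \<le> sqrt (1 + (norm \<xi>)\<^sup>2)" by (rule real_le_rsqrt) simp
  moreover have "R / (2 * \<kappa>) \<le> R / \<kappa>" using assms by (intro divide_left_mono) auto
  ultimately show "R / (2 * \<kappa>) \<le> sqrt (1 + (norm \<xi>)\<^sup>2)" using assms by linarith
  have "1 * 1 \<le> \<kappa> * R" using assms by (intro mult_mono) auto
  moreover have "sqrt (1 + (norm \<xi>)\<^sup>2) \<le> 1 + norm \<xi>" by (rule real_le_lsqrt) (simp_all add: power2_sum)
  ultimately show "sqrt (1 + (norm \<xi>)\<^sup>2) \<le> 2 * \<kappa> * R" using assms by linarith
qed (use assms in auto)

lemma test_fun_support_bounded:
  assumes "test_fun f" obtains R where "\<And>x. R < norm x \<Longrightarrow> f x = 0"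
proof -
  have "bounded (closure {x. f x \<noteq> 0})" using assms by (simp add: test_fun_def compact_imp_bounded)
  then obtain R where R: "\<And>x. x \<in> closure {x. f x \<noteq> 0} \<Longrightarrow> norm x \<le> R" by (auto simp: bounded_iff)
  have "f x = 0" if "R < norm x" for x
    using R[of x] closure_subset[of "{x. f x \<noteq> 0}"] that by fastforce
  then show ?thesis by (rule that)
qed

lemma emeasure_cball_euclidean:
  fixes c :: "'a::euclidean_space"
  assumes "0 < r" shows "emeasure lborel (cball c r) = ennreal (measure lborel (cball 0 1 :: 'a set) * r ^ DIM('a))"
proof -
  have "emeasure lborel (cball c r) = (\<integral>\<^sup>+x. indicator (cball c r) x \<partial>lborel)" by simp
  also have "\<dots> = ennreal (\<bar>r\<bar> ^ DIM('a)) * (\<integral>\<^sup>+x. indicator (cball c r) (c + r *\<^sub>R x) \<partial>lborel)"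
    using assms by (intro nn_integral_affine borel_measurable_indicator) auto
  also have "(\<lambda>x. indicator (cball c r) (c + r *\<^sub>R x) :: ennreal) = indicator (cball 0 1)"
    using assms by (auto simp: indicator_def dist_norm mult_le_cancel_left1 fun_eq_iff)
  also have "(\<integral>\<^sup>+x. indicator (cball 0 1 :: 'a set) x \<partial>lborel) = emeasure lborel (cball 0 1 :: 'a set)" by simp
  also have "emeasure lborel (cball 0 1 :: 'a set) = ennreal (measure lborel (cball 0 1 :: 'a set))"
    by (intro emeasure_eq_ennreal_measure) (use emeasure_bounded_finite[of "cball 0 1 :: 'a set"] in auto)
  finally show ?thesis using assms by (simp add: ennreal_mult[symmetric] mult.commute)
qed

text \<open>The common upper bound for both examples. For large \<open>R\<close> the annulus lies outside the support of
\<open>q\<close>; on it the packet symbol and the Bessel weight are at most constants times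
\<open>R powr ((n - 1) / 4)\<close> and \<open>R powr s\<close>. The sets \<open>A\<close> have to contain only the part of the support
of \<open>a\<close> in the sector where the packet symbol lives, and \<open>V\<close> is what distinguishes the examples.\<close>

lemma annular_HspFIO_norm_le:
  fixes \<theta> \<Psi> :: "'a::euclidean_space \<Rightarrow> real"
  assumes F: "FIO_cutoffs \<theta> \<Psi> q" and p: "2 \<le> p" and \<kappa>: "1 \<le> \<kappa>" and b: "0 < b"
  obtains K R0 where "0 < K" "1 \<le> R0"
    "\<And>R V a. R0 \<le> R \<Longrightarrow> 0 < V \<Longrightarrow> a \<in> schwartz \<Longrightarrow> (\<And>\<xi>. norm (a \<xi>) \<le> b) \<Longrightarrow>
      (\<And>\<xi>. a \<xi> \<noteq> 0 \<Longrightarrow> R / \<kappa> \<le> norm \<xi> \<and> norm \<xi> \<le> \<kappa> * R) \<Longrightarrow>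
      (\<And>\<omega>. norm \<omega> = 1 \<Longrightarrow> \<exists>A\<in>sets borel. emeasure lborel A \<le> ennreal V \<and>
        (\<forall>\<xi>. a \<xi> \<noteq> 0 \<longrightarrow> norm \<xi> * (norm (sgn \<xi> - \<omega>))\<^sup>2 \<le> 2 \<longrightarrow> \<xi> \<in> A)) \<Longrightarrow>
      distr_of (inv_fourier a) \<in> HspFIO \<theta> \<Psi> q s p \<and>
      epowr (HspFIO_norm \<theta> \<Psi> q s p (distr_of (inv_fourier a))) p
        \<le> ennreal (K * R powr (((real DIM('a) - 1) / 4 + s) * p) * V powr (p - 1))"
proof -
  define e where "e = (real DIM('a) - 1) / 4"
  have e0: "0 \<le> e" unfolding e_def using DIM_positive[where 'a='a] by simp
  have qf: "test_fun q" by (rule FIO_cutoffsD(8)[OF F])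
  have qt: "csmooth tame q" by (rule csmooth_weight_mono[OF test_fun_csmooth[OF qf] rapid_subset_tame])
  obtain CP where CP: "0 < CP" "\<And>\<omega> \<xi>::'a. 1 \<le> norm \<xi> \<Longrightarrow> norm (packet_symbol \<theta> \<Psi> \<omega> \<xi>) \<le> CP * norm \<xi> powr e"
    using packet_symbol_bound[OF F] unfolding e_def by blast
  obtain Rq where Rq: "\<And>x. Rq < norm x \<Longrightarrow> q x = 0" using test_fun_support_bounded[OF qf] by blast
  define R0 where "R0 = \<kappa> * (\<bar>Rq\<bar> + 1)"
  have "1 * 1 \<le> R0" unfolding R0_def using \<kappa> by (intro mult_mono) auto
  then have R01: "1 \<le> R0" by simp
  define B2 where "B2 = CP * \<kappa> powr e * (2 * \<kappa>) powr \<bar>s\<bar> * b"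
  have B2: "0 < B2" unfolding B2_def using CP b \<kappa> by simp
  have "distr_of (inv_fourier a) \<in> HspFIO \<theta> \<Psi> q s p \<and>
      epowr (HspFIO_norm \<theta> \<Psi> q s p (distr_of (inv_fourier a))) p
        \<le> ennreal (B2 powr p * R powr ((e + s) * p) * V powr (p - 1))"
    if RR: "R0 \<le> R" and V: "0 < V" and aS: "a \<in> schwartz" and na: "\<And>\<xi>. norm (a \<xi>) \<le> b"
      and an: "\<And>\<xi>. a \<xi> \<noteq> 0 \<Longrightarrow> R / \<kappa> \<le> norm \<xi> \<and> norm \<xi> \<le> \<kappa> * R"
      and AA: "\<And>\<omega>. norm \<omega> = 1 \<Longrightarrow> \<exists>A\<in>sets borel. emeasure lborel A \<le> ennreal V \<and>
        (\<forall>\<xi>. a \<xi> \<noteq> 0 \<longrightarrow> norm \<xi> * (norm (sgn \<xi> - \<omega>))\<^sup>2 \<le> 2 \<longrightarrow> \<xi> \<in> A)" for R V a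
  proof -
    have R1: "1 \<le> R" using RR R01 by linarith
    have low: "\<bar>Rq\<bar> + 1 \<le> norm \<xi>" if "a \<xi> \<noteq> 0" for \<xi>
    proof -
      have "\<bar>Rq\<bar> + 1 \<le> R / \<kappa>" using RR \<kappa> unfolding R0_def by (simp add: pos_le_divide_eq mult.commute)
      then show ?thesis using an[OF that] by linarith
    qed
    define B where "B = B2 * R powr (e + s)"
    have B: "0 < B" unfolding B_def using B2 R1 by simp
    have qa: "q \<xi> * a \<xi> = 0" for \<xi>
      using low[of \<xi>] Rq[of \<xi>] by (cases "a \<xi> = 0") auto
    have sym: "norm (packet_symbol \<theta> \<Psi> \<omega> \<xi> * (of_real (sqrt (1 + (norm \<xi>)\<^sup>2) powr s) * a \<xi>)) \<le> B" for \<omega> \<xi>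
    proof (cases "a \<xi> = 0")
      case True then show ?thesis using B by simp
    next
      case False
      note x = an[OF False]
      have "norm (packet_symbol \<theta> \<Psi> \<omega> \<xi>) \<le> CP * norm \<xi> powr e" by (rule CP(2)) (use low[OF False] in linarith)
      also have "\<dots> \<le> CP * (\<kappa> * R) powr e" using CP x e0 by (intro mult_left_mono powr_mono2) auto
      finally have 1: "norm (packet_symbol \<theta> \<Psi> \<omega> \<xi>) \<le> CP * (\<kappa> * R) powr e" .
      have 2: "sqrt (1 + (norm \<xi>)\<^sup>2) powr s \<le> (2 * \<kappa>) powr \<bar>s\<bar> * R powr s"
        by (rule bessel_weight_le) (use R1 \<kappa> x in auto)
      have 3: "sqrt (1 + (norm \<xi>)\<^sup>2) powr s * norm (a \<xi>) \<le> ((2 * \<kappa>) powr \<bar>s\<bar> * R powr s) * b"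
        by (rule mult_mono[OF 2 na]) auto
      have "norm (packet_symbol \<theta> \<Psi> \<omega> \<xi> * (of_real (sqrt (1 + (norm \<xi>)\<^sup>2) powr s) * a \<xi>)) =
         norm (packet_symbol \<theta> \<Psi> \<omega> \<xi>) * (sqrt (1 + (norm \<xi>)\<^sup>2) powr s * norm (a \<xi>))"
        by (simp add: norm_mult)
      also have "\<dots> \<le> (CP * (\<kappa> * R) powr e) * (((2 * \<kappa>) powr \<bar>s\<bar> * R powr s) * b)"
        by (rule mult_mono[OF 1 3]) (use CP in auto)
      also have "(\<kappa> * R) powr e = \<kappa> powr e * R powr e"
        by (rule powr_mult)
      finally show ?thesis unfolding B_def B2_def powr_add by (simp only: mult_ac)
    qed
    define P where "P \<omega> A \<longleftrightarrow> A \<in> sets borel \<and> emeasure lborel A \<le> ennreal V \<and>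
      (\<forall>\<xi>. a \<xi> \<noteq> 0 \<longrightarrow> norm \<xi> * (norm (sgn \<xi> - \<omega>))\<^sup>2 \<le> 2 \<longrightarrow> \<xi> \<in> A)" for \<omega> A
    define A where "A \<omega> = (SOME A. P \<omega> A)" for \<omega>
    have A: "P \<omega> (A \<omega>)" if u: "norm \<omega> = 1" for \<omega>
    proof -
      obtain A0 where "A0 \<in> sets borel" "emeasure lborel A0 \<le> ennreal V"
        "\<forall>\<xi>. a \<xi> \<noteq> 0 \<longrightarrow> norm \<xi> * (norm (sgn \<xi> - \<omega>))\<^sup>2 \<le> 2 \<longrightarrow> \<xi> \<in> A0"
        using AA[OF u] by (elim bexE conjE)
      then have "P \<omega> A0" unfolding P_def by (intro conjI)
      then show ?thesis unfolding A_def by (rule someI)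
    qed
    have A12: "A \<omega> \<in> sets borel" "emeasure lborel (A \<omega>) \<le> ennreal V" if "norm \<omega> = 1" for \<omega>
      using A[OF that] unfolding P_def by blast+
    have supp: "packet_symbol \<theta> \<Psi> \<omega> \<xi> * a \<xi> = 0" if "norm \<omega> = 1" "\<xi> \<notin> A \<omega>" for \<omega> \<xi>
      using A[OF that(1)] that(2) packet_symbol_support[OF F, of \<omega> \<xi>] unfolding P_def by auto
    note U = HspFIO_norm_le[OF aS p qt qa packet_symbol_tame[OF F] less_imp_le[OF B] sym less_imp_le[OF V] A12 supp]
    have "B powr p = B2 powr p * R powr ((e + s) * p)"
      unfolding B_def powr_mult powr_powr ..
    note U2 = U(2)[unfolded this]
    show ?thesis by (rule conjI[OF U(1) U2])
  qed
  with B2 R01 show ?thesis unfolding e_def by (intro that[of "B2 powr p" R0]) auto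
qed

section \<open>The focusing example\<close>

lemma integral_pos_near_0:
  fixes f :: "'a::euclidean_space \<Rightarrow> real"
  assumes f: "integrable lborel f" "\<And>x. 0 \<le> f x" and c: "0 < c" "0 < \<delta>" "\<And>x. norm x < \<delta> \<Longrightarrow> c \<le> f x"
  shows "0 < (LINT x|lborel. f x)"
proof -
  have fin: "emeasure lborel (ball 0 \<delta> :: 'a set) < \<infinity>" using emeasure_bounded_finite[of "ball 0 \<delta> :: 'a set"] by auto
  have "0 < c * measure lborel (ball 0 \<delta> :: 'a set)" using c content_ball_pos[OF c(2), of "0::'a"] by simp
  also have "\<dots> = (LINT x|lborel. c * indicator (ball 0 \<delta>) (x::'a))" by simp
  also have "\<dots> \<le> (LINT x|lborel. f x)"
  proof (rule Bochner_Integration.integral_mono[OF _ f(1)])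
    have "integrable lborel (indicat_real (ball 0 \<delta> :: 'a set))"
      by (intro integrable_real_indicator) (use fin in auto)
    then show "integrable lborel (\<lambda>x::'a. c * indicator (ball 0 \<delta>) x)" by (rule integrable_mult_right)
  qed (use f(2) c in \<open>auto simp: indicator_def\<close>)
  finally show ?thesis .
qed

lemma test_fun_integrable: "test_fun f \<Longrightarrow> integrable lborel (f :: 'a::euclidean_space \<Rightarrow> real)"
  using schwartz_integrable[OF test_fun_of_real_schwartz, of f] by (simp add: complex_of_real_integrable_eq)

lemma FIO_cutoffs_bump:
  assumes F: "FIO_cutoffs \<theta> \<Psi> (q :: 'a::euclidean_space \<Rightarrow> complex)"
  obtains \<delta> where "0 < \<delta>" "\<And>x. norm x < \<delta> \<Longrightarrow> \<theta> x = 1"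
proof -
  from FIO_cutoffsD(4)[OF F] obtain \<delta> where "0 < \<delta>" "\<And>\<xi>. dist \<xi> 0 < \<delta> \<Longrightarrow> \<theta> \<xi> = 1"
    unfolding eventually_nhds_metric by blast
  then show ?thesis using that by simp
qed

text \<open>The hypothesis bounds the angle between \<open>\<xi>\<close> and \<open>\<omega>\<close> by \<open>sqrt (2 / norm \<xi>)\<close>, and the
distance from the ray is at most \<open>norm \<xi>\<close> times the angle.\<close>

lemma dist_ray_le:
  assumes "norm \<xi> * (norm (sgn \<xi> - \<omega>))\<^sup>2 \<le> 2"
  shows "norm (\<xi> - norm \<xi> *\<^sub>R \<omega>) \<le> sqrt (2 * norm \<xi>)"
proof -
  have "\<xi> - norm \<xi> *\<^sub>R \<omega> = norm \<xi> *\<^sub>R (sgn \<xi> - \<omega>)"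
    by (cases "\<xi> = 0") (simp_all add: sgn_div_norm scaleR_right_diff_distrib)
  then have "(norm (\<xi> - norm \<xi> *\<^sub>R \<omega>))\<^sup>2 = norm \<xi> * (norm \<xi> * (norm (sgn \<xi> - \<omega>))\<^sup>2)"
    by (simp add: power_mult_distrib power2_eq_square mult_ac)
  also have "\<dots> \<le> norm \<xi> * 2" by (intro mult_left_mono assms) simp
  finally show ?thesis by (intro real_le_rsqrt) (simp add: mult.commute)
qed

text \<open>Up to distance \<open>5 R\<close> the sector is a tube of width comparable to \<open>sqrt R\<close> around the ray in
direction \<open>\<omega>\<close>, and is covered by balls of radius \<open>5 sqrt R\<close> whose centres lie \<open>sqrt R\<close> apart
on the ray. At most \<open>6 sqrt R\<close> balls are needed.\<close>

lemma sector_cover: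
  fixes \<omega> :: "'a::euclidean_space"
  assumes R: "1 \<le> R" and \<omega>: "norm \<omega> = 1"
  obtains A where "A \<in> sets borel"
    "emeasure lborel A \<le> ennreal (6 * 5 ^ DIM('a) * measure lborel (cball 0 1 :: 'a set) * R powr ((real DIM('a) + 1) / 2))"
    "\<And>\<xi>. norm \<xi> \<le> 5 * R \<Longrightarrow> norm \<xi> * (norm (sgn \<xi> - \<omega>))\<^sup>2 \<le> 2 \<Longrightarrow> \<xi> \<in> A"
proof -
  let ?n = "DIM('a)" and ?v = "measure lborel (cball 0 1 :: 'a set)"
  define r where "r = sqrt R"
  have r: "1 \<le> r" "r * r = R" unfolding r_def using R by auto
  define J where "J = nat \<lfloor>5 * r\<rfloor>"
  define A where "A = (\<Union>j\<in>{..J}. cball ((real j * r) *\<^sub>R \<omega>) (5 * r))"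
  have J: "real J \<le> 5 * r" unfolding J_def using r by simp
  have "A \<in> sets borel" unfolding A_def by (intro sets.finite_UN) auto
  moreover have "emeasure lborel A \<le> ennreal (6 * 5 ^ ?n * ?v * R powr ((real ?n + 1) / 2))"
  proof -
    have "emeasure lborel A \<le> (\<Sum>j\<le>J. emeasure lborel (cball ((real j * r) *\<^sub>R \<omega>) (5 * r)))"
      unfolding A_def by (rule emeasure_subadditive_finite) auto
    also have "\<dots> = of_nat (J + 1) * ennreal (?v * (5 * r) ^ ?n)"
      using r by (simp add: emeasure_cball_euclidean)
    also have "\<dots> = ennreal (real (J + 1) * (?v * (5 * r) ^ ?n))"
      using r by (subst ennreal_mult) (auto simp: ennreal_of_nat_eq_real_of_nat)
    also have "\<dots> \<le> ennreal ((6 * r) * (?v * (5 * r) ^ ?n))"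
      using r J by (intro ennreal_leI mult_right_mono) auto
    also have "(6 * r) * (?v * (5 * r) ^ ?n) = 6 * 5 ^ ?n * ?v * r ^ (?n + 1)"
      by (simp add: power_mult_distrib mult_ac)
    also have "r ^ (?n + 1) = r powr real (?n + 1)" by (rule powr_realpow[symmetric]) (use r in simp)
    also have "r = R powr (1/2)" unfolding r_def using R by (simp add: powr_half_sqrt)
    finally show ?thesis by (simp add: powr_powr add.commute)
  qed
  moreover have "\<xi> \<in> A" if \<xi>: "norm \<xi> \<le> 5 * R" "norm \<xi> * (norm (sgn \<xi> - \<omega>))\<^sup>2 \<le> 2" for \<xi>
  proof -
    define j where "j = nat \<lfloor>norm \<xi> / r\<rfloor>"
    have jr: "real j \<le> norm \<xi> / r" "norm \<xi> / r < real j + 1" unfolding j_def using r by (auto simp: floor_correct)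
    have "norm \<xi> / r \<le> 5 * r" using \<xi>(1) r by (simp add: pos_divide_le_eq mult.assoc)
    then have "j \<le> J" unfolding j_def J_def by (intro nat_mono floor_mono)
    have "norm (\<xi> - norm \<xi> *\<^sub>R \<omega>) \<le> sqrt (2 * norm \<xi>)" by (rule dist_ray_le[OF \<xi>(2)])
    also have "\<dots> \<le> 4 * r"
    proof (rule real_le_lsqrt)
      have "(4 * r)\<^sup>2 = 16 * R" using r(2) by (simp add: power2_eq_square)
      then show "2 * norm \<xi> \<le> (4 * r)\<^sup>2" using \<xi>(1) R by linarith
    qed (use r in auto)
    finally have 1: "norm (\<xi> - norm \<xi> *\<^sub>R \<omega>) \<le> 4 * r" .
    have "\<bar>norm \<xi> - real j * r\<bar> \<le> r"
      using jr r by (simp add: pos_le_divide_eq pos_divide_less_eq abs_le_iff algebra_simps)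
    then have 2: "norm (norm \<xi> *\<^sub>R \<omega> - (real j * r) *\<^sub>R \<omega>) \<le> r"
      using \<omega> by (simp flip: scaleR_left_diff_distrib)
    have "norm (\<xi> - (real j * r) *\<^sub>R \<omega>) \<le> 5 * r"
      using norm_triangle_ineq[of "\<xi> - norm \<xi> *\<^sub>R \<omega>" "norm \<xi> *\<^sub>R \<omega> - (real j * r) *\<^sub>R \<omega>"] 1 2 by simp
    then have "\<xi> \<in> cball ((real j * r) *\<^sub>R \<omega>) (5 * r)" by (simp add: dist_norm norm_minus_commute)
    with \<open>j \<le> J\<close> show ?thesis unfolding A_def by blast
  qed
  ultimately show ?thesis by (rule that)
qed

text \<open>The unit ball around \<open>4 e\<^sub>1\<close>, dilated by \<open>R\<close>; the centre is chosen such that the origin stays at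
a distance proportional to \<open>R\<close>.\<close>

lemma focusing_support:
  fixes \<theta> :: "'a::euclidean_space \<Rightarrow> real"
  assumes R: "0 < R" and \<theta>: "\<And>\<xi>. 1 < norm \<xi> \<Longrightarrow> \<theta> \<xi> = 0" and nz: "\<theta> (- 4 *\<^sub>R e1 + (1 / R) *\<^sub>R \<xi>) \<noteq> 0"
  shows "3 * R \<le> norm \<xi>" "norm \<xi> \<le> 5 * R"
proof -
  let ?e1 = "e1 :: 'a"
  have "norm (- 4 *\<^sub>R ?e1 + (1 / R) *\<^sub>R \<xi>) \<le> 1" using nz \<theta> by (metis not_le)
  moreover have "norm (4 *\<^sub>R ?e1) = 4" by (simp add: norm_Basis[OF e1_Basis])
  moreover have "norm ((1 / R) *\<^sub>R \<xi>) = norm \<xi> / R" using R by simp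
  moreover have "norm ((1 / R) *\<^sub>R \<xi>) \<le> norm (- 4 *\<^sub>R ?e1 + (1 / R) *\<^sub>R \<xi>) + norm (4 *\<^sub>R ?e1)"
    using norm_triangle_ineq[of "- 4 *\<^sub>R ?e1 + (1 / R) *\<^sub>R \<xi>" "4 *\<^sub>R ?e1"] by simp
  moreover have "norm (4 *\<^sub>R ?e1) \<le> norm ((1 / R) *\<^sub>R \<xi>) + norm (- 4 *\<^sub>R ?e1 + (1 / R) *\<^sub>R \<xi>)"
    using norm_triangle_ineq4[of "(1 / R) *\<^sub>R \<xi>" "- 4 *\<^sub>R ?e1 + (1 / R) *\<^sub>R \<xi>"] by simp
  ultimately have "norm \<xi> / R \<le> 5" "3 \<le> norm \<xi> / R" by linarith+
  then show "3 * R \<le> norm \<xi>" "norm \<xi> \<le> 5 * R" using R by (simp_all add: pos_divide_le_eq pos_le_divide_eq)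
qed

text \<open>The solution is paired with a bump \<open>G\<close> supported in the ball of radius \<open>\<eta> / R\<close>. For frequencies
up to \<open>5 R\<close> the phase \<open>t \<phi>(\<xi>) + x \<bullet> \<xi>\<close> is then at most
\<open>(\<eta> / R) (D + 1) 5 R = 1\<close>, so all contributions to the pairing have real part at least half of
their size. \<open>G\<close> itself serves as the weight, and the function \<open>g\<close> of \<open>Lp_norm_ge\<close> is 1.\<close>

lemma focusing_lower_bound:
  fixes \<theta> \<phi> :: "'a::euclidean_space \<Rightarrow> real"
  assumes \<theta>: "test_fun \<theta>" "\<And>\<xi>. 0 \<le> \<theta> \<xi>" "\<And>\<xi>. 1 < norm \<xi> \<Longrightarrow> \<theta> \<xi> = 0"
    and B1: "0 < B1" "\<And>x. \<theta> x \<le> B1"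
    and w0: "w0 = (LINT x|lborel. \<theta> x)" "0 < w0"
    and sm: "smooth_on (- {0}) \<phi>" and D: "0 < D" "\<And>\<xi>. \<xi> \<noteq> 0 \<Longrightarrow> \<bar>\<phi> \<xi>\<bar> \<le> D * norm \<xi>"
    and p: "2 < p" and R0: "0 < R" and \<eta>: "0 < \<eta>" "5 * \<eta> * (1 + D) = 1"
    and t: "0 \<le> t" "t \<le> \<eta> / R"
  defines "a \<equiv> \<lambda>\<xi>. complex_of_real (\<theta> (- 4 *\<^sub>R e1 + (1 / R) *\<^sub>R \<xi>))" and "cn \<equiv> 1 / (2 * pi) ^ DIM('a)"
  shows "ennreal (\<eta> ^ DIM('a) * w0 / B1 * ((w0 * cn / 2)\<^sup>2 / 2) powr (p / 2) * R powr (real DIM('a) * p - real DIM('a)))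
    \<le> epowr (Lp_norm p (wave_op \<theta>' \<Psi> q s p \<phi> t (distr_of (inv_fourier a)))) p"
proof -
  let ?n = "DIM('a)" and ?e1 = "e1 :: 'a"
  have \<theta>i: "integrable lborel \<theta>" by (rule test_fun_integrable[OF \<theta>(1)])
  have \<theta>m[measurable]: "\<theta> \<in> borel_measurable borel" by (rule test_fun_measurable[OF \<theta>(1)])
  have cn: "0 < cn" unfolding cn_def by simp
  have aS: "a \<in> schwartz"
    unfolding a_def using schwartz_affine[OF test_fun_of_real_schwartz[OF \<theta>(1)], of "1 / R" "- 4 *\<^sub>R ?e1"] R0 by simp
  have asupp: "3 * R \<le> norm \<xi>" "norm \<xi> \<le> 5 * R" if "a \<xi> \<noteq> 0" for \<xi>
    using focusing_support[OF R0, of \<theta> \<xi>] \<theta>(3) that unfolding a_def by auto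
  define G where "G x = \<theta> (0 + (R / \<eta>) *\<^sub>R x) / B1" for x
  have Gb: "0 \<le> G x" "G x \<le> 1" for x unfolding G_def using \<theta>(2) B1 by (auto simp: divide_le_eq)
  have Gm: "G \<in> borel_measurable borel" unfolding G_def[abs_def] by measurable
  have \<psi>: "(\<lambda>x. 1 * of_real (G x)) \<in> schwartz"
    using schwartz_cmult[OF schwartz_affine[OF test_fun_of_real_schwartz[OF \<theta>(1)], of "R / \<eta>" 0], of "of_real (1 / B1)"] R0 \<eta>
    unfolding G_def by simp
  then have \<psi>': "(\<lambda>x. complex_of_real (G x)) \<in> schwartz" by simp
  have Gi: "integrable lborel G"
    using schwartz_integrable[OF \<psi>'] by (simp add: complex_of_real_integrable_eq)
  define W where "W = (LINT x|lborel. G x)"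
  have W: "W = (\<eta> / R) ^ ?n * w0 / B1"
  proof -
    have "W = (LINT x|lborel. \<theta> (0 + (R / \<eta>) *\<^sub>R x)) / B1" unfolding W_def G_def by simp
    also have "(LINT x|lborel. \<theta> (0 + (R / \<eta>) *\<^sub>R x)) = w0 /\<^sub>R \<bar>R / \<eta>\<bar> ^ ?n"
      unfolding w0(1) by (rule integral_affine[OF \<theta>m]) (use R0 \<eta> in simp)
    also have "\<dots> = (\<eta> / R) ^ ?n * w0"
      using R0 \<eta> by (simp add: power_divide)
    finally show ?thesis .
  qed
  have W0: "0 < W" unfolding W using \<eta> R0 w0 B1 by simp
  have nnW: "(\<integral>\<^sup>+x. ennreal (G x) \<partial>lborel) \<le> ennreal W"
    unfolding W_def using Gi Gb by (simp add: nn_integral_eq_integral)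
  have Ia: "(LINT \<xi>|lborel. \<theta> (- 4 *\<^sub>R ?e1 + (1 / R) *\<^sub>R \<xi>)) = R ^ ?n * w0"
    using integral_affine[OF \<theta>m, of "1 / R" "- 4 *\<^sub>R ?e1"] R0 unfolding w0(1)
    by (simp add: power_divide divide_inverse power_inverse mult_ac)
  have iai: "integrable lborel (\<lambda>\<xi>. \<theta> (- 4 *\<^sub>R ?e1 + (1 / R) *\<^sub>R \<xi>))"
    by (rule integrable_affine[OF \<theta>i]) (use R0 in simp)
  define K1 where "K1 = (R ^ ?n * w0) * (cn / 2 * W)"
  have K1: "0 < K1" unfolding K1_def using R0 w0 cn W0 by simp
  have eqK: "K1\<^sup>2 / (2 * W * W) = ((w0 * cn / 2)\<^sup>2 / 2) * (R ^ ?n)\<^sup>2"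
    unfolding K1_def using W0 by (simp add: power2_eq_square field_simps)
  have "(R ^ ?n)\<^sup>2 = R powr (real (?n * 2))" by (subst powr_realpow) (use R0 in \<open>simp_all add: power_mult\<close>)
  then have Rp: "((R ^ ?n)\<^sup>2) powr (p / 2) = R powr (real ?n * p)" by (simp add: powr_powr)
  have "R powr (real ?n * p - real ?n) = R powr (real ?n * p) / R ^ ?n"
    using R0 by (simp add: powr_diff powr_realpow)
  moreover have "(\<eta> / R) ^ ?n * w0 / B1 * (x * y) = \<eta> ^ ?n * w0 / B1 * x * (y / R ^ ?n)" for x y
    using R0 by (simp add: power_divide mult_ac)
  ultimately have Y: "W * (K1\<^sup>2 / (2 * W * W)) powr (p / 2) =
      \<eta> ^ ?n * w0 / B1 * ((w0 * cn / 2)\<^sup>2 / 2) powr (p / 2) * R powr (real ?n * p - real ?n)"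
    unfolding eqK powr_mult Rp unfolding W by simp
  show ?thesis
    unfolding Y[symmetric] wave_op_distr_of[OF inv_fourier_schwartz[OF aS]]
  proof (rule Lp_norm_ge[OF \<psi> _ Gm Gb p K1 W0 W0])
    let ?m = "\<lambda>\<xi>. cis (t * \<phi> \<xi>)" and ?\<psi> = "\<lambda>x. complex_of_real (G x)"
    have [measurable]: "\<phi> \<in> borel_measurable borel" by (rule smooth_off_origin_measurable[OF sm])
    have pt: "cn / 2 * W \<le> Re (?m \<xi> * inv_fourier ?\<psi> \<xi>)" if "a \<xi> \<noteq> 0" for \<xi>
    proof -
      have x: "3 * R \<le> norm \<xi>" "norm \<xi> \<le> 5 * R" using asupp[OF that] by auto
      have "\<xi> \<noteq> 0" using x R0 by auto
      have ci: "integrable lborel (\<lambda>x. cos (t * \<phi> \<xi> + \<xi> \<bullet> x) * G x)"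
        by (rule Bochner_Integration.integrable_bound[OF Gi])
          (use Gm Gb in \<open>auto simp: abs_mult mult_left_le_one_le\<close>)
      have ii: "integrable lborel (\<lambda>x. cis (t * \<phi> \<xi> + \<xi> \<bullet> x) * ?\<psi> x)"
        by (rule integrable_schwartz_times_bounded[OF \<psi>', of _ 1]) auto
      have "?m \<xi> * inv_fourier ?\<psi> \<xi> = of_real cn * (?m \<xi> * (LINT x|lborel. cis (\<xi> \<bullet> x) * ?\<psi> x))"
        unfolding inv_fourier_def cn_def by simp
      also have "?m \<xi> * (LINT x|lborel. cis (\<xi> \<bullet> x) * ?\<psi> x) = (LINT x|lborel. cis (t * \<phi> \<xi> + \<xi> \<bullet> x) * ?\<psi> x)"
        by (subst integral_mult_right_zero[symmetric]) (simp add: cis_mult mult.assoc[symmetric])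
      finally have E: "Re (?m \<xi> * inv_fourier ?\<psi> \<xi>) = cn * Re (LINT x|lborel. cis (t * \<phi> \<xi> + \<xi> \<bullet> x) * ?\<psi> x)" by simp
      have E2: "Re (LINT x|lborel. cis (t * \<phi> \<xi> + \<xi> \<bullet> x) * ?\<psi> x) = (LINT x|lborel. cos (t * \<phi> \<xi> + \<xi> \<bullet> x) * G x)"
        using integral_Re[OF ii] by simp
      have "(LINT x|lborel. 1/2 * G x) \<le> (LINT x|lborel. cos (t * \<phi> \<xi> + \<xi> \<bullet> x) * G x)"
      proof (rule Bochner_Integration.integral_mono[OF integrable_mult_right[OF Gi] ci])
        fix x
        show "1/2 * G x \<le> cos (t * \<phi> \<xi> + \<xi> \<bullet> x) * G x"
        proof (cases "G x = 0")
          case False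
          have "norm ((R / \<eta>) *\<^sub>R x) \<le> 1"
          proof (rule ccontr)
            assume "\<not> norm ((R / \<eta>) *\<^sub>R x) \<le> 1"
            then have "\<theta> ((R / \<eta>) *\<^sub>R x) = 0" by (intro \<theta>(3)) (simp only: not_le)
            with False show False by (simp add: G_def)
          qed
          then have nx: "norm x \<le> \<eta> / R" using R0 \<eta> by (simp add: field_simps)
          have "\<bar>t * \<phi> \<xi>\<bar> \<le> (\<eta> / R) * (D * (5 * R))"
          proof -
            have "D * norm \<xi> \<le> D * (5 * R)" using D x by (intro mult_left_mono) auto
            with D(2)[OF \<open>\<xi> \<noteq> 0\<close>] have "\<bar>\<phi> \<xi>\<bar> \<le> D * (5 * R)" by linarith
            then show ?thesis unfolding abs_mult using t by (intro mult_mono) auto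
          qed
          moreover have "\<bar>\<xi> \<bullet> x\<bar> \<le> (5 * R) * (\<eta> / R)"
            by (rule order_trans[OF Cauchy_Schwarz_ineq2 mult_mono]) (use x nx R0 in auto)
          moreover have "(\<eta> / R) * (D * (5 * R)) + (5 * R) * (\<eta> / R) = 5 * \<eta> * (1 + D)"
            using R0 by (simp add: field_simps)
          ultimately have "\<bar>t * \<phi> \<xi> + \<xi> \<bullet> x\<bar> \<le> 1" using \<eta>(2) abs_triangle_ineq[of "t * \<phi> \<xi>" "\<xi> \<bullet> x"] by linarith
          then show ?thesis by (intro mult_right_mono cos_ge_half Gb)
        qed simp
      qed
      then have "cn * (1/2 * W) \<le> cn * (LINT x|lborel. cos (t * \<phi> \<xi> + \<xi> \<bullet> x) * G x)"
        unfolding W_def integral_mult_right_zero using cn by (intro mult_left_mono) auto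
      then show ?thesis unfolding E E2 by simp
    qed
    have inv: "inv_fourier ?\<psi> \<in> schwartz" by (rule inv_fourier_schwartz[OF \<psi>'])
    have int: "integrable lborel (\<lambda>\<xi>. (?m \<xi> * a \<xi>) * inv_fourier ?\<psi> \<xi>)"
      using integrable_schwartz_times_bounded[OF schwartz_mult[OF aS inv], of ?m 1] by (simp add: mult.assoc)
    have "K1 = (LINT \<xi>|lborel. \<theta> (- 4 *\<^sub>R ?e1 + (1 / R) *\<^sub>R \<xi>) * (cn / 2 * W))"
      unfolding K1_def integral_mult_left_zero Ia ..
    also have "\<dots> \<le> (LINT \<xi>|lborel. Re ((?m \<xi> * a \<xi>) * inv_fourier ?\<psi> \<xi>))"
    proof (rule Bochner_Integration.integral_mono[OF integrable_mult_left[OF iai] integrable_Re[OF int]])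
      fix \<xi> :: 'a
      have eq: "Re ((?m \<xi> * a \<xi>) * inv_fourier ?\<psi> \<xi>) = \<theta> (- 4 *\<^sub>R ?e1 + (1 / R) *\<^sub>R \<xi>) * Re (?m \<xi> * inv_fourier ?\<psi> \<xi>)"
        unfolding a_def by (simp add: algebra_simps)
      show "\<theta> (- 4 *\<^sub>R ?e1 + (1 / R) *\<^sub>R \<xi>) * (cn / 2 * W) \<le> Re ((?m \<xi> * a \<xi>) * inv_fourier ?\<psi> \<xi>)"
      proof (cases "a \<xi> = 0")
        case True
        then show ?thesis unfolding a_def by simp
      next
        case False
        show ?thesis unfolding eq by (rule mult_left_mono[OF pt[OF False] \<theta>(2)])
      qed
    qed
    also have "\<dots> = Re (LINT \<xi>|lborel. (?m \<xi> * a \<xi>) * inv_fourier ?\<psi> \<xi>)" by (rule integral_Re[OF int])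
    also have "\<dots> \<le> norm (LINT \<xi>|lborel. (?m \<xi> * a \<xi>) * inv_fourier ?\<psi> \<xi>)" by (rule complex_Re_le_cmod)
    also have "(LINT \<xi>|lborel. (?m \<xi> * a \<xi>) * inv_fourier ?\<psi> \<xi>) =
       (LINT x|lborel. multiplier_fun ?m (inv_fourier a) x * (1 * of_real (G x)))"
      using wave_op_pairing[OF sm aS \<psi>', of t] by simp
    finally show "K1 \<le> norm (LINT x|lborel. multiplier_fun ?m (inv_fourier a) x * (1 * of_real (G x)))" .
  qed (use nnW in simp_all)
qed

text \<open>The lower bound holds up to time \<open>\<eta> / R\<close>, which costs one power of \<open>R\<close>. With the volume
\<open>R powr ((n + 1) / 2)\<close> of a sector, comparing exponents gives
\<open>n p - n - 1 \<le> ((n - 1) / 4 + s) p + (p - 1) (n + 1) / 2\<close>, which is the claim.\<close>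

lemma focusing_exponent:
  fixes \<theta> \<Psi> \<phi> :: "'a::euclidean_space \<Rightarrow> real" and q :: "'a \<Rightarrow> complex"
  assumes F: "FIO_cutoffs \<theta> \<Psi> q" and sm: "smooth_on (- {0}) \<phi>" and hom: "positively_homogeneous1 \<phi>"
    and p: "2 < p" and C: "0 \<le> C"
    and hyp: "\<And>f. f \<in> HspFIO \<theta> \<Psi> q s p \<Longrightarrow>
      epowr (\<integral>\<^sup>+t\<in>{0..1}. epowr (Lp_norm p (wave_op \<theta> \<Psi> q s p \<phi> t f)) p \<partial>lborel) (1 / p)
        \<le> ennreal C * HspFIO_norm \<theta> \<Psi> q s p f"
  shows "s_exp DIM('a) p - 1 / p \<le> s"
proof -
  let ?n = "DIM('a)" and ?e1 = "e1 :: 'a"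
  define e where "e = (real ?n - 1) / 4"
  note \<theta> = FIO_cutoffsD[OF F]
  have \<theta>i: "integrable lborel \<theta>" by (rule test_fun_integrable[OF \<theta>(1)])
  obtain B1 where B1: "0 < B1" "\<And>x. norm (\<theta> x) \<le> B1" using test_fun_bounded[OF \<theta>(1)] by blast
  have B1': "\<theta> x \<le> B1" for x using B1(2)[of x] by simp
  obtain D where D: "0 < D" "\<And>\<xi>. \<xi> \<noteq> 0 \<Longrightarrow> \<bar>\<phi> \<xi>\<bar> \<le> D * norm \<xi>" using homogeneous_phase_bound[OF sm hom] by blast
  obtain \<delta> where \<delta>: "0 < \<delta>" "\<And>x. norm x < \<delta> \<Longrightarrow> \<theta> x = 1" using FIO_cutoffs_bump[OF F] by blast
  define w0 where "w0 = (LINT x|lborel. \<theta> x)"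
  have w0: "0 < w0" unfolding w0_def by (rule integral_pos_near_0[OF \<theta>i \<theta>(2), of 1 \<delta>]) (use \<delta> in auto)
  obtain K0 R0 where K0: "0 < K0" and R01: "1 \<le> R0" and upper:
    "\<And>R V a. R0 \<le> R \<Longrightarrow> 0 < V \<Longrightarrow> a \<in> schwartz \<Longrightarrow> (\<And>\<xi>. norm (a \<xi>) \<le> B1) \<Longrightarrow>
      (\<And>\<xi>::'a. a \<xi> \<noteq> 0 \<Longrightarrow> R / 5 \<le> norm \<xi> \<and> norm \<xi> \<le> 5 * R) \<Longrightarrow>
      (\<And>\<omega>. norm \<omega> = 1 \<Longrightarrow> \<exists>A\<in>sets borel. emeasure lborel A \<le> ennreal V \<and>
        (\<forall>\<xi>. a \<xi> \<noteq> 0 \<longrightarrow> norm \<xi> * (norm (sgn \<xi> - \<omega>))\<^sup>2 \<le> 2 \<longrightarrow> \<xi> \<in> A)) \<Longrightarrow>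
      distr_of (inv_fourier a) \<in> HspFIO \<theta> \<Psi> q s p \<and>
      epowr (HspFIO_norm \<theta> \<Psi> q s p (distr_of (inv_fourier a))) p \<le> ennreal (K0 * R powr ((e + s) * p) * V powr (p - 1))"
    unfolding e_def by (rule annular_HspFIO_norm_le[OF F less_imp_le[OF p] _ B1(1), of 5 s]) auto
  obtain m0 :: nat where m0: "R0 \<le> real m0" using real_arch_simple by blast
  define \<eta> where "\<eta> = 1 / (5 * (1 + D))"
  have \<eta>: "0 < \<eta>" "\<eta> \<le> 1" "5 * \<eta> * (1 + D) = 1" unfolding \<eta>_def using D by auto
  define cn where "cn = 1 / (2 * pi) ^ ?n"
  define V0 where "V0 = 6 * 5 ^ ?n * measure lborel (cball 0 1 :: 'a set)"
  have V0: "0 < V0" unfolding V0_def using content_cball_pos[of 1 "0::'a"] by simp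
  define k where "k = \<eta> ^ ?n * w0 / B1 * ((w0 * cn / 2)\<^sup>2 / 2) powr (p / 2)"
  have k: "0 < k" unfolding k_def cn_def using \<eta> w0 B1 by simp
  have main: "(\<eta> * k) * real m powr (real ?n * p - real ?n - 1)
      \<le> (C powr p * (K0 * V0 powr (p - 1))) * real m powr ((e + s) * p + (real ?n + 1) / 2 * (p - 1))"
    if m: "m0 \<le> m" for m
  proof -
    define R where "R = real m"
    have R: "R0 \<le> R" unfolding R_def using m0 m by linarith
    have R1: "1 \<le> R" "0 < R" using R R01 by auto
    define a where "a = (\<lambda>\<xi>. complex_of_real (\<theta> (- 4 *\<^sub>R ?e1 + (1 / R) *\<^sub>R \<xi>)))"
    define V where "V = V0 * R powr ((real ?n + 1) / 2)"
    have V: "0 < V" unfolding V_def using V0 R1 by simp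
    have aS: "a \<in> schwartz"
      unfolding a_def using schwartz_affine[OF test_fun_of_real_schwartz[OF \<theta>(1)], of "1 / R" "- 4 *\<^sub>R ?e1"] R1 by simp
    have asupp: "3 * R \<le> norm \<xi>" "norm \<xi> \<le> 5 * R" if "a \<xi> \<noteq> 0" for \<xi>
      using focusing_support[OF R1(2), of \<theta> \<xi>] \<theta>(3) that unfolding a_def by auto
    have U: "distr_of (inv_fourier a) \<in> HspFIO \<theta> \<Psi> q s p \<and>
        epowr (HspFIO_norm \<theta> \<Psi> q s p (distr_of (inv_fourier a))) p \<le> ennreal (K0 * R powr ((e + s) * p) * V powr (p - 1))"
    proof (rule upper[OF R V aS])
      show "norm (a \<xi>) \<le> B1" for \<xi> unfolding a_def using B1(2) by simp
      show "R / 5 \<le> norm \<xi> \<and> norm \<xi> \<le> 5 * R" if "a \<xi> \<noteq> 0" for \<xi> using asupp[OF that] R1 by simp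
      show "\<exists>A\<in>sets borel. emeasure lborel A \<le> ennreal V \<and>
          (\<forall>\<xi>. a \<xi> \<noteq> 0 \<longrightarrow> norm \<xi> * (norm (sgn \<xi> - \<omega>))\<^sup>2 \<le> 2 \<longrightarrow> \<xi> \<in> A)" if "norm \<omega> = 1" for \<omega>
        using sector_cover[OF R1(1) that] asupp unfolding V_def V0_def by (metis (no_types, lifting))
    qed
    have "\<eta> / R * (k * R powr (real ?n * p - real ?n)) \<le> C powr p * (K0 * R powr ((e + s) * p) * V powr (p - 1))"
    proof (rule testing_inequality[OF _ C _ _ _ _ hyp _ conjunct2[OF U]])
      show "\<eta> / R \<le> 1" using \<eta> R1 by (simp add: divide_le_eq)
      show "distr_of (inv_fourier a) \<in> HspFIO \<theta> \<Psi> q s p" using U by blast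
      show "ennreal (k * R powr (real ?n * p - real ?n)) \<le> epowr (Lp_norm p (wave_op \<theta> \<Psi> q s p \<phi> t (distr_of (inv_fourier a)))) p"
        if "0 \<le> t" "t \<le> \<eta> / R" for t
        unfolding k_def cn_def a_def
        by (rule focusing_lower_bound[OF \<theta>(1,2,3) B1(1) B1' w0_def w0 sm D p R1(2) \<eta>(1,3) that])
    qed (use p \<eta> R1 k K0 in auto)
    also have "\<eta> / R * (k * R powr (real ?n * p - real ?n)) = (\<eta> * k) * R powr (real ?n * p - real ?n - 1)"
      using R1 by (simp add: powr_diff mult_ac)
    also have "C powr p * (K0 * R powr ((e + s) * p) * V powr (p - 1)) =
        (C powr p * (K0 * V0 powr (p - 1))) * R powr ((e + s) * p + (real ?n + 1) / 2 * (p - 1))"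
      unfolding V_def powr_mult powr_powr powr_add by (simp only: mult_ac)
    finally show ?thesis unfolding R_def .
  qed
  have "real ?n * p - real ?n - 1 \<le> (e + s) * p + (real ?n + 1) / 2 * (p - 1)"
    by (rule exponent_le_if_powr_le[OF mult_pos_pos[OF \<eta>(1) k] main])
  then have "(real ?n - 1) / 2 * (p / 2 - 1) - 1 \<le> s * p" unfolding e_def by (simp add: field_simps)
  then have "((real ?n - 1) / 2 * (p / 2 - 1) - 1) / p \<le> s" using p by (simp add: pos_divide_le_eq)
  moreover have "s_exp ?n p - 1 / p = ((real ?n - 1) / 2 * (p / 2 - 1) - 1) / p"
  proof -
    have "\<bar>1 / 2 - 1 / p\<bar> = 1 / 2 - 1 / p" using p by (simp add: field_simps)
    then show ?thesis unfolding s_exp_def using p by (simp add: field_simps)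
  qed
  ultimately show ?thesis by simp
qed

section \<open>The example with packets in all directions\<close>

text \<open>A piece of a square lattice with spacing \<open>M\<close> in the hyperplane at height \<open>M\<^sup>2\<close>. With
\<open>R = M\<^sup>2\<close>, the points have norm comparable to \<open>R\<close> and directions separated by about
\<open>1 / sqrt R\<close>, which is the aperture of the sectors. The points of a hyperplane are easier to count than
points on a sphere.\<close>

definition lattice_freqs :: "nat \<Rightarrow> 'a::euclidean_space set" where
  "lattice_freqs M = {\<zeta>. \<zeta> \<bullet> e1 = (real M)\<^sup>2 \<and> (\<forall>b\<in>Basis - {e1}. \<exists>j<M. \<zeta> \<bullet> b = real M * real j)}"

lemma lattice_freqs_card:
  assumes M: "0 < M"
  shows "finite (lattice_freqs M :: 'a::euclidean_space set)"
    and "card (lattice_freqs M :: 'a set) = M ^ (DIM('a) - 1)"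
proof -
  let ?I = "Basis - {e1 :: 'a}" and ?P = "PiE (Basis - {e1 :: 'a}) (\<lambda>_. {..<M})"
  define f where "f k = (\<Sum>b\<in>Basis. (if b = (e1::'a) then (real M)\<^sup>2 else real M * real (k b)) *\<^sub>R b)" for k
  have fb: "f k \<bullet> b = (if b = e1 then (real M)\<^sup>2 else real M * real (k b))" if "b \<in> Basis" for k b
    unfolding f_def using that by (simp add: inner_sum_left_Basis)
  have E: "(e1::'a) \<in> Basis" by (rule e1_Basis)
  have img: "f ` ?P = lattice_freqs M"
  proof (intro equalityI subsetI)
    fix \<zeta> assume "\<zeta> \<in> f ` ?P"
    then show "\<zeta> \<in> lattice_freqs M" unfolding lattice_freqs_def by (auto simp: fb E PiE_def Pi_def)
  next
    fix \<zeta> :: 'a assume z: "\<zeta> \<in> lattice_freqs M"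
    then have "\<forall>b\<in>?I. \<exists>j<M. \<zeta> \<bullet> b = real M * real j" unfolding lattice_freqs_def by blast
    then obtain k where k: "\<And>b. b \<in> ?I \<Longrightarrow> k b < M \<and> \<zeta> \<bullet> b = real M * real (k b)" by metis
    have "f (restrict k ?I) = \<zeta>"
    proof (rule euclidean_eqI)
      fix b :: 'a assume b: "b \<in> Basis"
      show "f (restrict k ?I) \<bullet> b = \<zeta> \<bullet> b"
        using k[of b] z b by (auto simp: fb[OF b] lattice_freqs_def)
    qed
    moreover have "restrict k ?I \<in> ?P" using k by auto
    ultimately show "\<zeta> \<in> f ` ?P" by (metis imageI)
  qed
  have inj: "inj_on f ?P"
  proof (rule inj_onI)
    fix k l assume kl: "k \<in> ?P" "l \<in> ?P" "f k = f l"
    show "k = l"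
    proof (rule PiE_ext[OF kl(1,2)])
      fix b assume b: "b \<in> ?I"
      then have "f k \<bullet> b = f l \<bullet> b" using kl by simp
      then show "k b = l b" using b M by (simp add: fb)
    qed
  qed
  show "finite (lattice_freqs M :: 'a set)" unfolding img[symmetric] by (intro finite_imageI finite_PiE) auto
  show "card (lattice_freqs M :: 'a set) = M ^ (DIM('a) - 1)"
    unfolding img[symmetric] card_image[OF inj] by (subst card_PiE) (simp_all add: E card_Diff_singleton)
qed

lemma lattice_freqs_norm:
  assumes z: "\<zeta> \<in> (lattice_freqs M :: 'a::euclidean_space set)"
  shows "(real M)\<^sup>2 \<le> norm \<zeta>" "norm \<zeta> \<le> real DIM('a) * (real M)\<^sup>2"
proof -
  have z1: "\<zeta> \<bullet> e1 = (real M)\<^sup>2" using z by (simp add: lattice_freqs_def)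
  show "(real M)\<^sup>2 \<le> norm \<zeta>" using Basis_le_norm[OF e1_Basis, of \<zeta>] z1 by simp
  have "norm \<zeta> \<le> (\<Sum>b\<in>Basis. \<bar>\<zeta> \<bullet> b\<bar>)" by (rule norm_le_l1)
  also have "\<dots> \<le> (\<Sum>b\<in>(Basis :: 'a set). (real M)\<^sup>2)"
  proof (rule sum_mono)
    fix b :: 'a assume b: "b \<in> Basis"
    show "\<bar>\<zeta> \<bullet> b\<bar> \<le> (real M)\<^sup>2"
    proof (cases "b = e1")
      case False
      with z b obtain j where j: "j < M" "\<zeta> \<bullet> b = real M * real j" unfolding lattice_freqs_def by blast
      have "real M * real j \<le> real M * real M" using j by (intro mult_left_mono) auto
      then show ?thesis using j(2) by (simp add: power2_eq_square)
    qed (use z1 in simp)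
  qed
  also have "\<dots> = real DIM('a) * (real M)\<^sup>2" by simp
  finally show "norm \<zeta> \<le> real DIM('a) * (real M)\<^sup>2" .
qed

lemma lattice_freqs_diff:
  assumes z: "\<zeta> \<in> (lattice_freqs M :: 'a::euclidean_space set)" "\<zeta>' \<in> lattice_freqs M" and b: "b \<in> Basis"
  obtains i :: int where "(\<zeta> - \<zeta>') \<bullet> b = real M * of_int i"
proof (cases "b = e1")
  case True
  then have "(\<zeta> - \<zeta>') \<bullet> b = real M * of_int 0" using z by (simp add: lattice_freqs_def inner_diff_left)
  then show ?thesis by (rule that)
next
  case False
  with z b obtain j j' where "\<zeta> \<bullet> b = real M * real j" "\<zeta>' \<bullet> b = real M * real j'"
    unfolding lattice_freqs_def by blast
  then have "(\<zeta> - \<zeta>') \<bullet> b = real M * of_int (int j - int j')" by (simp add: inner_diff_left right_diff_distrib)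
  then show ?thesis by (rule that)
qed

lemma lattice_freqs_separated:
  assumes z: "\<zeta> \<in> (lattice_freqs M :: 'a::euclidean_space set)" "\<zeta>' \<in> lattice_freqs M" "\<zeta> \<noteq> \<zeta>'"
  shows "real M \<le> norm (\<zeta> - \<zeta>')"
proof -
  obtain b where b: "b \<in> Basis" "\<zeta> \<bullet> b \<noteq> \<zeta>' \<bullet> b" using z(3) by (metis euclidean_eqI)
  obtain i where i: "(\<zeta> - \<zeta>') \<bullet> b = real M * of_int i" by (rule lattice_freqs_diff[OF z(1,2) b(1)])
  then have "i \<noteq> 0" using b(2) by (auto simp: inner_diff_left)
  then have "1 \<le> \<bar>real_of_int i\<bar>" by linarith
  then have "real M * 1 \<le> real M * \<bar>real_of_int i\<bar>" by (intro mult_left_mono) auto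
  also have "\<dots> = \<bar>(\<zeta> - \<zeta>') \<bullet> b\<bar>" unfolding i by (simp add: abs_mult)
  also have "\<dots> \<le> norm (\<zeta> - \<zeta>')" by (rule Basis_le_norm[OF b(1)])
  finally show ?thesis by simp
qed

text \<open>Both points are within \<open>3 n M\<close> of the ray in direction \<open>\<omega>\<close>. As they lie at the same height
\<open>M\<^sup>2\<close>, and the ray crosses this hyperplane at an angle bounded below (this is \<open>w\<close> in the proof),
the feet on the ray are close to each other, and so are the points.\<close>

lemma lattice_freqs_sector_close:
  fixes \<omega> :: "'a::euclidean_space"
  assumes M: "6 * DIM('a) \<le> M"
    and z: "\<zeta> \<in> lattice_freqs M" "norm (\<xi> - \<zeta>) \<le> 1" "norm \<xi> * (norm (sgn \<xi> - \<omega>))\<^sup>2 \<le> 2"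
    and z': "\<zeta>' \<in> lattice_freqs M" "norm (\<xi>' - \<zeta>') \<le> 1" "norm \<xi>' * (norm (sgn \<xi>' - \<omega>))\<^sup>2 \<le> 2"
    and \<omega>: "norm \<omega> = 1"
  shows "norm (\<zeta> - \<zeta>') \<le> real (30 * DIM('a) ^ 2) * real M"
proof -
  define n where "n = real DIM('a)"
  have n: "1 \<le> n" unfolding n_def using DIM_positive[where 'a='a] by (simp add: Suc_leI)
  have Mr: "6 * n \<le> real M" unfolding n_def using M by (metis of_nat_le_iff of_nat_mult of_nat_numeral)
  have M1: "1 \<le> real M" using Mr n by linarith
  have near: "norm (\<zeta> - norm \<xi> *\<^sub>R \<omega>) \<le> 3 * n * real M \<and> norm \<xi> \<le> 2 * n * (real M)\<^sup>2"
    if z: "\<zeta> \<in> lattice_freqs M" "norm (\<xi> - \<zeta>) \<le> 1" "norm \<xi> * (norm (sgn \<xi> - \<omega>))\<^sup>2 \<le> 2" for \<zeta> \<xi> :: 'a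
  proof -
    have M2: "1 \<le> (real M)\<^sup>2" using M1 by (simp add: one_le_power)
    have nM2: "1 * 1 \<le> n * (real M)\<^sup>2" using n M2 by (intro mult_mono) auto
    have nM: "1 * 1 \<le> n * real M" using n M1 by (intro mult_mono) auto
    have x: "norm \<xi> \<le> 2 * n * (real M)\<^sup>2"
      using norm_triangle_ineq2[of \<xi> \<zeta>] z(2) lattice_freqs_norm(2)[OF z(1)] nM2 unfolding n_def[symmetric] by linarith
    have "norm (\<xi> - norm \<xi> *\<^sub>R \<omega>) \<le> sqrt (2 * norm \<xi>)" by (rule dist_ray_le[OF z(3)])
    also have "\<dots> \<le> 2 * n * real M"
    proof (rule real_le_lsqrt)
      have "n * (real M)\<^sup>2 * 1 \<le> n * (real M)\<^sup>2 * n" using n by (intro mult_left_mono) auto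
      then have "4 * n * (real M)\<^sup>2 \<le> (2 * n * real M)\<^sup>2" by (simp add: power2_eq_square mult_ac)
      then show "2 * norm \<xi> \<le> (2 * n * real M)\<^sup>2" using x by linarith
    qed (use n in auto)
    finally have "norm (\<xi> - norm \<xi> *\<^sub>R \<omega>) \<le> 2 * n * real M" .
    moreover have "norm (\<zeta> - norm \<xi> *\<^sub>R \<omega>) \<le> norm (\<zeta> - \<xi>) + norm (\<xi> - norm \<xi> *\<^sub>R \<omega>)"
      using norm_triangle_ineq[of "\<zeta> - \<xi>" "\<xi> - norm \<xi> *\<^sub>R \<omega>"] by simp
    ultimately show ?thesis using x z(2) nM by (simp add: norm_minus_commute)
  qed
  note N = near[OF z] note N' = near[OF z']
  let ?w = "\<omega> \<bullet> e1"
  have comp: "\<bar>(real M)\<^sup>2 - norm \<xi> * ?w\<bar> \<le> 3 * n * real M"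
    if "\<zeta> \<in> lattice_freqs M" "norm (\<zeta> - norm \<xi> *\<^sub>R \<omega>) \<le> 3 * n * real M" for \<zeta> \<xi> :: 'a
    using Basis_le_norm[OF e1_Basis, of "\<zeta> - norm \<xi> *\<^sub>R \<omega>"] that by (simp add: inner_diff_left lattice_freqs_def)
  have c: "\<bar>(real M)\<^sup>2 - norm \<xi> * ?w\<bar> \<le> 3 * n * real M" using comp z(1) N by blast
  have c': "\<bar>(real M)\<^sup>2 - norm \<xi>' * ?w\<bar> \<le> 3 * n * real M" using comp z'(1) N' by blast
  have "6 * n * real M \<le> (real M)\<^sup>2" unfolding power2_eq_square using Mr by (intro mult_right_mono) auto
  then have xw: "(real M)\<^sup>2 / 2 \<le> norm \<xi> * ?w" using c by (simp add: abs_le_iff)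
  have Mp: "0 < (real M)\<^sup>2" using M1 by simp
  have wpos: "0 < ?w"
  proof (rule ccontr)
    assume "\<not> 0 < ?w"
    then have "norm \<xi> * ?w \<le> 0" by (intro mult_nonneg_nonpos) auto
    then show False using xw Mp by linarith
  qed
  (* The ray is transversal to the hyperplane: its direction has a component of at least 1/(4n) along e1. *)
  have "norm \<xi> * ?w \<le> 2 * n * (real M)\<^sup>2 * ?w" using N wpos by (intro mult_right_mono) auto
  then have "(real M)\<^sup>2 * 1 \<le> (real M)\<^sup>2 * (4 * n * ?w)" using xw by (simp add: mult_ac)
  then have w: "1 \<le> 4 * n * ?w" using Mp by (simp only: mult_le_cancel_left_pos)
  have "\<bar>norm \<xi> - norm \<xi>'\<bar> * ?w = \<bar>norm \<xi> * ?w - norm \<xi>' * ?w\<bar>"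
    using wpos by (simp add: abs_mult flip: left_diff_distrib)
  also have "\<dots> \<le> 6 * n * real M" using c c' by linarith
  finally have d: "\<bar>norm \<xi> - norm \<xi>'\<bar> * ?w \<le> 6 * n * real M" .
  have "\<bar>norm \<xi> - norm \<xi>'\<bar> * 1 \<le> \<bar>norm \<xi> - norm \<xi>'\<bar> * (4 * n * ?w)" using w by (intro mult_left_mono) auto
  also have "\<dots> = 4 * n * (\<bar>norm \<xi> - norm \<xi>'\<bar> * ?w)" by simp
  also have "\<dots> \<le> 4 * n * (6 * n * real M)" using d n by (intro mult_left_mono) auto
  finally have d': "\<bar>norm \<xi> - norm \<xi>'\<bar> \<le> 24 * (n * n) * real M" by (simp add: mult_ac)
  have "\<zeta> - \<zeta>' = (\<zeta> - norm \<xi> *\<^sub>R \<omega>) + ((norm \<xi> - norm \<xi>') *\<^sub>R \<omega> - (\<zeta>' - norm \<xi>' *\<^sub>R \<omega>))"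
    by (simp add: scaleR_left_diff_distrib)
  then have "norm (\<zeta> - \<zeta>') \<le> norm (\<zeta> - norm \<xi> *\<^sub>R \<omega>) + (norm ((norm \<xi> - norm \<xi>') *\<^sub>R \<omega>) + norm (\<zeta>' - norm \<xi>' *\<^sub>R \<omega>))"
    using norm_triangle_ineq[of "\<zeta> - norm \<xi> *\<^sub>R \<omega>" "(norm \<xi> - norm \<xi>') *\<^sub>R \<omega> - (\<zeta>' - norm \<xi>' *\<^sub>R \<omega>)"]
      norm_triangle_ineq4[of "(norm \<xi> - norm \<xi>') *\<^sub>R \<omega>" "\<zeta>' - norm \<xi>' *\<^sub>R \<omega>"] by (simp only:)
  also have "\<dots> \<le> 6 * n * real M + 24 * (n * n) * real M" using N N' d' \<omega> by simp
  also have "6 * n * real M \<le> 6 * (n * n) * real M" using n by (intro mult_right_mono) (auto simp: mult_le_cancel_left1)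
  finally show ?thesis unfolding n_def by (simp add: power2_eq_square mult_ac)
qed

text \<open>The differences are lattice vectors of length at most a constant times the spacing; each of their
coordinates takes boundedly many values.\<close>

lemma lattice_freqs_sector_card:
  fixes \<omega> :: "'a::euclidean_space"
  assumes M: "6 * DIM('a) \<le> M" and \<omega>: "norm \<omega> = 1"
  shows "card {\<zeta> \<in> lattice_freqs M. \<exists>\<xi>. norm (\<xi> - \<zeta>) \<le> 1 \<and> norm \<xi> * (norm (sgn \<xi> - \<omega>))\<^sup>2 \<le> 2}
     \<le> (60 * DIM('a) ^ 2 + 1) ^ DIM('a)" (is "card ?S \<le> _")
proof (cases "?S = {}")
  case True then show ?thesis by (simp only: card.empty)
next
  case False
  then obtain \<zeta>0 where z0: "\<zeta>0 \<in> ?S" by blast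
  have M0: "0 < M" using M DIM_positive[where 'a='a] by linarith
  let ?H = "int (30 * DIM('a) ^ 2)"
  let ?T = "PiE (Basis :: 'a set) (\<lambda>_. real_of_int ` {- ?H..?H})"
  let ?f = "\<lambda>\<zeta>. \<lambda>b\<in>Basis. (\<zeta> - \<zeta>0) \<bullet> b / real M"
  have "inj_on ?f ?S"
  proof (rule inj_onI)
    fix \<zeta> \<zeta>' assume eq: "?f \<zeta> = ?f \<zeta>'"
    show "\<zeta> = \<zeta>'"
    proof (rule euclidean_eqI)
      fix b :: 'a assume "b \<in> Basis"
      then show "\<zeta> \<bullet> b = \<zeta>' \<bullet> b" using fun_cong[OF eq, of b] M0 by (simp add: inner_diff_left)
    qed
  qed
  moreover have "?f ` ?S \<subseteq> ?T"
  proof (intro image_subsetI PiE_I)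
    fix \<zeta> b assume \<zeta>: "\<zeta> \<in> ?S" and b: "b \<in> (Basis :: 'a set)"
    have l: "\<zeta> \<in> lattice_freqs M" "\<zeta>0 \<in> lattice_freqs M" using \<zeta> z0 by auto
    obtain i where i: "(\<zeta> - \<zeta>0) \<bullet> b = real M * of_int i" by (rule lattice_freqs_diff[OF l b])
    have "norm (\<zeta> - \<zeta>0) \<le> real (30 * DIM('a) ^ 2) * real M"
      using \<zeta> z0 lattice_freqs_sector_close[OF M _ _ _ _ _ _ \<omega>] by blast
    then have "\<bar>real M * of_int i\<bar> \<le> real (30 * DIM('a) ^ 2) * real M"
      using Basis_le_norm[OF b, of "\<zeta> - \<zeta>0"] unfolding i by linarith
    then have "real M * \<bar>real_of_int i\<bar> \<le> real M * real_of_int ?H" by (simp add: abs_mult mult.commute)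
    then have "\<bar>real_of_int i\<bar> \<le> real_of_int ?H" using M0 by (simp only: mult_le_cancel_left_pos of_nat_0_less_iff)
    then have "\<bar>i\<bar> \<le> ?H" by linarith
    then have "i \<in> {- ?H..?H}" by (simp add: abs_le_iff)
    then show "?f \<zeta> b \<in> real_of_int ` {- ?H..?H}" using i b M0 by simp
  qed auto
  moreover have "finite ?T" by (intro finite_PiE) auto
  ultimately have "card ?S \<le> card ?T" by (rule card_inj_on_le)
  also have "\<dots> = (card (real_of_int ` {- ?H..?H})) ^ DIM('a)" by (simp add: card_PiE)
  also have "card (real_of_int ` {- ?H..?H}) = 60 * DIM('a) ^ 2 + 1"
    by (subst card_image) (auto simp: inj_on_def nat_add_distrib nat_mult_distrib nat_power_eq)
  finally show ?thesis .
qed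

lemma integral_cis_gauss_scaled:
  fixes \<eta> :: "'a::euclidean_space"
  assumes L: "0 < L"
  shows "(LINT x|lborel. cis (x \<bullet> \<eta>) * gauss ((1 / L) *\<^sub>R x)) =
    of_real (sqrt (2 * pi) ^ DIM('a) * L ^ DIM('a) * exp (- (L * norm \<eta>)\<^sup>2 / 2))"
proof -
  let ?e = "\<lambda>y. cis (- (y \<bullet> (- (L *\<^sub>R \<eta>)))) * gauss y"
  have m: "?e \<in> borel_measurable borel" using schwartz_measurable[OF gauss_schwartz] by (intro borel_measurable_times) measurable
  have "(LINT x|lborel. cis (x \<bullet> \<eta>) * gauss ((1 / L) *\<^sub>R x)) = (LINT x|lborel. ?e (0 + (1 / L) *\<^sub>R x))"
    using L by simp
  also have "\<dots> = (LINT x|lborel. ?e x) /\<^sub>R \<bar>1 / L\<bar> ^ DIM('a)" by (rule integral_affine[OF m]) (use L in simp)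
  also have "(LINT x|lborel. ?e x) = fourier gauss (- (L *\<^sub>R \<eta>))" by (simp add: fourier_def)
  also have "\<dots> = of_real (sqrt (2 * pi) ^ DIM('a) * exp (- (L * norm \<eta>)\<^sup>2 / 2))"
    using L by (simp add: fourier_gauss gauss_def)
  also have "\<dots> /\<^sub>R \<bar>1 / L\<bar> ^ DIM('a) = of_real (sqrt (2 * pi) ^ DIM('a) * L ^ DIM('a) * exp (- (L * norm \<eta>)\<^sup>2 / 2))"
    using L by (simp add: scaleR_conv_of_real power_one_over mult_ac)
  finally show ?thesis .
qed

lemma sum_at_most_one:
  fixes f :: "'b \<Rightarrow> 'c::comm_monoid_add"
  assumes "finite Z" "z \<in> Z" "\<And>y. y \<in> Z \<Longrightarrow> y \<noteq> z \<Longrightarrow> f y = 0"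
  shows "sum f Z = f z"
  using assms by (subst sum.remove[of Z z]) auto

text \<open>Decay at this rate suffices, because \<open>L\<close> may be chosen as large as needed after the number of
frequencies is fixed.\<close>

lemma exp_neg_half_square_le:
  fixes L :: real
  assumes "1 \<le> L" shows "exp (- L\<^sup>2 / 2) \<le> 2 / L"
proof -
  have "1 + L\<^sup>2 / 2 \<le> exp (L\<^sup>2 / 2)" by (rule exp_ge_add_one_self_aux) simp
  moreover have "L \<le> L\<^sup>2" using assms by (simp add: power2_eq_square)
  ultimately have "L / 2 \<le> exp (L\<^sup>2 / 2)" by linarith
  then have "1 / exp (L\<^sup>2 / 2) \<le> 1 / (L / 2)" using assms by (intro divide_left_mono) auto
  moreover have "exp (- L\<^sup>2 / 2) = 1 / exp (L\<^sup>2 / 2)" by (simp add: exp_minus inverse_eq_divide)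
  ultimately show ?thesis by simp
qed

definition packet_sum :: "('a::euclidean_space \<Rightarrow> real) \<Rightarrow> real \<Rightarrow> 'a set \<Rightarrow> 'a \<Rightarrow> complex" where
  "packet_sum \<theta> L Z = (\<lambda>\<xi>. \<Sum>\<zeta>\<in>Z. complex_of_real (\<theta> (- (L *\<^sub>R \<zeta>) + L *\<^sub>R \<xi>)))"

lemma packet_sum_schwartz:
  "test_fun \<theta> \<Longrightarrow> finite Z \<Longrightarrow> L \<noteq> 0 \<Longrightarrow> packet_sum \<theta> L Z \<in> schwartz"
  unfolding packet_sum_def by (intro schwartz_sum schwartz_affine test_fun_of_real_schwartz)

lemma bump_near:
  fixes \<theta> :: "'a::euclidean_space \<Rightarrow> real"
  assumes \<theta>: "\<forall>\<xi>. 1 < norm \<xi> \<longrightarrow> \<theta> \<xi> = 0" and L: "0 < L" and nz: "\<theta> (- (L *\<^sub>R \<zeta>) + L *\<^sub>R \<xi>) \<noteq> 0"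
  shows "norm (\<xi> - \<zeta>) \<le> 1 / L"
proof -
  have "norm (- (L *\<^sub>R \<zeta>) + L *\<^sub>R \<xi>) \<le> 1" using nz \<theta> by (metis not_le)
  moreover have "- (L *\<^sub>R \<zeta>) + L *\<^sub>R \<xi> = L *\<^sub>R (\<xi> - \<zeta>)" by (simp add: scaleR_right_diff_distrib)
  ultimately have "L * norm (\<xi> - \<zeta>) \<le> 1" using L by simp
  then show ?thesis using L by (simp add: pos_le_divide_eq mult.commute)
qed

text \<open>The bumps have radius at most \<open>1/2\<close> and their centres are at distance at least 2, so at most one of
them is nonzero at a given point, and the other centres stay at distance at least 1.\<close>

lemma packet_sum_single:
  fixes \<theta> :: "'a::euclidean_space \<Rightarrow> real"
  assumes \<theta>: "\<forall>\<xi>. 1 < norm \<xi> \<longrightarrow> \<theta> \<xi> = 0" and L: "2 \<le> L" and Z: "finite Z"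
    and sep: "\<forall>\<zeta>\<in>Z. \<forall>\<zeta>'\<in>Z. \<zeta> \<noteq> \<zeta>' \<longrightarrow> 2 \<le> norm (\<zeta> - \<zeta>')"
    and \<zeta>: "\<zeta> \<in> Z" "\<theta> (- (L *\<^sub>R \<zeta>) + L *\<^sub>R \<xi>) \<noteq> 0"
  shows "norm (\<xi> - \<zeta>) \<le> 1 / L"
    "packet_sum \<theta> L Z \<xi> = of_real (\<theta> (- (L *\<^sub>R \<zeta>) + L *\<^sub>R \<xi>))"
    "\<And>\<zeta>'. \<zeta>' \<in> Z \<Longrightarrow> \<zeta>' \<noteq> \<zeta> \<Longrightarrow> \<theta> (- (L *\<^sub>R \<zeta>') + L *\<^sub>R \<xi>) = 0"
    "\<And>\<zeta>'. \<zeta>' \<in> Z \<Longrightarrow> \<zeta>' \<noteq> \<zeta> \<Longrightarrow> 1 \<le> norm (\<xi> - \<zeta>')"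
proof -
  have L0: "0 < L" and L2: "1 / L \<le> 1/2" using L by (auto simp: field_simps)
  show near: "norm (\<xi> - \<zeta>) \<le> 1 / L" by (rule bump_near[OF \<theta> L0 \<zeta>(2)])
  show far: "1 \<le> norm (\<xi> - \<zeta>')" if "\<zeta>' \<in> Z" "\<zeta>' \<noteq> \<zeta>" for \<zeta>'
  proof -
    have "2 \<le> norm (\<zeta>' - \<zeta>)" using sep that \<zeta>(1) by blast
    also have "\<dots> \<le> norm (\<xi> - \<zeta>) + norm (\<xi> - \<zeta>')"
      using norm_triangle_ineq4[of "\<xi> - \<zeta>" "\<xi> - \<zeta>'"] by simp
    finally show ?thesis using near L2 by linarith
  qed
  show one: "\<theta> (- (L *\<^sub>R \<zeta>') + L *\<^sub>R \<xi>) = 0" if "\<zeta>' \<in> Z" "\<zeta>' \<noteq> \<zeta>" for \<zeta>'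
  proof (rule ccontr)
    assume "\<theta> (- (L *\<^sub>R \<zeta>') + L *\<^sub>R \<xi>) \<noteq> 0"
    then have "norm (\<xi> - \<zeta>') \<le> 1 / L" by (rule bump_near[OF \<theta> L0])
    then show False using far[OF that] L2 by linarith
  qed
  show "packet_sum \<theta> L Z \<xi> = of_real (\<theta> (- (L *\<^sub>R \<zeta>) + L *\<^sub>R \<xi>))"
    unfolding packet_sum_def by (intro sum_at_most_one Z \<zeta>) (simp only: of_real_eq_0_iff, rule one)
qed

text \<open>The solution is paired with the sum of the characters \<open>cnj (c \<zeta>) * cis (- (x \<bullet> \<zeta>))\<close> times a
Gaussian of width \<open>L\<close>, where \<open>c \<zeta> = cis (t * \<phi> \<zeta>)\<close>. On the Fourier side this is a sum of
Gaussians of width \<open>1 / L\<close> around the frequencies, with coefficients that undo the phase of the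
propagator at the centre of each bump; by \<open>osc\<close> the remaining phase is at most 1 on the whole bump, so
the diagonal terms add up. The off-diagonal terms are of size \<open>exp (- L\<^sup>2 / 2)\<close> by the separation
of the frequencies, and the two smallness conditions on \<open>L\<close> make their sum harmless in the pairing
and in the mean square of the characters.\<close>

lemma packets_lower_bound:
  fixes \<theta> \<phi> :: "'a::euclidean_space \<Rightarrow> real" and Z :: "'a set"
  assumes \<theta>: "test_fun \<theta>" "\<And>\<xi>. 0 \<le> \<theta> \<xi>" "\<And>\<xi>. 1 < norm \<xi> \<Longrightarrow> \<theta> \<xi> = 0"
    and sm: "smooth_on (- {0}) \<phi>" and p: "2 < p"
    and Z: "finite Z" "Z \<noteq> {}" "\<And>\<zeta> \<zeta>'. \<zeta> \<in> Z \<Longrightarrow> \<zeta>' \<in> Z \<Longrightarrow> \<zeta> \<noteq> \<zeta>' \<Longrightarrow> 2 \<le> norm (\<zeta> - \<zeta>')"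
    and L: "2 \<le> L" "real (card Z) * exp (- L\<^sup>2 / 2) \<le> 1"
    and \<mu>: "0 < \<mu>" "\<mu> = (LINT x|lborel. \<theta> x * exp (- (norm x)\<^sup>2 / 2))"
    and w0: "w0 = (LINT x|lborel. \<theta> x)" "real (card Z) * exp (- L\<^sup>2 / 2) * w0 \<le> \<mu> / 4"
    and osc: "\<And>\<zeta> \<xi>. \<zeta> \<in> Z \<Longrightarrow> norm (\<xi> - \<zeta>) \<le> 1 / L \<Longrightarrow> \<bar>\<phi> \<xi> - \<phi> \<zeta>\<bar> \<le> 1"
    and t: "0 \<le> t" "t \<le> 1"
  defines "a \<equiv> packet_sum \<theta> L Z"
    and "\<kappa> \<equiv> sqrt (2 * pi) ^ DIM('a)" and "cn \<equiv> 1 / (2 * pi) ^ DIM('a)"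
  shows "ennreal (\<kappa> * (cn\<^sup>2 * \<mu>\<^sup>2 / 64) powr (p / 2) * (real (card Z) powr (p / 2) * L powr (real DIM('a) * (1 - p))))
     \<le> epowr (Lp_norm p (wave_op \<theta>' \<Psi> q s p \<phi> t (distr_of (inv_fourier a)))) p"
proof -
  let ?n = "DIM('a)"
  define N where "N = real (card Z)"
  define E where "E = exp (- L\<^sup>2 / 2)"
  have N: "1 \<le> N" unfolding N_def using Z(1,2) by (simp add: Suc_le_eq card_gt_0_iff)
  have L0: "0 < L" using L by simp
  have \<kappa>: "0 < \<kappa>" and cn: "0 < cn" unfolding \<kappa>_def cn_def by simp_all
  have E0: "0 < E" unfolding E_def by simp
  have \<theta>i: "integrable lborel \<theta>" by (rule test_fun_integrable[OF \<theta>(1)])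
  have \<theta>m[measurable]: "\<theta> \<in> borel_measurable borel" by (rule test_fun_measurable[OF \<theta>(1)])
  define th where "th \<zeta> \<xi> = \<theta> (- (L *\<^sub>R \<zeta>) + L *\<^sub>R \<xi>)" for \<zeta> \<xi>
  have aS: "a \<in> schwartz" unfolding a_def by (rule packet_sum_schwartz[OF \<theta>(1) Z(1)]) (use L0 in simp)
  have a_th: "a \<xi> = of_real (\<Sum>\<zeta>\<in>Z. th \<zeta> \<xi>)" for \<xi> unfolding a_def packet_sum_def th_def by simp
  define c where "c \<zeta> = cis (t * \<phi> \<zeta>)" for \<zeta>
  define g where "g x = (\<Sum>\<zeta>\<in>Z. cnj (c \<zeta>) * cis (- 1 * (x \<bullet> \<zeta>)))" for x
  define G where "G x = exp (- (norm ((1 / L) *\<^sub>R x))\<^sup>2 / 2)" for x :: 'a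
  have G: "complex_of_real (G x) = gauss ((1 / L) *\<^sub>R x)" for x unfolding G_def gauss_def by simp
  have Gb: "0 \<le> G x" "G x \<le> 1" for x unfolding G_def by simp_all
  have Gm: "G \<in> borel_measurable borel" unfolding G_def[abs_def] by measurable
  have GS: "(\<lambda>x. complex_of_real (G x)) \<in> schwartz"
    unfolding G using schwartz_affine[OF gauss_schwartz, of "1 / L" 0] L0 by simp
  have gt: "csmooth tame g"
    unfolding g_def[abs_def] by (intro csmooth_sum tame_cone Z csmooth_mult csmooth_const csmooth_cis)
  have gm: "g \<in> borel_measurable borel" by (rule csmooth_measurable[OF gt])
  have \<psi>: "(\<lambda>x. g x * of_real (G x)) \<in> schwartz" by (rule tame_mult_schwartz[OF gt GS])
  define W where "W = \<kappa> * L ^ ?n"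
  have W0: "0 < W" unfolding W_def using \<kappa> L0 by simp
  have Gint: "(LINT x|lborel. cis (x \<bullet> \<eta>) * of_real (G x)) = of_real (W * exp (- (L * norm \<eta>)\<^sup>2 / 2))" for \<eta>
    unfolding G using integral_cis_gauss_scaled[OF L0, of \<eta>] unfolding W_def \<kappa>_def .
  have Gi: "integrable lborel G" using schwartz_integrable[OF GS] by (simp add: complex_of_real_integrable_eq)
  have nnW: "(\<integral>\<^sup>+x. ennreal (G x) \<partial>lborel) \<le> ennreal W"
  proof -
    have "complex_of_real (LINT x|lborel. G x) = of_real W" using Gint[of 0] by simp
    then have "(LINT x|lborel. G x) = W" by (simp only: of_real_eq_iff)
    then show ?thesis using Gi Gb by (simp add: nn_integral_eq_integral)
  qed
  have sep: "exp (- (L * norm \<eta>)\<^sup>2 / 2) \<le> E" if "1 \<le> norm \<eta>" for \<eta> :: 'a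
  proof -
    have "L * 1 \<le> L * norm \<eta>" using that L0 by (intro mult_left_mono) auto
    then have "L\<^sup>2 \<le> (L * norm \<eta>)\<^sup>2" using L0 by (intro power_mono) auto
    then show ?thesis unfolding E_def by simp
  qed
  have rowsum: "(\<Sum>\<zeta>'\<in>Z - {\<zeta>}. exp (- (L * norm (\<xi> - \<zeta>'))\<^sup>2 / 2)) \<le> N * E"
    if "\<And>\<zeta>'. \<zeta>' \<in> Z - {\<zeta>} \<Longrightarrow> 1 \<le> norm (\<xi> - \<zeta>')" for \<zeta> \<xi>
  proof -
    have "(\<Sum>\<zeta>'\<in>Z - {\<zeta>}. exp (- (L * norm (\<xi> - \<zeta>'))\<^sup>2 / 2)) \<le> (\<Sum>\<zeta>'\<in>Z - {\<zeta>}. E)"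
      by (intro sum_mono sep that)
    also have "\<dots> \<le> N * E" unfolding N_def using Z(1) E0 card_mono[of Z "Z - {\<zeta>}"] by (auto intro!: mult_right_mono)
    finally show ?thesis .
  qed
  define Q where "Q = 2 * W * N"
  have Q0: "0 < Q" unfolding Q_def using W0 N by simp
  (* Almost orthogonality: the diagonal of the double sum contributes W per frequency, and the rest of each
     row at most W more. *)
  have nnQ: "(\<integral>\<^sup>+x. ennreal ((norm (g x))\<^sup>2 * G x) \<partial>lborel) \<le> ennreal Q"
  proof -
    have ii: "integrable lborel (\<lambda>x. cis (x \<bullet> \<eta>) * of_real (G x))" for \<eta>
      by (rule integrable_schwartz_times_bounded[OF GS, of _ 1]) auto
    have ptw: "complex_of_real ((norm (g x))\<^sup>2 * G x) =
       (\<Sum>\<zeta>\<in>Z. \<Sum>\<zeta>'\<in>Z. (cnj (c \<zeta>) * c \<zeta>') * (cis (x \<bullet> (\<zeta>' - \<zeta>)) * of_real (G x)))" for x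
    proof -
      have "complex_of_real ((norm (g x))\<^sup>2 * G x) = g x * cnj (g x) * of_real (G x)"
        by (simp only: of_real_mult complex_norm_square)
      also have "g x * cnj (g x) = (\<Sum>\<zeta>\<in>Z. \<Sum>\<zeta>'\<in>Z. (cnj (c \<zeta>) * cis (- 1 * (x \<bullet> \<zeta>))) * (c \<zeta>' * cis (x \<bullet> \<zeta>')))"
        unfolding g_def by (simp add: sum_product cis_cnj)
      also have "\<dots> * of_real (G x) = (\<Sum>\<zeta>\<in>Z. \<Sum>\<zeta>'\<in>Z. ((cnj (c \<zeta>) * cis (- 1 * (x \<bullet> \<zeta>))) * (c \<zeta>' * cis (x \<bullet> \<zeta>'))) * of_real (G x))"
        by (simp add: sum_distrib_right)
      also have "\<dots> = (\<Sum>\<zeta>\<in>Z. \<Sum>\<zeta>'\<in>Z. (cnj (c \<zeta>) * c \<zeta>') * (cis (x \<bullet> (\<zeta>' - \<zeta>)) * of_real (G x)))"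
      proof (intro sum.cong refl)
        fix \<zeta> \<zeta>'
        have "cis (x \<bullet> (\<zeta>' - \<zeta>)) = cis (- 1 * (x \<bullet> \<zeta>)) * cis (x \<bullet> \<zeta>')"
          by (simp add: cis_mult inner_diff_right algebra_simps)
        then show "((cnj (c \<zeta>) * cis (- 1 * (x \<bullet> \<zeta>))) * (c \<zeta>' * cis (x \<bullet> \<zeta>'))) * of_real (G x) =
            (cnj (c \<zeta>) * c \<zeta>') * (cis (x \<bullet> (\<zeta>' - \<zeta>)) * of_real (G x))" by (simp only: mult_ac)
      qed
      finally show ?thesis .
    qed
    have ir: "integrable lborel (\<lambda>x. complex_of_real ((norm (g x))\<^sup>2 * G x))"
      unfolding ptw by (intro Bochner_Integration.integrable_sum integrable_mult_right ii)
    then have irr: "integrable lborel (\<lambda>x. (norm (g x))\<^sup>2 * G x)" by (simp only: complex_of_real_integrable_eq)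
    have "complex_of_real (LINT x|lborel. (norm (g x))\<^sup>2 * G x) = (LINT x|lborel. complex_of_real ((norm (g x))\<^sup>2 * G x))"
      by (rule integral_complex_of_real[symmetric])
    also have "\<dots> = (\<Sum>\<zeta>\<in>Z. \<Sum>\<zeta>'\<in>Z. (cnj (c \<zeta>) * c \<zeta>') * of_real (W * exp (- (L * norm (\<zeta>' - \<zeta>))\<^sup>2 / 2)))"
      unfolding ptw by (simp add: Bochner_Integration.integral_sum integrable_mult_right ii Gint del: of_real_mult)
    finally have eq: "complex_of_real (LINT x|lborel. (norm (g x))\<^sup>2 * G x) =
       (\<Sum>\<zeta>\<in>Z. \<Sum>\<zeta>'\<in>Z. (cnj (c \<zeta>) * c \<zeta>') * of_real (W * exp (- (L * norm (\<zeta>' - \<zeta>))\<^sup>2 / 2)))" .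
    have "(LINT x|lborel. (norm (g x))\<^sup>2 * G x) \<le> norm (complex_of_real (LINT x|lborel. (norm (g x))\<^sup>2 * G x))" by simp
    also have "\<dots> \<le> (\<Sum>\<zeta>\<in>Z. \<Sum>\<zeta>'\<in>Z. W * exp (- (L * norm (\<zeta> - \<zeta>'))\<^sup>2 / 2))"
      unfolding eq
    proof (rule order_trans[OF norm_sum sum_mono], rule order_trans[OF norm_sum sum_mono])
      fix \<zeta> \<zeta>'
      show "norm ((cnj (c \<zeta>) * c \<zeta>') * of_real (W * exp (- (L * norm (\<zeta>' - \<zeta>))\<^sup>2 / 2))) \<le> W * exp (- (L * norm (\<zeta> - \<zeta>'))\<^sup>2 / 2)"
        using W0 unfolding norm_mult norm_of_real c_def by (simp add: norm_minus_commute)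
    qed
    also have "\<dots> \<le> (\<Sum>\<zeta>\<in>Z. 2 * W)"
    proof (rule sum_mono)
      fix \<zeta> assume \<zeta>: "\<zeta> \<in> Z"
      have "(\<Sum>\<zeta>'\<in>Z. exp (- (L * norm (\<zeta> - \<zeta>'))\<^sup>2 / 2)) = 1 + (\<Sum>\<zeta>'\<in>Z - {\<zeta>}. exp (- (L * norm (\<zeta> - \<zeta>'))\<^sup>2 / 2))"
        using Z(1) \<zeta> by (subst sum.remove[of Z \<zeta>]) auto
      also have "\<dots> \<le> 1 + N * E"
      proof (intro add_left_mono rowsum)
        fix \<zeta>' assume "\<zeta>' \<in> Z - {\<zeta>}"
        then show "1 \<le> norm (\<zeta> - \<zeta>')" using Z(3)[of \<zeta> \<zeta>'] \<zeta> by force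
      qed
      also have "\<dots> \<le> 2" using L(2) unfolding N_def E_def by simp
      finally have "W * (\<Sum>\<zeta>'\<in>Z. exp (- (L * norm (\<zeta> - \<zeta>'))\<^sup>2 / 2)) \<le> W * 2" using W0 by (intro mult_left_mono) auto
      then show "(\<Sum>\<zeta>'\<in>Z. W * exp (- (L * norm (\<zeta> - \<zeta>'))\<^sup>2 / 2)) \<le> 2 * W" by (simp add: sum_distrib_left mult.commute)
    qed
    also have "\<dots> = Q" unfolding Q_def N_def by simp
    finally have "(LINT x|lborel. (norm (g x))\<^sup>2 * G x) \<le> Q" .
    moreover have "(\<integral>\<^sup>+x. ennreal ((norm (g x))\<^sup>2 * G x) \<partial>lborel) = ennreal (LINT x|lborel. (norm (g x))\<^sup>2 * G x)"
      by (rule nn_integral_eq_integral[OF irr]) (use Gb in auto)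
    ultimately show ?thesis by (simp add: ennreal_leI)
  qed
  let ?\<psi> = "\<lambda>x. g x * complex_of_real (G x)"
  have inv: "inv_fourier ?\<psi> \<xi> = (\<Sum>\<zeta>\<in>Z. cnj (c \<zeta>) * of_real (cn * W * exp (- (L * norm (\<xi> - \<zeta>))\<^sup>2 / 2)))" for \<xi>
  proof -
    have ii: "integrable lborel (\<lambda>x. cis (x \<bullet> \<eta>) * of_real (G x))" for \<eta>
      by (rule integrable_schwartz_times_bounded[OF GS, of _ 1]) auto
    have "cis (\<xi> \<bullet> x) * ?\<psi> x = (\<Sum>\<zeta>\<in>Z. cnj (c \<zeta>) * (cis (x \<bullet> (\<xi> - \<zeta>)) * of_real (G x)))" for x
    proof -
      have "cis (x \<bullet> (\<xi> - \<zeta>)) = cis (\<xi> \<bullet> x) * cis (- 1 * (x \<bullet> \<zeta>))" for \<zeta>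
        by (simp add: cis_mult inner_diff_right inner_commute)
      then show ?thesis unfolding g_def by (simp add: sum_distrib_left sum_distrib_right mult_ac)
    qed
    then have "(LINT x|lborel. cis (\<xi> \<bullet> x) * ?\<psi> x) = (\<Sum>\<zeta>\<in>Z. cnj (c \<zeta>) * of_real (W * exp (- (L * norm (\<xi> - \<zeta>))\<^sup>2 / 2)))"
      by (simp add: Bochner_Integration.integral_sum integrable_mult_right ii Gint del: of_real_mult)
    then show ?thesis unfolding inv_fourier_def cn_def by (simp add: sum_distrib_left mult_ac)
  qed
  let ?m = "\<lambda>\<xi>. cis (t * \<phi> \<xi>)"
  define gam where "gam \<zeta> \<xi> = exp (- (L * norm (\<xi> - \<zeta>))\<^sup>2 / 2)" for \<zeta> \<xi> :: 'a
  (* At a frequency \<xi> in the bump around \<zeta>, the term of \<zeta> has real part at least half its size,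
     and the Gaussians around the other frequencies contribute at most N * E. *)
  have pt: "cn * W * (\<Sum>\<zeta>\<in>Z. th \<zeta> \<xi> * (1/2 * gam \<zeta> \<xi>) - th \<zeta> \<xi> * (N * E)) \<le> Re ((?m \<xi> * a \<xi>) * inv_fourier ?\<psi> \<xi>)" for \<xi>
  proof (cases "\<exists>\<zeta>\<in>Z. th \<zeta> \<xi> \<noteq> 0")
    case False
    then show ?thesis unfolding a_th by simp
  next
    case True
    then obtain \<zeta> where \<zeta>: "\<zeta> \<in> Z" "th \<zeta> \<xi> \<noteq> 0" by blast
    have supp: "\<forall>\<xi>. 1 < norm \<xi> \<longrightarrow> \<theta> \<xi> = 0" and sep2: "\<forall>\<zeta>\<in>Z. \<forall>\<zeta>'\<in>Z. \<zeta> \<noteq> \<zeta>' \<longrightarrow> 2 \<le> norm (\<zeta> - \<zeta>')"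
      using \<theta>(3) Z(3) by blast+
    note one = packet_sum_single[where \<theta> = \<theta>, OF supp L(1) Z(1) sep2 \<zeta>(1) \<zeta>(2)[unfolded th_def], folded th_def a_def]
    have s1: "(\<Sum>\<zeta>\<in>Z. th \<zeta> \<xi> * (1/2 * gam \<zeta> \<xi>) - th \<zeta> \<xi> * (N * E)) = th \<zeta> \<xi> * (1/2 * gam \<zeta> \<xi>) - th \<zeta> \<xi> * (N * E)"
      by (rule sum_at_most_one[OF Z(1) \<zeta>(1)]) (simp add: one(3))
    have s2: "a \<xi> = of_real (th \<zeta> \<xi>)" by (rule one(2))
    have "1/2 * gam \<zeta> \<xi> - N * E \<le> Re (\<Sum>\<zeta>'\<in>Z. (?m \<xi> * cnj (c \<zeta>')) * of_real (gam \<zeta>' \<xi>))"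
    proof -
      have split: "(\<Sum>\<zeta>'\<in>Z. (?m \<xi> * cnj (c \<zeta>')) * of_real (gam \<zeta>' \<xi>)) =
        (?m \<xi> * cnj (c \<zeta>)) * of_real (gam \<zeta> \<xi>) + (\<Sum>\<zeta>'\<in>Z - {\<zeta>}. (?m \<xi> * cnj (c \<zeta>')) * of_real (gam \<zeta>' \<xi>))"
        by (rule sum.remove[OF Z(1) \<zeta>(1)])
      have "?m \<xi> * cnj (c \<zeta>) = cis (t * (\<phi> \<xi> - \<phi> \<zeta>))" unfolding c_def by (simp add: cis_cnj cis_mult right_diff_distrib)
      then have r1: "Re ((?m \<xi> * cnj (c \<zeta>)) * of_real (gam \<zeta> \<xi>)) = cos (t * (\<phi> \<xi> - \<phi> \<zeta>)) * gam \<zeta> \<xi>" by simp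
      have "\<bar>t * (\<phi> \<xi> - \<phi> \<zeta>)\<bar> \<le> 1 * 1"
        unfolding abs_mult by (rule mult_mono) (use t osc[OF \<zeta>(1) one(1)] in auto)
      then have "1/2 * gam \<zeta> \<xi> \<le> cos (t * (\<phi> \<xi> - \<phi> \<zeta>)) * gam \<zeta> \<xi>"
        by (intro mult_right_mono cos_ge_half) (auto simp: gam_def)
      moreover have "norm (\<Sum>\<zeta>'\<in>Z - {\<zeta>}. (?m \<xi> * cnj (c \<zeta>')) * of_real (gam \<zeta>' \<xi>)) \<le> N * E"
      proof -
        have "norm (\<Sum>\<zeta>'\<in>Z - {\<zeta>}. (?m \<xi> * cnj (c \<zeta>')) * of_real (gam \<zeta>' \<xi>)) \<le> (\<Sum>\<zeta>'\<in>Z - {\<zeta>}. gam \<zeta>' \<xi>)"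
          by (rule order_trans[OF norm_sum]) (simp add: norm_mult c_def gam_def)
        also have "\<dots> \<le> N * E" unfolding gam_def by (rule rowsum) (use one(4) in auto)
        finally show ?thesis .
      qed
      then have "- (N * E) \<le> Re (\<Sum>\<zeta>'\<in>Z - {\<zeta>}. (?m \<xi> * cnj (c \<zeta>')) * of_real (gam \<zeta>' \<xi>))"
        using abs_Re_le_cmod[of "\<Sum>\<zeta>'\<in>Z - {\<zeta>}. (?m \<xi> * cnj (c \<zeta>')) * of_real (gam \<zeta>' \<xi>)"] by linarith
      ultimately show ?thesis unfolding split plus_complex.sel r1 by linarith
    qed
    then have s3: "(cn * W * th \<zeta> \<xi>) * (1/2 * gam \<zeta> \<xi> - N * E) \<le> (cn * W * th \<zeta> \<xi>) * Re (\<Sum>\<zeta>'\<in>Z. (?m \<xi> * cnj (c \<zeta>')) * of_real (gam \<zeta>' \<xi>))"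
      using cn W0 \<theta>(2) by (intro mult_left_mono) (auto simp: th_def)
    have s4: "(?m \<xi> * of_real (th \<zeta> \<xi>)) * inv_fourier ?\<psi> \<xi> = of_real (cn * W * th \<zeta> \<xi>) * (\<Sum>\<zeta>'\<in>Z. (?m \<xi> * cnj (c \<zeta>')) * of_real (gam \<zeta>' \<xi>))"
      unfolding inv gam_def sum_distrib_left by (intro sum.cong refl) (simp add: mult_ac)
    have s5: "Re (of_real r * z) = r * Re z" for r z by simp
    have s6: "cn * W * (th \<zeta> \<xi> * (1/2 * gam \<zeta> \<xi>) - th \<zeta> \<xi> * (N * E)) = (cn * W * th \<zeta> \<xi>) * (1/2 * gam \<zeta> \<xi> - N * E)"
      by (simp only: right_diff_distrib mult.assoc)
    show ?thesis unfolding s1 s2 s4 s5 s6 by (rule s3)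
  qed
  define K1 where "K1 = cn * \<kappa> * N * \<mu> / 4"
  have K1: "0 < K1" unfolding K1_def using cn \<kappa> N \<mu> by simp
  have \<theta>g: "integrable lborel (\<lambda>x. \<theta> x * exp (- (norm x)\<^sup>2 / 2))"
    by (rule Bochner_Integration.integrable_bound[OF \<theta>i]) (auto simp: abs_mult mult_right_le_one_le)
  have thi: "integrable lborel (th \<zeta>)" "(LINT \<xi>|lborel. th \<zeta> \<xi>) = w0 / L ^ ?n" for \<zeta>
    unfolding th_def[abs_def] w0(1)
    using integrable_affine[OF \<theta>i, of L "- (L *\<^sub>R \<zeta>)"] integral_affine[OF \<theta>m, of L "- (L *\<^sub>R \<zeta>)"] L0 by (auto simp: divide_inverse mult.commute)
  have ghi: "integrable lborel (\<lambda>\<xi>. th \<zeta> \<xi> * gam \<zeta> \<xi>)" "(LINT \<xi>|lborel. th \<zeta> \<xi> * gam \<zeta> \<xi>) = \<mu> / L ^ ?n" for \<zeta>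
  proof -
    have e: "th \<zeta> \<xi> * gam \<zeta> \<xi> = (\<lambda>x. \<theta> x * exp (- (norm x)\<^sup>2 / 2)) (- (L *\<^sub>R \<zeta>) + L *\<^sub>R \<xi>)" for \<xi>
    proof -
      have "- (L *\<^sub>R \<zeta>) + L *\<^sub>R \<xi> = L *\<^sub>R (\<xi> - \<zeta>)" by (simp add: scaleR_right_diff_distrib)
      then have "norm (- (L *\<^sub>R \<zeta>) + L *\<^sub>R \<xi>) = L * norm (\<xi> - \<zeta>)" using L0 by simp
      then show ?thesis unfolding th_def gam_def by simp
    qed
    have m: "(\<lambda>x. \<theta> x * exp (- (norm x)\<^sup>2 / 2)) \<in> borel_measurable borel" by measurable
    show "integrable lborel (\<lambda>\<xi>. th \<zeta> \<xi> * gam \<zeta> \<xi>)"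
      unfolding e by (rule integrable_affine[OF \<theta>g]) (use L0 in simp)
    have "(LINT \<xi>|lborel. th \<zeta> \<xi> * gam \<zeta> \<xi>) = \<mu> /\<^sub>R \<bar>L\<bar> ^ ?n"
      unfolding e \<mu>(2) by (rule integral_affine[OF m]) (use L0 in simp)
    then show "(LINT \<xi>|lborel. th \<zeta> \<xi> * gam \<zeta> \<xi>) = \<mu> / L ^ ?n" using L0 by (simp add: divide_inverse mult.commute)
  qed
  have ti: "integrable lborel (\<lambda>\<xi>. th \<zeta> \<xi> * (1/2 * gam \<zeta> \<xi>) - th \<zeta> \<xi> * (N * E))" for \<zeta>
  proof -
    have "integrable lborel (\<lambda>\<xi>. 1/2 * (th \<zeta> \<xi> * gam \<zeta> \<xi>) - th \<zeta> \<xi> * (N * E))"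
      by (intro Bochner_Integration.integrable_diff integrable_mult_right integrable_mult_left ghi thi)
    then show ?thesis by (simp add: mult_ac)
  qed
  have tv: "\<mu> / 4 / L ^ ?n \<le> (LINT \<xi>|lborel. th \<zeta> \<xi> * (1/2 * gam \<zeta> \<xi>) - th \<zeta> \<xi> * (N * E))" for \<zeta>
  proof -
    have "(LINT \<xi>|lborel. th \<zeta> \<xi> * (1/2 * gam \<zeta> \<xi>) - th \<zeta> \<xi> * (N * E)) =
       (LINT \<xi>|lborel. 1/2 * (th \<zeta> \<xi> * gam \<zeta> \<xi>) - th \<zeta> \<xi> * (N * E))" by (simp add: mult_ac)
    also have "\<dots> = 1/2 * (\<mu> / L ^ ?n) - w0 / L ^ ?n * (N * E)"
      by (subst Bochner_Integration.integral_diff[OF integrable_mult_right[OF ghi(1)] integrable_mult_left[OF thi(1)]])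
        (simp only: integral_mult_right_zero integral_mult_left_zero thi(2) ghi(2))
    also have "\<dots> = (\<mu> / 2 - N * E * w0) / L ^ ?n" by (simp add: diff_divide_distrib mult_ac)
    also have "\<dots> \<ge> (\<mu> / 4) / L ^ ?n"
      using w0(2) L0 unfolding N_def[symmetric] E_def[symmetric] by (intro divide_right_mono) auto
    finally show ?thesis by simp
  qed
  show ?thesis
    unfolding wave_op_distr_of[OF inv_fourier_schwartz[OF aS]]
  proof (rule order_trans[OF ennreal_leI Lp_norm_ge[OF \<psi> gm Gm Gb p K1 Q0 W0 _ nnQ nnW]])
    have invS: "inv_fourier ?\<psi> \<in> schwartz" by (rule inv_fourier_schwartz[OF \<psi>])
    have [measurable]: "\<phi> \<in> borel_measurable borel" by (rule smooth_off_origin_measurable[OF sm])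
    have int: "integrable lborel (\<lambda>\<xi>. (?m \<xi> * a \<xi>) * inv_fourier ?\<psi> \<xi>)"
      using integrable_schwartz_times_bounded[OF schwartz_mult[OF aS invS], of ?m 1] by (simp add: mult.assoc)
    have "K1 = cn * W * (\<Sum>\<zeta>\<in>Z. \<mu> / 4 / L ^ ?n)"
      unfolding K1_def W_def N_def using L0 by simp
    also have "\<dots> \<le> cn * W * (\<Sum>\<zeta>\<in>Z. LINT \<xi>|lborel. th \<zeta> \<xi> * (1/2 * gam \<zeta> \<xi>) - th \<zeta> \<xi> * (N * E))"
      using tv cn W0 by (intro mult_left_mono sum_mono) auto
    also have "\<dots> = (LINT \<xi>|lborel. cn * W * (\<Sum>\<zeta>\<in>Z. th \<zeta> \<xi> * (1/2 * gam \<zeta> \<xi>) - th \<zeta> \<xi> * (N * E)))"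
      by (subst integral_mult_right_zero, subst Bochner_Integration.integral_sum[OF ti]) simp
    also have "\<dots> \<le> (LINT \<xi>|lborel. Re ((?m \<xi> * a \<xi>) * inv_fourier ?\<psi> \<xi>))"
      by (rule Bochner_Integration.integral_mono[OF integrable_mult_right[OF Bochner_Integration.integrable_sum[OF ti]] integrable_Re[OF int] pt])
    also have "\<dots> = Re (LINT \<xi>|lborel. (?m \<xi> * a \<xi>) * inv_fourier ?\<psi> \<xi>)" by (rule integral_Re[OF int])
    also have "\<dots> \<le> norm (LINT \<xi>|lborel. (?m \<xi> * a \<xi>) * inv_fourier ?\<psi> \<xi>)" by (rule complex_Re_le_cmod)
    finally show "K1 \<le> norm (LINT x|lborel. multiplier_fun ?m (inv_fourier a) x * (g x * of_real (G x)))"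
      unfolding wave_op_pairing[OF sm aS \<psi>] .
    have kk: "K1\<^sup>2 / (2 * Q * W) = (cn\<^sup>2 * \<mu>\<^sup>2 / 64) * (N * (L powr (- real ?n))\<^sup>2)"
    proof -
      have "L powr (- real ?n) = 1 / L ^ ?n" using L0 by (simp add: powr_minus_divide powr_realpow)
      then show ?thesis unfolding K1_def Q_def W_def using \<kappa> N L0 by (simp add: power2_eq_square field_simps)
    qed
    have pm: "(x * y) powr (p / 2) = x powr (p / 2) * y powr (p / 2)" if "0 \<le> x" "0 \<le> y" for x y :: real
      using that by (simp add: powr_mult)
    have k: "(K1\<^sup>2 / (2 * Q * W)) powr (p / 2) = (cn\<^sup>2 * \<mu>\<^sup>2 / 64) powr (p / 2) * (N powr (p / 2) * ((L powr (- real ?n))\<^sup>2) powr (p / 2))"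
      unfolding kk using N by (subst pm, simp, simp, subst pm) simp_all
    have "((L powr (- real ?n))\<^sup>2) powr (p / 2) = (L powr (- real ?n * 2)) powr (p / 2)"
      using L0 by (simp add: powr_powr flip: powr_numeral)
    also have "\<dots> = L powr (- (real ?n * p))" by (simp add: powr_powr)
    finally have l: "((L powr (- real ?n))\<^sup>2) powr (p / 2) = L powr (- (real ?n * p))" .
    have "L ^ ?n * L powr (- (real ?n * p)) = L powr (real ?n * (1 - p))"
      using L0 by (simp add: powr_realpow[symmetric] right_diff_distrib flip: powr_add)
    note kl = this
    have "W * (K1\<^sup>2 / (2 * Q * W)) powr (p / 2) =
        \<kappa> * (cn\<^sup>2 * \<mu>\<^sup>2 / 64) powr (p / 2) * (N powr (p / 2) * (L ^ ?n * L powr (- (real ?n * p))))"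
      unfolding k l unfolding W_def by (simp only: mult_ac)
    then show "\<kappa> * (cn\<^sup>2 * \<mu>\<^sup>2 / 64) powr (p / 2) * (real (card Z) powr (p / 2) * L powr (real ?n * (1 - p)))
        \<le> W * (K1\<^sup>2 / (2 * Q * W)) powr (p / 2)"
      unfolding kl N_def by (simp only: order_refl)
  qed
qed

text \<open>Every direction meets a number of packets bounded by \<open>H1\<close>, so \<open>V\<close> is a multiple of
\<open>L powr (- n)\<close>, whereas the lower bound grows like the power \<open>p / 2\<close> of the number of packets. The
parameter \<open>L\<close> is chosen after \<open>M\<close>, and its powers cancel.\<close>

lemma packets_exponent:
  fixes \<theta> \<Psi> \<phi> :: "'a::euclidean_space \<Rightarrow> real" and q :: "'a \<Rightarrow> complex"
  assumes F: "FIO_cutoffs \<theta> \<Psi> q" and sm: "smooth_on (- {0}) \<phi>"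
    and p: "2 < p" and C: "0 \<le> C"
    and hyp: "\<And>f. f \<in> HspFIO \<theta> \<Psi> q s p \<Longrightarrow>
      epowr (\<integral>\<^sup>+t\<in>{0..1}. epowr (Lp_norm p (wave_op \<theta> \<Psi> q s p \<phi> t f)) p \<partial>lborel) (1 / p)
        \<le> ennreal C * HspFIO_norm \<theta> \<Psi> q s p f"
  shows "0 \<le> s"
proof -
  let ?n = "DIM('a)" and ?v = "measure lborel (cball 0 1 :: 'a set)"
  define e where "e = (real ?n - 1) / 4"
  have n1: "1 \<le> real ?n" using DIM_positive[where 'a='a] by (simp add: Suc_leI)
  have n2: "1 \<le> 2 * real ?n" using n1 by linarith
  note \<theta> = FIO_cutoffsD[OF F]
  have \<theta>i: "integrable lborel \<theta>" by (rule test_fun_integrable[OF \<theta>(1)])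
  have \<theta>m[measurable]: "\<theta> \<in> borel_measurable borel" by (rule test_fun_measurable[OF \<theta>(1)])
  obtain B0 where B0: "0 < B0" "\<And>x. norm (\<theta> x) \<le> B0" using test_fun_bounded[OF \<theta>(1)] by blast
  obtain K0 R0 where K0: "0 < K0" and upper:
    "\<And>R V a. R0 \<le> R \<Longrightarrow> 0 < V \<Longrightarrow> a \<in> schwartz \<Longrightarrow> (\<And>\<xi>. norm (a \<xi>) \<le> B0) \<Longrightarrow>
      (\<And>\<xi>::'a. a \<xi> \<noteq> 0 \<Longrightarrow> R / (2 * real ?n) \<le> norm \<xi> \<and> norm \<xi> \<le> 2 * real ?n * R) \<Longrightarrow>
      (\<And>\<omega>. norm \<omega> = 1 \<Longrightarrow> \<exists>A\<in>sets borel. emeasure lborel A \<le> ennreal V \<and>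
        (\<forall>\<xi>. a \<xi> \<noteq> 0 \<longrightarrow> norm \<xi> * (norm (sgn \<xi> - \<omega>))\<^sup>2 \<le> 2 \<longrightarrow> \<xi> \<in> A)) \<Longrightarrow>
      distr_of (inv_fourier a) \<in> HspFIO \<theta> \<Psi> q s p \<and>
      epowr (HspFIO_norm \<theta> \<Psi> q s p (distr_of (inv_fourier a))) p \<le> ennreal (K0 * R powr ((e + s) * p) * V powr (p - 1))"
    unfolding e_def by (rule annular_HspFIO_norm_le[OF F less_imp_le[OF p] n2 B0(1), of s]) auto
  obtain \<delta> where \<delta>: "0 < \<delta>" "\<And>x. norm x < \<delta> \<Longrightarrow> \<theta> x = 1" using FIO_cutoffs_bump[OF F] by blast
  define w0 where "w0 = (LINT x|lborel. \<theta> x)"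
  have w0: "0 < w0" unfolding w0_def by (rule integral_pos_near_0[OF \<theta>i \<theta>(2), of 1 \<delta>]) (use \<delta> in auto)
  define \<mu> where "\<mu> = (LINT x|lborel. \<theta> x * exp (- (norm x)\<^sup>2 / 2))"
  have \<mu>: "0 < \<mu>" unfolding \<mu>_def
  proof (rule integral_pos_near_0[of _ "exp (- \<delta>\<^sup>2 / 2)" \<delta>])
    show "integrable lborel (\<lambda>x. \<theta> x * exp (- (norm x)\<^sup>2 / 2))"
      by (rule Bochner_Integration.integrable_bound[OF \<theta>i]) (auto simp: abs_mult mult_right_le_one_le)
    show "exp (- \<delta>\<^sup>2 / 2) \<le> \<theta> x * exp (- (norm x)\<^sup>2 / 2)" if "norm x < \<delta>" for x
      using power_mono[of "norm x" \<delta> 2] that by (simp add: \<delta>(2))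
  qed (use \<theta>(2) \<delta> in auto)
  define m0 where "m0 = max (6 * ?n) (nat \<lceil>R0\<rceil>)"
  define H1 where "H1 = real ((60 * ?n ^ 2 + 1) ^ ?n)"
  have H1: "0 < H1" unfolding H1_def by (simp add: add_pos_nonneg)
  have v: "0 < ?v" by (rule content_cball_pos) simp
  define \<kappa> where "\<kappa> = sqrt (2 * pi) ^ ?n"
  define cn where "cn = 1 / (2 * pi) ^ ?n"
  define c where "c = \<kappa> * (cn\<^sup>2 * \<mu>\<^sup>2 / 64) powr (p / 2)"
  define K where "K = C powr p * (K0 * (H1 * ?v) powr (p - 1))"
  have c0: "0 < c" unfolding c_def \<kappa>_def cn_def using \<mu> by simp
  have main: "c * real M powr ((real ?n - 1) * (p / 2)) \<le> K * real M powr (2 * (e + s) * p)" if M: "m0 \<le> M" for M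
  proof -
    define R where "R = (real M)\<^sup>2"
    have M6: "6 * ?n \<le> M" using M unfolding m0_def by simp
    then have Mr: "6 \<le> real M" using n1 by (metis (no_types, opaque_lifting) DIM_ge_Suc0 One_nat_def le_trans mult.right_neutral mult_le_mono2 of_nat_le_iff of_nat_numeral)
    have MR: "real M * 1 \<le> R" unfolding R_def power2_eq_square using Mr by (intro mult_left_mono) auto
    have "R0 \<le> real (nat \<lceil>R0\<rceil>)" by linarith
    also have "\<dots> \<le> real M" using M unfolding m0_def by simp
    finally have RR: "R0 \<le> R" using MR by linarith
    have R1: "6 \<le> R" using MR Mr by linarith
    define Z where "Z = (lattice_freqs M :: 'a set)"
    have M0: "0 < M" using Mr by (simp add: order.strict_iff_not)
    have Zfin: "finite Z" and Zc: "card Z = M ^ (?n - 1)" unfolding Z_def using lattice_freqs_card[OF M0] by auto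
    have Zne: "Z \<noteq> {}" using Zc M0 by (metis card.empty less_numeral_extra(3) zero_less_power)
    have Zn: "R \<le> norm \<zeta>" "norm \<zeta> \<le> real ?n * R" if "\<zeta> \<in> Z" for \<zeta>
      using lattice_freqs_norm that unfolding Z_def R_def by blast+
    have Zsep: "2 \<le> norm (\<zeta> - \<zeta>')" if "\<zeta> \<in> Z" "\<zeta>' \<in> Z" "\<zeta> \<noteq> \<zeta>'" for \<zeta> \<zeta>'
      using lattice_freqs_separated[of \<zeta> M \<zeta>'] that Mr unfolding Z_def by linarith
    have "\<exists>d>0. \<forall>\<xi>. norm (\<xi> - \<zeta>) < d \<longrightarrow> \<bar>\<phi> \<xi> - \<phi> \<zeta>\<bar> < 1" if "\<zeta> \<in> Z" for \<zeta>
    proof -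
      have "\<zeta> \<noteq> 0" using Zn(1)[OF that] R1 by auto
      from smooth_off_origin_continuous[OF sm this] show ?thesis
        unfolding isCont_def LIM_eq by (metis abs_zero diff_self norm_zero real_norm_def zero_less_one)
    qed
    then obtain d where d: "\<And>\<zeta>. \<zeta> \<in> Z \<Longrightarrow> 0 < d \<zeta>" "\<And>\<zeta> \<xi>. \<zeta> \<in> Z \<Longrightarrow> norm (\<xi> - \<zeta>) < d \<zeta> \<Longrightarrow> \<bar>\<phi> \<xi> - \<phi> \<zeta>\<bar> < 1"
      by metis
    define N where "N = real (card Z)"
    have N0: "0 \<le> N" unfolding N_def by simp
    (* Large enough for all requirements at once: 1 / L < d \<zeta> for each frequency, which bounds the
       oscillation of \<phi> on the bumps, and the two smallness conditions on N * exp (- L^2 / 2). *)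
    define L where "L = 2 + (\<Sum>\<zeta>\<in>Z. 2 / d \<zeta>) + 2 * N + 8 * N * w0 / \<mu>"
    have sd: "0 \<le> (\<Sum>\<zeta>\<in>Z. 2 / d \<zeta>)" using d(1) by (intro sum_nonneg) (simp add: less_imp_le)
    have w\<mu>: "0 \<le> 8 * N * w0 / \<mu>" using N0 w0 \<mu> by simp
    have L2: "2 \<le> L" unfolding L_def using sd N0 w\<mu> by simp
    have L0: "0 < L" using L2 by simp
    have ex: "exp (- L\<^sup>2 / 2) \<le> 2 / L" by (rule exp_neg_half_square_le) (use L2 in simp)
    have LE1: "N * exp (- L\<^sup>2 / 2) \<le> 1"
    proof -
      have "N * exp (- L\<^sup>2 / 2) \<le> N * (2 / L)" using N0 ex by (intro mult_left_mono) auto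
      also have "\<dots> \<le> 1" using L0 unfolding L_def using sd w\<mu> by (simp add: divide_le_eq)
      finally show ?thesis .
    qed
    have LE2: "N * exp (- L\<^sup>2 / 2) * w0 \<le> \<mu> / 4"
    proof -
      have "8 * N * w0 / \<mu> \<le> L" unfolding L_def using sd N0 by simp
      then have l: "8 * N * w0 \<le> L * \<mu>" using \<mu> by (simp add: pos_divide_le_eq)
      have "N * exp (- L\<^sup>2 / 2) * w0 \<le> N * (2 / L) * w0" using N0 ex w0 by (intro mult_right_mono mult_left_mono) auto
      also have "\<dots> \<le> \<mu> / 4" using l L0 by (simp add: divide_le_eq) (simp add: field_simps)
      finally show ?thesis .
    qed
    have osc: "\<bar>\<phi> \<xi> - \<phi> \<zeta>\<bar> \<le> 1" if "\<zeta> \<in> Z" "norm (\<xi> - \<zeta>) \<le> 1 / L" for \<zeta> \<xi>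
    proof -
      have "2 / d \<zeta> \<le> (\<Sum>\<zeta>\<in>Z. 2 / d \<zeta>)"
        using d(1) Zfin that(1) by (intro member_le_sum) (auto simp: less_imp_le)
      also have "\<dots> < L" unfolding L_def using N0 w\<mu> by simp
      finally have "2 < L * d \<zeta>" using d(1)[OF that(1)] by (simp add: pos_divide_less_eq)
      then have "1 / L < d \<zeta>" using L0 by (simp add: pos_divide_less_eq mult.commute)
      then show ?thesis using d(2)[OF that(1), of \<xi>] that(2) by linarith
    qed
    define a where "a = packet_sum \<theta> L Z"
    have aS: "a \<in> schwartz" unfolding a_def by (rule packet_sum_schwartz[OF \<theta>(1) Zfin]) (use L0 in simp)
    have Lhalf: "1 / L \<le> 1/2" using L2 by (simp add: field_simps)
    have a_single: "\<exists>\<zeta>\<in>Z. norm (\<xi> - \<zeta>) \<le> 1 / L \<and> norm (a \<xi>) \<le> B0" if nz: "a \<xi> \<noteq> 0" for \<xi>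
    proof -
      obtain \<zeta> where \<zeta>: "\<zeta> \<in> Z" "\<theta> (- (L *\<^sub>R \<zeta>) + L *\<^sub>R \<xi>) \<noteq> 0"
        using nz unfolding a_def packet_sum_def by (metis (mono_tags, lifting) of_real_0 sum.neutral)
      have "\<forall>\<xi>. 1 < norm \<xi> \<longrightarrow> \<theta> \<xi> = 0" "\<forall>\<zeta>\<in>Z. \<forall>\<zeta>'\<in>Z. \<zeta> \<noteq> \<zeta>' \<longrightarrow> 2 \<le> norm (\<zeta> - \<zeta>')"
        using \<theta>(3) Zsep by blast+
      note one = packet_sum_single[where \<theta> = \<theta>, OF this(1) L2 Zfin this(2) \<zeta>, folded a_def]
      have "norm (a \<xi>) \<le> B0" unfolding one(2) using B0(2) by simp
      with one(1) \<zeta>(1) show ?thesis by blast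
    qed
    have na: "norm (a \<xi>) \<le> B0" for \<xi>
      using a_single[of \<xi>] B0(1) by (cases "a \<xi> = 0") auto
    have asupp: "R / (2 * real ?n) \<le> norm \<xi>" "norm \<xi> \<le> 2 * real ?n * R" if nz: "a \<xi> \<noteq> 0" for \<xi>
    proof -
      obtain \<zeta> where \<zeta>: "\<zeta> \<in> Z" "norm (\<xi> - \<zeta>) \<le> 1 / L" using a_single[OF nz] by blast
      have b: "norm \<zeta> - 1/2 \<le> norm \<xi>" "norm \<xi> \<le> norm \<zeta> + 1/2"
        using norm_triangle_ineq2[of \<zeta> \<xi>] norm_triangle_ineq2[of \<xi> \<zeta>] \<zeta>(2) Lhalf by (auto simp: norm_minus_commute)
      have nR: "1 * R \<le> real ?n * R" using n1 R1 by (intro mult_right_mono) auto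
      have "R / (2 * real ?n) \<le> R / 2" using n1 R1 by (intro divide_left_mono) auto
      then show "R / (2 * real ?n) \<le> norm \<xi>" using b Zn[OF \<zeta>(1)] R1 by linarith
      show "norm \<xi> \<le> 2 * real ?n * R" using b Zn[OF \<zeta>(1)] R1 nR by linarith
    qed
    (* Radius 1 instead of 1 / L around the frequencies, so that their number is bounded independently of L. *)
    define S where "S \<omega> = {\<zeta> \<in> Z. \<exists>\<xi>. norm (\<xi> - \<zeta>) \<le> 1 \<and> norm \<xi> * (norm (sgn \<xi> - \<omega>))\<^sup>2 \<le> 2}" for \<omega> :: 'a
    have Sfin: "finite (S \<omega>)" for \<omega> unfolding S_def using Zfin by simp
    define A where "A \<omega> = (\<Union>\<zeta>\<in>S \<omega>. cball \<zeta> (1 / L))" for \<omega>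
    define V where "V = H1 * ?v * L powr (- real ?n)"
    have V: "0 < V" unfolding V_def using H1 v L0 by simp
    have A1: "A \<omega> \<in> sets borel" for \<omega> unfolding A_def by (intro sets.finite_UN Sfin) auto
    have A2: "emeasure lborel (A \<omega>) \<le> ennreal V" if \<omega>: "norm \<omega> = 1" for \<omega>
    proof -
      have "emeasure lborel (A \<omega>) \<le> (\<Sum>\<zeta>\<in>S \<omega>. emeasure lborel (cball \<zeta> (1 / L)))"
        unfolding A_def by (rule emeasure_subadditive_finite[OF Sfin]) auto
      also have "\<dots> = of_nat (card (S \<omega>)) * ennreal (?v * (1 / L) ^ ?n)"
        using L0 by (simp add: emeasure_cball_euclidean)
      also have "\<dots> = ennreal (real (card (S \<omega>)) * (?v * (1 / L) ^ ?n))"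
        using L0 by (subst ennreal_mult) (auto simp: ennreal_of_nat_eq_real_of_nat)
      also have "\<dots> \<le> ennreal (H1 * (?v * (1 / L) ^ ?n))"
      proof (intro ennreal_leI mult_right_mono)
        show "real (card (S \<omega>)) \<le> H1"
          unfolding H1_def S_def Z_def of_nat_le_iff by (rule lattice_freqs_sector_card[OF M6 \<omega>])
      qed (use L0 in simp)
      also have "H1 * (?v * (1 / L) ^ ?n) = V"
        unfolding V_def using L0 by (simp add: powr_minus_divide powr_realpow power_one_over)
      finally show ?thesis .
    qed
    have U: "distr_of (inv_fourier a) \<in> HspFIO \<theta> \<Psi> q s p \<and>
        epowr (HspFIO_norm \<theta> \<Psi> q s p (distr_of (inv_fourier a))) p \<le> ennreal (K0 * R powr ((e + s) * p) * V powr (p - 1))"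
    proof (rule upper[OF RR V aS na])
      show "R / (2 * real ?n) \<le> norm \<xi> \<and> norm \<xi> \<le> 2 * real ?n * R" if "a \<xi> \<noteq> 0" for \<xi> using asupp[OF that] by blast
      show "\<exists>A\<in>sets borel. emeasure lborel A \<le> ennreal V \<and>
          (\<forall>\<xi>. a \<xi> \<noteq> 0 \<longrightarrow> norm \<xi> * (norm (sgn \<xi> - \<omega>))\<^sup>2 \<le> 2 \<longrightarrow> \<xi> \<in> A)" if u: "norm \<omega> = 1" for \<omega>
      proof (intro bexI[OF _ A1] conjI allI impI)
        show "emeasure lborel (A \<omega>) \<le> ennreal V" by (rule A2[OF u])
        fix \<xi> assume nz: "a \<xi> \<noteq> 0" and c: "norm \<xi> * (norm (sgn \<xi> - \<omega>))\<^sup>2 \<le> 2"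
        obtain \<zeta> where \<zeta>: "\<zeta> \<in> Z" "norm (\<xi> - \<zeta>) \<le> 1 / L" using a_single[OF nz] by blast
        then have "\<zeta> \<in> S \<omega>" unfolding S_def using c Lhalf by (auto intro!: exI[of _ \<xi>])
        then show "\<xi> \<in> A \<omega>" unfolding A_def using \<zeta>(2) by (auto simp: dist_norm norm_minus_commute)
      qed
    qed
    define Y where "Y = \<kappa> * (cn\<^sup>2 * \<mu>\<^sup>2 / 64) powr (p / 2) * (N powr (p / 2) * L powr (real ?n * (1 - p)))"
    have lower: "ennreal Y \<le> epowr (Lp_norm p (wave_op \<theta> \<Psi> q s p \<phi> t (distr_of (inv_fourier a)))) p"
      if t: "0 \<le> t" "t \<le> 1" for t
      unfolding Y_def \<kappa>_def cn_def N_def a_def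
      by (rule packets_lower_bound[OF \<theta>(1,2,3) sm p Zfin Zne Zsep L2 _ \<mu> \<mu>_def w0_def _ osc t])
        (use LE1 LE2 in \<open>simp_all add: N_def\<close>)
    have "1 * Y \<le> C powr p * (K0 * R powr ((e + s) * p) * V powr (p - 1))"
    proof (rule testing_inequality[OF _ C _ _ _ _ hyp[OF conjunct1[OF U]] lower conjunct2[OF U]])
      show "0 \<le> Y" unfolding Y_def \<kappa>_def by simp
    qed (use p K0 in auto)
    moreover have "V powr (p - 1) = (H1 * ?v) powr (p - 1) * L powr (real ?n * (1 - p))"
    proof -
      have "V powr (p - 1) = (H1 * ?v) powr (p - 1) * (L powr (- real ?n)) powr (p - 1)"
        unfolding V_def by (rule powr_mult)
      also have "(L powr (- real ?n)) powr (p - 1) = L powr (real ?n * (1 - p))"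
        unfolding powr_powr by (simp add: algebra_simps)
      finally show ?thesis .
    qed
    ultimately have "c * N powr (p / 2) * L powr (real ?n * (1 - p)) \<le>
        (C powr p * (K0 * R powr ((e + s) * p) * (H1 * ?v) powr (p - 1))) * L powr (real ?n * (1 - p))"
      unfolding Y_def c_def by (simp only: mult_ac mult_1_left mult_1)
    then have "c * N powr (p / 2) \<le> C powr p * (K0 * R powr ((e + s) * p) * (H1 * ?v) powr (p - 1))"
      by (rule mult_right_le_imp_le) (use L0 in simp)
    moreover have "N powr (p / 2) = real M powr ((real ?n - 1) * (p / 2))"
    proof -
      have "N = real M powr real (?n - 1)"
        unfolding N_def Zc of_nat_power by (rule powr_realpow[symmetric]) (use M0 in simp)
      moreover have "real (?n - 1) = real ?n - 1" using DIM_positive[where 'a='a] by (simp add: of_nat_diff)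
      ultimately show ?thesis by (simp only: powr_powr)
    qed
    moreover have "R powr ((e + s) * p) = real M powr (2 * (e + s) * p)"
    proof -
      have "R = real M powr 2" unfolding R_def using M0 by simp
      then show ?thesis by (simp only: powr_powr mult.assoc)
    qed
    ultimately show ?thesis unfolding K_def by (simp only: mult_ac)
  qed
  have "(real ?n - 1) * (p / 2) \<le> 2 * (e + s) * p"
    by (rule exponent_le_if_powr_le[OF c0 main])
  then have "0 \<le> s * p" unfolding e_def by (simp add: field_simps)
  then show ?thesis using p by (simp add: zero_le_mult_iff)
qed

theorem theorem5p3:
  fixes \<theta> \<Psi> :: "real ^ 'n \<Rightarrow> real" and q :: "real ^ 'n \<Rightarrow> complex"
    and \<phi> :: "real ^ 'n \<Rightarrow> real"
    and p s C :: real
  assumes "CARD('n) \<ge> 2"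
    and "FIO_cutoffs \<theta> \<Psi> q"
    and "smooth_on (- {0}) \<phi>"
    and "positively_homogeneous1 \<phi>"
    and "2 < p"
    and "C \<ge> 0"
    and "\<And>f. f \<in> HspFIO \<theta> \<Psi> q s p \<Longrightarrow>
      epowr (\<integral>\<^sup>+t\<in>{0..1}. epowr (Lp_norm p (wave_op \<theta> \<Psi> q s p \<phi> t f)) p \<partial>lborel) (1 / p)
        \<le> ennreal C * HspFIO_norm \<theta> \<Psi> q s p f"
  shows "s \<ge> d_exp CARD('n) p - s_exp CARD('n) p"
proof -
  have "s_exp CARD('n) p - 1 / p \<le> s"
    using focusing_exponent[OF assms(2-7)] by simp
  moreover have "0 \<le> s" by (rule packets_exponent[OF assms(2,3,5-7)])
  ultimately show ?thesis by (simp add: d_exp_def)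
qed

end
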